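(* Let $\mathbb K$ be $\mathbb R$ or $\mathbb C$. Suppose that $\Gamma\subset\mathsf{PGL}(d,\mathbb K)$ is $(1,1,q)$-hypertransverse and $\sigma_2(\gamma)=\sigma_q(\gamma)$ for all $\gamma\in\Gamma$. Then $$\dim_H(\Lambda_{1,c}(\Gamma))=\delta^{\alpha_1}(\Gamma).$$
   Context: For $g\in\mathsf{PGL}(d,\mathbb K)$ let $\sigma_1(g)\ge\dots\ge\sigma_d(g)>0$ be the singular values of a lift with determinant of modulus $1$, $\kappa(g)=\mathrm{diag}(\log\sigma_1(g),\dots,\log\sigma_d(g))$ and $\alpha_k(\kappa(g))=\log\frac{\sigma_k(g)}{\sigma_{k+1}(g)}$. Write $g=\ell am$ with $\ell,m$ in the maximal compact subgroup ($\mathsf{PO}(d)$ or $\mathsf{PU}(d)$) and $a$ diagonal with entries $\sigma_1(g),\dots,\sigma_d(g)$; if $\alpha_k(\kappa(g))>0$, $U_k(g)=\ell(\langle e_1,\dots,e_k\rangle)$ is well defined. A subset $\theta=\{k_1<\dots<k_r\}\subset\{1,\dots,d-1\}$ is symmetric if $k\in\theta\iff d-k\in\theta$. $\mathcal F_\theta$ is the space of partial flags in $\mathbb K^d$ with one subspace $F^k$ of each dimension $k\in\theta$. A subset $X\subset\mathcal F_\theta$ is transverse if for all distinct $F,G\in X$ and all $k\in\theta$, $F^k$ and $G^{d-k}$ are transverse. A subgroup $\Gamma$ is $P_k$-divergent if $\alpha_k(\kappa(\gamma_n))\to\infty$ for every sequence of pairwise distinct elements of $\Gamma$. If $\Gamma$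 is $P_k$-divergent for all $k\in\theta$, $\Lambda_\theta(\Gamma)\subset\mathcal F_\theta$ is the set of all limits of $U_\theta(\gamma_n)=(U_k(\gamma_n))_{k\in\theta}$ along sequences of pairwise distinct elements. $\Gamma$ is $P_\theta$-transverse if it is $P_k$-divergent for all $k\in\theta$ and $\Lambda_\theta(\Gamma)$ is a transverse subset. $\Gamma$ is $(1,1,q)$-hypertransverse if it is $P_\theta$-transverse for some symmetric $\theta$ containing $1$ and $q$, and $F^1+G^1+H^{d-q}$ is a direct sum for all pairwise distinct $F,G,H\in\Lambda_\theta(\Gamma)$. A point $x\in\Lambda_\theta(\Gamma)$ is a conical limit point if there are distinct $a,b\in\Lambda_\theta(\Gamma)$ and a sequence $\{\gamma_n\}$ of distinct elements of $\Gamma$ such that $\gamma_n(x)\to a$ and $\gamma_n(y)\to b$ for all $y\in\Lambda_\theta(\Gamma)\setminus\{x\}$. $\Lambda_{\theta,c}(\Gamma)$ is the set of conical limit points and $\Lambda_{1,c}(\Gamma)\subset\mathbb P(\mathbb K^d)$ is its image under $F\mapsto F^1$. The critical exponent is $\delta^{\alpha_1}(\Gamma)=\inf\{s:\sum_{\gamma\in\Gamma}e^{-s\alpha_1(\kappa(\gamma))}<\infty\}$. $\dim_H$ is Hausdorff dimension with respect to any Riemannian metric on $\mathbb P(\mathbb K^d)$.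
   Formalization: Assumes the limit set is not a single flag: for the group generated by a regular unipotent of SO(2,1) in PGL(3) there are no conical limit points, yet the critical exponent is 1/2. The exponent is the infimum over s ≥ 0, so finite groups have exponent 0. *)

theory Defs
  imports "HOL-Analysis.Analysis" "HOL-Algebra.Coset"
begin

text \<open>
  The scalar field is a type of sort \<open>{real_normed_field, euclidean_space}\<close>; only the instances
  \<open>real\<close> and \<open>complex\<close> are of interest. The norm of \<open>'k^'d\<close> is then the standard Euclidean or
  Hermitian norm. The dimension is \<open>d = CARD('d)\<close>, and the linear order of the index type turns its
  elements into the indices \<open>1, \<dots>, d\<close>.
\<close>

section \<open>The projective linear group and the Cartan decomposition\<close>

type_synonym ('k, 'd) sqmatrix = "(('k, 'd) vec, 'd) vec"

definition GL :: "('k::field^'d^'d) monoid" where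
  "GL = \<lparr>carrier = {A. invertible A}, mult = (**), one = mat 1\<rparr>"

definition PGL :: "('k::field^'d^'d) set monoid" where
  "PGL = GL Mod {mat c | c. c \<noteq> 0}"

definition index_rank :: "'d::{finite,linorder} \<Rightarrow> nat" where
  "index_rank i = card {..i}"

definition diag :: "(nat \<Rightarrow> real) \<Rightarrow> ('k::real_normed_field, 'd::{finite,linorder}) sqmatrix" where
  "diag s = (\<chi> i j. if i = j then of_real (s (index_rank i)) else 0)"

text \<open>A matrix acts by a scalar-linear map, so preserving the (real part of the) inner product means
  being orthogonal or unitary, respectively.\<close>

definition unitary :: "'k::{real_normed_field,euclidean_space}^'d^'d \<Rightarrow> bool" where
  "unitary L \<longleftrightarrow> orthogonal_transformation ((*v) L)"

definition cartan_decomposition ::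
    "('k::{real_normed_field,euclidean_space}, 'd::{finite,linorder}) sqmatrix \<Rightarrow> ('k, 'd) sqmatrix \<Rightarrow> (nat \<Rightarrow> real) \<Rightarrow> ('k, 'd) sqmatrix \<Rightarrow> bool" where
  "cartan_decomposition A L s M \<longleftrightarrow>
     unitary L \<and> unitary M \<and> A = L ** diag s ** M \<and>
     (\<forall>i\<in>{1..CARD('d)}. 0 < s i) \<and> antimono_on {1..CARD('d)} s"

text \<open>Meaningful for \<open>1 \<le> k \<le> d\<close>: the value depends neither on the lift with determinant of
  modulus one nor on the decomposition.\<close>

definition sing_val :: "('k::{real_normed_field,euclidean_space}, 'd::{finite,linorder}) sqmatrix set \<Rightarrow> nat \<Rightarrow> real" where
  "sing_val g k = (THE t. \<exists>A\<in>g. norm (det A) = 1 \<and> (\<exists>L s M. cartan_decomposition A L s M \<and> t = s k))"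

definition alpha :: "nat \<Rightarrow> ('k::{real_normed_field,euclidean_space}, 'd::{finite,linorder}) sqmatrix set \<Rightarrow> real" where
  "alpha k g = ln (sing_val g k / sing_val g (k + 1))"

text \<open>Meaningful if \<open>alpha k g > 0\<close>; it is only used in limits along sequences for which this holds
  eventually.\<close>

definition U_space :: "nat \<Rightarrow> ('k::{real_normed_field,euclidean_space}, 'd::{finite,linorder}) sqmatrix set \<Rightarrow> ('k, 'd) vec set" where
  "U_space k g = (THE F. \<exists>A\<in>g. norm (det A) = 1 \<and>
     (\<exists>L s M. cartan_decomposition A L s M \<and> F = (*v) L ` vec.span {axis i 1 | i. index_rank i \<le> k}))"

section \<open>Partial flags\<close>

definition symmetric_indices :: "nat \<Rightarrow> nat set \<Rightarrow> bool" where
  "symmetric_indices d \<theta> \<longleftrightarrow> \<theta> \<subseteq> {1..<d} \<and> (\<forall>k\<in>{1..<d}. k \<in> \<theta> \<longleftrightarrow> d - k \<in> \<theta>)"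

definition flags :: "nat set \<Rightarrow> (nat \<Rightarrow> ('k::field^'d) set) set" where
  "flags \<theta> = {F \<in> extensional \<theta>.
     (\<forall>k\<in>\<theta>. vec.subspace (F k) \<and> vec.dim (F k) = k) \<and> (\<forall>j\<in>\<theta>. \<forall>k\<in>\<theta>. j \<le> k \<longrightarrow> F j \<subseteq> F k)}"

text \<open>On subspaces, \<open>closest_point V\<close> is the orthogonal projection onto \<open>V\<close>; the operator norm of the
  difference of projections metrizes every Grassmannian.\<close>

definition grass_dist :: "('k::{real_normed_field,euclidean_space}^'d) set \<Rightarrow> ('k^'d) set \<Rightarrow> real" where
  "grass_dist V W = onorm (\<lambda>x. closest_point V x - closest_point W x)"

definition flag_tendsto ::
    "nat set \<Rightarrow> (nat \<Rightarrow> nat \<Rightarrow> ('k::{real_normed_field,euclidean_space}^'d) set) \<Rightarrow> (nat \<Rightarrow> ('k^'d) set) \<Rightarrow> bool" where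
  "flag_tendsto \<theta> X F \<longleftrightarrow> (\<forall>k\<in>\<theta>. (\<lambda>n. grass_dist (X n k) (F k)) \<longlonglongrightarrow> 0)"

definition transverse_spaces :: "('k::field^'d) set \<Rightarrow> ('k^'d) set \<Rightarrow> bool" where
  "transverse_spaces V W \<longleftrightarrow> {v + w | v w. v \<in> V \<and> w \<in> W} = UNIV"

definition transverse_flags :: "nat set \<Rightarrow> (nat \<Rightarrow> ('k::field^'d) set) set \<Rightarrow> bool" where
  "transverse_flags \<theta> X \<longleftrightarrow>
     (\<forall>F\<in>X. \<forall>G\<in>X. F \<noteq> G \<longrightarrow> (\<forall>k\<in>\<theta>. transverse_spaces (F k) (G (CARD('d) - k))))"

definition direct_sum3 :: "('k::field^'d) set \<Rightarrow> ('k^'d) set \<Rightarrow> ('k^'d) set \<Rightarrow> bool" where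
  "direct_sum3 V1 V2 V3 \<longleftrightarrow>
     (\<forall>x\<in>V1. \<forall>y\<in>V2. \<forall>z\<in>V3. x + y + z = 0 \<longrightarrow> x = 0 \<and> y = 0 \<and> z = 0)"

text \<open>For a subspace \<open>V\<close>, all lifts of \<open>g\<close> map \<open>V\<close> onto the same subspace.\<close>

definition act_space :: "('k::field^'d^'d) set \<Rightarrow> ('k^'d) set \<Rightarrow> ('k^'d) set" where
  "act_space g V = (\<Union>A\<in>g. (*v) A ` V)"

definition act_flag :: "nat set \<Rightarrow> ('k::field^'d^'d) set \<Rightarrow> (nat \<Rightarrow> ('k^'d) set) \<Rightarrow> nat \<Rightarrow> ('k^'d) set" where
  "act_flag \<theta> g F = (\<lambda>k\<in>\<theta>. act_space g (F k))"

section \<open>Transverse groups\<close>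

definition divergent :: "nat \<Rightarrow> ('k::{real_normed_field,euclidean_space}, 'd::{finite,linorder}) sqmatrix set set \<Rightarrow> bool" where
  "divergent k \<Gamma> \<longleftrightarrow>
     (\<forall>\<gamma>::nat \<Rightarrow> _. inj \<gamma> \<and> range \<gamma> \<subseteq> \<Gamma> \<longrightarrow> filterlim (\<lambda>n. alpha k (\<gamma> n)) at_top sequentially)"

definition limit_set ::
    "nat set \<Rightarrow> ('k::{real_normed_field,euclidean_space}, 'd::{finite,linorder}) sqmatrix set set \<Rightarrow> (nat \<Rightarrow> ('k, 'd) vec set) set" where
  "limit_set \<theta> \<Gamma> = {F \<in> flags \<theta>. \<exists>\<gamma>::nat \<Rightarrow> _. inj \<gamma> \<and> range \<gamma> \<subseteq> \<Gamma> \<and>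
     flag_tendsto \<theta> (\<lambda>n k. U_space k (\<gamma> n)) F}"

definition transverse_group :: "nat set \<Rightarrow> ('k::{real_normed_field,euclidean_space}, 'd::{finite,linorder}) sqmatrix set set \<Rightarrow> bool" where
  "transverse_group \<theta> \<Gamma> \<longleftrightarrow> (\<forall>k\<in>\<theta>. divergent k \<Gamma>) \<and> transverse_flags \<theta> (limit_set \<theta> \<Gamma>)"

text \<open>\<open>hypertransverse_wrt \<theta> q \<Gamma>\<close> says that \<open>\<theta>\<close> is a witness for \<open>\<Gamma>\<close> being
  \<open>(1,1,q)\<close>-hypertransverse. The witness is a parameter because the limit set depends on it.\<close>

definition hypertransverse_wrt ::
    "nat set \<Rightarrow> nat \<Rightarrow> ('k::{real_normed_field,euclidean_space}, 'd::{finite,linorder}) sqmatrix set set \<Rightarrow> bool" where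
  "hypertransverse_wrt \<theta> q \<Gamma> \<longleftrightarrow>
     symmetric_indices CARD('d) \<theta> \<and> 1 \<in> \<theta> \<and> q \<in> \<theta> \<and> transverse_group \<theta> \<Gamma> \<and>
     (\<forall>F\<in>limit_set \<theta> \<Gamma>. \<forall>G\<in>limit_set \<theta> \<Gamma>. \<forall>H\<in>limit_set \<theta> \<Gamma>.
        F \<noteq> G \<and> F \<noteq> H \<and> G \<noteq> H \<longrightarrow> direct_sum3 (F 1) (G 1) (H (CARD('d) - q)))"

definition conical_limit_set ::
    "nat set \<Rightarrow> ('k::{real_normed_field,euclidean_space}, 'd::{finite,linorder}) sqmatrix set set \<Rightarrow> (nat \<Rightarrow> ('k, 'd) vec set) set" where
  "conical_limit_set \<theta> \<Gamma> = {x \<in> limit_set \<theta> \<Gamma>.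
     \<exists>a\<in>limit_set \<theta> \<Gamma>. \<exists>b\<in>limit_set \<theta> \<Gamma>. a \<noteq> b \<and>
       (\<exists>\<gamma>::nat \<Rightarrow> _. inj \<gamma> \<and> range \<gamma> \<subseteq> \<Gamma> \<and>
          flag_tendsto \<theta> (\<lambda>n. act_flag \<theta> (\<gamma> n) x) a \<and>
          (\<forall>y\<in>limit_set \<theta> \<Gamma> - {x}. flag_tendsto \<theta> (\<lambda>n. act_flag \<theta> (\<gamma> n) y) b))}"

definition conical_limit_set1 ::
    "nat set \<Rightarrow> ('k::{real_normed_field,euclidean_space}, 'd::{finite,linorder}) sqmatrix set set \<Rightarrow> ('k, 'd) vec set set" where
  "conical_limit_set1 \<theta> \<Gamma> = (\<lambda>F. F 1) ` conical_limit_set \<theta> \<Gamma>"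

text \<open>If \<open>limit_set \<theta> \<Gamma>\<close> is a single point, there are no conical limit points, while the critical
  exponent can be positive: the powers of a regular unipotent element of \<open>SO(2,1)\<close> in \<open>PGL(3,\<real>)\<close>
  have critical exponent 1/2 with respect to \<open>alpha 1\<close>. Such elementary groups have to be excluded
  when conical limit sets are compared with critical exponents.\<close>

text \<open>As usual the exponent ranges over \<open>s \<ge> 0\<close>, so a finite group has critical exponent 0
  (and not \<open>-\<infinity>\<close>); the value is \<open>\<infinity>\<close> if the series diverges for all \<open>s\<close>.\<close>

definition critical_exponent :: "('g \<Rightarrow> real) \<Rightarrow> 'g set \<Rightarrow> ereal" where
  "critical_exponent \<phi> \<Gamma> = Inf (ereal ` {s. 0 \<le> s \<and> (\<lambda>\<gamma>. exp (- s * \<phi> \<gamma>)) summable_on \<Gamma>})"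

section \<open>Riemannian metrics on projective space\<close>

definition projective_space :: "('k::field^'d) set set" where
  "projective_space = {V. vec.subspace V \<and> vec.dim V = 1}"

text \<open>Infinite differentiability on an open set: the function belongs to a family of functions that
  are differentiable on the set and that is closed under directional derivatives.\<close>

definition smooth_fun_on :: "'a::real_normed_vector set \<Rightarrow> ('a \<Rightarrow> real) \<Rightarrow> bool" where
  "smooth_fun_on S f \<longleftrightarrow> (\<exists>\<F>. f \<in> \<F> \<and>
     (\<forall>h\<in>\<F>. (\<forall>x\<in>S. h differentiable (at x)) \<and> (\<forall>u. (\<lambda>x. frechet_derivative h (at x) u) \<in> \<F>)))"

text \<open>Let \<open>\<pi>\<close> be the projection from the nonzero vectors onto projective space. Its differential at
  \<open>v\<close> is onto with kernel the line spanned by \<open>v\<close>, and \<open>d\<pi>(c v)(c w) = d\<pi>(v)(w)\<close>. A Riemannian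
  metric on projective space is therefore the same as its pullback under \<open>\<pi>\<close>, that is, a smooth
  family of positive semidefinite real bilinear forms with these lines as kernels and invariant
  under scaling by nonzero scalars.\<close>

definition riemannian_metric ::
    "('k::{real_normed_field,euclidean_space}^'d \<Rightarrow> 'k^'d \<Rightarrow> 'k^'d \<Rightarrow> real) \<Rightarrow> bool" where
  "riemannian_metric G \<longleftrightarrow>
     (\<forall>v. v \<noteq> 0 \<longrightarrow> bilinear (G v) \<and> (\<forall>w w'. G v w w' = G v w' w) \<and>
        (\<forall>w. 0 \<le> G v w w) \<and> (\<forall>w. G v w w = 0 \<longleftrightarrow> w \<in> vec.span {v}) \<and>
        (\<forall>c w w'. c \<noteq> 0 \<longrightarrow> G (c *s v) (c *s w) (c *s w') = G v w w')) \<and>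
     (\<forall>w w'. smooth_fun_on (- {0}) (\<lambda>v. G v w w'))"

definition riemannian_length ::
    "('k::{real_normed_field,euclidean_space}^'d \<Rightarrow> 'k^'d \<Rightarrow> 'k^'d \<Rightarrow> real) \<Rightarrow> (real \<Rightarrow> 'k^'d) \<Rightarrow> real" where
  "riemannian_length G p =
     integral {0..1} (\<lambda>t. sqrt (G (p t) (vector_derivative p (at t)) (vector_derivative p (at t))))"

text \<open>Every continuously differentiable path in projective space lifts to such a path of nonzero
  vectors, so the infimum is over the lengths of all such paths between the two points. The library's
  \<open>valid_path\<close> is too weak here: it allows unbounded, non-integrable derivatives at the breakpoints.\<close>

definition riemannian_dist ::
    "('k::{real_normed_field,euclidean_space}^'d \<Rightarrow> 'k^'d \<Rightarrow> 'k^'d \<Rightarrow> real) \<Rightarrow> ('k^'d) set \<Rightarrow> ('k^'d) set \<Rightarrow> real" where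
  "riemannian_dist G V W = Inf {riemannian_length G p | p.
     p C1_differentiable_on {0..1} \<and> 0 \<notin> path_image p \<and> pathstart p \<in> V \<and> pathfinish p \<in> W}"

section \<open>Hausdorff dimension\<close>

text \<open>Here \<open>X\<close> is the ambient space and \<open>\<rho>\<close> its distance function.\<close>

definition ediam :: "('a \<Rightarrow> 'a \<Rightarrow> real) \<Rightarrow> 'a set \<Rightarrow> ennreal" where
  "ediam \<rho> U = (SUP x\<in>U. SUP y\<in>U. ennreal (\<rho> x y))"

text \<open>Covers by sets of diameter at most \<open>\<epsilon> < \<infinity>\<close>, so \<open>enn2real\<close> loses nothing; only used for \<open>s > 0\<close>.\<close>

definition hausdorff_premeasure :: "'a set \<Rightarrow> ('a \<Rightarrow> 'a \<Rightarrow> real) \<Rightarrow> real \<Rightarrow> real \<Rightarrow> 'a set \<Rightarrow> ennreal" where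
  "hausdorff_premeasure X \<rho> s \<epsilon> S =
     Inf {(\<Sum>i. ennreal (enn2real (ediam \<rho> (U i)) powr s)) | U :: nat \<Rightarrow> 'a set.
       (\<forall>i. U i \<subseteq> X \<and> ediam \<rho> (U i) \<le> ennreal \<epsilon>) \<and> S \<subseteq> (\<Union>i. U i)}"

definition hausdorff_measure :: "'a set \<Rightarrow> ('a \<Rightarrow> 'a \<Rightarrow> real) \<Rightarrow> real \<Rightarrow> 'a set \<Rightarrow> ennreal" where
  "hausdorff_measure X \<rho> s S = (SUP \<epsilon>\<in>{0<..}. hausdorff_premeasure X \<rho> s \<epsilon> S)"

text \<open>The infimum over \<open>s > 0\<close> agrees with the one over \<open>s \<ge> 0\<close>, since the zero-dimensional measure
  (counting measure) vanishes only on the empty set.\<close>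

definition hausdorff_dim :: "'a set \<Rightarrow> ('a \<Rightarrow> 'a \<Rightarrow> real) \<Rightarrow> 'a set \<Rightarrow> ereal" where
  "hausdorff_dim X \<rho> S = Inf (ereal ` {s. 0 < s \<and> hausdorff_measure X \<rho> s S = 0})"

end

theory Submission
  imports Defs
begin

text \<open>
  Sending a line to its orthogonal projection is a locally bi-Lipschitz embedding of projective space,
  so one may work with the compact set of lines \<open>F 1\<close> of limit flags \<open>F\<close>. Along a sequence \<open>\<gamma>\<^sub>n = l\<^sub>n a\<^sub>n m\<^sub>n\<close> of the group,
  points away from the repelling flag are moved to within \<open>C exp(- \<alpha>\<^sub>1(\<gamma>\<^sub>n))\<close> of \<open>U\<^sub>1(\<gamma>\<^sub>n)\<close>.
  Conversely \<open>\<bar>a\<^sub>n u\<bar> \<ge> \<sigma>\<^sub>q \<bar>u'\<bar>\<close> for the projection \<open>u'\<close> of \<open>u\<close> to the first \<open>q\<close> coordinates, the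
  direct sum condition keeps two distinct lines independent after this projection, and
  \<open>\<sigma>\<^sub>q = \<sigma>\<^sub>2\<close>; hence distinct points stay at distance at least \<open>c exp(- \<alpha>\<^sub>1(\<gamma>\<^sub>n))\<close>. In this sense
  the action on the limit set is conformal, and \<open>\<alpha>\<^sub>1\<close> is coarsely additive along transverse products.

  A conical limit point lies within \<open>C exp(- \<alpha>\<^sub>1(\<gamma>))\<close> of \<open>U\<^sub>1(\<gamma>)\<close> for infinitely many \<open>\<gamma>\<close>, so
  convergence of the series at \<open>s\<close> makes the \<open>s\<close>-dimensional measure vanish.

  For the lower bound no Patterson-Sullivan measure is needed. If the series diverges at \<open>s\<close>, it
  diverges over the elements with attracting point in \<open>V\<close> and repelling point in \<open>W\<close>, for suitable
  disjoint compact \<open>V\<close>, \<open>W\<close>. Shadows of elements of comparable size overlap boundedly often, so for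
  \<open>s' < s\<close> there are at least \<open>K exp(s' n)\<close> elements with \<open>\<alpha>\<^sub>1 \<le> n + 1\<close> that map \<open>V\<close> to disjoint
  subsets of itself. These generate an iterated function system whose limit set consists of conical
  points, and Lebesgue measure on \<open>[0, 1)\<close>, transported by the digit expansion, bounds the Hausdorff
  measure from below.
\<close>

section \<open>Sequences and exponential series\<close>

text \<open>The series may diverge only near a diagonal pair \<open>(\<xi>, \<xi>)\<close> of ends,
  where no disjoint \<open>V\<close> and \<open>W\<close> are available. A translation that moves
  \<open>\<xi>\<close> repairs this. Such an element exists once the limit set has a second point:
  if \<open>\<xi>\<close> were fixed by the whole group, the logarithm of the eigenvalue on the
  fixed line would give a contradiction. The equality of singular values enters twice: for the lower
  bound on distances and for the lower bound on the second singular value of a product. The exponent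
  survives the additive errors because the number of maps is fixed after the error constant
  \<open>C\<close> of products: a window is sought with
  \<open>2 * exp (s' * (1 + C)) * exp (s' * n)\<close> disjoint maps of size at most
  \<open>n + 1\<close>, so \<open>a = n + 1 + C\<close> satisfies
  \<open>exp (s' * a) \<le> N\<close>. Each letter then costs at most a factor
  \<open>exp (- a)\<close> in distance and gains \<open>N\<close> branches. All uniform constants
  come from compactness: a sequence of counterexamples is made constant or attracting by passing to
  a subsequence, and its limit is contradictory.\<close>

lemma constant_or_inj_subseq:
  fixes f :: "nat \<Rightarrow> 'a"
  shows "\<exists>r::nat\<Rightarrow>nat. strict_mono r \<and> ((\<exists>c. \<forall>n. f (r n) = c) \<or> inj (f \<circ> r))"
proof (cases "finite (range f)")
  case True
  then obtain c where c: "infinite {n. f n = c}"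
    using pigeonhole_infinite[of UNIV f] by auto
  have "strict_mono (enumerate {n. f n = c})" using c by (rule strict_mono_enumerate)
  moreover have "\<forall>n. f (enumerate {n. f n = c} n) = c"
    using enumerate_in_set[OF c] by blast
  ultimately show ?thesis by blast
next
  case False
  \<comment> \<open>First occurrences: \<open>f\<close> is injective on them and already takes all
    its values there, so \<open>S\<close> is infinite.\<close>
  define S where "S = {n. \<forall>m<n. f m \<noteq> f n}"
  have "f ` S = range f"
  proof (safe)
    fix n show "f n \<in> f ` S"
    proof (induction n rule: less_induct)
      case (less n)
      show ?case
      proof (cases "n \<in> S")
        case False
        then obtain m where "m < n" "f m = f n" unfolding S_def by auto
        with less[of m] show ?thesis by simp
      qed simp
    qed
  qed simp
  with False have inf: "infinite S" by (metis finite_imageI)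
  have injS: "inj_on f S"
    by (rule linorder_inj_onI) (auto simp: S_def)
  have "inj (f \<circ> enumerate S)"
  proof (rule injI)
    fix m n assume "(f \<circ> enumerate S) m = (f \<circ> enumerate S) n"
    then have "enumerate S m = enumerate S n"
      using inj_onD[OF injS] enumerate_in_set[OF inf] by auto
    then show "m = n" using strict_mono_eq[OF strict_mono_enumerate[OF inf]] by blast
  qed
  then show ?thesis using strict_mono_enumerate[OF inf] by blast
qed

text \<open>Each choice avoids the finitely many earlier ones. This provides the pairwise distinct
  elements that limit points demand, with conditions that tighten with \<open>n\<close>.\<close>

lemma injective_sequence_from_all_large:
  assumes "\<And>n::nat. infinite {x. P n x}"
  shows "\<exists>f. inj f \<and> (\<forall>n. P n (f n))"
proof -
  obtain f where f: "P n (f n) \<and> f n \<notin> f ` {..<n}" for n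
  proof (atomize_elim, rule dependent_wellorder_choice[of "\<lambda>f n x. P n x \<and> x \<notin> f ` {..<n}"])
    fix f :: "nat \<Rightarrow> 'a" and n :: nat
    have "infinite ({x. P n x} - f ` {..<n})" using assms[of n] by auto
    then obtain x where "x \<in> {x. P n x} - f ` {..<n}"
      using infinite_imp_nonempty by blast
    then show "\<exists>x. P n x \<and> x \<notin> f ` {..<n}" by blast
  next
    fix x and f g :: "nat \<Rightarrow> 'a" and n
    assume "\<And>y. y < n \<Longrightarrow> f y = g y"
    then have "f ` {..<n} = g ` {..<n}" by (intro image_cong) auto
    then show "(P n x \<and> x \<notin> f ` {..<n}) = (P n x \<and> x \<notin> g ` {..<n})" by simp
  qed
  have "inj f"
    by (rule linorder_injI) (metis f imageI lessThan_iff)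
  with f show ?thesis by blast
qed

text \<open>An unrelated subset of maximal cardinality: by maximality every element of
  \<open>S\<close> is related to one of \<open>F\<close>, so at most \<open>card F\<close> classes
  of size at most \<open>M\<close> cover \<open>S\<close>.\<close>

lemma exists_separated_subset:
  assumes "finite S" "\<And>x. x \<in> S \<Longrightarrow> R x x" "\<And>x y. R x y \<Longrightarrow> R y x"
    and "\<And>x. x \<in> S \<Longrightarrow> card {y\<in>S. R x y} \<le> M"
  shows "\<exists>F\<subseteq>S. (\<forall>x\<in>F. \<forall>y\<in>F. x \<noteq> y \<longrightarrow> \<not> R x y) \<and> card S \<le> M * card F"
proof -
  define P where "P F \<longleftrightarrow> F \<subseteq> S \<and> (\<forall>x\<in>F. \<forall>y\<in>F. x \<noteq> y \<longrightarrow> \<not> R x y)" for F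
  have "P {}" by (simp add: P_def)
  moreover have "\<forall>F. P F \<longrightarrow> card F < Suc (card S)"
    using assms(1) by (auto simp: P_def less_Suc_eq_le intro: card_mono)
  ultimately obtain F where F: "P F" and max: "\<forall>G. P G \<longrightarrow> card G \<le> card F"
    using ex_has_greatest_nat[of P "{}" card "Suc (card S)"] by blast
  have finF: "finite F" using F assms(1) finite_subset by (auto simp: P_def)
  have "S \<subseteq> (\<Union>x\<in>F. {y\<in>S. R x y})"
  proof
    fix y assume y: "y \<in> S"
    show "y \<in> (\<Union>x\<in>F. {y\<in>S. R x y})"
    proof (rule ccontr)
      assume n: "y \<notin> (\<Union>x\<in>F. {y\<in>S. R x y})"
      then have "P (insert y F)" "y \<notin> F"
        using F y assms(2,3) by (auto simp: P_def)
      then show False using max finF by force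
    qed
  qed
  then have "card S \<le> card (\<Union>x\<in>F. {y\<in>S. R x y})"
    using finF assms(1) by (intro card_mono) auto
  also have "\<dots> \<le> (\<Sum>x\<in>F. card {y\<in>S. R x y})" by (rule card_UN_le[OF finF])
  also have "\<dots> \<le> (\<Sum>x\<in>F. M)" using assms(4) F by (intro sum_mono) (auto simp: P_def)
  finally show ?thesis using F by (auto simp: P_def mult.commute)
qed

text \<open>Counting in unit windows loses an arbitrarily small amount of the exponent.\<close>

lemma summable_on_exp_if_window_bound:
  fixes \<alpha> :: "'g \<Rightarrow> real" and s s' K :: real
  assumes "s' < s" "\<And>x. x \<in> S \<Longrightarrow> 0 \<le> \<alpha> x"
    and fin: "\<And>n::nat. finite {x\<in>S. real n \<le> \<alpha> x \<and> \<alpha> x < real n + 1}"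
    and bd: "\<And>n::nat. card {x\<in>S. real n \<le> \<alpha> x \<and> \<alpha> x < real n + 1} \<le> K * exp (s' * n)"
    and "0 \<le> s"
  shows "(\<lambda>x. exp (- s * \<alpha> x)) summable_on S"
proof (rule nonneg_bounded_partial_sums_imp_summable_on[where C = "\<Sum>n. K * exp (- (s - s')) ^ n"])
  show "\<forall>\<^sub>F X in finite_subsets_at_top S. sum (\<lambda>x. exp (- s * \<alpha> x)) X \<le> (\<Sum>n. K * exp (- (s - s')) ^ n)"
  proof (rule eventually_finite_subsets_at_top_weakI)
    fix X assume X: "finite X" "X \<subseteq> S"
    \<comment> \<open>Grouped by integer parts, the partial sum receives from window
      \<open>n\<close> at most the geometric term \<open>K * exp (- (s - s')) ^ n\<close>.\<close>
    define l where "l x = nat \<lfloor>\<alpha> x\<rfloor>" for x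
    have l: "real (l x) \<le> \<alpha> x" "\<alpha> x < real (l x) + 1" if "x \<in> S" for x
      using assms(2)[OF that] by (auto simp: l_def)
    have K: "0 \<le> K" using order_trans[OF of_nat_0_le_iff bd[of 0]] by simp
    define N where "N = Suc (Max (insert 0 (l ` X)))"
    have lN: "l x < N" if "x \<in> X" for x
      unfolding N_def using X that by (auto simp: less_Suc_eq_le)
    have "sum (\<lambda>x. exp (- s * \<alpha> x)) X = (\<Sum>n<N. \<Sum>x\<in>{x\<in>X. l x = n}. exp (- s * \<alpha> x))"
      using X lN by (intro sum.group[symmetric]) auto
    also have "\<dots> \<le> (\<Sum>n<N. K * exp (- (s - s')) ^ n)"
    proof (rule sum_mono)
      fix n assume "n \<in> {..<N}"
      have sub: "{x\<in>X. l x = n} \<subseteq> {x\<in>S. real n \<le> \<alpha> x \<and> \<alpha> x < real n + 1}"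
        using X l by fastforce
      have "(\<Sum>x\<in>{x\<in>X. l x = n}. exp (- s * \<alpha> x)) \<le> (\<Sum>x\<in>{x\<in>X. l x = n}. exp (- s * n))"
        using l X assms(5) by (intro sum_mono) (auto intro!: mult_left_mono)
      also have "\<dots> = card {x\<in>X. l x = n} * exp (- s * n)" by simp
      also have "\<dots> \<le> card {x\<in>S. real n \<le> \<alpha> x \<and> \<alpha> x < real n + 1} * exp (- s * n)"
        using card_mono[OF fin sub] by (intro mult_right_mono) auto
      also have "\<dots> \<le> (K * exp (s' * n)) * exp (- s * n)"
        using bd[of n] by (intro mult_right_mono) (auto simp: algebra_simps)
      also have "\<dots> = K * exp (- (s - s')) ^ n"
        by (simp add: exp_of_nat_mult[symmetric] mult_exp_exp algebra_simps)
      finally show "(\<Sum>x\<in>{x\<in>X. l x = n}. exp (- s * \<alpha> x)) \<le> K * exp (- (s - s')) ^ n" .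
    qed
    also have "\<dots> \<le> (\<Sum>n. K * exp (- (s - s')) ^ n)"
      using assms(1) K by (intro sum_le_suminf summable_mult summable_geometric) auto
    finally show "sum (\<lambda>x. exp (- s * \<alpha> x)) X \<le> (\<Sum>n. K * exp (- (s - s')) ^ n)" .
  qed
qed auto

section \<open>Convergence actions with conformal contraction\<close>

lemma ex_common_constant:
  assumes "\<not> (\<exists>C::real. \<forall>x\<in>S. \<forall>y\<in>T. f x y \<le> C)"
  shows "\<exists>x y. \<forall>n::nat. x n \<in> S \<and> y n \<in> T \<and> f (x n) (y n) > real n"
proof -
  have "\<forall>n::nat. \<exists>x y. x \<in> S \<and> y \<in> T \<and> f x y > real n"
    using assms by (meson not_le)
  then show ?thesis by metis
qed

text \<open>\<open>attracting \<gamma> A R\<close> says that \<open>\<gamma>\<close> moves all points of \<open>\<Lambda>\<close> other than \<open>R\<close> to \<open>A\<close>, and that the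
  sequence is good enough for uniform estimates; \<open>att g\<close> stands for \<open>U\<^sub>1(g)\<close> and need not lie in \<open>\<Lambda>\<close>.
  The last assumption is a substitute for the eigenvalue of \<open>g\<close> at a global fixed point.\<close>

locale conformal_convergence_action = group G for G :: "('g, 'm) monoid_scheme" (structure) +
  fixes \<alpha> :: "'g \<Rightarrow> real" and att :: "'g \<Rightarrow> 'e::heine_borel" and act :: "'g \<Rightarrow> 'e \<Rightarrow> 'e"
    and \<Lambda> :: "'e set" and attracting :: "(nat \<Rightarrow> 'g) \<Rightarrow> 'e \<Rightarrow> 'e \<Rightarrow> bool"
  assumes compact_limit: "compact \<Lambda>"
    and \<alpha>_nonneg: "g \<in> carrier G \<Longrightarrow> 0 \<le> \<alpha> g"
    and act_in: "g \<in> carrier G \<Longrightarrow> x \<in> \<Lambda> \<Longrightarrow> act g x \<in> \<Lambda>"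
    and act_mult: "g \<in> carrier G \<Longrightarrow> h \<in> carrier G \<Longrightarrow> x \<in> \<Lambda> \<Longrightarrow> act (g \<otimes> h) x = act g (act h x)"
    and act_one: "x \<in> \<Lambda> \<Longrightarrow> act \<one> x = x"
    and act_cont: "g \<in> carrier G \<Longrightarrow> continuous_on \<Lambda> (act g)"
    and attracting_carrier: "attracting \<gamma> A R \<Longrightarrow> \<gamma> n \<in> carrier G"
    and attracting_limit: "attracting \<gamma> A R \<Longrightarrow> A \<in> \<Lambda> \<and> R \<in> \<Lambda>"
    and attracting_\<alpha>: "attracting \<gamma> A R \<Longrightarrow> filterlim (\<lambda>n. \<alpha> (\<gamma> n)) at_top sequentially"
    and attracting_att: "attracting \<gamma> A R \<Longrightarrow> (\<lambda>n. att (\<gamma> n)) \<longlonglongrightarrow> A"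
    and attracting_inv: "attracting \<gamma> A R \<Longrightarrow> attracting (\<lambda>n. inv (\<gamma> n)) R A"
    and attracting_subseq: "attracting \<gamma> A R \<Longrightarrow> strict_mono r \<Longrightarrow> attracting (\<lambda>n. \<gamma> (r n)) A R"
    and attracting_ex: "inj \<gamma> \<Longrightarrow> (\<And>n. \<gamma> n \<in> carrier G) \<Longrightarrow>
      \<exists>r A R. strict_mono r \<and> attracting (\<lambda>n. \<gamma> (r n)) A R"
    and attracting_att_bound: "attracting \<gamma> A R \<Longrightarrow> (\<And>n. X n \<in> \<Lambda>) \<Longrightarrow> X \<longlonglongrightarrow> x0 \<Longrightarrow> x0 \<in> \<Lambda> \<Longrightarrow> x0 \<noteq> R \<Longrightarrow>
      \<exists>C. \<forall>\<^sub>F n in sequentially. dist (act (\<gamma> n) (X n)) (att (\<gamma> n)) \<le> C * exp (- \<alpha> (\<gamma> n))"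
    and attracting_separation: "attracting \<gamma> A R \<Longrightarrow> (\<And>n. X n \<in> \<Lambda>) \<Longrightarrow> X \<longlonglongrightarrow> x0 \<Longrightarrow> x0 \<in> \<Lambda> \<Longrightarrow> x0 \<noteq> R \<Longrightarrow>
      (\<And>n. Y n \<in> \<Lambda>) \<Longrightarrow> Y \<longlonglongrightarrow> y0 \<Longrightarrow> y0 \<in> \<Lambda> \<Longrightarrow> y0 \<noteq> R \<Longrightarrow> x0 \<noteq> y0 \<Longrightarrow>
      \<exists>c>0. \<forall>\<^sub>F n in sequentially. c * exp (- \<alpha> (\<gamma> n)) \<le> dist (act (\<gamma> n) (X n)) (act (\<gamma> n) (Y n))"
    and attracting_add: "attracting \<gamma> A R \<Longrightarrow> attracting \<eta> A' R' \<Longrightarrow> A' \<noteq> R \<Longrightarrow>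
      \<exists>C. \<forall>\<^sub>F n in sequentially. \<bar>\<alpha> (\<gamma> n \<otimes> \<eta> n) - \<alpha> (\<gamma> n) - \<alpha> (\<eta> n)\<bar> \<le> C"
    and \<alpha>_mult_bound: "g \<in> carrier G \<Longrightarrow>
      \<exists>C. \<forall>h\<in>carrier G. \<bar>\<alpha> (g \<otimes> h) - \<alpha> h\<bar> \<le> C \<and> \<bar>\<alpha> (h \<otimes> g) - \<alpha> h\<bar> \<le> C"
    and att_mult_left: "attracting \<gamma> A R \<Longrightarrow> h \<in> carrier G \<Longrightarrow> (\<lambda>n. att (h \<otimes> \<gamma> n)) \<longlonglongrightarrow> act h A"
    and att_mult_right: "attracting \<gamma> A R \<Longrightarrow> h \<in> carrier G \<Longrightarrow> (\<lambda>n. att (\<gamma> n \<otimes> h)) \<longlonglongrightarrow> A"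
    and limit_attracting: "z \<in> \<Lambda> \<Longrightarrow> \<exists>\<gamma> R. attracting \<gamma> z R"
    and fixed_point_hom: "\<xi> \<in> \<Lambda> \<Longrightarrow> (\<And>g. g \<in> carrier G \<Longrightarrow> act g \<xi> = \<xi>) \<Longrightarrow>
      \<exists>f :: 'g \<Rightarrow> real. (\<forall>g\<in>carrier G. \<forall>h\<in>carrier G. f (g \<otimes> h) = f g + f h) \<and>
        (\<forall>\<gamma> R. attracting \<gamma> \<xi> R \<longrightarrow> R \<noteq> \<xi> \<longrightarrow> filterlim (\<lambda>n. f (\<gamma> n)) at_top sequentially)"
begin

text \<open>The definition of conical flags repeated for the action on \<open>\<Lambda>\<close>;
  \<open>conical_points\<close> identifies the two.\<close>

definition conical :: "'e set" where
  "conical = {x \<in> \<Lambda>. \<exists>a\<in>\<Lambda>. \<exists>b\<in>\<Lambda>. a \<noteq> b \<and> (\<exists>\<gamma>::nat \<Rightarrow> 'g. inj \<gamma> \<and> range \<gamma> \<subseteq> carrier G \<and>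
     (\<lambda>n. act (\<gamma> n) x) \<longlonglongrightarrow> a \<and> (\<forall>y\<in>\<Lambda> - {x}. (\<lambda>n. act (\<gamma> n) y) \<longlonglongrightarrow> b))}"

lemma act_inv: "g \<in> carrier G \<Longrightarrow> x \<in> \<Lambda> \<Longrightarrow> act (inv g) (act g x) = x"
  using act_mult[of "inv g" g x] by (auto simp: act_one)

lemma act_inj: "g \<in> carrier G \<Longrightarrow> inj_on (act g) \<Lambda>"
  by (metis inj_onI act_inv)

lemma act_eq_iff: "g \<in> carrier G \<Longrightarrow> x \<in> \<Lambda> \<Longrightarrow> y \<in> \<Lambda> \<Longrightarrow> act g x = act g y \<longleftrightarrow> x = y"
  using act_inj inj_on_eq_iff by metis

lemma limit_subseq:
  fixes x :: "nat \<Rightarrow> 'e"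
  assumes "\<And>n. x n \<in> \<Lambda>"
  shows "\<exists>l r. l \<in> \<Lambda> \<and> strict_mono (r :: nat \<Rightarrow> nat) \<and> (\<lambda>n. x (r n)) \<longlonglongrightarrow> l"
  using compact_limit assms unfolding compact_def comp_def by blast

text \<open>The points \<open>x n\<close> may move, so this is locally uniform convergence away from
  \<open>R\<close>: the distance to \<open>att (\<gamma> n)\<close> decays like
  \<open>exp (- \<alpha> (\<gamma> n))\<close>, and \<open>att (\<gamma> n)\<close> tends to
  \<open>A\<close>.\<close>

lemma attracting_tendsto:
  assumes "attracting \<gamma> A R" "\<And>n. x n \<in> \<Lambda>" "x \<longlonglongrightarrow> x0" "x0 \<in> \<Lambda>" "x0 \<noteq> R"
  shows "(\<lambda>n. act (\<gamma> n) (x n)) \<longlonglongrightarrow> A"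
proof -
  obtain C where C: "\<forall>\<^sub>F n in sequentially. dist (act (\<gamma> n) (x n)) (att (\<gamma> n)) \<le> C * exp (- \<alpha> (\<gamma> n))"
    using attracting_att_bound[OF assms] by blast
  have "filterlim (\<lambda>n. - \<alpha> (\<gamma> n)) at_bot sequentially"
    using attracting_\<alpha>[OF assms(1)] by (simp add: filterlim_uminus_at_top)
  then have "(\<lambda>n. exp (- \<alpha> (\<gamma> n))) \<longlonglongrightarrow> 0"
    by (rule filterlim_compose[OF exp_at_bot])
  then have "(\<lambda>n. C * exp (- \<alpha> (\<gamma> n))) \<longlonglongrightarrow> 0"
    by (rule tendsto_mult_right_zero)
  then have "(\<lambda>n. dist (act (\<gamma> n) (x n)) (att (\<gamma> n))) \<longlonglongrightarrow> 0"
    by (rule tendsto_sandwich[OF _ C tendsto_const, rotated]) simp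
  from tendsto_add[OF this tendsto_dist[OF attracting_att[OF assms(1)] tendsto_const, of A]]
  have lim: "(\<lambda>n. dist (act (\<gamma> n) (x n)) (att (\<gamma> n)) + dist (att (\<gamma> n)) A) \<longlonglongrightarrow> 0"
    by simp
  have "(\<lambda>n. dist (act (\<gamma> n) (x n)) A) \<longlonglongrightarrow> 0"
    by (rule tendsto_sandwich[OF _ _ tendsto_const lim]) (auto intro!: always_eventually dist_triangle)
  then show ?thesis by (subst tendsto_dist_iff)
qed

lemma attracting_tendsto_const:
  assumes "attracting \<gamma> A R" "x \<in> \<Lambda>" "x \<noteq> R"
  shows "(\<lambda>n. act (\<gamma> n) x) \<longlonglongrightarrow> A"
  using attracting_tendsto[OF assms(1), of "\<lambda>_. x" x] assms by simp

lemma attracting_att_inv: "attracting \<gamma> A R \<Longrightarrow> (\<lambda>n. att (inv (\<gamma> n))) \<longlonglongrightarrow> R"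
  using attracting_att attracting_inv by blast

lemma attracting_not_eventually_bounded:
  assumes "attracting \<gamma> A R"
  shows "\<not> (\<forall>\<^sub>F n in sequentially. \<alpha> (\<gamma> n) \<le> C)"
proof
  assume "\<forall>\<^sub>F n in sequentially. \<alpha> (\<gamma> n) \<le> C"
  moreover have "\<forall>\<^sub>F n in sequentially. \<alpha> (\<gamma> n) > C"
    using attracting_\<alpha>[OF assms] by (simp add: filterlim_at_top_dense)
  ultimately have "\<forall>\<^sub>F n::nat in sequentially. False" by eventually_elim simp
  then show False by simp
qed

lemma attracting_unbounded:
  assumes "attracting \<gamma> A R" shows "\<exists>n. \<alpha> (\<gamma> n) > C"
proof (rule ccontr)
  assume "\<nexists>n. \<alpha> (\<gamma> n) > C"
  then have "\<alpha> (\<gamma> n) \<le> C" for n using not_le by blast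
  then have "\<forall>\<^sub>F n in sequentially. \<alpha> (\<gamma> n) \<le> C" by (simp add: always_eventually)
  then show False using attracting_not_eventually_bounded[OF assms] by blast
qed

text \<open>An infinite set of elements contains an attracting sequence, along which
  \<open>\<alpha>\<close> is unbounded. Hence size windows are finite and the group is
  countable.\<close>

lemma finite_\<alpha>_le: "finite {g \<in> carrier G. \<alpha> g \<le> B}"
proof (rule ccontr)
  assume "infinite {g \<in> carrier G. \<alpha> g \<le> B}"
  from infinite_countable_subset[OF this] obtain f :: "nat \<Rightarrow> 'g"
    where f: "inj f" "\<And>n. f n \<in> carrier G" "\<And>n. \<alpha> (f n) \<le> B" by blast
  from attracting_ex[OF f(1,2)] obtain r A R where "attracting (\<lambda>n. f (r n)) A R" by blast
  from attracting_unbounded[OF this, of B] f(3) show False by (meson not_le)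
qed

lemma countable_G: "countable (carrier G)"
proof -
  have "carrier G = (\<Union>n::nat. {g \<in> carrier G. \<alpha> g \<le> n})"
    using real_arch_simple by fastforce
  moreover have "countable (\<Union>n::nat. {g \<in> carrier G. \<alpha> g \<le> n})"
    using countable_finite[OF finite_\<alpha>_le] by blast
  ultimately show ?thesis by simp
qed

section \<open>Uniform estimates for directed sets\<close>

text \<open>The two cases to which every sequence of group elements reduces after passing to a
  subsequence.\<close>

definition tame :: "(nat \<Rightarrow> 'g) \<Rightarrow> bool" where
  "tame \<gamma> \<longleftrightarrow> (\<exists>c\<in>carrier G. \<forall>n. \<gamma> n = c) \<or> (\<exists>A R. attracting \<gamma> A R)"

lemma tame_subseq: "tame \<gamma> \<Longrightarrow> strict_mono r \<Longrightarrow> tame (\<lambda>n. \<gamma> (r n))"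
  unfolding tame_def using attracting_subseq by blast

lemma tame_ex:
  fixes \<gamma> :: "nat \<Rightarrow> 'g"
  assumes "\<And>n. \<gamma> n \<in> carrier G"
  shows "\<exists>r :: nat \<Rightarrow> nat. strict_mono r \<and> tame (\<lambda>n. \<gamma> (r n))"
proof -
  obtain r :: "nat \<Rightarrow> nat" where r: "strict_mono r" "(\<exists>c. \<forall>n. \<gamma> (r n) = c) \<or> inj (\<gamma> \<circ> r)"
    using constant_or_inj_subseq[of \<gamma>] by blast
  from r(2) show ?thesis
  proof
    assume "\<exists>c. \<forall>n. \<gamma> (r n) = c"
    then show ?thesis using r(1) assms unfolding tame_def by metis
  next
    assume "inj (\<gamma> \<circ> r)"
    from attracting_ex[OF this] assms obtain r' A R where r': "strict_mono r'" "attracting (\<lambda>n. \<gamma> (r (r' n))) A R"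
      by auto
    have "strict_mono (\<lambda>n. r (r' n))" using strict_mono_o[OF r(1) r'(1)] by (simp add: comp_def)
    then show ?thesis using r'(2) unfolding tame_def by blast
  qed
qed

lemma tame_ex2:
  fixes \<gamma> \<eta> :: "nat \<Rightarrow> 'g"
  assumes "\<And>n. \<gamma> n \<in> carrier G" "\<And>n. \<eta> n \<in> carrier G"
  shows "\<exists>r :: nat \<Rightarrow> nat. strict_mono r \<and> tame (\<lambda>n. \<gamma> (r n)) \<and> tame (\<lambda>n. \<eta> (r n))"
proof -
  obtain r where r: "strict_mono r" "tame (\<lambda>n. \<gamma> (r n))" using tame_ex[of \<gamma>] assms by blast
  obtain r' where r': "strict_mono r'" "tame (\<lambda>n. \<eta> (r (r' n)))"
    using tame_ex[of "\<lambda>n. \<eta> (r n)"] assms by blast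
  have "strict_mono (\<lambda>n. r (r' n))" using strict_mono_o[OF r(1) r'(1)] by (simp add: comp_def)
  moreover have "tame (\<lambda>n. \<gamma> (r (r' n)))" using tame_subseq[OF r(2) r'(1)] .
  ultimately show ?thesis using r'(2) by blast
qed

text \<open>A constant factor changes \<open>\<alpha>\<close> by a bounded amount
  (\<open>\<alpha>_mult_bound\<close>); two attracting sequences are transverse by the last
  assumption, so \<open>attracting_add\<close> applies.\<close>

lemma tame_add:
  assumes "tame \<gamma>" "tame \<eta>" "\<And>A R A' R'. attracting \<gamma> A R \<Longrightarrow> attracting \<eta> A' R' \<Longrightarrow> A' \<noteq> R"
  shows "\<exists>C. \<forall>\<^sub>F n in sequentially. \<bar>\<alpha> (\<gamma> n \<otimes> \<eta> n) - \<alpha> (\<gamma> n) - \<alpha> (\<eta> n)\<bar> \<le> C"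
proof -
  have carr: "\<gamma> n \<in> carrier G" "\<eta> n \<in> carrier G" for n
    using assms(1,2) attracting_carrier unfolding tame_def by (metis, metis)
  consider (1) c where "c \<in> carrier G" "\<forall>n. \<gamma> n = c" | (2) c where "c \<in> carrier G" "\<forall>n. \<eta> n = c"
    | (3) A R A' R' where "attracting \<gamma> A R" "attracting \<eta> A' R'"
    using assms(1,2) unfolding tame_def by blast
  then show ?thesis
  proof cases
    case 1
    obtain C where C: "\<forall>h\<in>carrier G. \<bar>\<alpha> (c \<otimes> h) - \<alpha> h\<bar> \<le> C" using \<alpha>_mult_bound[OF 1(1)] by blast
    have "\<bar>\<alpha> (\<gamma> n \<otimes> \<eta> n) - \<alpha> (\<gamma> n) - \<alpha> (\<eta> n)\<bar> \<le> C + \<bar>\<alpha> c\<bar>" for n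
      using C[rule_format, OF carr(2)[of n]] 1(2) by simp
    then show ?thesis by (intro exI always_eventually allI)
  next
    case 2
    obtain C where C: "\<forall>h\<in>carrier G. \<bar>\<alpha> (h \<otimes> c) - \<alpha> h\<bar> \<le> C" using \<alpha>_mult_bound[OF 2(1)] by blast
    have "\<bar>\<alpha> (\<gamma> n \<otimes> \<eta> n) - \<alpha> (\<gamma> n) - \<alpha> (\<eta> n)\<bar> \<le> C + \<bar>\<alpha> c\<bar>" for n
      using C[rule_format, OF carr(1)[of n]] 2(2) by simp
    then show ?thesis by (intro exI always_eventually allI)
  next
    case 3
    then show ?thesis using attracting_add assms(3) by blast
  qed
qed

text \<open>Transversality of a set of elements, phrased through limits of sequences so that
  finitely many members do not matter: attracting points lie in \<open>V\<close>, repelling points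
  in \<open>W\<close>.\<close>

definition directed :: "'e set \<Rightarrow> 'e set \<Rightarrow> 'g set \<Rightarrow> bool" where
  "directed V W S \<longleftrightarrow> S \<subseteq> carrier G \<and> V \<subseteq> \<Lambda> \<and> W \<subseteq> \<Lambda> \<and> compact V \<and> compact W \<and> V \<inter> W = {} \<and>
     (\<forall>\<gamma> A R. (\<forall>n. \<gamma> n \<in> S) \<longrightarrow> attracting \<gamma> A R \<longrightarrow> A \<in> V \<and> R \<in> W)"

lemma directedD: "directed V W S \<Longrightarrow> (\<And>n. \<gamma> n \<in> S) \<Longrightarrow> attracting \<gamma> A R \<Longrightarrow> A \<in> V \<and> R \<in> W"
  unfolding directed_def by blast

text \<open>A sequence of pairs with unbounded defect has a tame subsequence; its ends lie in the
  disjoint sets \<open>V\<close> and \<open>W\<close>, so \<open>tame_add\<close> bounds the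
  defect.\<close>

lemma directed_add:
  assumes "directed V W S"
  shows "\<exists>C. \<forall>g\<in>S. \<forall>h\<in>S. \<bar>\<alpha> (g \<otimes> h) - \<alpha> g - \<alpha> h\<bar> \<le> C"
proof (rule ccontr)
  assume "\<not> ?thesis"
  from ex_common_constant[OF this] obtain g h where
    gh: "\<And>n::nat. g n \<in> S \<and> h n \<in> S \<and> \<bar>\<alpha> (g n \<otimes> h n) - \<alpha> (g n) - \<alpha> (h n)\<bar> > real n" by blast
  have S: "S \<subseteq> carrier G" using assms by (simp add: directed_def)
  obtain r where r: "strict_mono r" "tame (\<lambda>n. g (r n))" "tame (\<lambda>n. h (r n))"
    using tame_ex2[of g h] gh S by blast
  have ne: "A' \<noteq> R" if "attracting (\<lambda>n. g (r n)) A R" "attracting (\<lambda>n. h (r n)) A' R'" for A R A' R'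
  proof -
    have "A' \<in> V \<and> R' \<in> W" using directedD[OF assms _ that(2)] gh by blast
    moreover have "A \<in> V \<and> R \<in> W" using directedD[OF assms _ that(1)] gh by blast
    moreover have "V \<inter> W = {}" using assms unfolding directed_def by blast
    ultimately show ?thesis by blast
  qed
  have "\<exists>C. \<forall>\<^sub>F n in sequentially. \<bar>\<alpha> (g (r n) \<otimes> h (r n)) - \<alpha> (g (r n)) - \<alpha> (h (r n))\<bar> \<le> C"
    by (rule tame_add[OF r(2,3)]) (rule ne)
  then obtain C where
    "\<forall>\<^sub>F n in sequentially. \<bar>\<alpha> (g (r n) \<otimes> h (r n)) - \<alpha> (g (r n)) - \<alpha> (h (r n))\<bar> \<le> C" by blast
  moreover have "\<forall>\<^sub>F n in sequentially. real n > C"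
    using filterlim_real_sequentially by (simp add: filterlim_at_top_dense)
  ultimately have "\<forall>\<^sub>F n::nat in sequentially. False"
  proof eventually_elim
    case (elim n)
    have "real n \<le> real (r n)" using strict_mono_imp_increasing[OF r(1)] by simp
    then show ?case using elim gh[of "r n"] by linarith
  qed
  then show False by simp
qed

text \<open>Counterexamples have limits \<open>x0\<close> and \<open>y0\<close> in \<open>V\<close>,
  distinct because of \<open>c0\<close> and different from \<open>R\<close> because \<open>R\<close>
  lies in \<open>W\<close>. So \<open>attracting_separation\<close> contradicts the vanishing
  ratios.\<close>

lemma directed_separation:
  assumes "directed V W S" "c0 > 0"
  shows "\<exists>c>0. \<forall>w\<in>S. \<forall>x\<in>V. \<forall>y\<in>V. c0 \<le> dist x y \<longrightarrow> c * exp (- \<alpha> w) \<le> dist (act w x) (act w y)"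
proof (rule ccontr)
  assume neg: "\<not> ?thesis"
  have S: "S \<subseteq> carrier G" "V \<subseteq> \<Lambda>" "compact V" "V \<inter> W = {}" using assms by (simp_all add: directed_def)
  have "\<forall>n::nat. \<exists>w x y. w \<in> S \<and> x \<in> V \<and> y \<in> V \<and> c0 \<le> dist x y \<and>
      dist (act w x) (act w y) < inverse (real (Suc n)) * exp (- \<alpha> w)"
  proof
    fix n :: nat
    have "inverse (real (Suc n)) > 0" by simp
    then show "\<exists>w x y. w \<in> S \<and> x \<in> V \<and> y \<in> V \<and> c0 \<le> dist x y \<and>
      dist (act w x) (act w y) < inverse (real (Suc n)) * exp (- \<alpha> w)"
      using neg by (meson not_le)
  qed
  then obtain w x y where w: "\<And>n. w n \<in> S" and x: "\<And>n. x n \<in> V" and y: "\<And>n. y n \<in> V"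
    and xy: "\<And>n. c0 \<le> dist (x n) (y n)"
    and sm: "\<And>n. dist (act (w n) (x n)) (act (w n) (y n)) < inverse (real (Suc n)) * exp (- \<alpha> (w n))"
    by metis
  obtain r1 where r1: "strict_mono r1" "tame (\<lambda>n. w (r1 n))" using tame_ex[of w] w S by blast
  obtain x0 r2 where r2: "strict_mono r2" "x0 \<in> V" "(\<lambda>n. x (r1 (r2 n))) \<longlonglongrightarrow> x0"
    using S(3) x unfolding compact_def comp_def by meson
  obtain y0 r3 where r3: "strict_mono r3" "y0 \<in> V" "(\<lambda>n. y (r1 (r2 (r3 n)))) \<longlonglongrightarrow> y0"
    using S(3) y unfolding compact_def comp_def by meson
  define r where "r n = r1 (r2 (r3 n))" for n
  have r: "strict_mono r" using r1(1) r2(1) r3(1) unfolding r_def strict_mono_def by blast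
  have "strict_mono (\<lambda>n. r2 (r3 n))" using r2(1) r3(1) unfolding strict_mono_def by blast
  then have tame: "tame (\<lambda>n. w (r n))" using tame_subseq[OF r1(2)] by (simp add: r_def)
  have xl: "(\<lambda>n. x (r n)) \<longlonglongrightarrow> x0"
    using LIMSEQ_subseq_LIMSEQ[OF r2(3) r3(1)] by (simp add: r_def comp_def)
  have yl: "(\<lambda>n. y (r n)) \<longlonglongrightarrow> y0" using r3(3) by (simp add: r_def)
  have "c0 \<le> dist x0 y0"
    by (rule tendsto_lowerbound[OF tendsto_dist[OF xl yl]]) (use xy in auto)
  then have ne: "x0 \<noteq> y0" using assms(2) by auto
  have "\<exists>c>0. \<forall>\<^sub>F n in sequentially. c * exp (- \<alpha> (w (r n))) \<le> dist (act (w (r n)) (x (r n))) (act (w (r n)) (y (r n)))"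
  proof (cases "\<exists>A R. attracting (\<lambda>n. w (r n)) A R")
    case True
    then obtain A R where n: "attracting (\<lambda>n. w (r n)) A R" by blast
    then have "A \<in> V \<and> R \<in> W" using directedD[OF assms(1) _ n] w by blast
    then have "x0 \<noteq> R" "y0 \<noteq> R" using S r2 r3 by auto
    then show ?thesis using attracting_separation[OF n _ xl _ _ _ yl] ne x y S r2(2) r3(2) by blast
  next
    case False
    \<comment> \<open>A constant sequence: a single element acts continuously and injectively, which
      keeps the images of \<open>x0\<close> and \<open>y0\<close> apart.\<close>
    then obtain c where c: "c \<in> carrier G" "\<And>n. w (r n) = c" using tame unfolding tame_def by blast
    have "continuous_on \<Lambda> (act c)" using act_cont c by blast
    then have "(\<lambda>n. act c (x (r n))) \<longlonglongrightarrow> act c x0" "(\<lambda>n. act c (y (r n))) \<longlonglongrightarrow> act c y0"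
      using x y S(2) r2(2) r3(2)
      by (auto intro!: always_eventually subsetD[OF S(2)] continuous_on_tendsto_compose[OF _ xl] continuous_on_tendsto_compose[OF _ yl])
    then have lim: "(\<lambda>n. dist (act c (x (r n))) (act c (y (r n)))) \<longlonglongrightarrow> dist (act c x0) (act c y0)"
      by (rule tendsto_dist)
    have pos: "dist (act c x0) (act c y0) > 0" using ne act_eq_iff[OF c(1), of x0 y0] r2(2) r3(2) S(2) by auto
    define D where "D = dist (act c x0) (act c y0) / 2"
    have D: "D > 0" "D < dist (act c x0) (act c y0)" using pos by (auto simp: D_def)
    have "\<forall>\<^sub>F n in sequentially. D < dist (act c (x (r n))) (act c (y (r n)))"
      using order_tendstoD(1)[OF lim D(2)] .
    then have "\<forall>\<^sub>F n in sequentially. (D / exp (- \<alpha> c)) * exp (- \<alpha> (w (r n))) \<le> dist (act (w (r n)) (x (r n))) (act (w (r n)) (y (r n)))"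
      by eventually_elim (simp add: c)
    then show ?thesis using D by (intro exI[of _ "D / exp (- \<alpha> c)"]) auto
  qed
  then obtain c where c: "c > 0" "\<forall>\<^sub>F n in sequentially. c * exp (- \<alpha> (w (r n))) \<le> dist (act (w (r n)) (x (r n))) (act (w (r n)) (y (r n)))"
    by blast
  have "(\<lambda>n. inverse (real (Suc n))) \<longlonglongrightarrow> 0" by (rule LIMSEQ_inverse_real_of_nat)
  then have "\<forall>\<^sub>F n in sequentially. inverse (real (Suc n)) < c" using c(1) order_tendstoD(2) by blast
  with c(2) have "\<forall>\<^sub>F n::nat in sequentially. False"
  proof eventually_elim
    case (elim n)
    have "inverse (real (Suc (r n))) \<le> inverse (real (Suc n))"
      using strict_mono_imp_increasing[OF r, of n] by (intro le_imp_inverse_le) auto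
    then have "inverse (real (Suc (r n))) * exp (- \<alpha> (w (r n))) \<le> c * exp (- \<alpha> (w (r n)))"
      using elim by (intro mult_right_mono) (linarith, simp)
    then show ?case using elim sm[of "r n"] by linarith
  qed
  then show False by simp
qed

text \<open>Let \<open>z = inv g \<otimes> h\<close> be unbounded. Since
  \<open>h = g \<otimes> z\<close> and \<open>g = h \<otimes> inv z\<close> have nearly the same
  size, neither product can be coarsely additive, which forces both ends of \<open>z\<close> into
  \<open>W\<close>. But then \<open>z\<close> cannot map a point of \<open>V\<close> to a point of
  \<open>V\<close>, as a common point of the two images requires.\<close>

lemma directed_overlap:
  assumes "directed V W S"
  shows "\<exists>B. \<forall>g\<in>S. \<forall>h\<in>S. \<bar>\<alpha> g - \<alpha> h\<bar> \<le> 1 \<longrightarrow> act g ` V \<inter> act h ` V \<noteq> {} \<longrightarrow> \<alpha> (inv g \<otimes> h) \<le> B"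
proof (rule ccontr)
  assume neg: "\<not> ?thesis"
  have S: "S \<subseteq> carrier G" "V \<subseteq> \<Lambda>" "compact V" "V \<inter> W = {}" "compact W" using assms by (simp_all add: directed_def)
  have "\<forall>n::nat. \<exists>g h. g \<in> S \<and> h \<in> S \<and> \<bar>\<alpha> g - \<alpha> h\<bar> \<le> 1 \<and> act g ` V \<inter> act h ` V \<noteq> {} \<and> \<alpha> (inv g \<otimes> h) > real n"
    using neg by (meson not_le)
  then obtain g h where g: "\<And>n. g n \<in> S" and h: "\<And>n. h n \<in> S" and gh: "\<And>n. \<bar>\<alpha> (g n) - \<alpha> (h n)\<bar> \<le> 1"
    and ov: "\<And>n. act (g n) ` V \<inter> act (h n) ` V \<noteq> {}"
    and big: "\<And>n::nat. \<alpha> (inv (g n) \<otimes> h n) > real n"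
    by metis
  have "\<forall>n. \<exists>v v'. v \<in> V \<and> v' \<in> V \<and> act (g n) v = act (h n) v'" using ov by blast
  then obtain v v' where v: "\<And>n. v n \<in> V" and v': "\<And>n. v' n \<in> V" and vv: "\<And>n. act (g n) (v n) = act (h n) (v' n)"
    by metis
  define z where "z n = inv (g n) \<otimes> h n" for n
  have gc: "g n \<in> carrier G" and hc: "h n \<in> carrier G" and zc: "z n \<in> carrier G" for n
    using g[of n] h[of n] S(1) by (auto simp: z_def intro!: m_closed inv_closed)
  have gz: "g n \<otimes> z n = h n" and hz: "h n \<otimes> inv (z n) = g n" for n
    using gc hc by (simp_all add: z_def inv_mult_group m_assoc[symmetric])
  have zv: "act (z n) (v' n) = v n" for n
  proof -
    have "v n \<in> \<Lambda>" "v' n \<in> \<Lambda>" using v v' S(2) by auto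
    then show ?thesis
      using vv[of n] gc[of n] hc[of n] act_mult[of "inv (g n)" "h n" "v' n"] act_inv[of "g n" "v n"]
      by (simp add: z_def)
  qed
  obtain r1 where r1: "strict_mono r1" "tame (\<lambda>n. g (r1 n))" "tame (\<lambda>n. h (r1 n))"
    using tame_ex2[of g h] gc hc by blast
  obtain r2 where r2: "strict_mono r2" "tame (\<lambda>n. z (r1 (r2 n)))"
    using tame_ex[of "\<lambda>n. z (r1 n)"] zc by blast
  obtain y r3 where r3: "strict_mono r3" "y \<in> V" "(\<lambda>n. v' (r1 (r2 (r3 n)))) \<longlonglongrightarrow> y"
    using S(3) v' unfolding compact_def comp_def by meson
  define r where "r n = r1 (r2 (r3 n))" for n
  have r: "strict_mono r" using r1(1) r2(1) r3(1) unfolding r_def strict_mono_def by blast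
  have "strict_mono (\<lambda>n. r2 (r3 n))" using r2(1) r3(1) unfolding strict_mono_def by blast
  then have tg: "tame (\<lambda>n. g (r n))" and th: "tame (\<lambda>n. h (r n))"
    using tame_subseq[OF r1(2)] tame_subseq[OF r1(3)] by (simp_all add: r_def)
  have tz: "tame (\<lambda>n. z (r n))" using tame_subseq[OF r2(2) r3(1)] by (simp add: r_def)
  have zbig: "real n < \<alpha> (z (r n))" for n
  proof -
    have "real n \<le> real (r n)" using strict_mono_imp_increasing[OF r, of n] by simp
    then show ?thesis using big[of "r n"] unfolding z_def by linarith
  qed
  have "\<nexists>c. \<forall>n. z (r n) = c"
  proof
    assume "\<exists>c. \<forall>n. z (r n) = c"
    then obtain c where "\<And>n. real n < \<alpha> c" using zbig by metis
    then show False using reals_Archimedean2[of "\<alpha> c"] less_asym by blast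
  qed
  then obtain A R where nz: "attracting (\<lambda>n. z (r n)) A R" using tz unfolding tame_def by blast
  \<comment> \<open>Coarse additivity would bound \<open>\<alpha> (z' n)\<close> by the difference
    of two sizes that differ by at most 1.\<close>
  have notadd: "\<not> (\<exists>C. \<forall>\<^sub>F n in sequentially. \<bar>\<alpha> (p n) - \<alpha> (p' n) - \<alpha> (z' n)\<bar> \<le> C)"
    if "\<And>n. \<bar>\<alpha> (p n) - \<alpha> (p' n)\<bar> \<le> 1" "attracting z' A1 R1" for p p' z' A1 R1
  proof
    assume "\<exists>C. \<forall>\<^sub>F n in sequentially. \<bar>\<alpha> (p n) - \<alpha> (p' n) - \<alpha> (z' n)\<bar> \<le> C"
    then obtain C where "\<forall>\<^sub>F n in sequentially. \<bar>\<alpha> (p n) - \<alpha> (p' n) - \<alpha> (z' n)\<bar> \<le> C" by blast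
    then have "\<forall>\<^sub>F n in sequentially. \<alpha> (z' n) \<le> C + 1"
    proof eventually_elim
      case (elim n) then show ?case using that(1)[of n] by linarith
    qed
    then show False using attracting_not_eventually_bounded[OF that(2)] by blast
  qed
  \<comment> \<open>Outside \<open>W\<close>, the point \<open>A\<close> would differ from every
    repelling point of \<open>g\<close>, and sizes would add in
    \<open>h = g \<otimes> z\<close>.\<close>
  have "A \<in> W"
  proof (rule ccontr)
    assume nA: "A \<notin> W"
    have ne: "A' \<noteq> R1" if "attracting (\<lambda>n. g (r n)) A1 R1" "attracting (\<lambda>n. z (r n)) A' R'" for A1 R1 A' R'
    proof -
      have "R1 \<in> W" using directedD[OF assms _ that(1)] g by blast
      moreover have "A' = A" using attracting_att[OF that(2)] attracting_att[OF nz] LIMSEQ_unique by blast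
      ultimately show ?thesis using nA by auto
    qed
    from tame_add[OF tg tz ne] have "\<exists>C. \<forall>\<^sub>F n in sequentially. \<bar>\<alpha> (h (r n)) - \<alpha> (g (r n)) - \<alpha> (z (r n))\<bar> \<le> C"
      by (simp add: gz)
    then show False using notadd[of "\<lambda>n. h (r n)" "\<lambda>n. g (r n)" "\<lambda>n. z (r n)", OF _ nz] gh
      by (simp add: abs_minus_commute)
  qed
  have nz': "attracting (\<lambda>n. inv (z (r n))) R A" using attracting_inv[OF nz] .
  have "R \<in> W"
  \<comment> \<open>The same argument for \<open>g = h \<otimes> inv z\<close>, where
    \<open>R\<close> is the attracting point of \<open>inv z\<close>.\<close>
  proof (rule ccontr)
    assume nA: "R \<notin> W"
    have ne: "A' \<noteq> R1" if "attracting (\<lambda>n. h (r n)) A1 R1" "attracting (\<lambda>n. inv (z (r n))) A' R'" for A1 R1 A' R'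
    proof -
      have "R1 \<in> W" using directedD[OF assms _ that(1)] h by blast
      moreover have "A' = R" using attracting_att[OF that(2)] attracting_att[OF nz'] LIMSEQ_unique by blast
      ultimately show ?thesis using nA by auto
    qed
    have ti: "tame (\<lambda>n. inv (z (r n)))" unfolding tame_def using nz' by blast
    from tame_add[OF th ti ne]
    have "\<exists>C. \<forall>\<^sub>F n in sequentially. \<bar>\<alpha> (g (r n)) - \<alpha> (h (r n)) - \<alpha> (inv (z (r n)))\<bar> \<le> C"
      by (simp add: hz)
    then show False using notadd[of "\<lambda>n. g (r n)" "\<lambda>n. h (r n)" "\<lambda>n. inv (z (r n))", OF _ nz'] gh by simp
  qed
  \<comment> \<open>Away from \<open>R\<close>, the elements \<open>z\<close> move the points
    \<open>v'\<close> to \<open>A\<close>, which lies in \<open>W\<close>, although the images are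
    the points \<open>v\<close> of \<open>V\<close>.\<close>
  then have "y \<noteq> R" using r3(2) S(4) by auto
  then have "(\<lambda>n. act (z (r n)) (v' (r n))) \<longlonglongrightarrow> A"
    using attracting_tendsto[OF nz, of "\<lambda>n. v' (r n)" y] v' S(2) r3(2,3) by (auto simp: r_def)
  then have "(\<lambda>n. v (r n)) \<longlonglongrightarrow> A" by (simp add: zv)
  then have "A \<in> V" using closed_sequentially[OF compact_imp_closed[OF S(3)], of "\<lambda>n. v (r n)" A] v by blast
  then show False using \<open>A \<in> W\<close> S(4) by blast
qed

end

section \<open>Where the series diverges\<close>

context conformal_convergence_action
begin

lemma hom_pow:
  assumes f: "\<forall>g\<in>carrier G. \<forall>h\<in>carrier G. f (g \<otimes> h) = f g + (f h :: real)" and g: "g \<in> carrier G"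
  shows "f \<one> = 0" "f (inv g) = - f g" "f (g [^] (n::nat)) = n * f g"
proof -
  show f1: "f \<one> = 0" using f by (metis add_cancel_right_right one_closed r_one)
  show "f (inv g) = - f g" using f g f1 by (metis add_eq_0_iff inv_closed r_inv)
  show "f (g [^] n) = n * f g"
    using f1 f g by (induction n) (auto simp: algebra_simps)
qed

text \<open>If \<open>\<xi>\<close> were a global fixed point, some \<open>g\<close> would attract to another fixed point \<open>A\<close>, which some
  element \<open>p\<close> of the sequence \<open>\<gamma>\<close> moves. The conjugates \<open>g\<^sup>k p g\<^sup>-\<^sup>k\<close> are then unbounded, while the
  homomorphism of \<open>fixed_point_hom\<close> is constant on them and tends to infinity along such sequences or
  their inverses.\<close>

lemma exists_moving_fixed_point:
  assumes par: "attracting \<gamma> \<xi> \<xi>" and z: "z \<in> \<Lambda>" "z \<noteq> \<xi>"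
  shows "\<exists>h\<in>carrier G. act h \<xi> \<noteq> \<xi>"
proof (rule ccontr)
  assume "\<not> ?thesis"
  then have fixd: "act h \<xi> = \<xi>" if "h \<in> carrier G" for h using that by blast
  have \<xi>: "\<xi> \<in> \<Lambda>" using attracting_limit par by blast
  obtain f :: "'g \<Rightarrow> real" where f: "\<forall>g\<in>carrier G. \<forall>h\<in>carrier G. f (g \<otimes> h) = f g + f h"
    and f_top: "\<And>\<gamma> R. attracting \<gamma> \<xi> R \<Longrightarrow> R \<noteq> \<xi> \<Longrightarrow> filterlim (\<lambda>n. f (\<gamma> n)) at_top sequentially"
    using fixed_point_hom[OF \<xi> fixd] by blast
  \<comment> \<open>The fixed point is an end of every attracting sequence: unless it is the
    repelling point, it must itself move to the attracting one.\<close>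
  have one_end: "A = \<xi>" if "attracting g A R" "R \<noteq> \<xi>" for g A R
  proof -
    have "(\<lambda>n. act (g n) \<xi>) \<longlonglongrightarrow> A" using attracting_tendsto_const[OF that(1) \<xi>] that(2) by blast
    then show ?thesis using fixd attracting_carrier[OF that(1)] by (simp add: LIMSEQ_const_iff)
  qed
  obtain \<eta> R where \<eta>: "attracting \<eta> z R" using limit_attracting z by blast
  then have \<eta>: "attracting \<eta> z \<xi>" using one_end z by metis
  \<comment> \<open>\<open>W\<close> is a compact neighbourhood of \<open>z\<close> in
    \<open>\<Lambda>\<close> that misses \<open>\<xi>\<close>.\<close>
  define r where "r = dist z \<xi> / 2"
  define W where "W = \<Lambda> \<inter> cball z r"
  have r: "r > 0" "\<xi> \<notin> W" "z \<in> W" using z by (auto simp: r_def W_def)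
  have W: "compact W" "W \<subseteq> \<Lambda>" using compact_limit by (auto simp: W_def intro: compact_Int_closed)
  have "filterlim (\<lambda>n. f (inv (\<eta> n))) at_top sequentially" using f_top[OF attracting_inv[OF \<eta>] z(2)] .
  then have "\<forall>\<^sub>F n in sequentially. 0 < f (inv (\<eta> n))" by (simp add: filterlim_at_top_dense)
  then obtain N where N: "\<And>n. n \<ge> N \<Longrightarrow> 0 < f (inv (\<eta> n))" by (auto simp: eventually_sequentially)
  \<comment> \<open>The sequence repels from \<open>\<xi>\<close>, which lies outside
    \<open>W\<close>, and contracts to the centre \<open>z\<close> of \<open>W\<close>. The
    condition \<open>n \<ge> N\<close> also makes \<open>f\<close> negative on the chosen
    element.\<close>
  have "\<exists>n\<ge>N. act (\<eta> n) ` W \<subseteq> W"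
  proof (rule ccontr)
    assume "\<not> ?thesis"
    then have "\<forall>n. \<exists>x. x \<in> W \<and> act (\<eta> (N + n)) x \<notin> W" by (meson image_subsetI le_add1)
    then obtain x where x: "\<And>n. x n \<in> W" "\<And>n. act (\<eta> (N + n)) (x n) \<notin> W" by metis
    obtain l s where s: "l \<in> W" "strict_mono (s :: nat \<Rightarrow> nat)" "(\<lambda>n. x (s n)) \<longlonglongrightarrow> l"
      using W(1) x(1) unfolding compact_def comp_def by meson
    have "strict_mono (\<lambda>n. N + s n)" using s(2) by (simp add: strict_mono_def)
    then have n: "attracting (\<lambda>n. \<eta> (N + s n)) z \<xi>" using attracting_subseq[OF \<eta>] by blast
    have "(\<lambda>n. act (\<eta> (N + s n)) (x (s n))) \<longlonglongrightarrow> z"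
      by (rule attracting_tendsto[OF n _ s(3)]) (use x(1) W(2) s(1) r(2) in auto)
    then have "\<forall>\<^sub>F n in sequentially. dist (act (\<eta> (N + s n)) (x (s n))) z < r"
      using r(1) by (rule tendstoD)
    then obtain n where "dist (act (\<eta> (N + s n)) (x (s n))) z < r"
      using eventually_happens by fastforce
    moreover have "act (\<eta> (N + s n)) (x (s n)) \<in> \<Lambda>"
      using act_in attracting_carrier[OF \<eta>] x(1) W(2) by blast
    ultimately show False using x(2)[of "s n"] by (auto simp: W_def dist_commute)
  qed
  then obtain n where n: "n \<ge> N" "act (\<eta> n) ` W \<subseteq> W" by blast
  define g where "g = \<eta> n"
  have g: "g \<in> carrier G" "act g ` W \<subseteq> W" "f g < 0"
    using attracting_carrier[OF \<eta>] n N[OF n(1)] hom_pow(2)[OF f] by (auto simp: g_def)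
  have gW: "act (g [^] k) x \<in> W" if "x \<in> W" for k :: nat and x
  proof (induction k)
    case 0 then show ?case using that W(2) act_one by auto
  next
    case (Suc k)
    have "act (g [^] Suc k) x = act (g \<otimes> g [^] k) x" by (simp only: nat_pow_Suc2[OF g(1)])
    also have "\<dots> = act g (act (g [^] k) x)" using act_mult[of g "g [^] k" x] g(1) that W(2) by auto
    finally show ?case using Suc g(2) by auto
  qed
  have "inj (\<lambda>k::nat. g [^] k)"
  proof (rule injI)
    fix k l :: nat assume "g [^] k = g [^] l"
    then have "f (g [^] k) = f (g [^] l)" by simp
    then show "k = l" using g(3) hom_pow(3)[OF f g(1)] by simp
  qed
  from attracting_ex[OF this nat_pow_closed[OF g(1)]] obtain s :: "nat \<Rightarrow> nat" and A R
    where s: "strict_mono s" "attracting (\<lambda>k. g [^] s k) A R" by blast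
  \<comment> \<open>Otherwise the powers of \<open>g\<close> attract to \<open>\<xi>\<close> and
    \<open>f\<close> tends to infinity along them, although \<open>f g\<close> is negative.\<close>
  have R: "R = \<xi>"
  proof (rule ccontr)
    assume R: "R \<noteq> \<xi>"
    then have "A = \<xi>" using one_end s(2) by blast
    then have "filterlim (\<lambda>k. f (g [^] s k)) at_top sequentially" using f_top s(2) R by blast
    then have "\<forall>\<^sub>F k in sequentially. f (g [^] s k) > 0" by (simp add: filterlim_at_top_dense)
    then obtain k where "f (g [^] s k) > 0" using eventually_happens by fastforce
    moreover have "real (s k) * f g \<le> 0" using g(3) by (intro mult_nonneg_nonpos) auto
    ultimately show False using hom_pow(3)[OF f g(1), of "s k"] by simp
  qed
  have "(\<lambda>k. act (g [^] s k) z) \<longlonglongrightarrow> A" using attracting_tendsto_const[OF s(2) z(1)] z(2) R by simp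
  then have AW: "A \<in> W"
    using closed_sequentially[OF compact_imp_closed[OF W(1)], of "\<lambda>k. act (g [^] s k) z" A] gW r(3) by blast
  have A: "A \<in> \<Lambda>" "A \<noteq> \<xi>" using AW W(2) r(2) by auto
  have gs: "attracting (\<lambda>k. g [^] s k) A \<xi>" using s(2) R by simp
  \<comment> \<open>The two products are equal, and their attracting points tend to \<open>A\<close>
    and to \<open>act g A\<close>; hence \<open>g\<close> fixes \<open>A\<close>.\<close>
  have "(\<lambda>k. att (g [^] s k \<otimes> g)) \<longlonglongrightarrow> A" using att_mult_right[OF gs g(1)] .
  moreover have "(\<lambda>k. att (g \<otimes> g [^] s k)) \<longlonglongrightarrow> act g A" using att_mult_left[OF gs g(1)] .
  moreover have "(\<lambda>k. att (g [^] s k \<otimes> g)) = (\<lambda>k. att (g \<otimes> g [^] s k))"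
    using nat_pow_Suc2[OF g(1)] by (simp add: fun_eq_iff)
  ultimately have gA: "act g A = A" using LIMSEQ_unique by metis
  have gkA: "act (g [^] k) A = A" for k :: nat
    using gA A act_one act_mult g(1) by (induction k) auto
  \<comment> \<open>Both ends of \<open>\<gamma>\<close> are \<open>\<xi>\<close>, so
    \<open>A\<close> is moved towards \<open>\<xi>\<close> and is not fixed by all members.\<close>
  have "(\<lambda>n. act (\<gamma> n) A) \<longlonglongrightarrow> \<xi>" using attracting_tendsto_const[OF par A] .
  then have "\<forall>\<^sub>F n in sequentially. act (\<gamma> n) A \<noteq> A" using tendsto_imp_eventually_ne A(2) by metis
  then obtain m where m: "act (\<gamma> m) A \<noteq> A" using eventually_happens by fastforce
  define p where "p = \<gamma> m"
  have p: "p \<in> carrier G" "act p A \<noteq> A" using m attracting_carrier[OF par] by (auto simp: p_def)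
  have pA: "act p A \<in> \<Lambda>" "act p A \<noteq> \<xi>" using p A \<xi> act_in act_eq_iff fixd by metis+
  define q where "q k = g [^] s k \<otimes> p \<otimes> inv (g [^] s k)" for k
  have qc: "q k \<in> carrier G" for k using p g by (simp add: q_def)
  have fq: "f (q k) = f p" for k
    using f p(1) g(1) hom_pow(2)[OF f, of "g [^] s k"] by (simp add: q_def)
  have "act (inv (g [^] k)) A = A" for k :: nat using act_inv[of "g [^] k" A] gkA g(1) A(1) by simp
  then have qA: "act (q k) A = act (g [^] s k) (act p A)" for k
    using act_mult p(1) g(1) A(1) pA(1) by (simp add: q_def)
  \<comment> \<open>The inverse powers of \<open>g\<close> fix \<open>A\<close>, then
    \<open>p\<close> moves it away, and the powers of \<open>g\<close> bring it back. This
    determines the ends of a subsequence of the conjugates.\<close>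
  have qlim: "(\<lambda>k. act (q k) A) \<longlonglongrightarrow> A" unfolding qA using attracting_tendsto_const[OF gs pA] .
  obtain t where t: "strict_mono t" "tame (\<lambda>k. q (t k))" using tame_ex[of q] qc by blast
  have qtlim: "(\<lambda>k. act (q (t k)) A) \<longlonglongrightarrow> A"
    using LIMSEQ_subseq_LIMSEQ[OF qlim t(1)] by (simp add: comp_def)
  have not_top: "\<not> filterlim (\<lambda>k::nat. c) at_top sequentially" for c :: real
    by (simp add: filterlim_at_top_dense) (metis less_irrefl)
  consider c where "c \<in> carrier G" "\<forall>k. q (t k) = c" | B S where "attracting (\<lambda>k. q (t k)) B S"
    using t(2) unfolding tame_def by blast
  then show False
  proof cases
    case 1
    then have "act c A = A" using qtlim by (simp add: LIMSEQ_const_iff)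
    then have "act (g [^] s (t 0)) (act p A) = act (g [^] s (t 0)) A" using qA[of "t 0"] 1 gkA by simp
    then show False using act_eq_iff[of "g [^] s (t 0)" "act p A" A] g(1) pA(1) A(1) p(2) by simp
  next
    case 2
    \<comment> \<open>One end is \<open>\<xi>\<close>. In both cases \<open>f\<close> tends to
      infinity, along \<open>q\<close> or along its inverses, against
      \<open>f (q k) = f p\<close>.\<close>
    show False
    proof (cases "S = \<xi>")
      case True
      then have "(\<lambda>k. act (q (t k)) A) \<longlonglongrightarrow> B" using attracting_tendsto_const[OF 2 A(1)] A(2) by simp
      then have "B = A" using qtlim LIMSEQ_unique by blast
      then have "attracting (\<lambda>k. inv (q (t k))) \<xi> A" using attracting_inv[OF 2] True by simp
      then have "filterlim (\<lambda>k. f (inv (q (t k)))) at_top sequentially" using f_top A(2) by blast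
      then show False using hom_pow(2)[OF f qc] fq not_top by simp
    next
      case False
      then have "B = \<xi>" using one_end[OF 2] by blast
      then have "filterlim (\<lambda>k. f (q (t k))) at_top sequentially" using f_top 2 False by blast
      then show False using fq not_top by simp
    qed
  qed
qed

text \<open>\<open>att (inv g)\<close> serves as repelling point of the single element
  \<open>g\<close>, so the pair of ends of \<open>g\<close> lies in a box around
  \<open>(\<xi>, \<eta>)\<close>.\<close>

definition near :: "'e \<Rightarrow> 'e \<Rightarrow> real \<Rightarrow> 'g set" where
  "near \<xi> \<eta> \<epsilon> = {g \<in> carrier G. dist (att g) \<xi> < \<epsilon> \<and> dist (att (inv g)) \<eta> < \<epsilon>}"

lemma near_sequence:
  assumes "inj \<gamma>" "\<And>n::nat. \<gamma> n \<in> near \<xi> \<eta> (inverse (real (Suc n)))"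
  shows "\<exists>r. strict_mono r \<and> attracting (\<lambda>n. \<gamma> (r n)) \<xi> \<eta>"
proof -
  have c: "\<gamma> n \<in> carrier G" for n using assms(2)[of n] by (simp add: near_def)
  obtain r A R where r: "strict_mono r" "attracting (\<lambda>n. \<gamma> (r n)) A R" using attracting_ex[OF assms(1) c] by blast
  have "(\<lambda>n. att (\<gamma> n)) \<longlonglongrightarrow> \<xi>" "(\<lambda>n. att (inv (\<gamma> n))) \<longlonglongrightarrow> \<eta>"
  proof -
    have "(\<lambda>n. dist (att (\<gamma> n)) \<xi>) \<longlonglongrightarrow> 0" "(\<lambda>n. dist (att (inv (\<gamma> n))) \<eta>) \<longlonglongrightarrow> 0"
      by (rule tendsto_sandwich[OF _ _ tendsto_const LIMSEQ_inverse_real_of_nat];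
          use assms(2) in \<open>auto simp: near_def less_imp_le simp del: of_nat_Suc intro!: always_eventually\<close>)+
    then show "(\<lambda>n. att (\<gamma> n)) \<longlonglongrightarrow> \<xi>" "(\<lambda>n. att (inv (\<gamma> n))) \<longlonglongrightarrow> \<eta>"
      by (simp_all add: tendsto_dist_iff[symmetric])
  qed
  then have "(\<lambda>n. att (\<gamma> (r n))) \<longlonglongrightarrow> \<xi>" "(\<lambda>n. att (inv (\<gamma> (r n)))) \<longlonglongrightarrow> \<eta>"
    using LIMSEQ_subseq_LIMSEQ[OF _ r(1)] by (auto simp: comp_def)
  then have "A = \<xi>" "R = \<eta>" using attracting_att[OF r(2)] attracting_att_inv[OF r(2)] LIMSEQ_unique by blast+
  then show ?thesis using r by blast
qed

text \<open>If every pair had a box with convergent sum, finitely many boxes would cover the compact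
  product \<open>\<Lambda> \<times> \<Lambda>\<close>, and only finitely many elements have their
  ends outside these boxes.\<close>

lemma divergent_pair:
  assumes "\<not> (\<lambda>g. exp (- s * \<alpha> g)) summable_on carrier G"
  shows "\<exists>\<xi>\<in>\<Lambda>. \<exists>\<eta>\<in>\<Lambda>. \<forall>\<epsilon>>0. \<not> (\<lambda>g. exp (- s * \<alpha> g)) summable_on near \<xi> \<eta> \<epsilon>"
proof (rule ccontr)
  assume "\<not> ?thesis"
  then have "\<forall>p\<in>\<Lambda> \<times> \<Lambda>. \<exists>\<epsilon>>0. (\<lambda>g. exp (- s * \<alpha> g)) summable_on near (fst p) (snd p) \<epsilon>" by auto
  then obtain e where e: "\<And>p. p \<in> \<Lambda> \<times> \<Lambda> \<Longrightarrow> e p > 0 \<and> (\<lambda>g. exp (- s * \<alpha> g)) summable_on near (fst p) (snd p) (e p)"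
    by metis
  define B where "B p = ball (fst p) (e p) \<times> ball (snd p) (e p)" for p
  have cov: "\<Lambda> \<times> \<Lambda> \<subseteq> (\<Union>p\<in>\<Lambda> \<times> \<Lambda>. B p)"
  proof
    fix p assume p: "p \<in> \<Lambda> \<times> \<Lambda>"
    then have "p \<in> B p" using e[OF p] by (cases p) (auto simp: B_def)
    then show "p \<in> (\<Union>p\<in>\<Lambda> \<times> \<Lambda>. B p)" using p by blast
  qed
  have "compact (\<Lambda> \<times> \<Lambda>)" using compact_limit by (intro compact_Times)
  then obtain I where I: "I \<subseteq> \<Lambda> \<times> \<Lambda>" "finite I" "\<Lambda> \<times> \<Lambda> \<subseteq> (\<Union>p\<in>I. B p)"
    using compactE_image[OF _ _ cov] by (auto simp: B_def open_Times)
  define E where "E = carrier G - (\<Union>p\<in>I. near (fst p) (snd p) (e p))"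
  have "finite E"
  proof (rule ccontr)
    assume "infinite E"
    then obtain f :: "nat \<Rightarrow> 'g" where f: "inj f" "range f \<subseteq> E" using infinite_countable_subset by blast
    have fc: "f n \<in> carrier G" for n using f(2) by (auto simp: E_def)
    obtain r A R where r: "strict_mono r" "attracting (\<lambda>n. f (r n)) A R" using attracting_ex[OF f(1) fc] by blast
    have "(A, R) \<in> \<Lambda> \<times> \<Lambda>" using attracting_limit[OF r(2)] by simp
    then obtain p where p: "p \<in> I" "(A, R) \<in> B p" using I(3) by blast
    have "\<forall>\<^sub>F n in sequentially. att (f (r n)) \<in> ball (fst p) (e p)"
      "\<forall>\<^sub>F n in sequentially. att (inv (f (r n))) \<in> ball (snd p) (e p)"
      using topological_tendstoD[OF attracting_att[OF r(2)] open_ball] topological_tendstoD[OF attracting_att_inv[OF r(2)] open_ball] p(2)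
      by (auto simp: B_def)
    then have "\<forall>\<^sub>F n::nat in sequentially. False"
    proof eventually_elim
      case (elim n)
      then have "f (r n) \<in> near (fst p) (snd p) (e p)" using fc by (simp add: near_def dist_commute)
      then show False using p(1) f(2) by (auto simp: E_def)
    qed
    then show False by simp
  qed
  then have "(\<lambda>g. exp (- s * \<alpha> g)) summable_on E" by simp
  moreover have "(\<lambda>g. exp (- s * \<alpha> g)) summable_on (\<Union>p\<in>I. near (fst p) (snd p) (e p))"
    using I(2,1)
  proof (induction I rule: finite_induct)
    case (insert p J)
    then show ?case using e by (auto intro!: summable_on_union)
  qed simp
  ultimately have "(\<lambda>g. exp (- s * \<alpha> g)) summable_on (E \<union> (\<Union>p\<in>I. near (fst p) (snd p) (e p)))"
    by (rule summable_on_union)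
  then have "(\<lambda>g. exp (- s * \<alpha> g)) summable_on carrier G"
    by (rule summable_on_subset) (auto simp: E_def)
  then show False using assms by blast
qed

text \<open>A diagonal pair \<open>(\<xi>, \<xi>)\<close> is replaced by
  \<open>(act h \<xi>, \<xi>)\<close>: left translation by \<open>h\<close> moves the attracting
  point, keeps the repelling point in the limit, and changes \<open>\<alpha>\<close> by a bounded
  amount.\<close>

lemma divergent_transverse_pair:
  assumes "\<not> (\<lambda>g. exp (- s * \<alpha> g)) summable_on carrier G" "\<not> is_singleton \<Lambda>" "s \<ge> 0"
  shows "\<exists>\<xi>\<in>\<Lambda>. \<exists>\<eta>\<in>\<Lambda>. \<xi> \<noteq> \<eta> \<and> (\<forall>\<epsilon>>0. \<not> (\<lambda>g. exp (- s * \<alpha> g)) summable_on near \<xi> \<eta> \<epsilon>)"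
proof -
  obtain \<xi> \<eta> where p: "\<xi> \<in> \<Lambda>" "\<eta> \<in> \<Lambda>" "\<And>\<epsilon>. \<epsilon> > 0 \<Longrightarrow> \<not> (\<lambda>g. exp (- s * \<alpha> g)) summable_on near \<xi> \<eta> \<epsilon>"
    using divergent_pair[OF assms(1)] by blast
  show ?thesis
  proof (cases "\<xi> = \<eta>")
    case False then show ?thesis using p by blast
  next
    case True
    have inf: "infinite (near \<xi> \<xi> \<epsilon>)" if "\<epsilon> > 0" for \<epsilon> using p(3)[OF that] True by auto
    have "\<exists>f. inj f \<and> (\<forall>n. f n \<in> near \<xi> \<xi> (inverse (real (Suc n))))"
      by (rule injective_sequence_from_all_large) (use inf in simp)
    then obtain f where f: "inj f" "\<And>n. f n \<in> near \<xi> \<xi> (inverse (real (Suc n)))" by blast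
    obtain r where r: "attracting (\<lambda>n. f (r n)) \<xi> \<xi>" using near_sequence[OF f] by blast
    \<comment> \<open>The exclusion of a one-point limit set is used here; a parabolic group fixes
      its single limit point.\<close>
    obtain z where z: "z \<in> \<Lambda>" "z \<noteq> \<xi>" using assms(2) p(1) unfolding is_singleton_def by blast
    obtain h where h: "h \<in> carrier G" "act h \<xi> \<noteq> \<xi>" using exists_moving_fixed_point[OF r z] by blast
    have "\<not> (\<lambda>g. exp (- s * \<alpha> g)) summable_on near (act h \<xi>) \<xi> \<epsilon>" if \<epsilon>: "\<epsilon> > 0" for \<epsilon>
    proof
      assume sum: "(\<lambda>g. exp (- s * \<alpha> g)) summable_on near (act h \<xi>) \<xi> \<epsilon>"
      \<comment> \<open>Otherwise infinitely many exceptions exist for every \<open>n\<close>, and a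
        sequence of distinct ones with both ends tending to \<open>\<xi>\<close> contradicts the
        limits of its translates.\<close>
      have "\<exists>n::nat. finite {g. g \<in> near \<xi> \<xi> (inverse (real (Suc n))) \<and> h \<otimes> g \<notin> near (act h \<xi>) \<xi> \<epsilon>}"
      proof (rule ccontr)
        assume "\<not> ?thesis"
        then have "\<exists>f. inj f \<and> (\<forall>n. f n \<in> near \<xi> \<xi> (inverse (real (Suc n))) \<and> h \<otimes> f n \<notin> near (act h \<xi>) \<xi> \<epsilon>)"
          by (intro injective_sequence_from_all_large) simp
        then obtain f where f: "inj f" "\<And>n. f n \<in> near \<xi> \<xi> (inverse (real (Suc n)))"
          "\<And>n. h \<otimes> f n \<notin> near (act h \<xi>) \<xi> \<epsilon>" by blast
        obtain r where r: "attracting (\<lambda>n. f (r n)) \<xi> \<xi>" using near_sequence[OF f(1,2)] by blast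
        have c: "f n \<in> carrier G" for n using f(2)[of n] by (simp add: near_def)
        have "(\<lambda>n. att (h \<otimes> f (r n))) \<longlonglongrightarrow> act h \<xi>" using att_mult_left[OF r h(1)] .
        moreover have "(\<lambda>n. att (inv (f (r n)) \<otimes> inv h)) \<longlonglongrightarrow> \<xi>" using att_mult_right[OF attracting_inv[OF r]] h(1) by simp
        ultimately have "\<forall>\<^sub>F n in sequentially. dist (att (h \<otimes> f (r n))) (act h \<xi>) < \<epsilon>"
          "\<forall>\<^sub>F n in sequentially. dist (att (inv (f (r n)) \<otimes> inv h)) \<xi> < \<epsilon>"
          using \<epsilon> tendstoD by blast+
        then have "\<forall>\<^sub>F n::nat in sequentially. False"
        proof eventually_elim
          case (elim n)
          then have "h \<otimes> f (r n) \<in> near (act h \<xi>) \<xi> \<epsilon>" using c h(1) by (simp add: near_def inv_mult_group)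
          then show False using f(3) by blast
        qed
        then show False by simp
      qed
      then obtain n :: nat where fin: "finite {g. g \<in> near \<xi> \<xi> (inverse (real (Suc n))) \<and> h \<otimes> g \<notin> near (act h \<xi>) \<xi> \<epsilon>}"
        (is "finite ?E") by blast
      \<comment> \<open>Translation by \<open>h\<close> changes each term of the series at most by
        the factor \<open>exp (s * C)\<close>.\<close>
      obtain C where C: "\<forall>g\<in>carrier G. \<bar>\<alpha> (h \<otimes> g) - \<alpha> g\<bar> \<le> C" using \<alpha>_mult_bound[OF h(1)] by blast
      let ?S = "near \<xi> \<xi> (inverse (real (Suc n))) - ?E"
      have "(\<lambda>g. exp (- s * \<alpha> g)) summable_on ((\<lambda>g. h \<otimes> g) ` ?S)"
        by (rule summable_on_subset[OF sum]) auto
      then have "(\<lambda>g. exp (- s * \<alpha> (h \<otimes> g))) summable_on ?S"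
        using h(1) by (subst (asm) summable_on_reindex) (auto simp: inj_on_def near_def comp_def)
      then have "(\<lambda>g. exp (s * C) * exp (- s * \<alpha> (h \<otimes> g))) summable_on ?S"
        by (rule summable_on_cmult_right)
      then have "(\<lambda>g. exp (- s * \<alpha> g)) summable_on ?S"
      proof (rule summable_on_comparison_test)
        fix g assume "g \<in> ?S"
        then have "g \<in> carrier G" by (simp add: near_def)
        then have "\<alpha> (h \<otimes> g) \<le> \<alpha> g + C" using C by fastforce
        then have "s * \<alpha> (h \<otimes> g) \<le> s * (\<alpha> g + C)" using assms(3) by (rule mult_left_mono)
        then show "exp (- s * \<alpha> g) \<le> exp (s * C) * exp (- s * \<alpha> (h \<otimes> g))"
          by (simp add: mult_exp_exp algebra_simps)
      qed simp
      then have "(\<lambda>g. exp (- s * \<alpha> g)) summable_on (?S \<union> ?E)"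
        using fin by (intro summable_on_union) auto
      then have "(\<lambda>g. exp (- s * \<alpha> g)) summable_on near \<xi> \<xi> (inverse (real (Suc n)))"
        by (rule summable_on_subset) auto
      then show False using p(3)[of "inverse (real (Suc n))"] True by simp
    qed
    moreover have "act h \<xi> \<in> \<Lambda>" using act_in h(1) p(1) by blast
    ultimately show ?thesis using p(1) h(2) by blast
  qed
qed

end

section \<open>Cantor sets of conical points and the lower bound\<close>

text \<open>Integer division by \<open>N\<close> of the floor at scale \<open>n + 1\<close> gives
  the floor at scale \<open>n\<close>; the remainder is the digit.\<close>

lemma floor_power_digit:
  fixes t :: real and N :: nat
  assumes "0 \<le> t" "0 < N"
  shows "\<lfloor>t * real N ^ Suc n\<rfloor> = \<lfloor>t * real N ^ n\<rfloor> * int N + int (nat \<lfloor>t * real N ^ Suc n\<rfloor> mod N)"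
proof -
  have "\<lfloor>t * real N ^ n\<rfloor> = \<lfloor>(t * real N ^ Suc n) / real_of_int (int N)\<rfloor>"
    using assms by simp
  also have "\<dots> = \<lfloor>t * real N ^ Suc n\<rfloor> div int N"
    by (rule floor_divide_real_eq_div) simp
  finally have "\<lfloor>t * real N ^ n\<rfloor> = \<lfloor>t * real N ^ Suc n\<rfloor> div int N" .
  moreover have "int (nat \<lfloor>t * real N ^ Suc n\<rfloor> mod N) = \<lfloor>t * real N ^ Suc n\<rfloor> mod int N"
    using assms by (simp add: zmod_int)
  ultimately show ?thesis by simp
qed

text \<open>The digits after the point in base \<open>N\<close>, counted from 0.\<close>

definition digit :: "nat \<Rightarrow> real \<Rightarrow> nat \<Rightarrow> nat" where
  "digit N t n = nat \<lfloor>t * real N ^ Suc n\<rfloor> mod N"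

lemma floor_eq_if_digits_eq:
  assumes "0 \<le> t" "t < 1" "0 \<le> u" "u < 1" "0 < N" "\<And>i. i < k \<Longrightarrow> digit N t i = digit N u i"
  shows "\<lfloor>t * real N ^ k\<rfloor> = \<lfloor>u * real N ^ k\<rfloor>"
  using assms(6)
proof (induction k)
  case 0
  have "\<lfloor>t\<rfloor> = 0" "\<lfloor>u\<rfloor> = 0" using assms by (simp_all add: floor_eq_iff)
  then show ?case by simp
next
  case (Suc k)
  then have "digit N t k = digit N u k" "\<lfloor>t * real N ^ k\<rfloor> = \<lfloor>u * real N ^ k\<rfloor>" by auto
  then show ?case
    using floor_power_digit[OF assms(1,5), of k] floor_power_digit[OF assms(3,5), of k]
    by (simp add: digit_def)
qed

text \<open>The equation for \<open>m\<close> matters: the interval depends on \<open>t\<close> and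
  \<open>k\<close> only, so one interval serves for all \<open>u\<close> with the same first
  \<open>k\<close> digits.\<close>

lemma dist_le_if_digits_eq:
  assumes "0 \<le> t" "t < 1" "0 \<le> u" "u < 1" "0 < N" "\<And>i. i < k \<Longrightarrow> digit N t i = digit N u i"
  shows "\<exists>m::real. {t, u} \<subseteq> {m / real N ^ k .. (m + 1) / real N ^ k} \<and> m = \<lfloor>t * real N ^ k\<rfloor>"
proof -
  have "\<lfloor>t * real N ^ k\<rfloor> = \<lfloor>u * real N ^ k\<rfloor>" using floor_eq_if_digits_eq assms by blast
  then have "real_of_int \<lfloor>t * real N ^ k\<rfloor> \<le> u * real N ^ k" "u * real N ^ k \<le> real_of_int \<lfloor>t * real N ^ k\<rfloor> + 1"
    by linarith+
  moreover have "real_of_int \<lfloor>t * real N ^ k\<rfloor> \<le> t * real N ^ k" "t * real N ^ k \<le> real_of_int \<lfloor>t * real N ^ k\<rfloor> + 1"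
    by linarith+
  moreover have "real N ^ k > 0" using assms by simp
  ultimately show ?thesis by (intro exI[of _ "real_of_int \<lfloor>t * real N ^ k\<rfloor>"]) (simp add: divide_le_eq pos_le_divide_eq)
qed

text \<open>Countable subadditivity of Lebesgue measure; this takes the place of a mass distribution
  on the limit set.\<close>

lemma unit_interval_cover:
  fixes T :: "nat \<Rightarrow> real set" and b :: "nat \<Rightarrow> real"
  assumes "{0..<1} \<subseteq> (\<Union>i. T i)" "\<And>i. \<exists>u. T i \<subseteq> {u .. u + b i}" "\<And>i. 0 \<le> b i"
  shows "1 \<le> (\<Sum>i. ennreal (b i))"
proof -
  obtain u where u: "\<And>i. T i \<subseteq> {u i .. u i + b i}" using assms(2) by metis
  have "1 = emeasure lborel {0..<1::real}" by simp
  also have "\<dots> \<le> emeasure lborel (\<Union>i. {u i .. u i + b i})"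
    using assms(1) UN_mono[of UNIV UNIV T, OF subset_refl u]
    by (intro emeasure_mono) (auto intro: order_trans)
  also have "\<dots> \<le> (\<Sum>i. emeasure lborel {u i .. u i + b i})"
    by (rule emeasure_subadditive_countably) auto
  also have "\<dots> = (\<Sum>i. ennreal (b i))" using assms(3) by simp
  finally show ?thesis .
qed

section \<open>Ping-pong pairs and disjoint shadows\<close>

context conformal_convergence_action
begin

text \<open>A semigroup, in general not closed under inverses; the words of the iterated function
  system stay in it.\<close>

definition stabilizers :: "'e set \<Rightarrow> 'e set \<Rightarrow> 'g set" where
  "stabilizers V W = {w \<in> carrier G. act w ` V \<subseteq> V \<and> act (inv w) ` W \<subseteq> W}"

lemma stabilizers_mult:
  assumes "V \<subseteq> \<Lambda>" "W \<subseteq> \<Lambda>" "g \<in> stabilizers V W" "h \<in> stabilizers V W"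
  shows "g \<otimes> h \<in> stabilizers V W"
proof -
  have c: "g \<in> carrier G" "h \<in> carrier G" using assms by (auto simp: stabilizers_def)
  have "act (g \<otimes> h) x \<in> V" if "x \<in> V" for x
    using that assms subsetD[OF assms(1) that] act_mult[OF c, of x] by (auto simp: stabilizers_def image_subset_iff)
  moreover have "act (inv (g \<otimes> h)) x \<in> W" if "x \<in> W" for x
    using that assms c subsetD[OF assms(2) that] act_mult[of "inv h" "inv g" x]
    by (auto simp: stabilizers_def inv_mult_group image_subset_iff)
  ultimately show ?thesis using c by (auto simp: stabilizers_def)
qed

text \<open>A point of \<open>V\<close> other than \<open>R\<close> tends to \<open>A\<close> inside
  the closed set \<open>V\<close>; then \<open>W\<close> misses \<open>A\<close>, and the inverses
  move a point of \<open>W\<close> to \<open>R\<close> inside \<open>W\<close>. Two points of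
  \<open>V\<close> are given because \<open>R\<close> could be one of them until it is known to lie
  in \<open>W\<close>.\<close>

lemma stabilizers_directed:
  assumes "compact V" "compact W" "V \<subseteq> \<Lambda>" "W \<subseteq> \<Lambda>" "V \<inter> W = {}" "W \<noteq> {}" "x \<in> V" "y \<in> V" "x \<noteq> y"
  shows "directed V W (stabilizers V W)"
proof -
  have lims: "A \<in> V \<and> R \<in> W" if m: "\<And>n. \<gamma> n \<in> stabilizers V W" and n: "attracting \<gamma> A R" for \<gamma> A R
  proof -
    obtain v where v: "v \<in> V" "v \<noteq> R" using assms by metis
    have "(\<lambda>n. act (\<gamma> n) v) \<longlonglongrightarrow> A" using attracting_tendsto_const[OF n] v assms by blast
    moreover have "act (\<gamma> n) v \<in> V" for n using m v by (auto simp: stabilizers_def)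
    ultimately have A: "A \<in> V" using closed_sequentially[OF compact_imp_closed[OF assms(1)], of "\<lambda>n. act (\<gamma> n) v"] by blast
    obtain w where w: "w \<in> W" using assms by blast
    then have "w \<noteq> A" using A assms by blast
    then have "(\<lambda>n. act (inv (\<gamma> n)) w) \<longlonglongrightarrow> R" using attracting_tendsto_const[OF attracting_inv[OF n]] w assms by blast
    moreover have "act (inv (\<gamma> n)) w \<in> W" for n using m w by (auto simp: stabilizers_def image_subset_iff)
    ultimately have "R \<in> W" using closed_sequentially[OF compact_imp_closed[OF assms(2)], of "\<lambda>n. act (inv (\<gamma> n)) w"] by blast
    then show ?thesis using A by blast
  qed
  have "\<forall>\<gamma> A R. (\<forall>n. \<gamma> n \<in> stabilizers V W) \<longrightarrow> attracting \<gamma> A R \<longrightarrow> A \<in> V \<and> R \<in> W"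
    by (intro allI impI lims) auto
  moreover have "stabilizers V W \<subseteq> carrier G" by (auto simp: stabilizers_def)
  ultimately show ?thesis using assms(1-5) unfolding directed_def by (intro conjI)
qed

text \<open>Along a sequence of such elements the limit \<open>R\<close> is within
  \<open>r / 2\<close> of \<open>\<eta>\<close>, hence outside the ball of radius \<open>r\<close>
  about \<open>\<xi>\<close>; this ball moves to \<open>A\<close>, which is within
  \<open>r / 2\<close> of \<open>\<xi>\<close>. So points cannot be thrown beyond radius
  \<open>r\<close> infinitely often.\<close>

lemma nonstable_finite:
  assumes "\<xi> \<in> \<Lambda>" "\<eta> \<in> \<Lambda>" "2 * r < dist \<xi> \<eta>" "r > 0"
  shows "finite {g \<in> near \<xi> \<eta> (r / 2). \<not> act g ` (\<Lambda> \<inter> cball \<xi> r) \<subseteq> \<Lambda> \<inter> cball \<xi> r}"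
proof (rule ccontr)
  assume "infinite {g \<in> near \<xi> \<eta> (r / 2). \<not> act g ` (\<Lambda> \<inter> cball \<xi> r) \<subseteq> \<Lambda> \<inter> cball \<xi> r}"
  then obtain f :: "nat \<Rightarrow> 'g" where f: "inj f" "range f \<subseteq> {g \<in> near \<xi> \<eta> (r / 2). \<not> act g ` (\<Lambda> \<inter> cball \<xi> r) \<subseteq> \<Lambda> \<inter> cball \<xi> r}"
    using infinite_countable_subset by blast
  have fn: "f n \<in> near \<xi> \<eta> (r / 2)" for n using f(2) by auto
  have fc: "f n \<in> carrier G" for n using fn by (auto simp: near_def)
  have "\<exists>x. x \<in> \<Lambda> \<inter> cball \<xi> r \<and> act (f n) x \<notin> cball \<xi> r" for n using f(2) act_in[OF fc] by blast
  then obtain x where x: "\<And>n. x n \<in> \<Lambda>" "\<And>n. dist \<xi> (x n) \<le> r" "\<And>n. dist \<xi> (act (f n) (x n)) > r"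
    by (metis IntE mem_cball not_le)
  obtain s A R where s: "strict_mono s" "attracting (\<lambda>n. f (s n)) A R" using attracting_ex[OF f(1) fc] by blast
  obtain l t where t: "l \<in> \<Lambda>" "strict_mono (t :: nat \<Rightarrow> nat)" "(\<lambda>n. x (s (t n))) \<longlonglongrightarrow> l"
    using limit_subseq[of "\<lambda>n. x (s n)"] x by blast
  have n: "attracting (\<lambda>n. f (s (t n))) A R" using attracting_subseq[OF s(2) t(2)] .
  have "dist A \<xi> \<le> r / 2"
    by (rule tendsto_upperbound[OF tendsto_dist[OF attracting_att[OF n] tendsto_const]])
       (use fn in \<open>auto simp: near_def less_imp_le\<close>)
  moreover have R: "dist R \<eta> \<le> r / 2"
    by (rule tendsto_upperbound[OF tendsto_dist[OF attracting_att_inv[OF n] tendsto_const]])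
       (use fn in \<open>auto simp: near_def less_imp_le\<close>)
  moreover have "dist \<xi> l \<le> r"
    by (rule tendsto_upperbound[OF tendsto_dist[OF tendsto_const t(3)]]) (use x in auto)
  ultimately have "l \<noteq> R" using assms(3,4) dist_triangle[of \<xi> \<eta> l] by (auto simp: dist_commute)
  then have "(\<lambda>n. act (f (s (t n))) (x (s (t n)))) \<longlonglongrightarrow> A"
    using attracting_tendsto[OF n, of "\<lambda>n. x (s (t n))" l] x(1) t by blast
  then have "r \<le> dist \<xi> A"
    by (rule tendsto_lowerbound[OF tendsto_dist[OF tendsto_const]]) (use x(3) in \<open>auto simp: less_imp_le\<close>)
  then show False using \<open>dist A \<xi> \<le> r / 2\<close> assms(4) by (simp add: dist_commute)
qed

lemma divergent_directed_set:
  assumes "\<not> (\<lambda>g. exp (- s * \<alpha> g)) summable_on carrier G" "\<not> is_singleton \<Lambda>" "s \<ge> 0"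
  shows "\<exists>V W S. directed V W S \<and> S \<subseteq> stabilizers V W \<and> V \<noteq> {} \<and> W \<noteq> {} \<and>
    \<not> (\<lambda>g. exp (- s * \<alpha> g)) summable_on S"
proof -
  obtain \<xi> \<eta> where p: "\<xi> \<in> \<Lambda>" "\<eta> \<in> \<Lambda>" "\<xi> \<noteq> \<eta>"
    "\<And>\<epsilon>. \<epsilon> > 0 \<Longrightarrow> \<not> (\<lambda>g. exp (- s * \<alpha> g)) summable_on near \<xi> \<eta> \<epsilon>"
    using divergent_transverse_pair[OF assms] by blast
  \<comment> \<open>A third of the distance makes the two balls disjoint with the slack
    \<open>2 * r < dist \<xi> \<eta>\<close> of \<open>nonstable_finite\<close>.\<close>
  define r where "r = dist \<xi> \<eta> / 3"
  have r: "r > 0" "2 * r < dist \<xi> \<eta>" "2 * r < dist \<eta> \<xi>" using p(3) by (auto simp: r_def dist_commute)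
  define V W where "V = \<Lambda> \<inter> cball \<xi> r" and "W = \<Lambda> \<inter> cball \<eta> r"
  define S where "S = near \<xi> \<eta> (r / 2) \<inter> stabilizers V W"
  have disj: "V \<inter> W = {}"
  proof (rule ccontr)
    assume "V \<inter> W \<noteq> {}"
    then obtain x where "dist \<xi> x \<le> r" "dist \<eta> x \<le> r" by (auto simp: V_def W_def)
    then show False using r dist_triangle[of \<xi> \<eta> x] by (simp add: dist_commute)
  qed
  have "A \<in> V \<and> R \<in> W" if m: "\<And>n. \<gamma> n \<in> S" and n: "attracting \<gamma> A R" for \<gamma> A R
  proof -
    have "dist A \<xi> \<le> r / 2"
      by (rule tendsto_upperbound[OF tendsto_dist[OF attracting_att[OF n] tendsto_const]])
         (use m in \<open>auto simp: S_def near_def less_imp_le\<close>)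
    moreover have R: "dist R \<eta> \<le> r / 2"
      by (rule tendsto_upperbound[OF tendsto_dist[OF attracting_att_inv[OF n] tendsto_const]])
         (use m in \<open>auto simp: S_def near_def less_imp_le\<close>)
    ultimately show ?thesis using attracting_limit[OF n] r by (simp add: V_def W_def dist_commute)
  qed
  then have "directed V W S"
    using disj compact_limit by (auto simp: directed_def V_def W_def S_def near_def intro!: compact_Int_closed)
  moreover have "\<not> (\<lambda>g. exp (- s * \<alpha> g)) summable_on S"
  proof
    assume sum: "(\<lambda>g. exp (- s * \<alpha> g)) summable_on S"
    \<comment> \<open>All elements near \<open>(\<xi>, \<eta>)\<close> are in \<open>S\<close>,
      except for the finite set \<open>E1\<close> and the inverses of the finite set
      \<open>E2\<close>, so \<open>S\<close> carries the divergence.\<close>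
    define E1 where "E1 = {g \<in> near \<xi> \<eta> (r / 2). \<not> act g ` V \<subseteq> V}"
    define E2 where "E2 = {g \<in> near \<eta> \<xi> (r / 2). \<not> act g ` W \<subseteq> W}"
    have "finite E1" "finite E2"
      unfolding E1_def E2_def V_def W_def using nonstable_finite r p by blast+
    then have "(\<lambda>g. exp (- s * \<alpha> g)) summable_on (S \<union> (E1 \<union> (\<lambda>g. inv g) ` E2))"
      using sum by (intro summable_on_union) auto
    moreover have "near \<xi> \<eta> (r / 2) \<subseteq> S \<union> (E1 \<union> (\<lambda>g. inv g) ` E2)"
    proof
      fix g assume g: "g \<in> near \<xi> \<eta> (r / 2)"
      show "g \<in> S \<union> (E1 \<union> (\<lambda>g. inv g) ` E2)"
      proof (cases "act (inv g) ` W \<subseteq> W")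
        case True
        then show ?thesis using g by (auto simp: S_def E1_def stabilizers_def near_def)
      next
        case False
        then have "inv g \<in> E2" "inv (inv g) = g" using g by (auto simp: E2_def near_def)
        then show ?thesis by (metis UnI2 imageI)
      qed
    qed
    ultimately have "(\<lambda>g. exp (- s * \<alpha> g)) summable_on near \<xi> \<eta> (r / 2)"
      by (rule summable_on_subset)
    then show False using p(4)[of "r / 2"] r by simp
  qed
  moreover have "\<xi> \<in> V" "\<eta> \<in> W" using p r by (auto simp: V_def W_def)
  ultimately show ?thesis unfolding S_def by blast
qed

text \<open>Elements of nearly equal size whose shadows meet differ by a bounded element, so a
  positive proportion of each size window has pairwise disjoint shadows.\<close>

lemma many_disjoint_images:
  assumes "directed V W S" "V \<noteq> {}" "\<not> (\<lambda>g. exp (- s * \<alpha> g)) summable_on S" "s' < s" "0 \<le> s"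
  shows "\<exists>(n::nat) F. F \<subseteq> S \<and> finite F \<and> (\<forall>g\<in>F. \<alpha> g \<le> n + 1) \<and>
    (\<forall>g\<in>F. \<forall>h\<in>F. g \<noteq> h \<longrightarrow> act g ` V \<inter> act h ` V = {}) \<and> K * exp (s' * n) \<le> card F"
proof -
  have S: "S \<subseteq> carrier G" using assms by (simp add: directed_def)
  obtain B where B: "\<And>g h. g \<in> S \<Longrightarrow> h \<in> S \<Longrightarrow> \<bar>\<alpha> g - \<alpha> h\<bar> \<le> 1 \<Longrightarrow> act g ` V \<inter> act h ` V \<noteq> {} \<Longrightarrow> \<alpha> (inv g \<otimes> h) \<le> B"
    using directed_overlap[OF assms(1)] by blast
  \<comment> \<open>Within its window, a shadow meets at most \<open>M\<close> shadows, its own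
    included.\<close>
  define M where "M = card {g \<in> carrier G. \<alpha> g \<le> B}"
  define L where "L n = {g \<in> S. real n \<le> \<alpha> g \<and> \<alpha> g < real n + 1}" for n :: nat
  have fin: "finite (L n)" for n
    by (rule finite_subset[OF _ finite_\<alpha>_le[of "real n + 1"]]) (use S in \<open>auto simp: L_def\<close>)
  \<comment> \<open>The factor \<open>M\<close> in the threshold anticipates that only one element
    in \<open>M\<close> is kept.\<close>
  have "\<exists>n. \<not> card (L n) \<le> (K * M) * exp (s' * n)"
  proof (rule ccontr)
    assume "\<not> ?thesis"
    then have "card {x \<in> S. real n \<le> \<alpha> x \<and> \<alpha> x < real n + 1} \<le> (K * M) * exp (s' * n)" for n :: nat
      by (auto simp: L_def)
    then have "(\<lambda>g. exp (- s * \<alpha> g)) summable_on S"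
      using fin \<alpha>_nonneg S assms(4,5) by (intro summable_on_exp_if_window_bound) (auto simp: L_def)
    then show False using assms(3) by blast
  qed
  then obtain n where n: "(K * M) * exp (s' * n) < card (L n)" by (auto simp: not_le)
  have "\<exists>F\<subseteq>L n. (\<forall>x\<in>F. \<forall>y\<in>F. x \<noteq> y \<longrightarrow> \<not> act x ` V \<inter> act y ` V \<noteq> {}) \<and> card (L n) \<le> M * card F"
  proof (rule exists_separated_subset[OF fin])
    fix g assume g: "g \<in> L n"
    \<comment> \<open>\<open>h\<close> is determined by \<open>inv g \<otimes> h\<close>, which is
      bounded by \<open>B\<close> when the shadows meet.\<close>
    have "(\<lambda>h. inv g \<otimes> h) ` {h \<in> L n. act g ` V \<inter> act h ` V \<noteq> {}} \<subseteq> {g \<in> carrier G. \<alpha> g \<le> B}"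
    proof (clarify)
      fix h assume h: "h \<in> L n" "act g ` V \<inter> act h ` V \<noteq> {}"
      have "\<bar>\<alpha> g - \<alpha> h\<bar> \<le> 1" using g h by (auto simp: L_def)
      then show "inv g \<otimes> h \<in> carrier G \<and> \<alpha> (inv g \<otimes> h) \<le> B"
        using B[of g h] g h S by (auto simp: L_def)
    qed
    then have "card ((\<lambda>h. inv g \<otimes> h) ` {h \<in> L n. act g ` V \<inter> act h ` V \<noteq> {}}) \<le> M"
      unfolding M_def by (intro card_mono finite_\<alpha>_le)
    moreover have "inj_on (\<lambda>h. inv g \<otimes> h) {h \<in> L n. act g ` V \<inter> act h ` V \<noteq> {}}"
    proof (rule inj_onI)
      fix x y assume "x \<in> {h \<in> L n. act g ` V \<inter> act h ` V \<noteq> {}}" "y \<in> {h \<in> L n. act g ` V \<inter> act h ` V \<noteq> {}}"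
        "inv g \<otimes> x = inv g \<otimes> y"
      moreover from this(1,2) have "x \<in> carrier G" "y \<in> carrier G" "g \<in> carrier G"
        using g S by (auto simp: L_def)
      ultimately show "x = y" by simp
    qed
    ultimately show "card {h \<in> L n. act g ` V \<inter> act h ` V \<noteq> {}} \<le> M"
      by (simp add: card_image)
  qed (use assms(2) in auto)
  then obtain F where F: "F \<subseteq> L n" "\<forall>x\<in>F. \<forall>y\<in>F. x \<noteq> y \<longrightarrow> act x ` V \<inter> act y ` V = {}"
    "card (L n) \<le> M * card F" by auto
  have "M \<noteq> 0"
  proof
    assume "M = 0"
    then have "card (L n) = 0" using F(3) by simp
    then show False using n \<open>M = 0\<close> by simp
  qed
  then have M: "real M > 0" by simp
  have "real M * (K * exp (s' * n)) \<le> real M * card F"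
    using n F(3) by (simp add: mult_ac) (metis (no_types, opaque_lifting) less_imp_le of_nat_le_iff of_nat_mult order_trans)
  then have "K * exp (s' * n) \<le> card F" using M by simp
  moreover have "F \<subseteq> S" "finite F" "\<forall>g\<in>F. \<alpha> g \<le> n + 1" using F(1) fin finite_subset by (auto simp: L_def)
  ultimately show ?thesis using F(2) by (intro exI[of _ n] exI[of _ F]) auto
qed

end

lemma exists_power_scale:
  fixes D c \<Theta> :: real
  assumes "0 < D" "D < c" "0 < \<Theta>" "\<Theta> < 1"
  shows "\<exists>k::nat. c * \<Theta> ^ Suc k \<le> D \<and> D < c * \<Theta> ^ k"
proof -
  have "(\<lambda>k. c * \<Theta> ^ k) \<longlonglongrightarrow> 0" using assms by (intro tendsto_mult_right_zero LIMSEQ_realpow_zero) auto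
  then have "\<forall>\<^sub>F k in sequentially. c * \<Theta> ^ k < D" using assms(1) order_tendstoD(2) by blast
  then obtain m where "c * \<Theta> ^ m < D" using eventually_happens by fastforce
  then have ex: "\<exists>m. c * \<Theta> ^ m \<le> D" by (meson less_imp_le)
  define m where "m = (LEAST m. c * \<Theta> ^ m \<le> D)"
  have m: "c * \<Theta> ^ m \<le> D" unfolding m_def using ex by (rule LeastI_ex)
  then have "m \<noteq> 0" using assms by (intro notI) simp
  then obtain k where k: "m = Suc k" using not0_implies_Suc by blast
  then have "\<not> c * \<Theta> ^ k \<le> D" using not_less_Least[of k "\<lambda>m. c * \<Theta> ^ m \<le> D"] by (simp add: m_def)
  then show ?thesis using m k by auto
qed

lemma eq_if_all_digits_eq:
  assumes "0 \<le> t" "t < 1" "0 \<le> u" "u < 1" "2 \<le> N" "\<And>i. digit N t i = digit N u i"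
  shows "t = u"
proof (rule ccontr)
  assume "t \<noteq> u"
  then have pos: "0 < \<bar>t - u\<bar>" by simp
  have "(\<lambda>k. (1 / real N) ^ k) \<longlonglongrightarrow> 0" using assms by (intro LIMSEQ_realpow_zero) auto
  then have "\<forall>\<^sub>F k in sequentially. (1 / real N) ^ k < \<bar>t - u\<bar>" using pos order_tendstoD(2) by blast
  then obtain k where k: "(1 / real N) ^ k < \<bar>t - u\<bar>" using eventually_happens by fastforce
  have "0 < N" using assms by simp
  then obtain m :: real where "{t, u} \<subseteq> {m / real N ^ k .. (m + 1) / real N ^ k}"
    using dist_le_if_digits_eq[of t u N k] assms by blast
  then have "\<bar>t - u\<bar> \<le> (m + 1) / real N ^ k - m / real N ^ k" by auto
  also have "\<dots> = (1 / real N) ^ k" by (simp add: diff_divide_distrib[symmetric] power_one_over)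
  finally show False using k by simp
qed

section \<open>The iterated function system\<close>

context conformal_convergence_action
begin

text \<open>The shadows of words in a finite set \<open>F\<close> of elements of size at most \<open>a\<close> with disjoint
  shadows form a Cantor set of conical points; it is parametrized by the base-\<open>card F\<close> digits of
  \<open>t \<in> [0, 1)\<close>.\<close>

lemma cantor_set:
  assumes dir: "directed V W (stabilizers V W)" and V: "V \<noteq> {}"
    and F: "F \<subseteq> stabilizers V W" "finite F" "2 \<le> card F"
    and disj: "\<And>g h. g \<in> F \<Longrightarrow> h \<in> F \<Longrightarrow> g \<noteq> h \<Longrightarrow> act g ` V \<inter> act h ` V = {}"
    and C: "\<And>g h. g \<in> stabilizers V W \<Longrightarrow> h \<in> stabilizers V W \<Longrightarrow> \<alpha> (g \<otimes> h) \<le> \<alpha> g + \<alpha> h + C"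
    and a: "\<And>g. g \<in> F \<Longrightarrow> \<alpha> g + C \<le> a"
  shows "\<exists>x c. c > 0 \<and> (\<forall>t\<in>{0..<1}. x t \<in> conical) \<and>
    (\<forall>t\<in>{0..<1}. \<forall>u\<in>{0..<1}. \<forall>n. digit (card F) t n \<noteq> digit (card F) u n \<longrightarrow>
      (\<forall>i<n. digit (card F) t i = digit (card F) u i) \<longrightarrow> c * exp (- a) ^ n \<le> dist (x t) (x u))"
proof -
  define N where "N = card F"
  have VW: "compact V" "compact W" "V \<subseteq> \<Lambda>" "W \<subseteq> \<Lambda>" "V \<inter> W = {}" using dir by (auto simp: directed_def)
  have st: "stabilizers V W \<subseteq> carrier G" by (auto simp: stabilizers_def)
  have Fc: "F \<subseteq> carrier G" using F(1) st by blast
  obtain e where e: "bij_betw e {0..<N} F" using ex_bij_betw_nat_finite[OF F(2)] N_def by blast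
  have eF: "e (digit N t n) \<in> F" for t n
  proof -
    have "digit N t n \<in> {0..<N}" using F(3) by (simp add: digit_def N_def)
    then show ?thesis using bij_betwE[OF e] by blast
  qed
  have sep1: "\<exists>d>0. g \<noteq> h \<longrightarrow> (\<forall>x\<in>act g ` V. \<forall>y\<in>act h ` V. d \<le> dist x y)" if "g \<in> F" "h \<in> F" for g h
  proof (cases "g = h")
    case False
    have "compact (act g ` V)" "compact (act h ` V)"
      using that Fc VW continuous_on_subset[OF act_cont] by (auto intro!: compact_continuous_image)
    then show ?thesis using separate_compact_closed[of "act g ` V" "act h ` V"] disj[OF that False] compact_imp_closed by blast
  qed (auto intro: exI[of _ 1])
  then obtain d where d: "\<And>g h. g \<in> F \<Longrightarrow> h \<in> F \<Longrightarrow> d g h > 0"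
    "\<And>g h x y. g \<in> F \<Longrightarrow> h \<in> F \<Longrightarrow> g \<noteq> h \<Longrightarrow> x \<in> act g ` V \<Longrightarrow> y \<in> act h ` V \<Longrightarrow> d g h \<le> dist x y"
    by metis
  \<comment> \<open>The smallest distance between two pieces of the first level.\<close>
  define c0 where "c0 = Min ((\<lambda>(g, h). d g h) ` (F \<times> F))"
  have F0: "F \<noteq> {}" using F(3) by auto
  have c0: "c0 > 0" unfolding c0_def using F(2) F0 d(1) by (subst Min_gr_iff) auto
  have c0_le: "c0 \<le> d g h" if "g \<in> F" "h \<in> F" for g h
    unfolding c0_def using F(2) that by (intro Min_le) auto
  obtain c where c: "c > 0" "\<And>w x y. w \<in> stabilizers V W \<Longrightarrow> x \<in> V \<Longrightarrow> y \<in> V \<Longrightarrow> c0 \<le> dist x y \<Longrightarrow>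
      c * exp (- \<alpha> w) \<le> dist (act w x) (act w y)"
    using directed_separation[OF dir c0] by blast
  \<comment> \<open>Letters are appended on the right, so that the images of \<open>V\<close> under
    the words are nested.\<close>
  define w where "w t = rec_nat \<one> (\<lambda>k u. u \<otimes> e (digit N t k))" for t
  have w0: "w t 0 = \<one>" and wS: "w t (Suc n) = w t n \<otimes> e (digit N t n)" for t n by (simp_all add: w_def)
  have one: "\<one> \<in> stabilizers V W" using act_one VW by (auto simp: stabilizers_def)
  have wst: "w t n \<in> stabilizers V W" for t n
  proof (induction n)
    case (Suc n) show ?case unfolding wS by (rule stabilizers_mult[OF VW(3,4) Suc subsetD[OF F(1) eF]])
  qed (simp add: w0 one)
  have wc: "w t n \<in> carrier G" for t n using wst st by blast
  \<comment> \<open>Each letter adds its size plus the error \<open>C\<close>, together at most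
    \<open>a\<close>; the identity contributes \<open>\<alpha> \<one>\<close>.\<close>
  have w\<alpha>: "\<alpha> (w t n) \<le> \<alpha> \<one> + n * a" for t n
  proof (induction n)
    case (Suc n)
    have "\<alpha> (w t (Suc n)) \<le> \<alpha> (w t n) + \<alpha> (e (digit N t n)) + C"
      unfolding wS using C wst eF F(1) by blast
    then show ?case using Suc a[OF eF[of t n]] by (simp add: algebra_simps)
  qed (simp add: w0)
  have ec: "e (digit N t n) \<in> carrier G" for t n by (rule subsetD[OF Fc eF])
  have wimg: "act (w t (Suc n)) ` V = act (w t n) ` (act (e (digit N t n)) ` V)" for t n
    unfolding wS image_image by (intro image_cong refl act_mult[OF wc ec subsetD[OF VW(3)]])
  have eV: "act (e (digit N t n)) ` V \<subseteq> V" for t n using subsetD[OF F(1) eF, of t n] by (simp add: stabilizers_def)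
  have dec: "act (w t n) ` V \<subseteq> act (w t m) ` V" if "m \<le> n" for t m n
    using that
  proof (induction n rule: dec_induct)
    case (step n) then show ?case using wimg eV by (metis image_mono order_trans)
  qed simp
  have "\<exists>x. x \<in> (\<Inter>n. act (w t n) ` V)" for t
  proof -
    have "\<Inter> (range (\<lambda>n. act (w t n) ` V)) \<noteq> {}"
      by (rule compact_nest) (use V dec VW wc continuous_on_subset[OF act_cont] in \<open>auto intro!: compact_continuous_image\<close>)
    then show ?thesis by blast
  qed
  then obtain x where x: "\<And>t n. x t \<in> act (w t n) ` V" by (metis INT_E UNIV_I)
  have x\<Lambda>: "x t \<in> \<Lambda>" for t using x[of t 0] VW(3) act_in[OF wc] by auto
  \<comment> \<open>The longer word maps \<open>V\<close> into the piece of one letter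
    \<open>g\<close> below the shorter word; equality would put the disjoint piece of another letter
    \<open>h\<close> there too.\<close>
  have injw: "inj (w t)" for t
  proof (rule linorder_injI)
    fix m n :: nat assume mn: "m < n"
    show "w t m \<noteq> w t n"
    proof
      assume eq: "w t m = w t n"
      define g where "g = e (digit N t m)"
      have "\<not> F \<subseteq> {g}" using F(3) card_mono[of "{g}" F] by auto
      then obtain h where h: "h \<in> F" "h \<noteq> g" by blast
      have gF: "g \<in> F" using eF g_def by blast
      obtain v where v: "v \<in> V" using V by blast
      have hv: "act h v \<in> V" using h(1) F(1) v by (auto simp: stabilizers_def)
      then have "act (w t m) (act h v) \<in> act (w t n) ` V" using eq by auto
      also have "\<dots> \<subseteq> act (w t (Suc m)) ` V" using dec mn by simp
      finally have "act (w t m) (act h v) \<in> act (w t m) ` (act g ` V)" by (simp add: wimg g_def)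
      then obtain v' where v': "v' \<in> V" "act (w t m) (act h v) = act (w t m) (act g v')" by auto
      have "act h v \<in> \<Lambda>" "act g v' \<in> \<Lambda>" using act_in h(1) gF Fc v v'(1) VW(3) by blast+
      then have "act h v = act g v'" using act_eq_iff[OF wc] v'(2) by blast
      then show False using disj[OF h(1) gF h(2)] v v'(1) by blast
    qed
  qed
  \<comment> \<open>The inverses of the words witness conicality: they pull \<open>x t\<close> back
    into \<open>V\<close> and move every other point to \<open>R\<close> in
    \<open>W\<close>.\<close>
  have con: "x t \<in> conical" for t
  proof -
    obtain r A R where r: "strict_mono r" "attracting (\<lambda>n. w t (r n)) A R" using attracting_ex[OF injw wc] by blast
    have AR: "A \<in> V" "R \<in> W" using directedD[OF dir wst r(2)] by blast+
    define y where "y n = act (inv (w t n)) (x t)" for n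
    have yV: "y n \<in> V" for n
    proof -
      obtain v where "v \<in> V" "x t = act (w t n) v" using x[of t n] by blast
      then show ?thesis using act_inv[OF wc, of v t n] VW(3) by (auto simp: y_def)
    qed
    have nR: "attracting (\<lambda>n. inv (w t (r n))) R A" using attracting_inv[OF r(2)] .
    \<comment> \<open>Otherwise the inverse words would move \<open>x t\<close> to \<open>R\<close>
      in \<open>W\<close>, whereas its images \<open>y n\<close> stay in the closed set
      \<open>V\<close>.\<close>
    have xA: "x t = A"
    proof (rule ccontr)
      assume "x t \<noteq> A"
      then have "(\<lambda>n. y (r n)) \<longlonglongrightarrow> R" using attracting_tendsto_const[OF nR x\<Lambda>] by (simp add: y_def)
      then have "R \<in> V" using closed_sequentially[OF compact_imp_closed[OF VW(1)], of "\<lambda>n. y (r n)"] yV by blast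
      then show False using AR VW(5) by blast
    qed
    obtain l q where l: "l \<in> V" "strict_mono (q :: nat \<Rightarrow> nat)" "(\<lambda>n. y (r (q n))) \<longlonglongrightarrow> l"
      using VW(1) yV unfolding compact_def comp_def by meson
    have nq: "attracting (\<lambda>n. inv (w t (r (q n)))) R A" using attracting_subseq[OF nR l(2)] .
    define \<gamma> where "\<gamma> n = inv (w t (r (q n)))" for n
    have "inj \<gamma>"
    proof (rule injI)
      fix m n assume "\<gamma> m = \<gamma> n"
      then have "w t (r (q m)) = w t (r (q n))" using wc by (metis \<gamma>_def inv_inv)
      then show "m = n" using injD[OF injw] strict_mono_eq[OF r(1)] strict_mono_eq[OF l(2)] by blast
    qed
    moreover have "range \<gamma> \<subseteq> carrier G" using wc by (auto simp: \<gamma>_def)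
    moreover have "(\<lambda>n. act (\<gamma> n) (x t)) \<longlonglongrightarrow> l" using l(3) by (simp add: y_def \<gamma>_def)
    moreover have "(\<lambda>n. act (\<gamma> n) y) \<longlonglongrightarrow> R" if "y \<in> \<Lambda> - {x t}" for y
      using attracting_tendsto_const[OF nq] that xA by (auto simp: \<gamma>_def)
    moreover have "l \<noteq> R" "l \<in> \<Lambda>" "R \<in> \<Lambda>" using l(1) AR VW by auto
    ultimately show ?thesis using x\<Lambda> unfolding conical_def by blast
  qed
  have weq: "w t n = w u n" if "\<And>i. i < n \<Longrightarrow> digit N t i = digit N u i" for t u n
    using that by (induction n) (auto simp: w0 wS)
  \<comment> \<open>The common word of length \<open>n\<close> is factored out. The remaining points
    lie in different first-level pieces, at distance at least \<open>c0\<close>, and the word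
    shrinks this by at most its size.\<close>
  have sep: "c * exp (- \<alpha> \<one>) * exp (- a) ^ n \<le> dist (x t) (x u)"
    if ne: "digit N t n \<noteq> digit N u n" and eq: "\<And>i. i < n \<Longrightarrow> digit N t i = digit N u i" for t u n
  proof -
    define g h where "g = e (digit N t n)" and "h = e (digit N u n)"
    have "digit N t n \<in> {0..<N}" "digit N u n \<in> {0..<N}" using F(3) by (simp_all add: digit_def N_def)
    then have gh: "g \<noteq> h" using ne bij_betw_imp_inj_on[OF e] by (auto simp: g_def h_def inj_on_def)
    have ghF: "g \<in> F" "h \<in> F" using eF by (auto simp: g_def h_def)
    obtain p where p: "p \<in> act g ` V" "x t = act (w t n) p" using x[of t "Suc n"] by (auto simp: wimg g_def)
    obtain p' where p': "p' \<in> act h ` V" "x u = act (w t n) p'"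
      using x[of u "Suc n"] weq[OF eq] by (auto simp: wimg h_def)
    have "c0 \<le> dist p p'" using d(2)[OF ghF gh p(1) p'(1)] c0_le[OF ghF] by linarith
    moreover have "p \<in> V" "p' \<in> V" using p(1) p'(1) eV by (auto simp: g_def h_def)
    ultimately have "c * exp (- \<alpha> (w t n)) \<le> dist (x t) (x u)" using c(2)[OF wst] p(2) p'(2) by metis
    moreover have "exp (- \<alpha> \<one>) * exp (- a) ^ n \<le> exp (- \<alpha> (w t n))"
      using w\<alpha>[of t n] by (simp add: exp_of_nat_mult[symmetric] mult_exp_exp)
    then have "c * (exp (- \<alpha> \<one>) * exp (- a) ^ n) \<le> c * exp (- \<alpha> (w t n))" using c(1) by (intro mult_left_mono) auto
    ultimately show ?thesis by (simp add: mult.assoc)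
  qed
  show ?thesis
    by (rule exI[of _ x], rule exI[of _ "c * exp (- \<alpha> \<one>)"]) (use con sep c(1) in \<open>auto simp: N_def\<close>)
qed

text \<open>A mass distribution principle: a set of diameter below \<open>c * exp (- a) ^ k\<close>
  meets the Cantor set only in parameters with the same first \<open>k\<close> digits, an interval
  of length \<open>N\<close> to the power \<open>- k\<close>, which is at most
  \<open>exp (- (s' * a * k))\<close>. Diameters are controlled by \<open>D\<close> on conical
  points only.\<close>

lemma conical_cover_lower_bound:
  assumes "\<not> (\<lambda>g. exp (- s * \<alpha> g)) summable_on carrier G" "\<not> is_singleton \<Lambda>" "0 < s'" "s' < s"
  shows "\<exists>\<kappa>\<ge>0. \<exists>\<epsilon>>0. \<forall>U D. conical \<subseteq> (\<Union>i::nat. U i) \<longrightarrow>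
    (\<forall>i. 0 \<le> D i \<and> D i \<le> \<epsilon> \<and> (\<forall>x\<in>U i \<inter> conical. \<forall>y\<in>U i \<inter> conical. dist x y \<le> D i)) \<longrightarrow>
    1 \<le> (\<Sum>i. ennreal (\<kappa> * D i powr s'))"
proof -
  obtain V W S where VW: "directed V W S" "S \<subseteq> stabilizers V W" "V \<noteq> {}" "W \<noteq> {}"
    "\<not> (\<lambda>g. exp (- s * \<alpha> g)) summable_on S"
    using divergent_directed_set[OF assms(1,2)] assms(3,4) by auto
  have VW': "compact V" "compact W" "V \<subseteq> \<Lambda>" "W \<subseteq> \<Lambda>" "V \<inter> W = {}" using VW(1) by (auto simp: directed_def)
  have many: "\<exists>(n::nat) F. F \<subseteq> S \<and> finite F \<and> (\<forall>g\<in>F. \<alpha> g \<le> n + 1) \<and>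
    (\<forall>g\<in>F. \<forall>h\<in>F. g \<noteq> h \<longrightarrow> act g ` V \<inter> act h ` V = {}) \<and> K * exp (s' * n) \<le> card F" for K
    using many_disjoint_images[OF VW(1,3,5) assms(4)] assms(3,4) by simp
  \<comment> \<open>A preliminary family with two disjoint images provides the two points of
    \<open>V\<close> that \<open>stabilizers_directed\<close> asks for; only then is the constant
    \<open>C\<close> available.\<close>
  have dir: "directed V W (stabilizers V W)"
  proof -
    obtain n :: nat and F where F: "F \<subseteq> S" "finite F"
      "\<forall>g\<in>F. \<forall>h\<in>F. g \<noteq> h \<longrightarrow> act g ` V \<inter> act h ` V = {}" "2 * exp (s' * n) \<le> card F"
      using many[of 2] by blast
    have "1 \<le> exp (s' * n)" using assms(3) by simp
    then have c2: "card F \<ge> 2" using F(4) by linarith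
    then obtain g where g: "g \<in> F" by fastforce
    have "\<not> F \<subseteq> {g}" using c2 card_mono[of "{g}" F] by auto
    then obtain h where h: "h \<in> F" "h \<noteq> g" by blast
    obtain v where v: "v \<in> V" using VW(3) by blast
    have "act g v \<in> V" "act h v \<in> V" using v g h F(1) VW(2) by (auto simp: stabilizers_def)
    moreover have "act g v \<noteq> act h v" using F(3) g h v by blast
    ultimately show ?thesis using stabilizers_directed[OF VW' VW(4)] by blast
  qed
  obtain C0 where C0: "\<forall>g\<in>stabilizers V W. \<forall>h\<in>stabilizers V W. \<bar>\<alpha> (g \<otimes> h) - \<alpha> g - \<alpha> h\<bar> \<le> C0"
    using directed_add[OF dir] by blast
  define C where "C = max C0 0"
  have C: "\<alpha> (g \<otimes> h) \<le> \<alpha> g + \<alpha> h + C" if "g \<in> stabilizers V W" "h \<in> stabilizers V W" for g h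
  proof -
    have "\<bar>\<alpha> (g \<otimes> h) - \<alpha> g - \<alpha> h\<bar> \<le> C0" "C0 \<le> C" using C0 that by (auto simp: C_def)
    then show ?thesis by linarith
  qed
  \<comment> \<open>The factor \<open>exp (s' * (1 + C))\<close> pays in advance for the window
    width 1 and the error \<open>C\<close>, so that \<open>exp (s' * a) \<le> card F\<close>; the
    factor 2 guarantees two maps.\<close>
  obtain n :: nat and F where F: "F \<subseteq> S" "finite F" "\<forall>g\<in>F. \<alpha> g \<le> real n + 1"
    "\<forall>g\<in>F. \<forall>h\<in>F. g \<noteq> h \<longrightarrow> act g ` V \<inter> act h ` V = {}"
    "2 * exp (s' * (1 + C)) * exp (s' * n) \<le> card F"
    using many[of "2 * exp (s' * (1 + C))"] by (elim exE conjE) (rule that, assumption+)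
  define a where "a = n + 1 + C"
  define N where "N = card F"
  have a: "a \<ge> 1" by (simp add: a_def C_def)
  have "2 * exp (s' * a) \<le> N" using F(5) by (simp add: N_def a_def mult_exp_exp algebra_simps)
  moreover have "1 \<le> exp (s' * a)" using a assms(3) by simp
  ultimately have N: "2 \<le> N" "exp (s' * a) \<le> N" by linarith+
  have aF: "\<And>g. g \<in> F \<Longrightarrow> \<alpha> g + C \<le> a" using F(3) by (fastforce simp: a_def)
  have FW: "F \<subseteq> stabilizers V W" using F(1) VW(2) by blast
  have "\<exists>x c. c > 0 \<and> (\<forall>t\<in>{0..<1}. x t \<in> conical) \<and>
    (\<forall>t\<in>{0..<1}. \<forall>u\<in>{0..<1}. \<forall>n. digit N t n \<noteq> digit N u n \<longrightarrow>
      (\<forall>i<n. digit N t i = digit N u i) \<longrightarrow> c * exp (- a) ^ n \<le> dist (x t) (x u))"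
    unfolding N_def
    by (rule cantor_set[OF dir VW(3) FW F(2)]) (use N(1) F(4) C aF in \<open>auto simp: N_def\<close>)
  then obtain x c where c: "c > 0" and x: "\<And>t. t \<in> {0..<1} \<Longrightarrow> x t \<in> conical"
    and sep: "\<And>t u n. t \<in> {0..<1} \<Longrightarrow> u \<in> {0..<1} \<Longrightarrow> digit N t n \<noteq> digit N u n \<Longrightarrow>
      (\<And>i. i < n \<Longrightarrow> digit N t i = digit N u i) \<Longrightarrow> c * exp (- a) ^ n \<le> dist (x t) (x u)"
    by blast
  \<comment> \<open>The numerator \<open>exp (s' * a)\<close> is the loss of one level, since
    \<open>D i\<close> is only bounded below at level \<open>k + 1\<close>.\<close>
  define \<kappa> where "\<kappa> = exp (s' * a) / c powr s'"
  have \<kappa>: "\<kappa> \<ge> 0" by (simp add: \<kappa>_def)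
  have "1 \<le> (\<Sum>i. ennreal (\<kappa> * D i powr s'))"
    if cov: "conical \<subseteq> (\<Union>i::nat. U i)"
      and D: "\<And>i. 0 \<le> D i" "\<And>i. D i \<le> c / 2" "\<And>i x y. x \<in> U i \<inter> conical \<Longrightarrow> y \<in> U i \<inter> conical \<Longrightarrow> dist x y \<le> D i" for U D
  proof (rule unit_interval_cover)
    define T where "T i = {t \<in> {0..<1}. x t \<in> U i}" for i
    show "{0..<1} \<subseteq> (\<Union>i. T i)" using subsetD[OF cov x] by (auto simp: T_def)
    show "0 \<le> \<kappa> * D i powr s'" for i using \<kappa> by simp
    show "\<exists>u. T i \<subseteq> {u..u + \<kappa> * D i powr s'}" for i
    proof (cases "T i = {}")
      case False
      then obtain t where t: "t \<in> T i" by blast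
      \<comment> \<open>At the first index where the digits differ, the separation of the Cantor set
        exceeds \<open>D i\<close> unless that index comes after \<open>j\<close>.\<close>
      have dig: "digit N t j = digit N u j" if u: "u \<in> T i" and j: "D i < c * exp (- a) ^ j" for u j
      proof (rule ccontr)
        assume "digit N t j \<noteq> digit N u j"
        define n where "n = (LEAST n. digit N t n \<noteq> digit N u n)"
        have n: "digit N t n \<noteq> digit N u n" unfolding n_def by (rule LeastI) fact
        have nj: "n \<le> j" unfolding n_def by (rule Least_le) fact
        have "digit N t i = digit N u i" if "i < n" for i using not_less_Least that unfolding n_def by blast
        then have "c * exp (- a) ^ n \<le> dist (x t) (x u)" using sep n t u by (auto simp: T_def)
        also have "\<dots> \<le> D i" using D(3) t u x by (auto simp: T_def)
        also have "\<dots> < c * exp (- a) ^ j" by fact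
        also have "\<dots> \<le> c * exp (- a) ^ n" using c nj a by (intro mult_left_mono power_decreasing) auto
        finally show False by simp
      qed
      have t01: "0 \<le> t" "t < 1" using t by (auto simp: T_def)
      have N0: "0 < N" using N by simp
      show ?thesis
      proof (cases "D i = 0")
        case True
        \<comment> \<open>A set of diameter 0 contains at most one point of the Cantor set, and
          \<open>0 powr s'\<close> is 0, so the degenerate interval at \<open>t\<close>
          suffices.\<close>
        have "u = t" if u: "u \<in> T i" for u
        proof -
          have "digit N t j = digit N u j" for j using dig[OF u] True c by simp
          then show ?thesis using eq_if_all_digits_eq[OF t01 _ _ N(1), of u] u by (auto simp: T_def)
        qed
        then show ?thesis using \<kappa> by (intro exI[of _ t]) auto
      next
        case False
        then have "0 < D i" "D i < c" using D(1,2)[of i] c by auto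
        then obtain k where k: "c * exp (- a) ^ Suc k \<le> D i" "D i < c * exp (- a) ^ k"
          using exists_power_scale[of "D i" c "exp (- a)"] a by auto
        define m where "m = real_of_int \<lfloor>t * real N ^ k\<rfloor>"
        \<comment> \<open>Here \<open>exp (s' * a) \<le> N\<close> converts the number of branches
          into the exponent \<open>s'\<close>.\<close>
        have Nk: "1 / real N ^ k \<le> \<kappa> * D i powr s'"
        proof -
          have "exp (s' * a) ^ k \<le> real N ^ k" using N by (intro power_mono) auto
          then have "1 / real N ^ k \<le> 1 / exp (s' * a) ^ k" using N0 by (intro divide_left_mono mult_pos_pos) auto
          also have "\<dots> = exp (- (s' * a * k))" by (simp add: exp_minus exp_of_nat_mult[symmetric] field_simps)
          also have "\<dots> = exp (s' * a) / c powr s' * (c powr s' * exp (- (s' * a * Suc k)))"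
            using c by (simp add: mult_exp_exp algebra_simps)
          also have "c powr s' * exp (- (s' * a * Suc k)) = (c * exp (- a) ^ Suc k) powr s'"
            using c by (subst powr_mult) (auto simp: exp_of_nat_mult[symmetric] exp_powr_real algebra_simps simp del: power_Suc)
          also have "\<dots> \<le> D i powr s'" using k(1) assms(3) c by (intro powr_mono2) auto
          finally show ?thesis using \<kappa> by (simp add: \<kappa>_def mult_left_mono divide_right_mono)
        qed
        have "T i \<subseteq> {m / real N ^ k .. m / real N ^ k + \<kappa> * D i powr s'}"
        proof
          fix u assume u: "u \<in> T i"
          have "digit N t j = digit N u j" if "j < k" for j
          proof (rule dig[OF u])
            have "exp (- a) ^ k \<le> exp (- a) ^ j" using that a by (intro power_decreasing) auto
            then have "c * exp (- a) ^ k \<le> c * exp (- a) ^ j" using c by simp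
            then show "D i < c * exp (- a) ^ j" using k(2) by linarith
          qed
          then have "\<exists>m::real. {t, u} \<subseteq> {m / real N ^ k .. (m + 1) / real N ^ k} \<and> m = \<lfloor>t * real N ^ k\<rfloor>"
            using u by (intro dist_le_if_digits_eq t01 N0) (auto simp: T_def)
          then show "u \<in> {m / real N ^ k .. m / real N ^ k + \<kappa> * D i powr s'}"
            using Nk by (auto simp: m_def add_divide_distrib)
        qed
        then show ?thesis by blast
      qed
    qed simp
  qed
  then show ?thesis using c \<kappa> by (intro exI[of _ \<kappa>] conjI exI[of _ "c / 2"]) auto
qed

end

section \<open>Covering conical points by shadows\<close>

context conformal_convergence_action
begin

text \<open>The inverses of the sequence in the definition attract to \<open>x\<close> and repel
  from \<open>b\<close>. Applied to the points \<open>act (\<gamma> n) x\<close>, which tend to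
  \<open>a \<noteq> b\<close>, \<open>attracting_att_bound\<close> gives the estimate.\<close>

lemma conical_near_att:
  assumes x: "x \<in> conical" and inf: "infinite \<Lambda>"
  shows "\<exists>m::nat. infinite {g \<in> carrier G. dist x (att g) \<le> m * exp (- \<alpha> g)}"
proof -
  obtain a b \<gamma> where x\<Lambda>: "x \<in> \<Lambda>" and ab: "a \<in> \<Lambda>" "b \<in> \<Lambda>" "a \<noteq> b"
    and \<gamma>: "inj (\<gamma> :: nat \<Rightarrow> 'g)" "range \<gamma> \<subseteq> carrier G"
    and xa: "(\<lambda>n. act (\<gamma> n) x) \<longlonglongrightarrow> a" and yb: "\<And>y. y \<in> \<Lambda> - {x} \<Longrightarrow> (\<lambda>n. act (\<gamma> n) y) \<longlonglongrightarrow> b"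
    using x unfolding conical_def by blast
  have \<gamma>c: "\<gamma> n \<in> carrier G" for n using \<gamma>(2) by blast
  obtain r A R where r: "strict_mono r" "attracting (\<lambda>n. \<gamma> (r n)) A R" using attracting_ex[OF \<gamma>(1) \<gamma>c] by blast
  have sub: "(\<lambda>n. f (r n)) \<longlonglongrightarrow> l" if "f \<longlonglongrightarrow> l" for f and l :: 'e
    using LIMSEQ_subseq_LIMSEQ[OF that r(1)] by (simp add: comp_def)
  \<comment> \<open>A point other than \<open>x\<close> and \<open>R\<close> moves both to
    \<open>A\<close> and to \<open>b\<close>, which identifies them.\<close>
  have "\<not> \<Lambda> \<subseteq> {x, R}" using inf finite_subset[of \<Lambda> "{x, R}"] by auto
  then obtain y where y: "y \<in> \<Lambda>" "y \<noteq> x" "y \<noteq> R" by blast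
  have Ab: "A = b"
    using LIMSEQ_unique[OF attracting_tendsto_const[OF r(2) y(1,3)] sub[OF yb]] y by auto
  have Rx: "R = x"
  proof (rule ccontr)
    assume "R \<noteq> x"
    then have "A = a" using LIMSEQ_unique[OF attracting_tendsto_const[OF r(2) x\<Lambda>] sub[OF xa]] by auto
    then show False using Ab ab(3) by simp
  qed
  have n: "attracting (\<lambda>n. inv (\<gamma> (r n))) x b" using attracting_inv[OF r(2)] Ab Rx by simp
  obtain C where "\<forall>\<^sub>F n in sequentially. dist (act (inv (\<gamma> (r n))) (act (\<gamma> (r n)) x)) (att (inv (\<gamma> (r n))))
      \<le> C * exp (- \<alpha> (inv (\<gamma> (r n))))"
    using attracting_att_bound[OF n _ sub[OF xa] ab(1,3)] act_in[OF \<gamma>c x\<Lambda>] by blast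
  then have C: "\<forall>\<^sub>F n in sequentially. dist x (att (inv (\<gamma> (r n)))) \<le> C * exp (- \<alpha> (inv (\<gamma> (r n))))"
    using act_inv[OF \<gamma>c x\<Lambda>] by simp
  \<comment> \<open>Rounding the constant up to an integer leaves countably many cases for the
    covers.\<close>
  obtain m :: nat where m: "C \<le> m" using real_arch_simple by blast
  obtain N where N: "\<And>n. n \<ge> N \<Longrightarrow> dist x (att (inv (\<gamma> (r n)))) \<le> C * exp (- \<alpha> (inv (\<gamma> (r n))))"
    using C unfolding eventually_sequentially by blast
  have "(\<lambda>n. inv (\<gamma> (r n))) ` {N..} \<subseteq> {g \<in> carrier G. dist x (att g) \<le> m * exp (- \<alpha> g)}"
  proof (rule image_subsetI)
    fix n assume "n \<in> {N..}"
    then have "dist x (att (inv (\<gamma> (r n)))) \<le> C * exp (- \<alpha> (inv (\<gamma> (r n))))" using N by simp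
    also have "\<dots> \<le> m * exp (- \<alpha> (inv (\<gamma> (r n))))"
      using m by (intro mult_right_mono) auto
    finally show "inv (\<gamma> (r n)) \<in> {g \<in> carrier G. dist x (att g) \<le> m * exp (- \<alpha> g)}"
      using \<gamma>c by auto
  qed
  moreover have "infinite ((\<lambda>n. inv (\<gamma> (r n))) ` {N..})"
  proof -
    have "inj_on (\<lambda>n. inv (\<gamma> (r n))) {N..}"
    proof (rule inj_onI)
      fix m n assume "inv (\<gamma> (r m)) = inv (\<gamma> (r n))"
      then have "\<gamma> (r m) = \<gamma> (r n)" using \<gamma>c by (metis inv_inv)
      then show "m = n" using injD[OF \<gamma>(1)] strict_mono_eq[OF r(1)] by blast
    qed
    then show ?thesis using infinite_Ici finite_image_iff by blast
  qed
  ultimately show ?thesis using finite_subset by blast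
qed

text \<open>A Borel-Cantelli argument: for each integer constant \<open>m\<close>, the balls of
  radius \<open>m * exp (- \<alpha> g)\<close> about \<open>att g\<close>, with \<open>g\<close> in
  a tail of an enumeration of the group, still cover the points that lie in infinitely many of
  them.\<close>

lemma conical_cover_upper_bound:
  assumes sum: "(\<lambda>g. exp (- s * \<alpha> g)) summable_on carrier G" and s: "s > 0" and \<tau>: "\<tau> > 0" and \<epsilon>: "\<epsilon> > 0"
  shows "\<exists>U D. conical \<subseteq> (\<Union>i::nat. U i) \<and>
    (\<forall>i. 0 \<le> D i \<and> D i \<le> \<epsilon> \<and> (\<forall>x\<in>U i. \<forall>y\<in>U i. dist x y \<le> D i)) \<and> (\<Sum>i. ennreal (D i powr s)) \<le> ennreal \<tau>"
proof (cases "finite \<Lambda>")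
  case True
  \<comment> \<open>A finite limit set is covered by single points of diameter 0, which contribute
    nothing since \<open>0 powr s\<close> is 0.\<close>
  have "\<Lambda> \<subseteq> (\<Union>i::nat. {from_nat_into \<Lambda> i})"
    using from_nat_into_surj[OF countable_finite[OF True]] by blast
  then show ?thesis using s \<epsilon>
    by (intro exI[of _ "\<lambda>i. {from_nat_into \<Lambda> i}"] exI[of _ "\<lambda>i. 0"]) (auto simp: conical_def)
next
  case False
  show ?thesis
  proof (cases "finite (carrier G)")
    case True
    have "conical = {}"
    proof (rule equals0I)
      fix x assume "x \<in> conical"
      from conical_near_att[OF this False] True show False by simp
    qed
    then show ?thesis using s \<epsilon> by (intro exI[of _ "\<lambda>i. {}"] exI[of _ "\<lambda>i. 0"]) auto
  next
    case infG: False
    define h where "h = from_nat_into (carrier G)"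
    have h: "bij_betw h UNIV (carrier G)" unfolding h_def using bij_betw_from_nat_into[OF countable_G infG] .
    have "(\<lambda>j. exp (- s * \<alpha> (h j))) summable_on UNIV"
      using sum summable_on_reindex_bij_betw[OF h, of "\<lambda>g. exp (- s * \<alpha> g)"] by simp
    then have sh: "summable (\<lambda>j. exp (- s * \<alpha> (h j)))"
      by (subst (asm) summable_on_UNIV_nonneg_real_iff) auto
    define d where "d m j = 2 * real m * exp (- \<alpha> (h j))" for m j
    have d0: "0 \<le> d m j" for m j by (simp add: d_def)
    have d_powr: "d m j powr s = (2 * real m) powr s * exp (- s * \<alpha> (h j))" for m j
      by (simp add: d_def powr_mult exp_powr_real mult.commute)
    have sd: "summable (\<lambda>j. d m j powr s)" for m
      unfolding d_powr using sh by (rule summable_mult)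
    \<comment> \<open>The first bound gives level \<open>m\<close> its share of the budget
      \<open>\<tau>\<close>; the second keeps each diameter in the tail below
      \<open>\<epsilon>\<close>.\<close>
    define \<tau>' where "\<tau>' m = min (\<tau> * (1/2) ^ Suc m) (\<epsilon> powr s)" for m :: nat
    have "\<exists>J. \<forall>n\<ge>J. norm (\<Sum>i. d m (i + n) powr s) < \<tau>' m" for m
      using \<tau> \<epsilon> by (intro suminf_exist_split sd) (simp add: \<tau>'_def)
    then have "\<forall>m. \<exists>J. norm (\<Sum>i. d m (i + J) powr s) < \<tau>' m" by blast
    then obtain J where J: "\<And>m. norm (\<Sum>i. d m (i + J m) powr s) < \<tau>' m" by metis
    define U where "U = (\<lambda>(m, i). {y. dist y (att (h (i + J m))) \<le> real m * exp (- \<alpha> (h (i + J m)))})"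
    define D where "D = (\<lambda>(m, i). d m (i + J m))"
    have sdJ: "summable (\<lambda>i. d m (i + J m) powr s)" for m using sd by (subst summable_iff_shift)
    have tail: "(\<Sum>i. d m (i + J m) powr s) < \<tau>' m" for m using J[of m] by auto
    have trm: "d m (i + J m) powr s \<le> \<tau>' m" for m i
    proof -
      have "(\<Sum>j\<in>{i}. d m (j + J m) powr s) \<le> (\<Sum>i. d m (i + J m) powr s)"
        by (rule sum_le_suminf[OF sdJ]) auto
      then show ?thesis using tail[of m] by simp
    qed
    have D\<epsilon>: "D p \<le> \<epsilon>" for p
    proof (rule ccontr)
      assume "\<not> D p \<le> \<epsilon>"
      then have "\<epsilon> powr s < D p powr s" using \<epsilon> s by (intro powr_less_mono2) auto
      then show False using trm[of "fst p" "snd p"] by (auto simp: D_def \<tau>'_def split: prod.splits)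
    qed
    have cov: "conical \<subseteq> (\<Union>i::nat. U (prod_decode i))"
    proof
      fix x assume "x \<in> conical"
      then obtain m :: nat where m: "infinite {g \<in> carrier G. dist x (att g) \<le> m * exp (- \<alpha> g)}"
        using conical_near_att[OF _ False] by blast
      \<comment> \<open>Infinitely many elements cannot all belong to the deleted initial part of
        the enumeration.\<close>
      then have "\<not> {g \<in> carrier G. dist x (att g) \<le> m * exp (- \<alpha> g)} \<subseteq> h ` {..<J m}"
        using finite_subset by blast
      then obtain g where g: "g \<in> carrier G" "dist x (att g) \<le> m * exp (- \<alpha> g)" "g \<notin> h ` {..<J m}" by blast
      then obtain j where j: "g = h j" using h by (metis bij_betw_def imageE)
      then have "\<not> j < J m" using g(3) by blast
      then have "x \<in> U (m, j - J m)" using g(2) j by (simp add: U_def)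
      then show "x \<in> (\<Union>i::nat. U (prod_decode i))" by (metis UN_I UNIV_I prod_encode_inverse)
    qed
    have diam: "dist x y \<le> D p" if "x \<in> U p" "y \<in> U p" for x y p
    proof -
      obtain m i where p: "p = (m, i)" by force
      have "dist x y \<le> dist x (att (h (i + J m))) + dist y (att (h (i + J m)))" by (rule dist_triangle2)
      then show ?thesis using that p by (simp add: U_def D_def d_def)
    qed
    have "(\<Sum>i. ennreal (D (prod_decode i) powr s)) = (\<Sum>m. \<Sum>i. ennreal (D (m, i) powr s))"
      by (rule suminf_ennreal_2dimen[of _ "\<lambda>p. ennreal (D p powr s)"]) simp
    also have "\<dots> = (\<Sum>m. ennreal (\<Sum>i. d m (i + J m) powr s))"
      unfolding D_def by (simp add: suminf_ennreal2[OF _ sdJ])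
    also have "\<dots> \<le> (\<Sum>m. ennreal (\<tau> * (1/2) ^ Suc m))"
    proof (rule suminf_le)
      fix m show "ennreal (\<Sum>i. d m (i + J m) powr s) \<le> ennreal (\<tau> * (1/2) ^ Suc m)"
        using tail[of m] by (intro ennreal_leI) (simp add: \<tau>'_def)
    qed auto
    also have "\<dots> = ennreal (\<Sum>m. \<tau> * (1/2) ^ Suc m)"
      using \<tau> power_half_series by (intro suminf_ennreal2 summable_mult) (auto simp: sums_iff)
    also have "(\<Sum>m. \<tau> * (1/2) ^ Suc m) = \<tau>"
      using sums_unique[OF sums_mult[OF power_half_series, of \<tau>]] by simp
    finally have total: "(\<Sum>i. ennreal (D (prod_decode i) powr s)) \<le> ennreal \<tau>" .
    have "0 \<le> D p" for p using d0 by (simp add: D_def split: prod.splits)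
    then show ?thesis using cov diam D\<epsilon> total
      by (intro exI[of _ "\<lambda>i. U (prod_decode i)"] exI[of _ "\<lambda>i. D (prod_decode i)"]) blast
  qed
qed

end

section \<open>Orthogonal projections\<close>

lemma norm_vector_scalar_mult: "norm (c *s v) = norm c * norm (v :: 'k::{real_normed_field,euclidean_space}^'d)"
  by (simp add: norm_vec_def vector_scalar_mult_def norm_mult L2_set_right_distrib)

lemma scaleR_eq_scalar_mult: "r *\<^sub>R (v :: 'k::{real_normed_field,euclidean_space}^'d) = of_real r *s v"
  by (simp add: vec_eq_iff scaleR_conv_of_real[where 'a = 'k])

lemma vector_scalar_mult_diff: "c *s (x - y) = c *s x - c *s (y :: 'k::ring_1^'d)"
  by (simp add: vec_eq_iff right_diff_distrib)

text \<open>Polarization: the inner product is the real one, so scalars of the field act on it only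
  through norms.\<close>

lemma inner_scalar_mult:
  fixes v w :: "'k::{real_normed_field,euclidean_space}^'d"
  shows "(c *s v) \<bullet> (c *s w) = (norm c)\<^sup>2 * (v \<bullet> w)"
proof -
  have sum: "norm (c *s v + c *s w) = norm c * norm (v + w)"
    using norm_vector_scalar_mult[of c "v + w"] by (simp only: vector_add_ldistrib)
  have "(c *s v) \<bullet> (c *s w) = ((norm (c *s v + c *s w))\<^sup>2 - (norm (c *s v))\<^sup>2 - (norm (c *s w))\<^sup>2) / 2"
    by (simp add: dot_norm)
  also have "\<dots> = (norm c)\<^sup>2 * (((norm (v + w))\<^sup>2 - (norm v)\<^sup>2 - (norm w)\<^sup>2) / 2)"
    by (simp only: sum norm_vector_scalar_mult power_mult_distrib) (simp add: field_simps)
  also have "\<dots> = (norm c)\<^sup>2 * (v \<bullet> w)" by (simp add: dot_norm)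
  finally show ?thesis .
qed

lemma vec_subspace_real: 
  assumes "vec.subspace (V :: ('k::{real_normed_field,euclidean_space}^'d) set)"
  shows "subspace V"
  using assms by (auto simp: subspace_def vec.subspace_def scaleR_eq_scalar_mult)

lemma vec_subspace_closed: "vec.subspace (V :: ('k::{real_normed_field,euclidean_space}^'d) set) \<Longrightarrow> closed V"
  using closed_subspace vec_subspace_real by blast

text \<open>Only meaningful for subspaces. It embeds Grassmannians in a finite-dimensional normed
  space of operators, where \<open>grass_dist\<close> is the distance and bounded closed sets are
  compact.\<close>

definition proj :: "('k::{real_normed_field,euclidean_space}^'d) set \<Rightarrow> ('k^'d) \<Rightarrow>\<^sub>L ('k^'d)" where
  "proj V = Blinfun (closest_point V)"

lemma closest_point_subspace_unique:
  fixes V :: "'a::euclidean_space set"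
  assumes "subspace V" "y \<in> V" "\<And>v. v \<in> V \<Longrightarrow> (x - y) \<bullet> v = 0"
  shows "closest_point V x = y"
proof -
  have "dist x y \<le> dist x z" if "z \<in> V" for z
  proof -
    have "(x - y) \<bullet> (y - z) = 0" using assms that by (simp add: subspace_diff)
    then have "(norm (x - z))\<^sup>2 = (norm (x - y))\<^sup>2 + (norm (y - z))\<^sup>2"
      using norm_add_Pythagorean[of "x - y" "y - z"] by (simp add: orthogonal_def)
    then show ?thesis by (simp add: dist_norm) (metis norm_ge_zero power2_le_imp_le le_add_same_cancel1 zero_le_power2)
  qed
  then show ?thesis
    using closest_point_unique[of V y x] assms(1,2) subspace_imp_convex closed_subspace by metis
qed

lemma closest_point_subspace:
  fixes V :: "'a::euclidean_space set"
  assumes "subspace V"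
  shows "closest_point V x \<in> V" "v \<in> V \<Longrightarrow> (x - closest_point V x) \<bullet> v = 0"
proof -
  obtain y z where yz: "y \<in> span V" "\<And>w. w \<in> span V \<Longrightarrow> orthogonal z w" "x = y + z"
    using orthogonal_subspace_decomp_exists[of V x] by blast
  have sp: "span V = V" using assms by (simp add: span_eq_iff)
  have "closest_point V x = y"
    using yz by (intro closest_point_subspace_unique[OF assms]) (auto simp: sp orthogonal_def)
  then show "closest_point V x \<in> V" "v \<in> V \<Longrightarrow> (x - closest_point V x) \<bullet> v = 0"
    using yz by (auto simp: sp orthogonal_def)
qed

lemma bounded_linear_closest_point:
  fixes V :: "'a::euclidean_space set"
  assumes "subspace V"
  shows "bounded_linear (closest_point V)"
proof -
  note cp = closest_point_subspace[OF assms]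
  have "linear (closest_point V)"
  proof (rule linearI)
    fix x y and r :: real
    show "closest_point V (x + y) = closest_point V x + closest_point V y"
    proof (rule closest_point_subspace_unique[OF assms])
      fix v assume v: "v \<in> V"
      have "x + y - (closest_point V x + closest_point V y) = (x - closest_point V x) + (y - closest_point V y)" by simp
      then show "(x + y - (closest_point V x + closest_point V y)) \<bullet> v = 0"
        using cp(2)[OF v] by (simp only: inner_add_left)
    qed (use cp(1) assms in \<open>simp add: subspace_add\<close>)
    show "closest_point V (r *\<^sub>R x) = r *\<^sub>R closest_point V x"
    proof (rule closest_point_subspace_unique[OF assms])
      fix v assume v: "v \<in> V"
      have "r *\<^sub>R x - r *\<^sub>R closest_point V x = r *\<^sub>R (x - closest_point V x)" by (simp add: algebra_simps)
      then show "(r *\<^sub>R x - r *\<^sub>R closest_point V x) \<bullet> v = 0" using cp(2)[OF v] by simp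
    qed (use cp(1) assms in \<open>simp add: subspace_mul\<close>)
  qed
  then show ?thesis by (rule linear_conv_bounded_linear[THEN iffD1])
qed

lemma proj_eq_closest_point: "vec.subspace V \<Longrightarrow> blinfun_apply (proj V) = closest_point V"
  unfolding proj_def by (rule bounded_linear_Blinfun_apply[OF bounded_linear_closest_point[OF vec_subspace_real]])

lemma proj_in: "vec.subspace V \<Longrightarrow> proj V x \<in> V"
  and proj_orth: "vec.subspace V \<Longrightarrow> v \<in> V \<Longrightarrow> (x - proj V x) \<bullet> v = 0"
  using closest_point_subspace[OF vec_subspace_real] by (auto simp: proj_eq_closest_point)

lemma proj_unique: "vec.subspace V \<Longrightarrow> y \<in> V \<Longrightarrow> (\<And>v. v \<in> V \<Longrightarrow> (x - y) \<bullet> v = 0) \<Longrightarrow> proj V x = y"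
  using closest_point_subspace_unique[OF vec_subspace_real, of V y x] by (simp add: proj_eq_closest_point)

lemma proj_id: "vec.subspace V \<Longrightarrow> x \<in> V \<Longrightarrow> proj V x = x"
  by (rule proj_unique) auto

lemma proj_eq_iff_in: "vec.subspace V \<Longrightarrow> proj V x = x \<longleftrightarrow> x \<in> V"
  using proj_id proj_in by metis

lemma proj_inject:
  assumes VW: "vec.subspace V" "vec.subspace W"
  shows "proj V = proj W \<longleftrightarrow> V = W"
proof
  assume eq: "proj V = proj W"
  have "x \<in> V \<longleftrightarrow> x \<in> W" for x
    unfolding proj_eq_iff_in[OF VW(1), symmetric] proj_eq_iff_in[OF VW(2), symmetric] eq by (rule refl)
  then show "V = W" by blast
qed simp

lemma proj_pythagoras:
  assumes "vec.subspace V"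
  shows "(norm x)\<^sup>2 = (norm (proj V x))\<^sup>2 + (norm (x - proj V x))\<^sup>2"
  using norm_add_Pythagorean[of "proj V x" "x - proj V x"] proj_orth[OF assms proj_in[OF assms]]
  by (simp add: orthogonal_def inner_commute)

lemma norm_proj_le: "vec.subspace V \<Longrightarrow> norm (proj V x) \<le> norm x"
  and norm_proj_compl_le: "vec.subspace V \<Longrightarrow> norm (x - proj V x) \<le> norm x"
proof -
  assume "vec.subspace V"
  note py = proj_pythagoras[OF this, of x]
  show "norm (proj V x) \<le> norm x" by (rule power2_le_imp_le) (simp_all add: py)
  show "norm (x - proj V x) \<le> norm x" by (rule power2_le_imp_le) (simp_all add: py)
qed

lemma norm_minus_proj_le:
  assumes "vec.subspace V" "v \<in> V"
  shows "norm (x - proj V x) \<le> norm (x - v)"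
proof -
  have "norm ((x - v) - proj V (x - v)) \<le> norm (x - v)" by (rule norm_proj_compl_le[OF assms(1)])
  moreover have "proj V (x - v) = proj V x - v" by (simp add: blinfun.diff_right proj_id[OF assms])
  ultimately show ?thesis by simp
qed

lemma grass_dist_eq_dist_proj:
  assumes "vec.subspace V" "vec.subspace W"
  shows "grass_dist V W = dist (proj V) (proj W)"
  by (simp add: grass_dist_def dist_norm norm_blinfun.rep_eq blinfun.diff_left[abs_def] proj_eq_closest_point assms)

lemma dist_proj_lower:
  assumes "vec.subspace V" "vec.subspace W" "w \<in> W"
  shows "norm (w - proj V w) \<le> dist (proj V) (proj W) * norm w"
proof -
  have "w - proj V w = (proj W - proj V) w" by (simp add: blinfun.diff_left proj_id[OF assms(2,3)])
  then show ?thesis using norm_blinfun[of "proj W - proj V" w] by (simp add: dist_norm norm_minus_commute)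
qed

text \<open>\<open>P - Q = P (1 - Q) - (1 - P) Q\<close>, and \<open>P (1 - Q)\<close> is the adjoint of \<open>(1 - Q) P\<close>.\<close>

lemma dist_proj_upper:
  assumes V: "vec.subspace V" and W: "vec.subspace W" and g: "g \<ge> 0"
    and VW: "\<And>v. v \<in> V \<Longrightarrow> \<exists>w\<in>W. norm (v - w) \<le> g * norm v"
    and WV: "\<And>w. w \<in> W \<Longrightarrow> \<exists>v\<in>V. norm (w - v) \<le> g * norm w"
  shows "dist (proj V) (proj W) \<le> 2 * g"
  unfolding dist_norm
proof (rule norm_blinfun_bound)
  show "0 \<le> 2 * g" using g by simp
  fix x
  have a: "norm (proj W x - proj V (proj W x)) \<le> g * norm x"
  proof -
    obtain v where "v \<in> V" "norm (proj W x - v) \<le> g * norm (proj W x)" using WV[OF proj_in[OF W]] by blast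
    then have "norm (proj W x - proj V (proj W x)) \<le> g * norm (proj W x)"
      using norm_minus_proj_le[OF V] order_trans by blast
    also have "\<dots> \<le> g * norm x" using norm_proj_le[OF W] g by (rule mult_left_mono)
    finally show ?thesis .
  qed
  have b: "norm (proj V (x - proj W x)) \<le> g * norm x"
  proof -
    define u where "u = x - proj W x"
    define p where "p = proj V u"
    have pV: "p \<in> V" using proj_in[OF V] p_def by auto
    \<comment> \<open>\<open>w\<close> approximates \<open>p\<close> inside \<open>W\<close>;
      subtracting it is free in the pairing with \<open>u\<close>, which is orthogonal to
      \<open>W\<close>.\<close>
    obtain w where w: "w \<in> W" "norm (p - w) \<le> g * norm p" using VW[OF pV] by blast
    have "(norm p)\<^sup>2 = p \<bullet> p" by (simp add: power2_norm_eq_inner)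
    also have "\<dots> = u \<bullet> p" using proj_orth[OF V pV, of u] by (simp add: p_def inner_diff_left)
    also have "\<dots> = u \<bullet> (p - w)" using proj_orth[OF W w(1), of x] by (simp add: u_def inner_diff_right)
    also have "\<dots> \<le> norm u * norm (p - w)" by (rule norm_cauchy_schwarz)
    also have "\<dots> \<le> norm x * (g * norm p)"
      using w(2) norm_proj_compl_le[OF W] unfolding u_def by (intro mult_mono) auto
    finally have "norm p * norm p \<le> (g * norm x) * norm p" by (simp add: power2_eq_square mult_ac)
    then show ?thesis unfolding p_def[symmetric] u_def[symmetric]
      using g by (cases "norm p = 0") (auto simp: mult_le_cancel_right)
  qed
  have "(proj V - proj W) x = proj V (x - proj W x) - (proj W x - proj V (proj W x))"
    by (simp add: blinfun.diff_left blinfun.diff_right)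
  then have "norm ((proj V - proj W) x) \<le> norm (proj V (x - proj W x)) + norm (proj W x - proj V (proj W x))"
    by (simp add: norm_triangle_ineq4)
  then show "norm ((proj V - proj W) x) \<le> 2 * g * norm x" using a b by simp
qed

section \<open>Lines and convergence of lines\<close>

definition line :: "'k::field^'d \<Rightarrow> ('k^'d) set" where
  "line v = vec.span {v}"

lemma line_eq: "line v = range (\<lambda>c. c *s v)"
  by (simp add: line_def vec.span_singleton)

lemma line_subspace [simp]: "vec.subspace (line v)" by (simp add: line_def)

lemma line_self [simp]: "v \<in> line v" by (simp add: line_def vec.span_base)

lemma line_scale: "c \<noteq> 0 \<Longrightarrow> line (c *s v) = line v"
  by (auto simp: line_eq image_iff) (metis divide_self_if mult.commute nonzero_mult_div_cancel_left times_divide_eq_right vector_smult_assoc)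

lemma projective_space_iff: "V \<in> projective_space \<longleftrightarrow> (\<exists>v. v \<noteq> 0 \<and> V = line v)"
proof
  assume "V \<in> projective_space"
  then have V: "vec.subspace V" "vec.dim V = 1" by (auto simp: projective_space_def)
  then obtain v where v: "v \<in> V" "v \<noteq> 0"
    using vec.dim_eq_0[of V] by auto
  have "line v \<subseteq> V" unfolding line_def using V v by (simp add: vec.span_minimal)
  moreover have "vec.dim (line v) = 1" using v by (simp add: line_def vec.dim_span)
  ultimately have "vec.span (line v) = vec.span V" using V by (intro vec.dim_eq_span) auto
  then have "line v = V" using V by (simp add: vec.span_eq_iff[THEN iffD2])
  then show "\<exists>v. v \<noteq> 0 \<and> V = line v" using v by blast
qed (auto simp: projective_space_def line_def vec.dim_span)

lemma line_eq_if_in: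
  assumes "V \<in> projective_space" "v \<in> V" "v \<noteq> 0"
  shows "V = line v"
proof -
  obtain w where w: "w \<noteq> 0" "V = line w" using assms projective_space_iff by blast
  then obtain c where c: "v = c *s w" using assms by (auto simp: line_eq)
  then have "c \<noteq> 0" using assms(3) by auto
  then show ?thesis using w c by (simp add: line_scale)
qed

text \<open>A multiple of \<open>v\<close> is approximated by the same multiple of \<open>w\<close>,
  and conversely. Both quotients are kept so that one symmetric constant serves in
  \<open>dist_proj_upper\<close>.\<close>

lemma dist_proj_line_le:
  fixes v w :: "'k::{real_normed_field,euclidean_space}^'d"
  assumes "v \<noteq> 0" "w \<noteq> 0"
  shows "dist (proj (line v)) (proj (line w)) \<le> 2 * (norm (v - w) / norm v + norm (v - w) / norm w)"
proof (rule dist_proj_upper)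
  have aux: "\<exists>y\<in>line w. norm (x - y) \<le> (norm (v - w) / norm v + norm (v - w) / norm w) * norm x"
    if xv: "x \<in> line v" "v \<noteq> 0" for v w x :: "'k^'d"
  proof -
    obtain c where c: "x = c *s v" using xv(1) unfolding line_eq by blast
    have "norm (x - c *s w) = norm c * norm (v - w)"
      unfolding c vector_scalar_mult_diff[symmetric] by (rule norm_vector_scalar_mult)
    also have "\<dots> = (norm (v - w) / norm v) * norm x" using xv by (simp add: c norm_vector_scalar_mult)
    also have "\<dots> \<le> (norm (v - w) / norm v + norm (v - w) / norm w) * norm x"
      by (intro mult_right_mono) auto
    finally show ?thesis by (intro bexI[of _ "c *s w"]) (auto simp: line_eq)
  qed
  show "\<exists>y\<in>line w. norm (x - y) \<le> (norm (v - w) / norm v + norm (v - w) / norm w) * norm x"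
    if "x \<in> line v" for x using aux[OF that assms(1)] .
  show "\<exists>y\<in>line v. norm (x - y) \<le> (norm (v - w) / norm v + norm (v - w) / norm w) * norm x"
    if "x \<in> line w" for x using aux[OF that assms(2), of v] by (simp add: norm_minus_commute add.commute)
qed auto

lemma tendsto_proj_line:
  fixes v :: "nat \<Rightarrow> 'k::{real_normed_field,euclidean_space}^'d"
  assumes "v \<longlonglongrightarrow> l" "l \<noteq> 0"
  shows "(\<lambda>n. proj (line (v n))) \<longlonglongrightarrow> proj (line l)"
proof (rule metric_tendsto_imp_tendsto)
  have "(\<lambda>n. 2 * (norm (v n - l) / norm (v n) + norm (v n - l) / norm l)) \<longlonglongrightarrow> 2 * (norm (l - l) / norm l + norm (l - l) / norm l)"
    using assms by (intro tendsto_intros) auto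
  then show "(\<lambda>n. 2 * (norm (v n - l) / norm (v n) + norm (v n - l) / norm l)) \<longlonglongrightarrow> 0" by simp
  have "\<forall>\<^sub>F n in sequentially. v n \<noteq> 0" using tendsto_imp_eventually_ne[OF assms] .
  then show "\<forall>\<^sub>F n in sequentially. dist (proj (line (v n))) (proj (line l))
      \<le> dist (2 * (norm (v n - l) / norm (v n) + norm (v n - l) / norm l)) 0"
    by eventually_elim (use dist_proj_line_le assms(2) in \<open>fastforce simp: dist_real_def\<close>)
qed

lemma tendsto_blinfun_apply_const: "(\<lambda>n. P n) \<longlonglongrightarrow> P0 \<Longrightarrow> (\<lambda>n. blinfun_apply (P n) x) \<longlonglongrightarrow> blinfun_apply P0 x"
  by (intro tendsto_intros)

text \<open>A convergent sequence of lines is spanned by a convergent sequence of vectors, namely the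
  projections of a vector of the limit line.\<close>

lemma convergent_lines:
  fixes X :: "nat \<Rightarrow> ('k::{real_normed_field,euclidean_space}^'d) set"
  assumes "\<And>n. X n \<in> projective_space" "(\<lambda>n. proj (X n)) \<longlonglongrightarrow> proj (line v)" "v \<noteq> 0"
  shows "(\<lambda>n. proj (X n) v) \<longlonglongrightarrow> v" "\<forall>\<^sub>F n in sequentially. proj (X n) v \<noteq> 0 \<and> X n = line (proj (X n) v)"
proof -
  have "(\<lambda>n. proj (X n) v) \<longlonglongrightarrow> proj (line v) v" by (rule tendsto_blinfun_apply_const[OF assms(2)])
  then show l: "(\<lambda>n. proj (X n) v) \<longlonglongrightarrow> v" by (simp add: proj_id)
  have "\<forall>\<^sub>F n in sequentially. proj (X n) v \<noteq> 0" using tendsto_imp_eventually_ne[OF l assms(3)] .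
  then show "\<forall>\<^sub>F n in sequentially. proj (X n) v \<noteq> 0 \<and> X n = line (proj (X n) v)"
  proof eventually_elim
    case (elim n)
    have "vec.subspace (X n)" using assms(1) by (simp add: projective_space_def)
    then show ?case using line_eq_if_in[OF assms(1) proj_in elim] elim by blast
  qed
qed

section \<open>Cartan decompositions\<close>

lemma index_rank_strict_mono: "strict_mono (index_rank :: 'd::{finite,linorder} \<Rightarrow> nat)"
  by (rule strict_monoI) (auto simp: index_rank_def intro!: psubset_card_mono)

lemma index_rank_bij: "bij_betw (index_rank :: 'd::{finite,linorder} \<Rightarrow> nat) UNIV {1..CARD('d)}"
proof -
  have inj: "inj (index_rank :: 'd \<Rightarrow> nat)" using index_rank_strict_mono by (rule strict_mono_imp_inj_on)
  have sub: "range (index_rank :: 'd \<Rightarrow> nat) \<subseteq> {1..CARD('d)}"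
    by (auto simp: index_rank_def card_mono Suc_le_eq card_gt_0_iff)
  have "range (index_rank :: 'd \<Rightarrow> nat) = {1..CARD('d)}"
    by (rule card_subset_eq[OF _ sub]) (use inj in \<open>auto simp: card_image\<close>)
  then show ?thesis using inj by (simp add: bij_betw_def)
qed

lemma index_rank_in: "index_rank (i :: 'd::{finite,linorder}) \<in> {1..CARD('d)}"
  using index_rank_bij bij_betwE by blast

lemma index_rank_inject [simp]: "index_rank i = index_rank j \<longleftrightarrow> i = j"
  using index_rank_bij by (metis bij_betw_imp_inj_on inj_eq)

lemma index_rank_surj: "k \<in> {1..CARD('d)} \<Longrightarrow> \<exists>i :: 'd::{finite,linorder}. index_rank i = k"
  using index_rank_bij by (metis bij_betw_def imageE)

lemma unitary_iff: "unitary L \<longleftrightarrow> (\<forall>x. norm (L *v x) = norm x)"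
proof -
  have "linear ((*v) L)"
    by (rule linearI) (simp_all add: matrix_vector_right_distrib scaleR_eq_scalar_mult vector_scalar_commute)
  then show ?thesis by (simp add: unitary_def orthogonal_transformation)
qed

lemma unitary_norm [simp]: "unitary L \<Longrightarrow> norm (L *v x) = norm x"
  by (simp add: unitary_iff)

lemma unitary_inner: "unitary L \<Longrightarrow> (L *v x) \<bullet> (L *v y) = x \<bullet> y"
  by (simp add: unitary_def orthogonal_transformation_def)

lemma unitary_mult: "unitary L \<Longrightarrow> unitary M \<Longrightarrow> unitary (L ** M)"
  by (simp add: unitary_iff matrix_vector_mul_assoc[symmetric])

lemma unitary_inverse:
  assumes "unitary L"
  shows "\<exists>L'. unitary L' \<and> L ** L' = mat 1 \<and> L' ** L = mat 1"
proof -
  have "inj ((*v) L)"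
  proof (rule injI)
    fix x y assume "L *v x = L *v y"
    then have "L *v (x - y) = 0" by (simp add: matrix_vector_mult_diff_distrib)
    then have "norm (x - y) = 0" using unitary_norm[OF assms, of "x - y"] by simp
    then show "x = y" by simp
  qed
  then obtain L' where L': "L' ** L = mat 1" using matrix_left_invertible_injective by blast
  then have L'': "L ** L' = mat 1" by (simp add: matrix_left_right_inverse)
  have "norm (L' *v x) = norm x" for x
  proof -
    have "norm (L' *v x) = norm (L *v (L' *v x))" using assms by simp
    then show ?thesis by (simp add: matrix_vector_mul_assoc L'')
  qed
  then show ?thesis using L' L'' by (auto simp: unitary_iff)
qed

text \<open>Hermitian orthogonality through the real inner product: \<open>y\<close> is orthogonal
  to the whole line of \<open>x\<close>.\<close>

definition korth :: "'k::{real_normed_field,euclidean_space}^'d \<Rightarrow> 'k^'d \<Rightarrow> bool" where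
  "korth x y \<longleftrightarrow> (\<forall>c. (c *s x) \<bullet> y = 0)"

text \<open>Over the complex numbers \<open>(norm c)\<^sup>2 * inverse c\<close> is the conjugate of
  \<open>c\<close>, so this is the adjoint rule in a form common to both fields.\<close>

lemma korth_shift: "c \<noteq> 0 \<Longrightarrow> (c *s x) \<bullet> y = (norm c)\<^sup>2 * (x \<bullet> (inverse c *s y))"
  for x y :: "'k::{real_normed_field,euclidean_space}^'d"
  using inner_scalar_mult[of c x "inverse c *s y"] by simp

lemma korth_inner: "korth x y \<Longrightarrow> x \<bullet> y = 0"
  unfolding korth_def by (metis vector_smult_lid)

lemma korth_scale: "korth x y \<Longrightarrow> korth (a *s x) (b *s y)"
proof -
  assume k: "korth x y"
  show ?thesis unfolding korth_def
  proof
    fix c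
    show "(c *s (a *s x)) \<bullet> (b *s y) = 0"
    proof (cases "b = 0")
      case False
      have "(c *s (a *s x)) \<bullet> (b *s y) = (b *s y) \<bullet> (c *s (a *s x))" by (rule inner_commute)
      also have "\<dots> = (norm b)\<^sup>2 * (((inverse b * c * a) *s x) \<bullet> y)"
        using korth_shift[OF False, of y "c *s (a *s x)"] by (simp add: inner_commute[of y] mult.assoc)
      finally show ?thesis using k by (simp add: korth_def)
    qed simp
  qed
qed

lemma korth_sym: "korth x y \<Longrightarrow> korth y x"
  unfolding korth_def
proof
  fix c assume k: "\<forall>c. (c *s x) \<bullet> y = 0"
  show "(c *s y) \<bullet> x = 0"
    using k korth_shift[of c y x] by (cases "c = 0") (auto simp: inner_commute)
qed

lemma unitary_of_columns:
  fixes w :: "'d::finite \<Rightarrow> 'k::{real_normed_field,euclidean_space}^'d"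
  assumes "\<And>j. norm (w j) = 1" "\<And>i j. i \<noteq> j \<Longrightarrow> korth (w i) (w j)"
  shows "unitary (\<chi> i j. w j $ i)"
  unfolding unitary_iff
proof
  fix x :: "'k^'d"
  have e: "(\<chi> i j. w j $ i) *v x = (\<Sum>j\<in>UNIV. x $ j *s w j)"
    by (simp add: vec_eq_iff matrix_vector_mult_def mult.commute)
  have o: "(x $ j *s w j) \<bullet> (x $ k *s w k) = (if j = k then (norm (x $ j))\<^sup>2 else 0)" for j k
    using korth_inner[OF korth_scale[OF assms(2)]] assms(1)
    by (auto simp: norm_vector_scalar_mult power2_norm_eq_inner[symmetric])
  have "(norm ((\<chi> i j. w j $ i) *v x))\<^sup>2 = (\<Sum>j\<in>UNIV. x $ j *s w j) \<bullet> (\<Sum>k\<in>UNIV. x $ k *s w k)"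
    by (simp add: e power2_norm_eq_inner)
  also have "\<dots> = (\<Sum>j\<in>UNIV. \<Sum>k\<in>UNIV. (x $ j *s w j) \<bullet> (x $ k *s w k))"
    by (simp add: inner_sum_left inner_sum_right) (rule sum.swap)
  also have "\<dots> = (\<Sum>j\<in>UNIV. (norm (x $ j))\<^sup>2)" by (simp add: o)
  also have "\<dots> = (norm x)\<^sup>2" by (simp add: norm_vec_def L2_set_def sum_nonneg)
  finally show "norm ((\<chi> i j. w j $ i) *v x) = norm x" by (simp add: power2_eq_iff_nonneg)
qed

lemma norm_add_scaleR_power2:
  fixes a b :: "'a::real_inner"
  shows "(norm (a + t *\<^sub>R b))\<^sup>2 = (norm a)\<^sup>2 + 2 * t * (a \<bullet> b) + t\<^sup>2 * (norm b)\<^sup>2"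
  unfolding power2_norm_eq_inner
  by (simp add: inner_add_left inner_add_right inner_commute[of b a] power2_eq_square algebra_simps)

text \<open>For small \<open>t\<close> the linear term dominates. It yields the orthogonality of
  singular vectors at a maximum and, later, the radical of a semidefinite form.\<close>

lemma quadratic_first_variation:
  assumes "\<And>t::real. 2 * t * b \<le> t\<^sup>2 * K"
  shows "b = 0"
proof (rule ccontr)
  assume b: "b \<noteq> 0"
  define t where "t = b / (\<bar>K\<bar> + 1)"
  have p: "\<bar>K\<bar> + 1 > 0" by simp
  have "2 * t * b = 2 * b\<^sup>2 / (\<bar>K\<bar> + 1)" by (simp add: t_def power2_eq_square)
  moreover have "t\<^sup>2 * K \<le> b\<^sup>2 / (\<bar>K\<bar> + 1)"
  proof -
    have "t\<^sup>2 * K \<le> t\<^sup>2 * (\<bar>K\<bar> + 1)" by (intro mult_left_mono) auto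
    also have "\<dots> = b\<^sup>2 / (\<bar>K\<bar> + 1)" using p by (simp add: t_def power2_eq_square)
    finally show ?thesis .
  qed
  moreover have "b\<^sup>2 / (\<bar>K\<bar> + 1) > 0" using b p by simp
  ultimately show False using assms[of t] by simp
qed

lemma tendsto_matrix_vector_mult:
  fixes A :: "'a \<Rightarrow> 'k::{real_normed_field,euclidean_space}^'d^'e"
  assumes "(A \<longlongrightarrow> A0) F" "(x \<longlongrightarrow> x0) F"
  shows "((\<lambda>n. A n *v x n) \<longlongrightarrow> A0 *v x0) F"
  by (rule vec_tendstoI) (auto simp: matrix_vector_mult_def intro!: tendsto_intros assms tendsto_vec_nth)

lemma tendsto_matrix_mult:
  fixes A :: "'a \<Rightarrow> 'k::{real_normed_field,euclidean_space}^'d^'e" and B :: "'a \<Rightarrow> 'k^'f^'d"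
  assumes "(A \<longlongrightarrow> A0) F" "(B \<longlongrightarrow> B0) F"
  shows "((\<lambda>n. A n ** B n) \<longlongrightarrow> A0 ** B0) F"
  by (intro vec_tendstoI) (auto simp: matrix_matrix_mult_def intro!: tendsto_intros assms tendsto_vec_nth)

lemma continuous_on_matrix_vector_mult:
  fixes A :: "'k::{real_normed_field,euclidean_space}^'d^'e"
  shows "continuous_on S ((*v) A)"
  unfolding continuous_on_def by (auto intro!: tendsto_matrix_vector_mult)

text \<open>Successive maximization: each new vector maximizes \<open>norm (A *v x)\<close> on the
  unit vectors orthogonal to the earlier ones. The last clause carries the induction:
  \<open>A\<close> maps this complement into the complement of the earlier images and is bounded
  there by all earlier singular values.\<close>

lemma exists_singular_system:
  fixes A :: "'k::{real_normed_field,euclidean_space}^'d^'d"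
  assumes "n \<le> CARD('d)"
  shows "\<exists>v :: nat \<Rightarrow> 'k^'d. (\<forall>i\<in>{1..n}. norm (v i) = 1) \<and>
    (\<forall>i\<in>{1..n}. \<forall>j\<in>{1..n}. i \<noteq> j \<longrightarrow> korth (v i) (v j) \<and> korth (A *v v i) (A *v v j)) \<and>
    (\<forall>i\<in>{1..n}. \<forall>j\<in>{1..n}. i \<le> j \<longrightarrow> norm (A *v v j) \<le> norm (A *v v i)) \<and>
    (\<forall>x. (\<forall>i\<in>{1..n}. korth (v i) x) \<longrightarrow>
      (\<forall>i\<in>{1..n}. korth (A *v v i) (A *v x) \<and> norm (A *v x) \<le> norm (A *v v i) * norm x))"
  using assms
proof (induction n)
  case 0
  show ?case by simp
next
  case (Suc n)
  obtain v :: "nat \<Rightarrow> 'k^'d" where v1: "\<forall>i\<in>{1..n}. norm (v i) = 1"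
    and vo: "\<forall>i\<in>{1..n}. \<forall>j\<in>{1..n}. i \<noteq> j \<longrightarrow> korth (v i) (v j) \<and> korth (A *v v i) (A *v v j)"
    and vd: "\<forall>i\<in>{1..n}. \<forall>j\<in>{1..n}. i \<le> j \<longrightarrow> norm (A *v v j) \<le> norm (A *v v i)"
    and vx: "\<forall>x. (\<forall>i\<in>{1..n}. korth (v i) x) \<longrightarrow>
      (\<forall>i\<in>{1..n}. korth (A *v v i) (A *v x) \<and> norm (A *v x) \<le> norm (A *v v i) * norm x)"
    using Suc.IH[OF Suc_leD[OF Suc.prems]] by blast
  define H where "H = {x. \<forall>i\<in>{1..n}. korth (v i) x}"
  have H_scale: "c *s x \<in> H" if "x \<in> H" for c x using that korth_scale[of _ x 1 c] by (auto simp: H_def)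
  have H_scaleR: "r *\<^sub>R x \<in> H" if "x \<in> H" for r x using H_scale[OF that] by (simp add: scaleR_eq_scalar_mult)
  have H_add: "x + y \<in> H" if "x \<in> H" "y \<in> H" for x y using that by (auto simp: H_def korth_def inner_add_right)
  have "\<exists>x\<in>H. x \<noteq> 0"
  proof -
    define S where "S = vec.span (v ` {1..n})"
    have sp: "span S = S" unfolding S_def by (rule span_eq_iff[THEN iffD2, OF vec_subspace_real[OF vec.subspace_span]])
    have "vec.dim S \<le> n"
      unfolding S_def vec.dim_span using vec.dim_le_card'[of "v ` {1..n}"] card_image_le[of "{1..n}" v] by simp
    moreover have "vec.dim (UNIV :: ('k^'d) set) = CARD('d)" by (rule vec_dim_card)
    ultimately have "S \<noteq> UNIV" using Suc.prems by (metis Suc_n_not_le_n order_trans)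
    then have psub: "span S \<subset> span UNIV" by (auto simp: sp)
    obtain x where x: "x \<noteq> 0" "\<And>y. y \<in> span S \<Longrightarrow> orthogonal x y"
      using orthogonal_to_subspace_exists_gen[OF psub] by metis
    have "korth (v i) x" if "i \<in> {1..n}" for i
      unfolding korth_def
    proof
      fix c
      have "c *s v i \<in> S" unfolding S_def using that by (intro vec.span_scale vec.span_base) auto
      then show "(c *s v i) \<bullet> x = 0" using x(2)[of "c *s v i"] by (simp add: sp orthogonal_def inner_commute)
    qed
    then show ?thesis unfolding H_def using x(1) by blast
  qed
  then obtain x0 where x0: "x0 \<in> H" "x0 \<noteq> 0" by blast
  define C where "C = H \<inter> sphere 0 1"
  have "(inverse (norm x0)) *\<^sub>R x0 \<in> C" using x0 H_scaleR by (auto simp: C_def)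
  then have C0: "C \<noteq> {}" by blast
  have "closed H"
  proof -
    have "H = (\<Inter>i\<in>{1..n}. \<Inter>c. {x. (c *s v i) \<bullet> x = 0})" by (auto simp: H_def korth_def)
    moreover have "closed (\<Inter>i\<in>{1..n}. \<Inter>c. {x. (c *s v i) \<bullet> x = 0})"
      by (intro closed_INT ballI closed_hyperplane)
    ultimately show ?thesis by simp
  qed
  then have "compact C" unfolding C_def by (intro closed_Int_compact compact_sphere)
  moreover have "continuous_on C (\<lambda>x. norm (A *v x))" by (intro continuous_on_norm continuous_on_matrix_vector_mult)
  ultimately obtain u where u: "u \<in> C" "\<And>y. y \<in> C \<Longrightarrow> norm (A *v y) \<le> norm (A *v u)"
    using continuous_attains_sup[OF _ C0] by blast
  have uH: "u \<in> H" "norm u = 1" using u(1) by (auto simp: C_def)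
  have umax: "norm (A *v y) \<le> norm (A *v u) * norm y" if "y \<in> H" for y
  proof (cases "y = 0")
    case False
    have "(inverse (norm y)) *\<^sub>R y \<in> C" using that H_scaleR False by (auto simp: C_def)
    from u(2)[OF this] have "norm (A *v y) / norm y \<le> norm (A *v u)"
      by (simp add: scaleR_eq_scalar_mult vector_scalar_commute norm_vector_scalar_mult norm_inverse divide_inverse mult.commute)
    then show ?thesis using False by (simp add: pos_divide_le_eq)
  qed simp
  \<comment> \<open>First variation of the norm of the image at the maximum \<open>u\<close> in the
    direction \<open>y\<close>.\<close>
  have uorth: "(A *v u) \<bullet> (A *v y) = 0" if y: "y \<in> H" "u \<bullet> y = 0" for y
  proof (rule quadratic_first_variation)
    fix t :: real
    have "u + t *\<^sub>R y \<in> H" using uH(1) y(1) H_add H_scaleR by blast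
    from umax[OF this] have "(norm (A *v (u + t *\<^sub>R y)))\<^sup>2 \<le> (norm (A *v u) * norm (u + t *\<^sub>R y))\<^sup>2" by (rule power_mono) simp
    moreover have "(norm (u + t *\<^sub>R y))\<^sup>2 = 1 + t\<^sup>2 * (norm y)\<^sup>2"
      using y(2) uH(2) by (simp add: norm_add_scaleR_power2)
    moreover have "A *v (u + t *\<^sub>R y) = A *v u + t *\<^sub>R (A *v y)"
      by (simp add: matrix_vector_right_distrib scaleR_eq_scalar_mult vector_scalar_commute)
    moreover have "(norm (A *v u + t *\<^sub>R (A *v y)))\<^sup>2 = (norm (A *v u))\<^sup>2 + 2 * t * ((A *v u) \<bullet> (A *v y)) + t\<^sup>2 * (norm (A *v y))\<^sup>2"
      by (rule norm_add_scaleR_power2)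
    ultimately have "2 * t * ((A *v u) \<bullet> (A *v y)) + t\<^sup>2 * (norm (A *v y))\<^sup>2 \<le> t\<^sup>2 * ((norm (A *v u))\<^sup>2 * (norm y)\<^sup>2)"
      by (simp add: power_mult_distrib algebra_simps)
    moreover have "0 \<le> t\<^sup>2 * (norm (A *v y))\<^sup>2" by simp
    ultimately show "2 * t * ((A *v u) \<bullet> (A *v y)) \<le> t\<^sup>2 * ((norm (A *v u))\<^sup>2 * (norm y)\<^sup>2)" by linarith
  qed
  \<comment> \<open>Applying the real statement to all multiples of \<open>y\<close> upgrades it to
    orthogonality over the field.\<close>
  have ukorth: "korth (A *v u) (A *v y)" if "y \<in> H" "korth u y" for y
  proof -
    have "(c *s (A *v y)) \<bullet> (A *v u) = 0" for c
    proof -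
      have "u \<bullet> (c *s y) = 0" using korth_inner[OF korth_scale[OF that(2), of 1 c]] by simp
      then show ?thesis using uorth[OF H_scale[OF that(1)], of c] by (simp add: vector_scalar_commute inner_commute)
    qed
    then show ?thesis using korth_sym[of "A *v y" "A *v u"] by (simp add: korth_def)
  qed
  define v' where "v' = v(Suc n := u)"
  have v'1: "v' i = v i" if "i \<in> {1..n}" for i using that by (simp add: v'_def)
  have v'2: "v' (Suc n) = u" by (simp add: v'_def)
  have ins: "{1..Suc n} = insert (Suc n) {1..n}" by auto
  have uv: "korth (v i) u \<and> korth u (v i) \<and> korth (A *v v i) (A *v u) \<and> korth (A *v u) (A *v v i)
      \<and> norm (A *v u) \<le> norm (A *v v i)" if "i \<in> {1..n}" for i
  proof -
    have "korth (A *v v i) (A *v u)" "norm (A *v u) \<le> norm (A *v v i) * norm u" "korth (v i) u"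
      using vx that uH(1) unfolding H_def by blast+
    then show ?thesis using korth_sym uH(2) by (metis mult.right_neutral)
  qed
  have vx': "korth (A *v v i) (A *v x) \<and> norm (A *v x) \<le> norm (A *v v i) * norm x"
    if "\<And>i. i \<in> {1..n} \<Longrightarrow> korth (v i) x" "i \<in> {1..n}" for x i using vx that by blast
  show ?case
  proof (intro exI[of _ v'] conjI)
    show "\<forall>i\<in>{1..Suc n}. norm (v' i) = 1" unfolding ins using v1 uH(2) by (simp add: v'1 v'2 del: atLeastAtMost_iff)
    show "\<forall>i\<in>{1..Suc n}. \<forall>j\<in>{1..Suc n}. i \<noteq> j \<longrightarrow> korth (v' i) (v' j) \<and> korth (A *v v' i) (A *v v' j)"
      unfolding ins using vo uv by (auto simp: v'1 v'2 simp del: atLeastAtMost_iff)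
    show "\<forall>i\<in>{1..Suc n}. \<forall>j\<in>{1..Suc n}. i \<le> j \<longrightarrow> norm (A *v v' j) \<le> norm (A *v v' i)"
      unfolding ins
    proof (intro ballI impI)
      fix i j assume ij: "i \<in> insert (Suc n) {1..n}" "j \<in> insert (Suc n) {1..n}" "i \<le> j"
      show "norm (A *v v' j) \<le> norm (A *v v' i)"
      proof (cases "j = Suc n")
        case True then show ?thesis using ij uv by (cases "i = Suc n") (auto simp: v'1 v'2)
      next
        case False
        then have "i \<in> {1..n}" "j \<in> {1..n}" using ij by auto
        then show ?thesis using vd ij by (simp add: v'1)
      qed
    qed
    show "\<forall>x. (\<forall>i\<in>{1..Suc n}. korth (v' i) x) \<longrightarrow>
      (\<forall>i\<in>{1..Suc n}. korth (A *v v' i) (A *v x) \<and> norm (A *v x) \<le> norm (A *v v' i) * norm x)"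
    proof (intro allI impI)
      fix x assume x: "\<forall>i\<in>{1..Suc n}. korth (v' i) x"
      have xv: "korth (v i) x" if "i \<in> {1..n}" for i using x that v'1[OF that] by (metis ins insertI2)
      have xu: "korth u x" using x v'2 by (metis ins insertI1)
      have xH: "x \<in> H" using xv by (simp add: H_def)
      show "\<forall>i\<in>{1..Suc n}. korth (A *v v' i) (A *v x) \<and> norm (A *v x) \<le> norm (A *v v' i) * norm x"
        unfolding ins using vx'[OF xv] ukorth[OF xH xu] umax[OF xH]
        by (simp add: v'1 v'2 del: atLeastAtMost_iff)
    qed
  qed
qed

lemma diag_mult_vec: "(diag s *v y) $ i = of_real (s (index_rank i)) * y $ i"
  by (simp add: diag_def matrix_vector_mult_def if_distrib[of "\<lambda>x. x * _"] cong: if_cong)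

text \<open>With the singular vectors as columns of \<open>V\<close> and their normalized images as
  columns of \<open>L\<close>, \<open>A ** V = L ** diag s\<close>; \<open>M\<close> is the inverse
  of \<open>V\<close>.\<close>

lemma cartan_decomposition_exists:
  fixes A :: "('k::{real_normed_field,euclidean_space}, 'd::{finite,linorder}) sqmatrix"
  assumes "invertible A"
  shows "\<exists>L s M. cartan_decomposition A L s M"
proof -
  obtain v :: "nat \<Rightarrow> ('k, 'd) vec" where v1: "\<forall>i\<in>{1..CARD('d)}. norm (v i) = 1"
    and vo: "\<forall>i\<in>{1..CARD('d)}. \<forall>j\<in>{1..CARD('d)}. i \<noteq> j \<longrightarrow> korth (v i) (v j) \<and> korth (A *v v i) (A *v v j)"
    and vd: "\<forall>i\<in>{1..CARD('d)}. \<forall>j\<in>{1..CARD('d)}. i \<le> j \<longrightarrow> norm (A *v v j) \<le> norm (A *v v i)"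
    using exists_singular_system[OF order_refl, of A] by blast
  obtain A' where A': "A' ** A = mat 1" using assms by (auto simp: invertible_def)
  define s where "s k = norm (A *v v k)" for k
  have spos: "s k > 0" if "k \<in> {1..CARD('d)}" for k
  proof -
    have "A' *v (A *v v k) = v k" by (simp add: matrix_vector_mul_assoc A')
    moreover have "v k \<noteq> 0" using v1 that by force
    ultimately have "A *v v k \<noteq> 0" by (metis matrix_vector_mult_0_right)
    then show ?thesis by (simp add: s_def)
  qed
  define w where "w k = inverse (of_real (s k)) *s (A *v v k)" for k
  have wk: "of_real (s k) *s w k = A *v v k" if "k \<in> {1..CARD('d)}" for k
    using spos[OF that] by (simp add: w_def)
  define V :: "('k, 'd) sqmatrix" where "V = (\<chi> i j. v (index_rank j) $ i)"
  define L :: "('k, 'd) sqmatrix" where "L = (\<chi> i j. w (index_rank j) $ i)"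
  have V: "unitary V" unfolding V_def
  proof (rule unitary_of_columns)
    show "norm (v (index_rank j)) = 1" for j :: 'd using v1 index_rank_in[of j] by blast
    show "korth (v (index_rank i)) (v (index_rank j))" if "i \<noteq> j" for i j :: 'd
      using vo index_rank_in[of i] index_rank_in[of j] that index_rank_inject by blast
  qed
  have L: "unitary L" unfolding L_def
  proof (rule unitary_of_columns)
    show "norm (w (index_rank j)) = 1" for j :: 'd
      using spos[OF index_rank_in[of j]] by (simp add: w_def norm_vector_scalar_mult norm_inverse) (simp add: s_def)
    show "korth (w (index_rank i)) (w (index_rank j))" if "i \<noteq> j" for i j :: 'd
      unfolding w_def using vo index_rank_in[of i] index_rank_in[of j] that by (intro korth_scale) auto
  qed
  obtain M where M: "unitary M" "V ** M = mat 1" using unitary_inverse[OF V] by blast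
  have AV: "A ** V = L ** diag s"
  proof -
    have "(A ** V) $ i $ j = (L ** diag s) $ i $ j" for i j
    proof -
      have "(A ** V) $ i $ j = (A *v v (index_rank j)) $ i"
        by (simp add: matrix_matrix_mult_def matrix_vector_mult_def V_def)
      also have "\<dots> = of_real (s (index_rank j)) * w (index_rank j) $ i"
        using wk[OF index_rank_in[of j]] by (metis vector_smult_component)
      also have "\<dots> = (L ** diag s) $ i $ j"
        by (simp add: matrix_matrix_mult_def L_def diag_def if_distrib[of "\<lambda>x. _ * x"] mult.commute cong: if_cong)
      finally show ?thesis .
    qed
    then show ?thesis by (simp add: vec_eq_iff)
  qed
  have "A = A ** (V ** M)" by (simp add: M)
  also have "\<dots> = L ** diag s ** M" by (simp add: matrix_mul_assoc AV)
  finally have "A = L ** diag s ** M" .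
  moreover have "antimono_on {1..CARD('d)} s" using vd by (auto simp: monotone_on_def s_def)
  ultimately show ?thesis using L M(1) spos unfolding cartan_decomposition_def by blast
qed

section \<open>Truncation of coordinates and variational bounds\<close>

definition head :: "nat \<Rightarrow> ('k::real_normed_field, 'd::{finite,linorder}) vec \<Rightarrow> ('k, 'd) vec" where
  "head k y = (\<chi> i. if index_rank i \<le> k then y $ i else 0)"

definition head_space :: "nat \<Rightarrow> ('k::real_normed_field, 'd::{finite,linorder}) vec set" where
  "head_space k = {y. head k y = y}"

definition tail_space :: "nat \<Rightarrow> ('k::real_normed_field, 'd::{finite,linorder}) vec set" where
  "tail_space k = {y. head k y = 0}"

lemma head_nth: "head k y $ i = (if index_rank i \<le> k then y $ i else 0)" by (simp add: head_def)

lemma head_add: "head k (x + y) = head k x + head k y"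
  and head_diff: "head k (x - y) = head k x - head k y"
  and head_scale: "head k (c *s x) = c *s head k x"
  and head_zero [simp]: "head k 0 = 0"
  and head_head: "head k (head k x) = head k x"
  by (simp_all add: vec_eq_iff head_nth)

lemma head_idem_in: "head k y \<in> head_space k" by (simp add: head_space_def head_head)

lemma head_compl_in: "y - head k y \<in> tail_space k" by (simp add: tail_space_def head_diff head_head)

lemma head_space_subspace: "vec.subspace (head_space k)"
  and tail_space_subspace: "vec.subspace (tail_space k)"
  by (auto simp: vec.subspace_def head_space_def tail_space_def head_add head_scale)

lemma norm_head_power2:
  fixes y :: "('k::{real_normed_field,euclidean_space}, 'd::{finite,linorder}) vec"
  shows "(norm y)\<^sup>2 = (norm (head k y))\<^sup>2 + (norm (y - head k y))\<^sup>2"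
proof -
  have "(norm y)\<^sup>2 = (\<Sum>i\<in>UNIV. (norm (y $ i))\<^sup>2)"
    by (simp add: norm_vec_def L2_set_def sum_nonneg)
  also have "\<dots> = (\<Sum>i\<in>UNIV. (norm (head k y $ i))\<^sup>2 + (norm ((y - head k y) $ i))\<^sup>2)"
    by (intro sum.cong) (auto simp: head_nth)
  also have "\<dots> = (norm (head k y))\<^sup>2 + (norm (y - head k y))\<^sup>2"
    by (simp add: sum.distrib norm_vec_def L2_set_def sum_nonneg)
  finally show ?thesis .
qed

lemma norm_head_le: "norm (head k y) \<le> norm y"
  and norm_head_compl_le: "norm (y - head k y) \<le> norm y"
  for y :: "('k::{real_normed_field,euclidean_space}, 'd::{finite,linorder}) vec"
  by (rule power2_le_imp_le; simp add: norm_head_power2[of y k])+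

lemma tendsto_head:
  fixes x :: "'a \<Rightarrow> ('k::{real_normed_field,euclidean_space}, 'd::{finite,linorder}) vec"
  assumes "(x \<longlongrightarrow> l) F"
  shows "((\<lambda>n. head k (x n)) \<longlongrightarrow> head k l) F"
  by (rule vec_tendstoI) (auto simp: head_nth intro!: tendsto_vec_nth assms)

lemma head_0: "head 0 (y :: ('k::real_normed_field, 'd::{finite,linorder}) vec) = 0"
  unfolding vec_eq_iff head_nth
proof
  fix i :: 'd
  show "(if index_rank i \<le> 0 then y $ i else 0) = 0 $ i" using index_rank_in[of i] by simp
qed

lemma head_space_eq_span:
  "(head_space k :: ('k::real_normed_field, 'd::{finite,linorder}) vec set) = vec.span {axis i 1 | i. index_rank i \<le> k}"
proof
  show "head_space k \<subseteq> (vec.span {axis i 1 | i. index_rank i \<le> k} :: ('k, 'd) vec set)"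
  proof
    fix y :: "('k, 'd) vec" assume y: "y \<in> head_space k"
    have "y = (\<Sum>i\<in>UNIV. y $ i *s axis i 1)" using basis_expansion[of y] by simp
    also have "\<dots> \<in> vec.span {axis i 1 | i. index_rank i \<le> k}"
    proof (rule vec.span_sum)
      fix i :: 'd
      show "y $ i *s axis i 1 \<in> vec.span {axis i 1 | i. index_rank i \<le> k}"
      proof (cases "index_rank i \<le> k")
        case True then show ?thesis by (intro vec.span_scale vec.span_base) auto
      next
        case False
        then have "y $ i = 0" using y unfolding head_space_def by (metis (mono_tags, lifting) head_nth mem_Collect_eq)
        then show ?thesis by (simp add: vec.span_zero)
      qed
    qed
    finally show "y \<in> vec.span {axis i 1 | i. index_rank i \<le> k}" .
  qed
  show "vec.span {axis i 1 | i. index_rank i \<le> k} \<subseteq> (head_space k :: ('k, 'd) vec set)"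
    by (rule vec.span_minimal[OF _ head_space_subspace]) (auto simp: head_space_def vec_eq_iff head_nth axis_def)
qed

lemma card_index_rank_le:
  assumes "k \<le> CARD('d)"
  shows "card {i :: 'd::{finite,linorder}. index_rank i \<le> k} = k"
proof -
  have "bij_betw index_rank {i :: 'd. index_rank i \<le> k} {1..k}"
    unfolding bij_betw_def
  proof
    show "inj_on index_rank {i :: 'd. index_rank i \<le> k}" by (simp add: inj_on_def)
    show "index_rank ` {i :: 'd. index_rank i \<le> k} = {1..k}"
    proof (intro equalityI subsetI)
      fix m assume "m \<in> {1..k}"
      then obtain i :: 'd where "index_rank i = m" using index_rank_surj[of m, where 'd='d] assms by auto
      then show "m \<in> index_rank ` {i :: 'd. index_rank i \<le> k}" using \<open>m \<in> {1..k}\<close> by force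
    next
      fix m assume "m \<in> index_rank ` {i :: 'd. index_rank i \<le> k}"
      then obtain i :: 'd where "m = index_rank i" "index_rank i \<le> k" by blast
      then show "m \<in> {1..k}" using index_rank_in[of i] by simp
    qed
  qed
  then show ?thesis by (simp add: bij_betw_same_card[of index_rank _ "{1..k}"])
qed

lemma dim_head_space:
  assumes "k \<le> CARD('d)"
  shows "vec.dim (head_space k :: ('k::real_normed_field, 'd::{finite,linorder}) vec set) = k"
proof -
  let ?B = "(\<lambda>i. axis i 1) ` {i :: 'd. index_rank i \<le> k} :: ('k, 'd) vec set"
  have B: "{axis i 1 | i. index_rank i \<le> k} = ?B" by blast
  have inj: "inj_on (\<lambda>i. axis i 1 :: ('k, 'd) vec) S" for S by (auto simp: inj_on_def axis_eq_axis)
  have "vec.independent (range (\<lambda>i. axis i 1) :: ('k, 'd) vec set)"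
    using vec.independent_Basis by (simp add: cart_basis_def full_SetCompr_eq)
  then have "vec.independent ?B" by (rule vec.independent_mono) auto
  then have "vec.dim (vec.span ?B) = card ?B" by (rule vec.dim_span_eq_card_independent)
  also have "card ?B = k" using card_index_rank_le[OF assms] card_image[OF inj] by simp
  finally show ?thesis by (simp add: head_space_eq_span B)
qed

lemma head_tail_sum: "{x + y | x y. x \<in> head_space k \<and> y \<in> tail_space k} = UNIV"
proof (intro equalityI subset_UNIV subsetI)
  fix z :: "('a, 'b) vec" show "z \<in> {x + y | x y. x \<in> head_space k \<and> y \<in> tail_space k}"
    using head_idem_in[of k z] head_compl_in[of z k] by (intro CollectI exI[of _ "head k z"] exI[of _ "z - head k z"]) simp
qed

lemma dim_tail_space:
  assumes "k \<le> CARD('d)"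
  shows "vec.dim (tail_space k :: ('k::real_normed_field, 'd::{finite,linorder}) vec set) = CARD('d) - k"
proof -
  have i: "head_space k \<inter> tail_space k = ({0} :: ('k, 'd) vec set)" by (auto simp: head_space_def tail_space_def)
  have S: "vec.subspace (head_space k :: ('k, 'd) vec set)" "vec.subspace (tail_space k :: ('k, 'd) vec set)"
    by (rule head_space_subspace tail_space_subspace)+
  have "CARD('d) + 0 = k + vec.dim (tail_space k :: ('k, 'd) vec set)"
    using vec.dim_sums_Int[OF S] unfolding head_tail_sum i dim_head_space[OF assms] vec_dim_card vec.dim_singleton by simp
  then show ?thesis by simp
qed

lemma vec_subspace_vimage: "vec.subspace V \<Longrightarrow> vec.subspace ((*v) A -` V)"
  by (auto simp: vec.subspace_def matrix_vector_right_distrib vector_scalar_commute)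

lemma vec_subspace_image: "vec.subspace V \<Longrightarrow> vec.subspace ((*v) A ` V)"
  by (rule vec.linear_subspace_image[OF matrix_vector_mul_linear_gen])

lemma dim_image_matrix:
  fixes A :: "'k::field^'d^'d"
  assumes "B ** A = mat 1"
  shows "vec.dim ((*v) A ` V) = vec.dim V"
proof (rule vec.dim_image_eq[OF matrix_vector_mul_linear_gen])
  show "inj_on ((*v) A) (vec.span V)"
    by (rule inj_on_inverseI[of _ "(*v) B"]) (simp add: matrix_vector_mul_assoc assms)
qed

lemma vimage_eq_image_matrix:
  fixes A :: "'k::field^'d^'d"
  assumes "B ** A = mat 1" "A ** B = mat 1"
  shows "(*v) A -` V = (*v) B ` V"
proof (intro equalityI subsetI)
  fix x assume "x \<in> (*v) A -` V"
  then show "x \<in> (*v) B ` V" by (intro image_eqI[of _ _ "A *v x"]) (simp_all add: matrix_vector_mul_assoc assms)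
qed (auto simp: matrix_vector_mul_assoc assms)

lemma dim_vimage_matrix:
  fixes A :: "'k::field^'d^'d"
  assumes "B ** A = mat 1" "A ** B = mat 1"
  shows "vec.dim ((*v) A -` V) = vec.dim V"
  using vimage_eq_image_matrix[OF assms] dim_image_matrix[OF assms(2)] by simp

lemma exists_common_nonzero:
  fixes S T :: "('k::field^'d) set"
  assumes "vec.subspace S" "vec.subspace T" "vec.dim S + vec.dim T > CARD('d)"
  shows "\<exists>x\<in>S \<inter> T. x \<noteq> 0"
proof -
  have "vec.dim {x + y |x y. x \<in> S \<and> y \<in> T} \<le> CARD('d)"
    using vec.dim_subset[OF subset_UNIV, of "{x + y |x y. x \<in> S \<and> y \<in> T}"] by (simp only: vec_dim_card)
  then have "vec.dim (S \<inter> T) \<noteq> 0" using vec.dim_sums_Int[OF assms(1,2)] assms(3) by linarith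
  then have "\<not> S \<inter> T \<subseteq> {0}" by (subst (asm) vec.dim_eq_0)
  then show ?thesis by blast
qed

lemma cartan_apply: "cartan_decomposition A L s M \<Longrightarrow> A *v x = L *v (diag s *v (M *v x))"
  by (simp add: cartan_decomposition_def matrix_vector_mul_assoc matrix_mul_assoc)

lemma cartan_unitary: "cartan_decomposition A L s M \<Longrightarrow> unitary L" "cartan_decomposition A L s M \<Longrightarrow> unitary M"
  by (simp_all add: cartan_decomposition_def)

lemma cartan_pos: 
  fixes A :: "('k::{real_normed_field,euclidean_space}, 'd::{finite,linorder}) sqmatrix"
  shows "cartan_decomposition A L s M \<Longrightarrow> k \<in> {1..CARD('d)} \<Longrightarrow> 0 < s k"
  by (simp add: cartan_decomposition_def)

lemma cartan_antimono: 
  fixes A :: "('k::{real_normed_field,euclidean_space}, 'd::{finite,linorder}) sqmatrix"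
  shows "cartan_decomposition A L s M \<Longrightarrow> 1 \<le> j \<Longrightarrow> j \<le> k \<Longrightarrow> k \<le> CARD('d) \<Longrightarrow> s k \<le> s j"
  by (auto simp: cartan_decomposition_def monotone_on_def)

lemma head_diag: "head k (diag s *v y) = diag s *v head k y"
  for y :: "('k::{real_normed_field,euclidean_space}, 'd::{finite,linorder}) vec"
  by (simp add: vec_eq_iff head_nth diag_mult_vec)

lemma norm_vec_mono:
  fixes x y :: "'a::real_normed_vector^'n"
  assumes "\<And>i. norm (x $ i) \<le> norm (y $ i)"
  shows "norm x \<le> norm y"
  unfolding norm_vec_def by (intro L2_set_mono assms) simp

lemma norm_diag_head_ge:
  fixes A :: "('k::{real_normed_field,euclidean_space}, 'd::{finite,linorder}) sqmatrix" and y :: "('k, 'd) vec"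
  assumes "cartan_decomposition A L s M" "k \<in> {1..CARD('d)}"
  shows "s k * norm (head k y) \<le> norm (head k (diag s *v y))"
proof -
  have "norm (of_real (s k) *s head k y) \<le> norm (head k (diag s *v y))"
  proof (rule norm_vec_mono)
    fix i :: 'd
    have "s k \<le> s (index_rank i)" if "index_rank i \<le> k"
      using cartan_antimono[OF assms(1)] index_rank_in[of i] that assms(2) by simp
    then show "norm ((of_real (s k) *s head k y) $ i) \<le> norm (head k (diag s *v y) $ i)"
      using cartan_pos[OF assms] by (auto simp: head_nth diag_mult_vec norm_mult intro!: mult_right_mono)
  qed
  then show ?thesis using cartan_pos[OF assms] by (simp add: norm_vector_scalar_mult)
qed

lemma norm_diag_tail_le:
  fixes A :: "('k::{real_normed_field,euclidean_space}, 'd::{finite,linorder}) sqmatrix" and y :: "('k, 'd) vec"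
  assumes "cartan_decomposition A L s M" "k < CARD('d)"
  shows "norm (diag s *v y - head k (diag s *v y)) \<le> s (k + 1) * norm (y - head k y)"
proof -
  have pos: "0 < s (k + 1)" using cartan_pos[OF assms(1)] assms(2) by simp
  have "norm (diag s *v y - head k (diag s *v y)) \<le> norm (of_real (s (k + 1)) *s (y - head k y))"
  proof (rule norm_vec_mono)
    fix i :: 'd
    have "s (index_rank i) \<le> s (k + 1)" if "\<not> index_rank i \<le> k"
      using cartan_antimono[OF assms(1)] index_rank_in[of i] that by simp
    moreover have "0 < s (index_rank i)" using cartan_pos[OF assms(1) index_rank_in[of i]] .
    ultimately show "norm ((diag s *v y - head k (diag s *v y)) $ i) \<le> norm ((of_real (s (k + 1)) *s (y - head k y)) $ i)"
      using pos by (auto simp: head_nth diag_mult_vec norm_mult intro!: mult_right_mono)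
  qed
  then show ?thesis using pos unfolding norm_vector_scalar_mult norm_of_real by simp
qed

lemma cartan_lower:
  fixes A :: "('k::{real_normed_field,euclidean_space}, 'd::{finite,linorder}) sqmatrix"
  assumes "cartan_decomposition A L s M" "k \<in> {1..CARD('d)}"
  shows "s k * norm (head k (M *v x)) \<le> norm (A *v x)"
  using norm_diag_head_ge[OF assms, of "M *v x"] norm_head_le[of k "diag s *v (M *v x)"]
  by (simp add: cartan_apply[OF assms(1)] cartan_unitary[OF assms(1)])

lemma cartan_tail:
  fixes A :: "('k::{real_normed_field,euclidean_space}, 'd::{finite,linorder}) sqmatrix"
  assumes "cartan_decomposition A L s M" "k < CARD('d)"
  shows "norm (A *v x - L *v head k (diag s *v (M *v x))) \<le> s (k + 1) * norm x"
proof -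
  have "norm (A *v x - L *v head k (diag s *v (M *v x))) = norm (diag s *v (M *v x) - head k (diag s *v (M *v x)))"
    by (simp add: cartan_apply[OF assms(1)] matrix_vector_mult_diff_distrib[symmetric] cartan_unitary[OF assms(1)])
  also have "\<dots> \<le> s (k + 1) * norm (M *v x - head k (M *v x))" by (rule norm_diag_tail_le[OF assms])
  also have "\<dots> \<le> s (k + 1) * norm (M *v x)"
    using cartan_pos[OF assms(1), of "k + 1"] assms(2) norm_head_compl_le by (intro mult_left_mono) auto
  finally show ?thesis using cartan_unitary[OF assms(1)] by simp
qed

lemma cartan_upper:
  fixes A :: "('k::{real_normed_field,euclidean_space}, 'd::{finite,linorder}) sqmatrix"
  assumes "cartan_decomposition A L s M"
  shows "norm (A *v x) \<le> s 1 * norm x"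
  using cartan_tail[OF assms, of 0 x] by (simp add: head_0)

lemma cartan_upper_tail:
  fixes A :: "('k::{real_normed_field,euclidean_space}, 'd::{finite,linorder}) sqmatrix"
  assumes "cartan_decomposition A L s M" "k < CARD('d)" "head k (M *v x) = 0"
  shows "norm (A *v x) \<le> s (k + 1) * norm x"
  using cartan_tail[OF assms(1,2), of x] assms(3) by (simp add: head_diag)

text \<open>Half of the min-max principle: \<open>W\<close> meets the preimage under
  \<open>M\<close> of \<open>tail_space (k - 1)\<close>, whose dimension is
  \<open>d - k + 1\<close>, and there \<open>A\<close> stretches at most by
  \<open>s k\<close>.\<close>

lemma sing_val_ge:
  fixes A :: "('k::{real_normed_field,euclidean_space}, 'd::{finite,linorder}) sqmatrix"
  assumes A: "cartan_decomposition A L s M" "k \<in> {1..CARD('d)}" and W: "vec.subspace W" "k \<le> vec.dim W"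
    and t: "\<And>w. w \<in> W \<Longrightarrow> t * norm w \<le> norm (A *v w)"
  shows "t \<le> s k"
proof -
  obtain M' where M': "M ** M' = mat 1" "M' ** M = mat 1" using unitary_inverse cartan_unitary[OF A(1)] by blast
  have "vec.dim ((*v) M -` tail_space (k - 1)) = CARD('d) - (k - 1)"
    using A(2) by (subst dim_vimage_matrix[OF M'(2,1)]) (rule dim_tail_space, use A(2) in arith)
  then have "vec.dim W + vec.dim ((*v) M -` tail_space (k - 1)) > CARD('d)" using W(2) A(2) by simp
  from exists_common_nonzero[OF W(1) vec_subspace_vimage[OF tail_space_subspace] this]
  obtain x where x: "x \<in> W" "head (k - 1) (M *v x) = 0" "x \<noteq> 0" by (auto simp: tail_space_def)
  have "k - 1 < CARD('d)" using A(2) by auto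
  have "t * norm x \<le> norm (A *v x)" using t x by blast
  also have "\<dots> \<le> s (k - 1 + 1) * norm x" by (rule cartan_upper_tail[OF A(1) \<open>k - 1 < _\<close> x(2)])
  finally show ?thesis using x A(2) by simp
qed

text \<open>The other half: \<open>W\<close> meets the preimage of \<open>head_space k\<close>,
  where \<open>A\<close> stretches at least by \<open>s k\<close>.\<close>

lemma sing_val_le:
  fixes A :: "('k::{real_normed_field,euclidean_space}, 'd::{finite,linorder}) sqmatrix"
  assumes A: "cartan_decomposition A L s M" "k \<in> {1..CARD('d)}" and W: "vec.subspace W" "CARD('d) < vec.dim W + k"
    and t: "\<And>w. w \<in> W \<Longrightarrow> norm (A *v w) \<le> t * norm w"
  shows "s k \<le> t"
proof -
  obtain M' where M': "M ** M' = mat 1" "M' ** M = mat 1" using unitary_inverse cartan_unitary[OF A(1)] by blast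
  have "vec.dim ((*v) M -` head_space k) = k"
    using A(2) by (subst dim_vimage_matrix[OF M'(2,1)]) (simp add: dim_head_space)
  then have "vec.dim W + vec.dim ((*v) M -` head_space k) > CARD('d)" using W(2) by simp
  from exists_common_nonzero[OF W(1) vec_subspace_vimage[OF head_space_subspace] this]
  obtain x where x: "x \<in> W" "head k (M *v x) = M *v x" "x \<noteq> 0" by (auto simp: head_space_def)
  have "s k * norm x \<le> norm (A *v x)" using cartan_lower[OF A, of x] x(2) cartan_unitary[OF A(1)] by simp
  also have "\<dots> \<le> t * norm x" using t x by blast
  finally show ?thesis using x by simp
qed

text \<open>The preimage of \<open>head_space k\<close> under one decomposition is a test space for
  the other.\<close>

lemma cartan_singular_unique:
  fixes A :: "('k::{real_normed_field,euclidean_space}, 'd::{finite,linorder}) sqmatrix"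
  assumes "cartan_decomposition A L s M" "cartan_decomposition A L' s' M'" "k \<in> {1..CARD('d)}"
  shows "s k = s' k"
proof -
  have le: "s k \<le> s' k" if A: "cartan_decomposition A L s M" "cartan_decomposition A L' s' M'" for L s M L' s' M'
  proof (rule sing_val_ge[OF A(2) assms(3) vec_subspace_vimage[OF head_space_subspace]])
    obtain N where N: "M ** N = mat 1" "N ** M = mat 1" using unitary_inverse cartan_unitary[OF A(1)] by blast
    show "k \<le> vec.dim ((*v) M -` head_space k)"
      using assms(3) by (subst dim_vimage_matrix[OF N(2,1)]) (simp add: dim_head_space)
    fix x assume "x \<in> (*v) M -` head_space k"
    then show "s k * norm x \<le> norm (A *v x)"
      using cartan_lower[OF A(1) assms(3), of x] cartan_unitary[OF A(1)] by (simp add: head_space_def)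
  qed
  show ?thesis using le[OF assms(1,2)] le[OF assms(2,1)] by simp
qed

lemma inner_diag: "(diag s *v x) \<bullet> y = x \<bullet> (diag s *v y)"
  for x y :: "('k::{real_normed_field,euclidean_space}, 'd::{finite,linorder}) vec"
proof -
  have "of_real r * a = r *\<^sub>R a" for r and a :: 'k by (simp add: scaleR_conv_of_real)
  then show ?thesis by (simp add: inner_vec_def diag_mult_vec)
qed

lemma vec_eq_if_inner_eq:
  fixes a b :: "'a::real_inner"
  assumes "\<And>x. x \<bullet> a = x \<bullet> b" shows "a = b"
proof -
  have "(a - b) \<bullet> (a - b) = 0" using assms[of "a - b"] by (simp add: inner_diff_right)
  then show ?thesis by simp
qed

text \<open>If \<open>L D M = L' D' M'\<close>, then \<open>Q = L'\<inverse> L\<close> commutes with \<open>D\<^sup>2\<close>, by comparing \<open>Q D = D R\<close> with its adjoint.\<close>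

lemma cartan_space_unique:
  fixes A :: "('k::{real_normed_field,euclidean_space}, 'd::{finite,linorder}) sqmatrix"
  assumes c: "cartan_decomposition A L s M" "cartan_decomposition A L' s' M'" and k: "k < CARD('d)" "0 < k" "s (k + 1) < s k"
  shows "(*v) L ` head_space k = (*v) L' ` head_space k"
proof -
  have sub: "(*v) L ` head_space k \<subseteq> (*v) L' ` head_space k"
    if c: "cartan_decomposition A L s M" "cartan_decomposition A L' s' M'" and gap: "s (k + 1) < s k" for L s M L' s' M'
  proof -
    note u = cartan_unitary[OF c(1)] cartan_unitary[OF c(2)]
    obtain Li Mi Li' Mi' where i: "unitary Li" "L ** Li = mat 1" "Li ** L = mat 1"
      "unitary Mi" "M ** Mi = mat 1" "Mi ** M = mat 1" "unitary Li'" "L' ** Li' = mat 1" "Li' ** L' = mat 1"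
      "unitary Mi'" "M' ** Mi' = mat 1" "Mi' ** M' = mat 1"
      using unitary_inverse u by metis
    define D :: "('k, 'd) sqmatrix" where "D = diag s"
    have DD: "diag s' = D"
      by (simp add: vec_eq_iff D_def diag_def cartan_singular_unique[OF c index_rank_in])
    define Q Q' R R' where "Q = Li' ** L" and "Q' = Li ** L'" and "R = M' ** Mi" and "R' = M ** Mi'"
    have cancel: "(X ** Y) ** (Y' ** Z) = X ** Z" if "Y ** Y' = mat 1" for X Y Y' Z :: "('k, 'd) sqmatrix"
      using that by (metis matrix_mul_assoc matrix_mul_rid)
    have uQ: "unitary Q" "unitary R" using u i by (auto simp: Q_def R_def intro!: unitary_mult)
    have QQ: "Q ** Q' = mat 1" "Q' ** Q = mat 1" "R ** R' = mat 1" "R' ** R = mat 1"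
      using i by (simp_all add: Q_def Q'_def R_def R'_def cancel)
    have "A = L ** D ** M" "A = L' ** D ** M'" using c DD by (simp_all add: cartan_decomposition_def D_def)
    then have e: "L ** D ** M = L' ** D ** M'" by simp
    have QD: "Q ** D = D ** R"
    proof -
      have "Li' ** (L ** D ** M) ** Mi = Li' ** (L' ** D ** M') ** Mi" by (simp add: e)
      moreover have "Li' ** (L ** D ** M) ** Mi = Q ** D" using cancel[OF i(5), of "Li' ** L ** D" "mat 1"]
        by (simp add: Q_def matrix_mul_assoc)
      moreover have "Li' ** (L' ** D ** M') ** Mi = D ** R" using i(9)
        by (simp add: R_def matrix_mul_assoc)
      ultimately show ?thesis by simp
    qed
    \<comment> \<open>The adjoint of \<open>QD\<close>, obtained by testing against all vectors:
      \<open>D\<close> is self-adjoint, and \<open>Q'\<close>, \<open>R'\<close> are the adjoints of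
      the unitary \<open>Q\<close>, \<open>R\<close>.\<close>
    have DQ: "D *v (Q' *v y) = R' *v (D *v y)" for y
    proof (rule vec_eq_if_inner_eq)
      fix x
      have "x \<bullet> (D *v (Q' *v y)) = (D *v x) \<bullet> (Q' *v y)" by (simp add: D_def inner_diag)
      also have "\<dots> = (Q *v (D *v x)) \<bullet> (Q *v (Q' *v y))" by (simp add: unitary_inner uQ)
      also have "\<dots> = (D *v (R *v x)) \<bullet> y" by (simp add: matrix_vector_mul_assoc QQ QD)
      also have "\<dots> = (R *v x) \<bullet> (R *v (R' *v (D *v y)))"
        by (simp add: matrix_vector_mul_assoc[of R R'] QQ D_def inner_diag)
      also have "\<dots> = x \<bullet> (R' *v (D *v y))" by (simp add: unitary_inner uQ)
      finally show "x \<bullet> (D *v (Q' *v y)) = x \<bullet> (R' *v (D *v y))" .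
    qed
    have RD: "R *v (D *v z) = D *v (Q *v z)" for z
    proof -
      have "Q' *v (Q *v z) = z" "R *v (R' *v u) = u" for u by (simp_all add: matrix_vector_mul_assoc QQ)
      then show ?thesis using DQ by metis
    qed
    have QDD: "Q *v (D *v (D *v z)) = D *v (D *v (Q *v z))" for z
      by (metis QD RD matrix_vector_mul_assoc)
    \<comment> \<open>The column is an eigenvector of the square of \<open>D\<close>; beyond index
      \<open>k\<close> the gap makes the eigenvalues different, so those coordinates vanish.\<close>
    have col: "Q *v axis j 1 \<in> head_space k" if "index_rank j \<le> k" for j
    proof -
      have "D *v (D *v axis j 1) = of_real ((s (index_rank j))\<^sup>2) *s axis j 1"
        by (simp add: vec_eq_iff D_def diag_mult_vec axis_def power2_eq_square)
      then have eq: "of_real ((s (index_rank j))\<^sup>2) *s (Q *v axis j 1) = D *v (D *v (Q *v axis j 1))"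
        using QDD[of "axis j 1"] by (simp add: vector_scalar_commute)
      have "(Q *v axis j 1) $ i = 0" if "\<not> index_rank i \<le> k" for i
      proof -
        have "of_real ((s (index_rank j))\<^sup>2) * (Q *v axis j 1) $ i = of_real ((s (index_rank i))\<^sup>2) * (Q *v axis j 1) $ i"
          using arg_cong[OF eq, of "\<lambda>v. v $ i"] by (simp add: D_def diag_mult_vec power2_eq_square mult.assoc)
        moreover have "(s (index_rank j))\<^sup>2 \<noteq> (s (index_rank i))\<^sup>2"
        proof -
          have "s (index_rank i) \<le> s (k + 1)" "s k \<le> s (index_rank j)"
            using cartan_antimono[OF c(1)] index_rank_in[of i] index_rank_in[of j] that \<open>index_rank j \<le> k\<close> k by auto
          moreover have "0 < s (index_rank i)" using cartan_pos[OF c(1) index_rank_in[of i]] .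
          ultimately show ?thesis using gap by (simp add: power2_eq_iff_nonneg)
        qed
        ultimately show ?thesis by (metis mult_right_cancel of_real_eq_iff)
      qed
      then show ?thesis by (auto simp: head_space_def vec_eq_iff head_nth)
    qed
    have "(*v) Q ` head_space k \<subseteq> head_space k"
    proof -
      have "(*v) Q ` vec.span {axis i 1 | i. index_rank i \<le> k} = vec.span ((*v) Q ` {axis i 1 | i. index_rank i \<le> k})"
        by (rule vec.linear_span_image[OF matrix_vector_mul_linear_gen, symmetric])
      also have "\<dots> \<subseteq> head_space k" using col by (intro vec.span_minimal[OF _ head_space_subspace]) auto
      finally show ?thesis by (simp add: head_space_eq_span)
    qed
    moreover have "L *v x = L' *v (Q *v x)" for x using i by (simp add: Q_def matrix_vector_mul_assoc matrix_mul_assoc)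
    ultimately show ?thesis by auto
  qed
  have k1: "k \<in> {1..CARD('d)}" "k + 1 \<in> {1..CARD('d)}" using k by auto
  have "s' (k + 1) < s' k" using cartan_singular_unique[OF c k1(1)] cartan_singular_unique[OF c k1(2)] k(3) by simp
  then show ?thesis using sub[OF c k(3)] sub[OF c(2,1)] by blast
qed

section \<open>Lifts of elements of the projective linear group\<close>

lemma mat_mult_vec: "mat c *v x = c *s (x :: 'k::comm_ring_1^'d)"
  by (simp add: vec_eq_iff mat_def matrix_vector_mult_def if_distrib[of "\<lambda>x. x * _"] cong: if_cong)

lemma mat_mult_comm: "mat c ** A = A ** mat (c :: 'k::field)"
  by (simp add: matrix_eq matrix_vector_mul_assoc[symmetric] mat_mult_vec vector_scalar_commute)

lemma mat_mult_mat: "mat a ** mat b = mat (a * b :: 'k::field)"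
  by (simp add: matrix_eq matrix_vector_mul_assoc[symmetric] mat_mult_vec)

lemma det_mat: "det (mat c :: 'k::field^'d^'d) = c ^ CARD('d)"
  by (subst det_diagonal) (auto simp: mat_def)

lemma invertible_mat: "c \<noteq> 0 \<Longrightarrow> invertible (mat c :: 'k::field^'d^'d)"
  unfolding invertible_def by (rule exI[of _ "mat (inverse c)"]) (simp add: mat_mult_mat)

definition proj_class :: "'k::field^'d^'d \<Rightarrow> ('k^'d^'d) set" where
  "proj_class A = {mat c ** A | c. c \<noteq> 0}"

lemma group_GL: "group (GL :: ('k::field^'d^'d) monoid)"
proof (rule groupI)
  fix A :: "'k^'d^'d" assume "A \<in> carrier GL"
  then obtain B where B: "A ** B = mat 1" "B ** A = mat 1" by (auto simp: GL_def invertible_def)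
  then show "\<exists>B\<in>carrier GL. B \<otimes>\<^bsub>GL\<^esub> A = \<one>\<^bsub>GL\<^esub>"
    by (intro bexI[of _ B]) (auto simp: GL_def invertible_def)
qed (auto simp: GL_def invertible_mult matrix_mul_assoc invertible_mat)

lemma scalars_normal: "{mat c | c. c \<noteq> 0} \<lhd> (GL :: ('k::field^'d^'d) monoid)"
proof -
  interpret group "GL :: ('k^'d^'d) monoid" by (rule group_GL)
  have sub: "subgroup {mat c | c. c \<noteq> 0} (GL :: ('k^'d^'d) monoid)"
  proof (rule subgroupI)
    fix A :: "'k^'d^'d" assume "A \<in> {mat c | c. c \<noteq> 0}"
    then obtain c where c: "A = mat c" "c \<noteq> 0" by blast
    then have "inv\<^bsub>GL\<^esub> A = mat (inverse c)"
      by (intro inv_equality) (auto simp: GL_def mat_mult_mat invertible_mat)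
    then show "inv\<^bsub>GL\<^esub> A \<in> {mat c | c. c \<noteq> 0}" using c by auto
  qed (auto simp: GL_def mat_mult_mat invertible_mat intro: exI[of _ 1])
  show ?thesis
  proof (rule normalI[OF sub], intro ballI)
    fix A :: "'k^'d^'d" assume "A \<in> carrier GL"
    show "{mat c | c. c \<noteq> 0} #>\<^bsub>GL\<^esub> A = A <#\<^bsub>GL\<^esub> {mat c | c. c \<noteq> 0}"
      by (auto simp: r_coset_def l_coset_def GL_def mat_mult_comm)
  qed
qed

lemma group_PGL: "group (PGL :: ('k::field^'d^'d) set monoid)"
  unfolding PGL_def by (rule normal.factorgroup_is_group[OF scalars_normal])

lemma scalar_coset: "{mat c | c. c \<noteq> 0} #>\<^bsub>GL\<^esub> A = proj_class A"
  by (auto simp: r_coset_def GL_def proj_class_def)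

lemma carrier_PGL: "carrier PGL = proj_class ` {A :: 'k::field^'d^'d. invertible A}"
  unfolding PGL_def FactGroup_def RCOSETS_def by (auto simp: scalar_coset) (auto simp: GL_def)

lemma one_PGL: "\<one>\<^bsub>PGL\<^esub> = proj_class (mat 1 :: 'k::field^'d^'d)"
  by (simp add: PGL_def FactGroup_def proj_class_def)

lemma proj_class_mult: "invertible A \<Longrightarrow> invertible B \<Longrightarrow> proj_class A \<otimes>\<^bsub>PGL\<^esub> proj_class B = proj_class (A ** B :: 'k::field^'d^'d)"
  using normal.rcos_sum[OF scalars_normal, of A B]
  by (simp add: PGL_def FactGroup_def scalar_coset) (simp add: GL_def)

lemma proj_class_self: "A \<in> proj_class (A :: 'k::field^'d^'d)"
  unfolding proj_class_def by (auto intro: exI[of _ 1])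

lemma in_PGL:
  assumes "g \<in> carrier PGL" "A \<in> g"
  shows "g = proj_class A" "invertible (A :: 'k::field^'d^'d)"
proof -
  obtain B c where B: "invertible B" "g = proj_class B" "c \<noteq> 0" "A = mat c ** B"
    using assms unfolding carrier_PGL proj_class_def by auto
  show "invertible A" using B by (simp add: invertible_mult invertible_mat)
  have "mat b ** B = mat (b / c) ** A" "mat b ** A = mat (b * c) ** B" for b
    using B by (simp_all add: matrix_mul_assoc mat_mult_mat)
  moreover have "b / c \<noteq> 0" "b * c \<noteq> 0" if "b \<noteq> 0" for b using B(3) that by simp_all
  ultimately show "g = proj_class A" unfolding B(2) proj_class_def by blast
qed

definition lift_of :: "('k::{real_normed_field,euclidean_space}, 'd::{finite,linorder}) sqmatrix set \<Rightarrow> ('k, 'd) sqmatrix \<Rightarrow> bool" where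
  "lift_of g A \<longleftrightarrow> A \<in> g \<and> norm (det A) = 1"

lemma lift_ex:
  fixes g :: "('k::{real_normed_field,euclidean_space}, 'd::{finite,linorder}) sqmatrix set"
  assumes "g \<in> carrier PGL"
  shows "\<exists>A. lift_of g A"
proof -
  obtain B where B: "invertible B" "g = proj_class B" using assms by (auto simp: carrier_PGL)
  have det: "det B \<noteq> 0" using B(1) by (simp add: invertible_det_nz)
  define r where "r = root CARD('d) (1 / norm (det B))"
  have r: "r > 0" "r ^ CARD('d) = 1 / norm (det B)" using det by (simp_all add: r_def real_root_pow_pos2)
  have "norm (det (mat (of_real r) ** B)) = r ^ CARD('d) * norm (det B)"
    using r(1) by (simp add: det_mul det_mat norm_mult norm_power)
  also have "\<dots> = 1" using r det by simp
  finally have "norm (det (mat (of_real r) ** B)) = 1" .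
  moreover have "mat (of_real r) ** B \<in> g" using B(2) r(1) by (auto simp: proj_class_def intro: exI[of _ "of_real r"])
  ultimately show ?thesis unfolding lift_of_def by blast
qed

lemma lift_mult:
  fixes g :: "('k::{real_normed_field,euclidean_space}, 'd::{finite,linorder}) sqmatrix set"
  assumes "g \<in> carrier PGL" "h \<in> carrier PGL" "lift_of g A" "lift_of h B"
  shows "lift_of (g \<otimes>\<^bsub>PGL\<^esub> h) (A ** B)"
proof -
  have "g = proj_class A" "invertible A" "h = proj_class B" "invertible B" using in_PGL assms by (auto simp: lift_of_def)
  then show ?thesis using assms by (simp add: lift_of_def proj_class_mult proj_class_self det_mul norm_mult)
qed

lemma lift_inverse:
  fixes g :: "('k::{real_normed_field,euclidean_space}, 'd::{finite,linorder}) sqmatrix set"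
  assumes "g \<in> carrier PGL" "lift_of g A" "B ** A = mat 1"
  shows "lift_of (inv\<^bsub>PGL\<^esub> g) B"
proof -
  interpret group "PGL :: ('k, 'd) sqmatrix set monoid" by (rule group_PGL)
  have g: "g = proj_class A" "invertible A" using in_PGL assms by (auto simp: lift_of_def)
  have AB: "A ** B = mat 1" using assms(3) by (simp add: matrix_left_right_inverse)
  then have iB: "invertible B" using assms(3) by (auto simp: invertible_def)
  have "inv\<^bsub>PGL\<^esub> g = proj_class B"
    by (rule inv_equality) (use g iB assms(3) in \<open>auto simp: proj_class_mult one_PGL carrier_PGL\<close>)
  moreover have "norm (det B) * norm (det A) = 1"
    using arg_cong[OF assms(3), of "\<lambda>X. norm (det X)"] by (simp add: det_mul norm_mult)
  ultimately show ?thesis using assms(2) by (simp add: lift_of_def proj_class_self)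
qed

lemma lift_unique:
  fixes g :: "('k::{real_normed_field,euclidean_space}, 'd::{finite,linorder}) sqmatrix set"
  assumes "g \<in> carrier PGL" "lift_of g A" "lift_of g B"
  shows "\<exists>c. norm c = 1 \<and> B = mat c ** A"
proof -
  have "g = proj_class A" using in_PGL assms by (auto simp: lift_of_def)
  then obtain c where c: "B = mat c ** A" using assms(3) by (auto simp: lift_of_def proj_class_def)
  then have "norm c ^ CARD('d) = 1" using assms(2,3) by (simp add: lift_of_def det_mul det_mat norm_mult norm_power)
  then have "norm c = 1" using power_eq_imp_eq_base[of "norm c" "CARD('d)" 1] by simp
  then show ?thesis using c by blast
qed

lemma cartan_scale:
  assumes "cartan_decomposition A L s M" "norm c = 1"
  shows "cartan_decomposition (mat c ** A) (mat c ** L) s M"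
  using assms unfolding cartan_decomposition_def
  by (auto simp: unitary_iff matrix_mul_assoc matrix_vector_mul_assoc[symmetric] mat_mult_vec norm_vector_scalar_mult)

lemma scale_image_subspace:
  assumes "vec.subspace V" "c \<noteq> (0 :: 'k::field)"
  shows "(*v) (mat c ** A) ` V = (*v) A ` V"
proof -
  have "(mat c ** A) *v x = A *v (c *s x)" for x
    by (simp add: matrix_vector_mul_assoc[symmetric] mat_mult_vec vector_scalar_commute)
  moreover have "A *v x = (mat c ** A) *v (inverse c *s x)" for x
    using assms(2) by (simp add: matrix_vector_mul_assoc[symmetric] mat_mult_vec vector_scalar_commute)
  moreover have "c *s x \<in> V" "inverse c *s x \<in> V" if "x \<in> V" for x
    using assms(1) that by (simp_all add: vec.subspace_def)
  ultimately show ?thesis by blast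
qed

lemma sing_val_eq:
  fixes g :: "('k::{real_normed_field,euclidean_space}, 'd::{finite,linorder}) sqmatrix set"
  assumes "g \<in> carrier PGL" "lift_of g A" "cartan_decomposition A L s M" "k \<in> {1..CARD('d)}"
  shows "sing_val g k = s k"
  unfolding sing_val_def
proof (rule the_equality)
  show "\<exists>A\<in>g. norm (det A) = 1 \<and> (\<exists>L s' M. cartan_decomposition A L s' M \<and> s k = s' k)"
    using assms by (auto simp: lift_of_def)
  fix t assume "\<exists>A\<in>g. norm (det A) = 1 \<and> (\<exists>L s M. cartan_decomposition A L s M \<and> t = s k)"
  then obtain B L' s' M' where B: "lift_of g B" "cartan_decomposition B L' s' M'" "t = s' k" by (auto simp: lift_of_def)
  obtain c where "norm c = 1" "B = mat c ** A" using lift_unique[OF assms(1,2) B(1)] by blast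
  then have "cartan_decomposition B (mat c ** L) s M" using cartan_scale assms(3) by blast
  then show "t = s k" using cartan_singular_unique[OF B(2) _ assms(4)] B(3) by blast
qed

text \<open>The gap makes the space independent of the decomposition, and another lift differs by a
  scalar, which does not move subspaces.\<close>

lemma U_space_eq:
  fixes g :: "('k::{real_normed_field,euclidean_space}, 'd::{finite,linorder}) sqmatrix set"
  assumes "g \<in> carrier PGL" "lift_of g A" "cartan_decomposition A L s M" "0 < k" "k < CARD('d)" "s (k + 1) < s k"
  shows "U_space k g = (*v) L ` head_space k"
  unfolding U_space_def head_space_eq_span[symmetric]
proof (rule the_equality)
  show "\<exists>A\<in>g. norm (det A) = 1 \<and> (\<exists>L' s M. cartan_decomposition A L' s M \<and> (*v) L ` head_space k = (*v) L' ` head_space k)"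
    using assms by (auto simp: lift_of_def)
  fix F assume "\<exists>A\<in>g. norm (det A) = 1 \<and> (\<exists>L s M. cartan_decomposition A L s M \<and> F = (*v) L ` head_space k)"
  then obtain B L' s' M' where B: "lift_of g B" "cartan_decomposition B L' s' M'" "F = (*v) L' ` head_space k" by (auto simp: lift_of_def)
  obtain c where c: "norm c = 1" "B = mat c ** A" using lift_unique[OF assms(1,2) B(1)] by blast
  then have "cartan_decomposition B (mat c ** L) s M" using cartan_scale assms(3) by blast
  then have "(*v) (mat c ** L) ` head_space k = F" using cartan_space_unique[OF _ B(2) assms(5,4,6)] B(3) by blast
  moreover have "c \<noteq> 0" using c(1) by auto
  ultimately show "F = (*v) L ` head_space k" using scale_image_subspace[OF head_space_subspace, of c L k] by simp
qed

lemma act_space_eq: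
  fixes A :: "'k::field^'d^'d"
  assumes "g \<in> carrier PGL" "A \<in> g" "vec.subspace V"
  shows "act_space g V = (*v) A ` V"
proof -
  have "g = proj_class A" using in_PGL assms by blast
  then have "act_space g V = (\<Union>c\<in>{c. c \<noteq> 0}. (*v) (mat c ** A) ` V)" by (auto simp: act_space_def proj_class_def)
  also have "\<dots> = (*v) A ` V"
  proof (rule SUP_eq_const)
    show "{c :: 'k. c \<noteq> 0} \<noteq> {}" using one_neq_zero by blast
  qed (use scale_image_subspace[OF assms(3)] in blast)
  finally show ?thesis .
qed

section \<open>Limits of Cartan decompositions\<close>

lemma norm_matrix_vector_mult_le:
  fixes A :: "'k::{real_normed_field,euclidean_space}^'d^'e"
  shows "norm (A *v x) \<le> norm A * norm x"
proof -
  have "norm ((A *v x) $ i) \<le> norm (A $ i) * norm x" for i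
  proof -
    have "norm ((A *v x) $ i) \<le> (\<Sum>j\<in>UNIV. \<bar>norm (A $ i $ j)\<bar> * \<bar>norm (x $ j)\<bar>)"
      unfolding matrix_vector_mult_def by (simp add: norm_mult[symmetric] norm_sum)
    also have "\<dots> \<le> norm (A $ i) * norm x" unfolding norm_vec_def by (rule L2_set_mult_ineq)
    finally show ?thesis .
  qed
  then have "norm (A *v x) \<le> L2_set (\<lambda>i. norm (A $ i) * norm x) UNIV"
    unfolding norm_vec_def[of "A *v x"] by (intro L2_set_mono) auto
  also have "\<dots> = norm A * norm x"
    by (simp add: norm_vec_def[of A] L2_set_left_distrib)
  finally show ?thesis .
qed

lemma matrix_minus_vector_mult: "(A - B) *v x = A *v x - B *v (x :: 'k::ring_1^'d)"
  by (simp add: matrix_vector_mult_def vec_eq_iff sum_subtractf left_diff_distrib)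

lemma mult_axis_nth: "(A *v axis j 1) $ i = (A $ i $ j :: 'k::comm_ring_1)"
  by (simp add: matrix_vector_mult_def axis_def if_distrib[of "\<lambda>x. _ * x"] cong: if_cong)

lemma norm_axis_one: "norm (axis j 1 :: 'k::{real_normed_field,euclidean_space}^'d) = 1"
  by (simp add: norm_vec_def L2_set_def axis_def if_distrib[of norm] if_distrib[of "\<lambda>x. x ^ 2"] cong: if_cong)

lemma unitary_limit:
  assumes "\<And>n. unitary (L n)" "L \<longlonglongrightarrow> L0"
  shows "unitary L0"
  unfolding unitary_iff
proof
  fix x
  have "(\<lambda>n. norm (L n *v x)) \<longlonglongrightarrow> norm (L0 *v x)"
    by (intro tendsto_norm tendsto_matrix_vector_mult assms tendsto_const)
  then show "norm (L0 *v x) = norm x" using assms(1) by (simp add: LIMSEQ_const_iff)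
qed

text \<open>Compactness of the unitary group: all entries have norm at most 1.\<close>

lemma unitary_subseq:
  fixes L :: "nat \<Rightarrow> 'k::{real_normed_field,euclidean_space}^'d^'d"
  assumes "\<And>n. unitary (L n)"
  shows "\<exists>r L0. strict_mono (r :: nat \<Rightarrow> nat) \<and> (\<lambda>n. L (r n)) \<longlonglongrightarrow> L0"
proof -
  have "norm (L n) \<le> real CARD('d) * real CARD('d)" for n
  proof -
    have e: "norm (L n $ i $ j) \<le> 1" for i j
    proof -
      have "norm ((L n *v axis j 1) $ i) \<le> norm (L n *v axis j 1)" by (rule Finite_Cartesian_Product.norm_nth_le)
      also have "\<dots> = 1" using assms by (simp add: norm_axis_one)
      finally show ?thesis by (simp add: mult_axis_nth)
    qed
    have r: "norm (L n $ i) \<le> real CARD('d)" for i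
    proof -
      have "norm (L n $ i) \<le> (\<Sum>j\<in>UNIV. norm (L n $ i $ j))"
        unfolding norm_vec_def[of "L n $ i"] by (rule L2_set_le_sum) simp
      also have "\<dots> \<le> real CARD('d)" using sum_mono[of UNIV "\<lambda>j. norm (L n $ i $ j)" "\<lambda>_. 1"] e by simp
      finally show ?thesis .
    qed
    have "norm (L n) \<le> (\<Sum>i\<in>UNIV. norm (L n $ i))"
      unfolding norm_vec_def[of "L n"] by (rule L2_set_le_sum) simp
    also have "\<dots> \<le> real CARD('d) * real CARD('d)" using sum_mono[of UNIV "\<lambda>i. norm (L n $ i)" "\<lambda>_. real CARD('d)"] r by simp
    finally show ?thesis .
  qed
  then have "bounded (range L)" unfolding bounded_iff by blast
  from bounded_imp_convergent_subsequence[OF this] show ?thesis by (auto simp: comp_def)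
qed

lemma tendsto_unitary_inverse:
  fixes L :: "nat \<Rightarrow> 'k::{real_normed_field,euclidean_space}^'d^'d"
  assumes "\<And>n. unitary (N n)" "\<And>n. N n ** L n = mat 1" "L \<longlonglongrightarrow> L0" "L0 ** N0 = mat 1"
  shows "N \<longlonglongrightarrow> N0"
proof (intro vec_tendstoI)
  fix i j
  have "(\<lambda>n. N n *v x) \<longlonglongrightarrow> N0 *v x" for x
  proof (rule metric_tendsto_imp_tendsto)
    have "(\<lambda>n. L n *v (N0 *v x)) \<longlonglongrightarrow> L0 *v (N0 *v x)" by (intro tendsto_matrix_vector_mult assms tendsto_const)
    then show "(\<lambda>n. L n *v (N0 *v x)) \<longlonglongrightarrow> x" by (simp add: matrix_vector_mul_assoc assms)
    have "dist (N n *v x) (N0 *v x) = dist (L n *v (N0 *v x)) x" for n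
    proof -
      have "N n *v (L n *v (N0 *v x)) = N0 *v x" using assms(2) by (simp add: matrix_vector_mul_assoc matrix_mul_assoc)
      then have "dist (N n *v x) (N0 *v x) = norm (N n *v (x - L n *v (N0 *v x)))"
        by (simp add: dist_norm matrix_vector_mult_diff_distrib)
      then show ?thesis using assms(1) by (simp add: dist_norm norm_minus_commute)
    qed
    then show "\<forall>\<^sub>F n in sequentially. dist (N n *v x) (N0 *v x) \<le> dist (L n *v (N0 *v x)) x" by simp
  qed
  from tendsto_vec_nth[OF this[of "axis j 1"], of i]
  show "(\<lambda>n. N n $ i $ j) \<longlonglongrightarrow> N0 $ i $ j" by (simp add: mult_axis_nth)
qed

lemma tendsto_proj_image:
  fixes L :: "nat \<Rightarrow> 'k::{real_normed_field,euclidean_space}^'d^'d"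
  assumes u: "\<And>n. unitary (L n)" and l: "L \<longlonglongrightarrow> L0" and V: "vec.subspace V"
  shows "(\<lambda>n. proj ((*v) (L n) ` V)) \<longlonglongrightarrow> proj ((*v) L0 ` V)"
proof (rule metric_tendsto_imp_tendsto)
  have u0: "unitary L0" using unitary_limit u l by blast
  have "(\<lambda>n. 2 * norm (L n - L0)) \<longlonglongrightarrow> 2 * norm (L0 - L0)" by (intro tendsto_intros l)
  then show "(\<lambda>n. 2 * norm (L n - L0)) \<longlonglongrightarrow> 0" by simp
  have "dist (proj ((*v) (L n) ` V)) (proj ((*v) L0 ` V)) \<le> 2 * norm (L n - L0)" for n
  proof (rule dist_proj_upper)
    have e: "norm (L n *v x - L0 *v x) \<le> norm (L n - L0) * norm x" for x
      using norm_matrix_vector_mult_le[of "L n - L0" x] by (simp add: matrix_minus_vector_mult)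
    show "\<exists>w\<in>(*v) L0 ` V. norm (v - w) \<le> norm (L n - L0) * norm v" if v: "v \<in> (*v) (L n) ` V" for v
    proof -
      obtain x where x: "x \<in> V" "v = L n *v x" using v by blast
      then show ?thesis using e[of x] u by (intro bexI[of _ "L0 *v x"]) auto
    qed
    show "\<exists>w\<in>(*v) (L n) ` V. norm (v - w) \<le> norm (L n - L0) * norm v" if v: "v \<in> (*v) L0 ` V" for v
    proof -
      obtain x where x: "x \<in> V" "v = L0 *v x" using v by blast
      then show ?thesis using e[of x] u0 by (intro bexI[of _ "L n *v x"]) (auto simp: norm_minus_commute)
    qed
  qed (use V in \<open>auto intro: vec_subspace_image\<close>)
  then show "\<forall>\<^sub>F n in sequentially. dist (proj ((*v) (L n) ` V)) (proj ((*v) L0 ` V)) \<le> dist (2 * norm (L n - L0)) 0"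
    by (simp add: dist_real_def)
qed

section \<open>Reversal of indices and inverses\<close>

text \<open>The longest Weyl group element; the inverse of a decreasing diagonal is increasing and
  has to be reordered.\<close>

definition rev_index :: "'d::{finite,linorder} \<Rightarrow> 'd" where
  "rev_index i = (THE j. index_rank j = CARD('d) + 1 - index_rank i)"

lemma index_rank_rev: "index_rank (rev_index (i :: 'd::{finite,linorder})) = CARD('d) + 1 - index_rank i"
proof -
  have "CARD('d) + 1 - index_rank i \<in> {1..CARD('d)}" using index_rank_in[of i] by auto
  then obtain j :: 'd where j: "index_rank j = CARD('d) + 1 - index_rank i" using index_rank_surj by blast
  show ?thesis unfolding rev_index_def by (rule theI[of _ j]) (use j in \<open>auto simp flip: index_rank_inject\<close>)
qed

lemma rev_index_rev [simp]: "rev_index (rev_index i) = i"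
  using index_rank_in[of i] by (simp add: index_rank_rev flip: index_rank_inject)

definition rev_matrix :: "('k::{real_normed_field,euclidean_space}, 'd::{finite,linorder}) sqmatrix" where
  "rev_matrix = (\<chi> i j. if j = rev_index i then 1 else 0)"

lemma rev_matrix_nth: "(rev_matrix *v x) $ i = x $ rev_index i"
  by (simp add: rev_matrix_def matrix_vector_mult_def if_distrib[of "\<lambda>x. x * _"] cong: if_cong)

lemma rev_matrix_rev: "rev_matrix ** rev_matrix = mat 1"
  by (simp add: matrix_eq matrix_vector_mul_assoc[symmetric] vec_eq_iff rev_matrix_nth)

lemma unitary_rev_matrix: "unitary (rev_matrix :: ('k::{real_normed_field,euclidean_space}, 'd::{finite,linorder}) sqmatrix)"
  unfolding unitary_iff
proof
  fix x :: "('k, 'd) vec"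
  have "bij (rev_index :: 'd \<Rightarrow> 'd)" by (rule o_bij[of rev_index]) (auto simp: fun_eq_iff)
  then have "(\<Sum>i\<in>UNIV. (norm (x $ rev_index i))\<^sup>2) = (\<Sum>i\<in>UNIV. (norm (x $ i))\<^sup>2)"
    by (rule sum.reindex_bij_betw)
  then show "norm (rev_matrix *v x) = norm x" by (simp add: norm_vec_def L2_set_def rev_matrix_nth)
qed

lemma rev_matrix_head:
  assumes "k \<le> CARD('d)"
  shows "rev_matrix *v x \<in> (tail_space (CARD('d) - k) :: ('k::{real_normed_field,euclidean_space}, 'd::{finite,linorder}) vec set) \<longleftrightarrow> x \<in> head_space k"
proof -
  have "rev_matrix *v x \<in> tail_space (CARD('d) - k) \<longleftrightarrow> (\<forall>i. index_rank i \<le> CARD('d) - k \<longrightarrow> x $ rev_index i = 0)"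
    by (auto simp: tail_space_def vec_eq_iff head_nth rev_matrix_nth)
  also have "\<dots> \<longleftrightarrow> (\<forall>i. index_rank (rev_index i) \<le> CARD('d) - k \<longrightarrow> x $ i = 0)"
    by (metis rev_index_rev)
  also have "\<dots> \<longleftrightarrow> (\<forall>i. \<not> index_rank i \<le> k \<longrightarrow> x $ i = 0)"
  proof -
    have "index_rank (rev_index i) \<le> CARD('d) - k \<longleftrightarrow> \<not> index_rank i \<le> k" for i :: 'd
      using index_rank_in[of i] assms by (auto simp: index_rank_rev)
    then show ?thesis by simp
  qed
  also have "\<dots> \<longleftrightarrow> x \<in> head_space k" by (auto simp: head_space_def vec_eq_iff head_nth)
  finally show ?thesis .
qed

lemma rev_image_head:
  assumes "k \<le> CARD('d)"
  shows "(*v) rev_matrix ` head_space k = (tail_space (CARD('d) - k) :: ('k::{real_normed_field,euclidean_space}, 'd::{finite,linorder}) vec set)"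
proof (intro equalityI subsetI)
  fix y :: "('k, 'd) vec" assume "y \<in> tail_space (CARD('d) - k)"
  moreover have "y = rev_matrix *v (rev_matrix *v y)" by (simp add: matrix_vector_mul_assoc rev_matrix_rev)
  ultimately show "y \<in> (*v) rev_matrix ` head_space k" using rev_matrix_head[OF assms] by (metis imageI)
qed (use rev_matrix_head[OF assms] in auto)

text \<open>Inverting \<open>L ** diag s ** M\<close> gives the factors in reverse order, and a pair
  of reversal matrices is inserted around the inverse diagonal to restore the decreasing
  order.\<close>

lemma cartan_inverse:
  fixes A :: "('k::{real_normed_field,euclidean_space}, 'd::{finite,linorder}) sqmatrix"
  assumes c: "cartan_decomposition A L s M" and i: "Li ** L = mat 1" "L ** Li = mat 1" "Mi ** M = mat 1" "M ** Mi = mat 1"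
    and u: "unitary Li" "unitary Mi" and B: "B ** A = mat 1"
  shows "cartan_decomposition B (Mi ** rev_matrix) (\<lambda>k. inverse (s (CARD('d) + 1 - k))) (rev_matrix ** Li)"
  unfolding cartan_decomposition_def
proof (intro conjI)
  define s' where "s' k = inverse (s (CARD('d) + 1 - k))" for k
  have s'_eq: "(\<lambda>k. inverse (s (CARD('d) + 1 - k))) = s'" by (simp add: s'_def fun_eq_iff)
  show "unitary (Mi ** rev_matrix)" "unitary (rev_matrix ** Li)" using u unitary_rev_matrix unitary_mult by blast+
  have pos: "0 < s k" if "k \<in> {1..CARD('d)}" for k using cartan_pos[OF c that] .
  have flip: "CARD('d) + 1 - k \<in> {1..CARD('d)}" if "k \<in> {1..CARD('d)}" for k using that by auto
  show "\<forall>k\<in>{1..CARD('d)}. 0 < inverse (s (CARD('d) + 1 - k))" using pos flip by simp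
  show "antimono_on {1..CARD('d)} (\<lambda>k. inverse (s (CARD('d) + 1 - k)))"
  proof (rule monotone_onI)
    fix j k assume jk: "j \<in> {1..CARD('d)}" "k \<in> {1..CARD('d)}" "j \<le> k"
    have "s (CARD('d) + 1 - j) \<le> s (CARD('d) + 1 - k)" using jk by (intro cartan_antimono[OF c]) auto
    then show "inverse (s (CARD('d) + 1 - k)) \<le> inverse (s (CARD('d) + 1 - j))"
      using pos[OF flip[OF jk(1)]] by (intro le_imp_inverse_le)
  qed
  define X where "X = Mi ** rev_matrix ** diag s' ** (rev_matrix ** Li)"
  have D: "rev_matrix *v (diag s' *v (rev_matrix *v (diag s *v z))) = z" for z :: "('k, 'd) vec"
  proof -
    have "of_real (s' (CARD('d) + 1 - index_rank i)) * (of_real (s (index_rank i)) * z $ i) = z $ i" for i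
    proof -
      have "CARD('d) + 1 - (CARD('d) + 1 - index_rank i) = index_rank i" using index_rank_in[of i] by auto
      then have "s' (CARD('d) + 1 - index_rank i) = inverse (s (index_rank i))" by (simp only: s'_def)
      then show ?thesis using pos[OF index_rank_in[of i]] by simp
    qed
    then show ?thesis unfolding vec_eq_iff rev_matrix_nth diag_mult_vec index_rank_rev rev_index_rev by blast
  qed
  have "X *v (A *v x) = x" for x
  proof -
    have "Li *v (L *v y) = y" "Mi *v (M *v y) = y" for y by (simp_all add: matrix_vector_mul_assoc i)
    then show ?thesis by (simp add: X_def cartan_apply[OF c] matrix_vector_mul_assoc[symmetric] D)
  qed
  then have "X ** A = mat 1" by (simp add: matrix_eq matrix_vector_mul_assoc[symmetric])
  moreover have "A ** B = mat 1" using B by (simp add: matrix_left_right_inverse)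
  ultimately show "B = Mi ** rev_matrix ** diag (\<lambda>k. inverse (s (CARD('d) + 1 - k))) ** (rev_matrix ** Li)"
    unfolding s'_eq X_def[symmetric] by (metis matrix_mul_assoc matrix_mul_lid matrix_mul_rid)
qed

lemma sing_val_mult_ge:
  fixes A B C Ci :: "('k::{real_normed_field,euclidean_space}, 'd::{finite,linorder}) sqmatrix"
  assumes A: "cartan_decomposition A L s M" and A': "cartan_decomposition (B ** A ** C) L' s' M'"
    and k: "k \<in> {1..CARD('d)}" and b: "b \<ge> 0" "\<And>x. b * norm x \<le> norm (B *v x)" and c: "c \<ge> 0" "\<And>x. c * norm x \<le> norm (C *v x)"
    and Ci: "Ci ** C = mat 1" "C ** Ci = mat 1"
  shows "b * c * s k \<le> s' k"
proof (rule sing_val_ge[OF A' k])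
  obtain N where N: "M ** N = mat 1" "N ** M = mat 1" using unitary_inverse cartan_unitary[OF A] by blast
  show "vec.subspace ((*v) C -` ((*v) M -` head_space k))" by (intro vec_subspace_vimage head_space_subspace)
  show "k \<le> vec.dim ((*v) C -` ((*v) M -` head_space k))"
    unfolding dim_vimage_matrix[OF Ci] dim_vimage_matrix[OF N(2,1)] using k by (simp add: dim_head_space)
  fix w assume w: "w \<in> (*v) C -` ((*v) M -` head_space k)"
  then have "head k (M *v (C *v w)) = M *v (C *v w)" by (simp add: head_space_def)
  then have "s k * norm (C *v w) \<le> norm (A *v (C *v w))"
    using cartan_lower[OF A k, of "C *v w"] cartan_unitary[OF A] by simp
  moreover have "s k * (c * norm w) \<le> s k * norm (C *v w)"
    using c(2) cartan_pos[OF A k] by (intro mult_left_mono) auto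
  ultimately have "s k * (c * norm w) \<le> norm (A *v (C *v w))" by linarith
  then have "b * (s k * (c * norm w)) \<le> b * norm (A *v (C *v w))" using b(1) by (rule mult_left_mono)
  also have "\<dots> \<le> norm (B *v (A *v (C *v w)))" by (rule b(2))
  finally show "b * c * s k * norm w \<le> norm ((B ** A ** C) *v w)"
    by (simp add: matrix_vector_mul_assoc[symmetric] mult_ac)
qed

lemma invertible_lower_bound:
  fixes B :: "'k::{real_normed_field,euclidean_space}^'d^'d"
  assumes "Bi ** B = mat 1"
  shows "\<exists>b>0. \<forall>x. b * norm x \<le> norm (B *v x)"
proof (intro exI[of _ "inverse (norm Bi + 1)"] conjI allI)
  show "inverse (norm Bi + 1) > 0" by (simp add: add_nonneg_pos)
  fix x
  have "x = Bi *v (B *v x)" by (simp add: matrix_vector_mul_assoc assms)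
  then have "norm x \<le> norm Bi * norm (B *v x)" using norm_matrix_vector_mult_le by metis
  also have "\<dots> \<le> (norm Bi + 1) * norm (B *v x)" by (intro mult_right_mono) auto
  finally have le: "norm x \<le> (norm Bi + 1) * norm (B *v x)" .
  have pos: "norm Bi + 1 > 0" by (simp add: add_nonneg_pos)
  have "norm x / (norm Bi + 1) \<le> norm (B *v x)"
    using le unfolding pos_divide_le_eq[OF pos] by (simp only: mult.commute)
  then show "inverse (norm Bi + 1) * norm x \<le> norm (B *v x)" by (simp add: divide_inverse mult.commute)
qed

text \<open>A vector \<open>L' n *v e\<close> of the attracting space of the product is the image of
  some \<open>x\<close> of norm at most a constant over \<open>s n k\<close>. So
  \<open>Bi *v (L' n *v e)\<close> is an image under \<open>A n\<close> of a vector that small, and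
  its part outside the attracting space of \<open>A n\<close> is at most a constant times
  \<open>s n (k + 1) / s n k\<close>.\<close>

lemma tendsto_attracting_space_mult:
  fixes A :: "nat \<Rightarrow> ('k::{real_normed_field,euclidean_space}, 'd::{finite,linorder}) sqmatrix" and B C Bi Ci :: "('k, 'd) sqmatrix"
  assumes A: "\<And>n. cartan_decomposition (A n) (L n) (s n) (M n)" and L: "L \<longlonglongrightarrow> L0"
    and A': "\<And>n. cartan_decomposition (B ** A n ** C) (L' n) (s' n) (M' n)" and L': "L' \<longlonglongrightarrow> L0'"
    and inv: "Bi ** B = mat 1" "Ci ** C = mat 1" and k: "0 < k" "k < CARD('d)"
    and gap: "(\<lambda>n. s n (k + 1) / s n k) \<longlonglongrightarrow> 0"
  shows "(*v) L0' ` head_space k = (*v) B ` ((*v) L0 ` head_space k)"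
proof -
  have inv': "B ** Bi = mat 1" "C ** Ci = mat 1" using inv by (simp_all add: matrix_left_right_inverse)
  have u: "unitary (L n)" "unitary (L' n)" "unitary (M n)" "unitary (M' n)" for n using cartan_unitary A A' by blast+
  have u0: "unitary L0" "unitary L0'" using unitary_limit u L L' by blast+
  obtain N0 N0' where N0: "L0 ** N0 = mat 1" "N0 ** L0 = mat 1" "L0' ** N0' = mat 1" "N0' ** L0' = mat 1" using unitary_inverse u0 by metis
  have "\<forall>n. \<exists>N. unitary N \<and> L n ** N = mat 1 \<and> N ** L n = mat 1" using unitary_inverse u by blast
  then obtain N where N: "\<And>n. unitary (N n)" "\<And>n. L n ** N n = mat 1" "\<And>n. N n ** L n = mat 1" by metis
  have Nl: "N \<longlonglongrightarrow> N0" using tendsto_unitary_inverse[OF N(1) N(3) L N0(1)] .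
  obtain b where b: "b > 0" "\<And>x. b * norm x \<le> norm (B *v x)" using invertible_lower_bound[OF inv(1)] by blast
  obtain c where c: "c > 0" "\<And>x. c * norm x \<le> norm (C *v x)" using invertible_lower_bound[OF inv(2)] by blast
  have k1: "k \<in> {1..CARD('d)}" "k + 1 \<in> {1..CARD('d)}" using k by auto
  have sk: "b * c * s n k \<le> s' n k" for n
    using sing_val_mult_ge[OF A A' k1(1) _ b(2) _ c(2) inv(2) inv'(2)] b c by simp
  have pos: "0 < s n k" "0 < s n (k + 1)" "0 < s' n k" for n using cartan_pos[OF A] cartan_pos[OF A'] k1 by auto
  have sub: "(*v) L0' ` head_space k \<subseteq> (*v) B ` ((*v) L0 ` head_space k)"
  proof clarify
    fix e :: "('k, 'd) vec" assume e: "e \<in> head_space k"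
    define y where "y n = Bi *v (L' n *v e)" for n
    have y: "y \<longlonglongrightarrow> Bi *v (L0' *v e)" unfolding y_def
      by (intro tendsto_matrix_vector_mult tendsto_const L')
    have small: "norm (N n *v y n - head k (N n *v y n)) \<le> (norm C * norm e / (b * c)) * (s n (k + 1) / s n k)" for n
    proof -
      \<comment> \<open>Inverting the diagonal factor produces the \<open>x\<close> that the product
        maps to \<open>L' n *v e\<close>; it stays in the first \<open>k\<close> coordinates, where
        all singular values are at least \<open>s' n k\<close>.\<close>
      define z where "z = (\<chi> i. inverse (of_real (s' n (index_rank i))) * e $ i)"
      have zD: "diag (s' n) *v z = e"
        using cartan_pos[OF A' index_rank_in] by (simp add: vec_eq_iff diag_mult_vec z_def less_imp_neq[symmetric])
      have "e $ i = 0" if "\<not> index_rank i \<le> k" for i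
        using e that unfolding head_space_def by (metis (mono_tags, lifting) head_nth mem_Collect_eq)
      then have zh: "head k z = z" by (auto simp: z_def vec_eq_iff head_nth)
      obtain K where K: "M' n ** K = mat 1" using unitary_inverse u(4) by blast
      define x where "x = K *v z"
      have Mx: "M' n *v x = z" by (simp add: x_def matrix_vector_mul_assoc K)
      have BAC: "(B ** A n ** C) *v x = L' n *v e" by (simp add: cartan_apply[OF A'] Mx zD)
      have "s' n k * norm x \<le> norm e"
        using cartan_lower[OF A' k1(1), of n x] Mx zh u BAC by (metis unitary_norm)
      then have nx: "norm x \<le> norm e / s' n k" using pos by (simp add: pos_le_divide_eq mult.commute)
      also have "\<dots> \<le> norm e / (b * c * s n k)" using sk b c pos by (intro divide_left_mono) auto
      finally have nx: "norm x \<le> norm e / (b * c * s n k)" .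
      have yA: "y n = A n *v (C *v x)"
      proof -
        have "Bi *v ((B ** A n ** C) *v x) = A n *v (C *v x)"
          by (simp add: matrix_vector_mul_assoc matrix_mul_assoc inv)
        then show ?thesis using BAC by (simp add: y_def)
      qed
      define h where "h = head k (diag (s n) *v (M n *v (C *v x)))"
      have "norm (y n - L n *v h) \<le> s n (k + 1) * norm (C *v x)"
        unfolding yA h_def by (rule cartan_tail[OF A k(2)])
      moreover have "N n *v y n - h = N n *v (y n - L n *v h)"
        by (simp add: matrix_vector_mult_diff_distrib matrix_vector_mul_assoc N)
      ultimately have n1: "norm (N n *v y n - h) \<le> s n (k + 1) * norm (C *v x)" using N(1) by simp
      have eq: "N n *v y n - head k (N n *v y n) = (N n *v y n - h) - head k (N n *v y n - h)"
        by (simp add: head_diff h_def head_head)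
      have "norm (N n *v y n - head k (N n *v y n)) \<le> s n (k + 1) * norm (C *v x)"
        unfolding eq using norm_head_compl_le n1 by (rule order_trans)
      also have "\<dots> \<le> s n (k + 1) * (norm C * (norm e / (b * c * s n k)))"
      proof -
        have "norm (C *v x) \<le> norm C * norm x" by (rule norm_matrix_vector_mult_le)
        also have "\<dots> \<le> norm C * (norm e / (b * c * s n k))" using nx by (intro mult_left_mono) auto
        finally show ?thesis using pos by (intro mult_left_mono) (auto intro: less_imp_le)
      qed
      finally show ?thesis by (simp add: field_simps)
    qed
    have "(\<lambda>n. norm (N n *v y n - head k (N n *v y n))) \<longlonglongrightarrow> 0"
    proof (rule tendsto_sandwich[OF _ _ tendsto_const])
      show "(\<lambda>n. (norm C * norm e / (b * c)) * (s n (k + 1) / s n k)) \<longlonglongrightarrow> 0"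
        using gap by (rule tendsto_mult_right_zero)
    qed (use small in auto)
    moreover have "(\<lambda>n. norm (N n *v y n - head k (N n *v y n))) \<longlonglongrightarrow>
        norm (N0 *v (Bi *v (L0' *v e)) - head k (N0 *v (Bi *v (L0' *v e))))"
      by (intro tendsto_norm tendsto_diff tendsto_head tendsto_matrix_vector_mult Nl y)
    ultimately have "norm (N0 *v (Bi *v (L0' *v e)) - head k (N0 *v (Bi *v (L0' *v e)))) = 0"
      using LIMSEQ_unique by blast
    then have "N0 *v (Bi *v (L0' *v e)) \<in> head_space k" by (simp add: head_space_def)
    moreover have "L0' *v e = B *v (L0 *v (N0 *v (Bi *v (L0' *v e))))"
      by (simp add: matrix_vector_mul_assoc[of L0 N0] N0) (simp add: matrix_vector_mul_assoc[of B Bi] inv')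
    ultimately show "L0' *v e \<in> (*v) B ` ((*v) L0 ` head_space k)" by blast
  qed
  \<comment> \<open>Both spaces have dimension \<open>k\<close>, so the inclusion is an
    equality.\<close>
  have "vec.dim ((*v) L0' ` head_space k) = vec.dim ((*v) B ` ((*v) L0 ` head_space k))"
    by (simp add: dim_image_matrix[OF N0(4)] dim_image_matrix[OF N0(2)] dim_image_matrix[OF inv(1)])
  then have "vec.span ((*v) L0' ` head_space k) = vec.span ((*v) B ` ((*v) L0 ` head_space k))"
    using sub by (intro vec.dim_eq_span) simp_all
  moreover have "vec.subspace ((*v) L0' ` head_space k)" "vec.subspace ((*v) B ` ((*v) L0 ` head_space k))"
    by (intro vec_subspace_image head_space_subspace)+
  ultimately show ?thesis by (metis vec.span_eq_iff)
qed

text \<open>Quantitative transversality: a positive minimum on the unit sphere for the limit, half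
  of which survives for nearby matrices.\<close>

lemma uniform_head_lower_bound:
  fixes K :: "nat \<Rightarrow> ('k::{real_normed_field,euclidean_space}, 'd::{finite,linorder}) sqmatrix"
  assumes "K \<longlonglongrightarrow> K0" and inj: "\<And>u. u \<in> head_space k \<Longrightarrow> head k (K0 *v u) = 0 \<Longrightarrow> u = 0"
  shows "\<exists>\<kappa>>0. \<forall>\<^sub>F n in sequentially. \<forall>u\<in>head_space k. \<kappa> * norm u \<le> norm (head k (K n *v u))"
proof -
  define S where "S = head_space k \<inter> sphere (0 :: ('k, 'd) vec) 1"
  have "compact S" unfolding S_def by (intro closed_Int_compact compact_sphere vec_subspace_closed head_space_subspace)
  moreover have "continuous_on S (\<lambda>u. norm (head k (K0 *v u)))"
    unfolding continuous_on_def by (intro ballI tendsto_norm tendsto_head tendsto_matrix_vector_mult tendsto_const tendsto_ident_at)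
  ultimately have "S = {} \<or> (\<exists>u\<in>S. \<forall>v\<in>S. norm (head k (K0 *v u)) \<le> norm (head k (K0 *v v)))"
    using continuous_attains_inf by blast
  then obtain m where m: "m > 0" "\<And>u. u \<in> S \<Longrightarrow> m \<le> norm (head k (K0 *v u))"
  proof
    assume "\<exists>u\<in>S. \<forall>v\<in>S. norm (head k (K0 *v u)) \<le> norm (head k (K0 *v v))"
    then obtain u where u: "u \<in> S" "\<forall>v\<in>S. norm (head k (K0 *v u)) \<le> norm (head k (K0 *v v))" by blast
    have "u \<noteq> 0" using u(1) by (auto simp: S_def)
    then have "norm (head k (K0 *v u)) > 0" using inj[of u] u(1) by (auto simp: S_def)
    then show ?thesis using that u(2) by blast
  qed (use that[of 1] in auto)
  have m': "m * norm u \<le> norm (head k (K0 *v u))" if u: "u \<in> head_space k" for u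
  proof (cases "u = 0")
    case False
    define r where "r = inverse (norm u)"
    have "of_real r *s u \<in> S" using u False vec.subspace_scale[OF head_space_subspace u]
      by (auto simp: S_def r_def norm_vector_scalar_mult norm_inverse)
    from m(2)[OF this] have "m \<le> r * norm (head k (K0 *v u))"
      using False by (simp add: vector_scalar_commute head_scale norm_vector_scalar_mult r_def norm_inverse)
    then show ?thesis using False by (simp add: r_def field_simps)
  qed simp
  have "(\<lambda>n. norm (K n - K0)) \<longlonglongrightarrow> norm (K0 - K0)" by (intro tendsto_intros assms(1))
  then have "\<forall>\<^sub>F n in sequentially. norm (K n - K0) < m / 2" using m(1) by (intro order_tendstoD(2)) auto
  then have "\<forall>\<^sub>F n in sequentially. \<forall>u\<in>head_space k. (m / 2) * norm u \<le> norm (head k (K n *v u))"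
  proof eventually_elim
    case (elim n)
    show ?case
    proof
      fix u :: "('k, 'd) vec" assume u: "u \<in> head_space k"
      have "norm (head k ((K n - K0) *v u)) \<le> norm (K n - K0) * norm u"
        using norm_head_le norm_matrix_vector_mult_le order_trans by blast
      also have "\<dots> \<le> (m / 2) * norm u" using elim by (intro mult_right_mono) auto
      finally have "norm (head k (K n *v u) - head k (K0 *v u)) \<le> (m / 2) * norm u"
        by (simp add: matrix_minus_vector_mult head_diff)
      moreover have "norm (head k (K0 *v u)) \<le> norm (head k (K n *v u)) + norm (head k (K n *v u) - head k (K0 *v u))"
        by (metis norm_minus_commute norm_triangle_sub add.commute)
      ultimately show "(m / 2) * norm u \<le> norm (head k (K n *v u))" using m'[OF u] by simp
    qed
  qed
  then show ?thesis using m(1) by (intro exI[of _ "m / 2"]) auto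
qed

section \<open>Limit flags of hypertransverse groups\<close>

lemma tendsto_if_subseq_tendsto:
  fixes x :: "nat \<Rightarrow> 'a::metric_space"
  assumes "\<And>r :: nat \<Rightarrow> nat. strict_mono r \<Longrightarrow> \<exists>s :: nat \<Rightarrow> nat. strict_mono s \<and> (\<lambda>n. x (r (s n))) \<longlonglongrightarrow> l"
  shows "x \<longlonglongrightarrow> l"
proof (rule ccontr)
  assume "\<not> x \<longlonglongrightarrow> l"
  then obtain e where e: "e > 0" "\<not> (\<forall>\<^sub>F n in sequentially. dist (x n) l < e)" by (auto simp: tendsto_iff)
  then have inf: "infinite {n. \<not> dist (x n) l < e}"
    by (simp add: frequently_cofinite[symmetric] cofinite_eq_sequentially not_eventually)
  define r where "r = enumerate {n. \<not> dist (x n) l < e}"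
  have r: "strict_mono r" "\<And>n. \<not> dist (x (r n)) l < e"
    using strict_mono_enumerate[OF inf] enumerate_in_set[OF inf] by (auto simp: r_def)
  obtain s :: "nat \<Rightarrow> nat" where "(\<lambda>n. x (r (s n))) \<longlonglongrightarrow> l" using assms[OF r(1)] by blast
  then have "\<forall>\<^sub>F n in sequentially. dist (x (r (s n))) l < e" using e(1) by (rule tendstoD)
  then have "\<forall>\<^sub>F n::nat in sequentially. False" by eventually_elim (use r(2) in simp)
  then show False by simp
qed

lemma head_space_iff: "y \<in> head_space k \<longleftrightarrow> (\<forall>i. \<not> index_rank i \<le> k \<longrightarrow> y $ i = 0)"
  by (auto simp: head_space_def vec_eq_iff head_nth)

lemma head_space_mono: "j \<le> k \<Longrightarrow> head_space j \<subseteq> head_space k"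
  by (auto simp: head_space_iff)

locale hypertransverse_group =
  fixes \<Gamma> :: "('k::{real_normed_field,euclidean_space}, 'd::{finite,linorder}) sqmatrix set set"
    and \<theta> :: "nat set" and q :: nat
  assumes sub: "subgroup \<Gamma> PGL" and hyp: "hypertransverse_wrt \<theta> q \<Gamma>"
    and sing: "\<And>\<gamma>. \<gamma> \<in> \<Gamma> \<Longrightarrow> sing_val \<gamma> 2 = sing_val \<gamma> q"
begin

abbreviation flag_limits :: "(nat \<Rightarrow> ('k, 'd) vec set) set" where "flag_limits \<equiv> limit_set \<theta> \<Gamma>"

lemma \<Gamma>_carrier: "g \<in> \<Gamma> \<Longrightarrow> g \<in> carrier PGL"
  using sub subgroup.subset by blast

lemma \<Gamma>_mult: "g \<in> \<Gamma> \<Longrightarrow> h \<in> \<Gamma> \<Longrightarrow> g \<otimes>\<^bsub>PGL\<^esub> h \<in> \<Gamma>"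
  and \<Gamma>_inv: "g \<in> \<Gamma> \<Longrightarrow> inv\<^bsub>PGL\<^esub> g \<in> \<Gamma>"
  using subgroup.m_closed[OF sub] subgroup.m_inv_closed[OF sub] by auto

lemma inv_inject: "g \<in> \<Gamma> \<Longrightarrow> h \<in> \<Gamma> \<Longrightarrow> inv\<^bsub>PGL\<^esub> g = inv\<^bsub>PGL\<^esub> h \<Longrightarrow> g = h"
  using group.inv_inv[OF group_PGL] \<Gamma>_carrier by metis

lemma \<theta>_range: "k \<in> \<theta> \<Longrightarrow> 0 < k" "k \<in> \<theta> \<Longrightarrow> k < CARD('d)"
  and \<theta>_sym: "k \<in> \<theta> \<Longrightarrow> CARD('d) - k \<in> \<theta>"
  and one_in: "1 \<in> \<theta>" and q_in: "q \<in> \<theta>"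
  using hyp by (auto simp: hypertransverse_wrt_def symmetric_indices_def)

lemma d_gt_1: "1 < CARD('d)" using \<theta>_range[OF one_in] by simp

lemma \<alpha>_tends:
  assumes "inj \<gamma>" "\<And>n::nat. \<gamma> n \<in> \<Gamma>" "k \<in> \<theta>"
  shows "filterlim (\<lambda>n. alpha k (\<gamma> n)) at_top sequentially"
proof -
  have "divergent k \<Gamma>" using hyp assms(3) by (simp add: hypertransverse_wrt_def transverse_group_def)
  then show ?thesis using assms(1,2) by (auto simp: divergent_def)
qed

lemma \<alpha>_eq:
  assumes "g \<in> \<Gamma>" "lift_of g A" "cartan_decomposition A L s M" "k \<in> \<theta>"
  shows "alpha k g = ln (s k / s (k + 1))" "exp (- alpha k g) = s (k + 1) / s k" "0 \<le> alpha k g"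
    "0 < s k" "0 < s (k + 1)"
proof -
  have k: "k \<in> {1..CARD('d)}" "k + 1 \<in> {1..CARD('d)}" using \<theta>_range[OF assms(4)] by auto
  show pos: "0 < s k" "0 < s (k + 1)" using cartan_pos[OF assms(3)] k by auto
  have "s (k + 1) \<le> s k" using cartan_antimono[OF assms(3), of k "k + 1"] k by auto
  show 1: "alpha k g = ln (s k / s (k + 1))"
    using sing_val_eq[OF \<Gamma>_carrier[OF assms(1)] assms(2,3)] k by (simp add: alpha_def)
  show "exp (- alpha k g) = s (k + 1) / s k" using pos by (simp add: 1 exp_minus)
  show "0 \<le> alpha k g" using pos \<open>s (k + 1) \<le> s k\<close> by (simp add: 1)
qed

lemma s2_eq_sq:
  assumes "g \<in> \<Gamma>" "lift_of g A" "cartan_decomposition A L s M"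
  shows "s 2 = s q"
  using sing[OF assms(1)] sing_val_eq[OF \<Gamma>_carrier[OF assms(1)] assms(2,3)] d_gt_1 \<theta>_range[OF q_in] by simp

text \<open>A sequence with lifts, Cartan decompositions and limits of its unitary factors. Carrying
  this data lets estimates refer to singular values of fixed decompositions.\<close>

definition framed where
  "framed \<gamma> A L s M L0 M0 \<longleftrightarrow> inj \<gamma> \<and> L \<longlonglongrightarrow> L0 \<and> M \<longlonglongrightarrow> M0 \<and>
     (\<forall>n::nat. \<gamma> n \<in> \<Gamma> \<and> lift_of (\<gamma> n) (A n) \<and> cartan_decomposition (A n) (L n) (s n) (M n))"

text \<open>If \<open>L\<close> and \<open>M\<close> converge to \<open>L0\<close> and \<open>M0\<close> in Cartan decompositions of a sequence, these are its
  attracting and repelling flags.\<close>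

definition att_flag :: "('k, 'd) sqmatrix \<Rightarrow> nat \<Rightarrow> ('k, 'd) vec set" where
  "att_flag L0 = (\<lambda>k\<in>\<theta>. (*v) L0 ` head_space k)"

text \<open>\<open>tail_space (d - k)\<close> has dimension \<open>k\<close>; its preimage consists
  of the directions that are expanded least in the limit.\<close>

definition rep_flag :: "('k, 'd) sqmatrix \<Rightarrow> nat \<Rightarrow> ('k, 'd) vec set" where
  "rep_flag M0 = (\<lambda>k\<in>\<theta>. (*v) M0 -` tail_space (CARD('d) - k))"

lemma framedD:
  assumes "framed \<gamma> A L s M L0 M0"
  shows "inj \<gamma>" "L \<longlonglongrightarrow> L0" "M \<longlonglongrightarrow> M0" "\<gamma> n \<in> \<Gamma>" "lift_of (\<gamma> n) (A n)"
    "cartan_decomposition (A n) (L n) (s n) (M n)" "unitary (L n)" "unitary (M n)" "unitary L0" "unitary M0"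
proof -
  show c: "cartan_decomposition (A n) (L n) (s n) (M n)" for n using assms by (simp add: framed_def)
  show u: "unitary (L n)" "unitary (M n)" for n using cartan_unitary c by blast+
  show "L \<longlonglongrightarrow> L0" "M \<longlonglongrightarrow> M0" using assms by (simp_all add: framed_def)
  then show "unitary L0" "unitary M0" using unitary_limit u by blast+
qed (use assms in \<open>simp_all add: framed_def\<close>)

lemma framed_subseq:
  assumes "framed \<gamma> A L s M L0 M0" "strict_mono r"
  shows "framed (\<lambda>n. \<gamma> (r n)) (\<lambda>n. A (r n)) (\<lambda>n. L (r n)) (\<lambda>n. s (r n)) (\<lambda>n. M (r n)) L0 M0"
proof -
  have "inj (\<lambda>n. \<gamma> (r n))" using inj_compose[OF framedD(1)[OF assms(1)] strict_mono_imp_inj_on[OF assms(2)]] by (simp add: comp_def)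
  moreover have "(\<lambda>n. L (r n)) \<longlonglongrightarrow> L0" "(\<lambda>n. M (r n)) \<longlonglongrightarrow> M0"
    using LIMSEQ_subseq_LIMSEQ[OF framedD(2)[OF assms(1)] assms(2)] LIMSEQ_subseq_LIMSEQ[OF framedD(3)[OF assms(1)] assms(2)]
    by (simp_all add: comp_def)
  ultimately show ?thesis using assms(1) by (simp add: framed_def)
qed

lemma framed_ex_lift:
  assumes "inj \<gamma>" "\<And>n::nat. \<gamma> n \<in> \<Gamma>" "\<And>n. lift_of (\<gamma> n) (A n)"
  shows "\<exists>(r :: nat \<Rightarrow> nat) L s M L0 M0. strict_mono r \<and> framed (\<lambda>n. \<gamma> (r n)) (\<lambda>n. A (r n)) L s M L0 M0"
proof -
  have "\<exists>L s M. cartan_decomposition (A n) L s M" for n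
    using in_PGL(2)[OF \<Gamma>_carrier[OF assms(2)]] assms(3) cartan_decomposition_exists unfolding lift_of_def by blast
  then obtain L s M where c: "\<And>n. cartan_decomposition (A n) (L n) (s n) (M n)" by metis
  have u: "unitary (L n)" "unitary (M n)" for n using cartan_unitary c by blast+
  obtain r1 L0 where r1: "strict_mono (r1 :: nat \<Rightarrow> nat)" "(\<lambda>n. L (r1 n)) \<longlonglongrightarrow> L0" using unitary_subseq[of L] u by blast
  obtain r2 M0 where r2: "strict_mono (r2 :: nat \<Rightarrow> nat)" "(\<lambda>n. M (r1 (r2 n))) \<longlonglongrightarrow> M0" using unitary_subseq[of "\<lambda>n. M (r1 n)"] u by blast
  define r where "r n = r1 (r2 n)" for n
  have r: "strict_mono r" using r1(1) r2(1) unfolding r_def strict_mono_def by blast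
  have "inj (\<lambda>n. \<gamma> (r n))" using inj_compose[OF assms(1) strict_mono_imp_inj_on[OF r]] by (simp add: comp_def)
  moreover have "(\<lambda>n. L (r n)) \<longlonglongrightarrow> L0" using LIMSEQ_subseq_LIMSEQ[OF r1(2) r2(1)] by (simp add: r_def comp_def)
  ultimately have "framed (\<lambda>n. \<gamma> (r n)) (\<lambda>n. A (r n)) (\<lambda>n. L (r n)) (\<lambda>n. s (r n)) (\<lambda>n. M (r n)) L0 M0"
    using r2(2) c assms(2,3) by (simp add: framed_def r_def)
  then show ?thesis using r by blast
qed

lemma framed_ex:
  assumes "inj \<gamma>" "\<And>n::nat. \<gamma> n \<in> \<Gamma>"
  shows "\<exists>(r :: nat \<Rightarrow> nat) A L s M L0 M0. strict_mono r \<and> framed (\<lambda>n. \<gamma> (r n)) A L s M L0 M0"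
proof -
  have "\<forall>n. \<exists>A. lift_of (\<gamma> n) A" using lift_ex \<Gamma>_carrier assms(2) by blast
  then obtain A where "\<And>n. lift_of (\<gamma> n) (A n)" by metis
  from framed_ex_lift[OF assms this] show ?thesis by blast
qed

text \<open>The reversal matrix in the decomposition of the inverse exchanges head and tail spaces,
  hence the two flags.\<close>

lemma framed_inverse:
  assumes "framed \<gamma> A L s M L0 M0"
  shows "\<exists>A' L' s' M' L0' M0'. framed (\<lambda>n. inv\<^bsub>PGL\<^esub> (\<gamma> n)) A' L' s' M' L0' M0' \<and>
    att_flag L0' = rep_flag M0 \<and> rep_flag M0' = att_flag L0"
proof -
  note f = framedD[OF assms]
  have "\<exists>B. B ** A n = mat 1" for n
  proof -
    have "invertible (A n)" using in_PGL(2)[OF \<Gamma>_carrier[OF f(4)]] f(5) unfolding lift_of_def by blast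
    then show ?thesis unfolding invertible_def by blast
  qed
  then obtain B where B: "\<And>n. B n ** A n = mat 1" by metis
  have "\<forall>n. \<exists>K. unitary K \<and> L n ** K = mat 1 \<and> K ** L n = mat 1" "\<forall>n. \<exists>N. unitary N \<and> M n ** N = mat 1 \<and> N ** M n = mat 1"
    using unitary_inverse[OF f(7)] unitary_inverse[OF f(8)] by blast+
  then obtain K N where K: "\<And>n. unitary (K n)" "\<And>n. L n ** K n = mat 1" "\<And>n. K n ** L n = mat 1"
    and N: "\<And>n. unitary (N n)" "\<And>n. M n ** N n = mat 1" "\<And>n. N n ** M n = mat 1" by metis
  obtain K0 where K0: "L0 ** K0 = mat 1" "K0 ** L0 = mat 1" using unitary_inverse f(9) by metis
  obtain N0 where N0: "M0 ** N0 = mat 1" "N0 ** M0 = mat 1" using unitary_inverse f(10) by metis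
  have Kl: "K \<longlonglongrightarrow> K0" using tendsto_unitary_inverse[OF K(1) K(3) f(2) K0(1)] .
  have Nl: "N \<longlonglongrightarrow> N0" using tendsto_unitary_inverse[OF N(1) N(3) f(3) N0(1)] .
  have "inj (\<lambda>n. inv\<^bsub>PGL\<^esub> (\<gamma> n))" using f(1) inv_inject[OF f(4) f(4)] by (auto simp: inj_def)
  moreover have "(\<lambda>n. N n ** rev_matrix) \<longlonglongrightarrow> N0 ** rev_matrix" "(\<lambda>n. rev_matrix ** K n) \<longlonglongrightarrow> rev_matrix ** K0"
    by (intro tendsto_matrix_mult tendsto_const Nl Kl)+
  moreover have "lift_of (inv\<^bsub>PGL\<^esub> (\<gamma> n)) (B n)" for n
    using lift_inverse[OF \<Gamma>_carrier[OF f(4)] f(5) B] .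
  moreover have "cartan_decomposition (B n) (N n ** rev_matrix) (\<lambda>k. inverse (s n (CARD('d) + 1 - k))) (rev_matrix ** K n)" for n
    using cartan_inverse[OF f(6) K(3,2) N(3,2) K(1) N(1) B] .
  ultimately have fr: "framed (\<lambda>n. inv\<^bsub>PGL\<^esub> (\<gamma> n)) B (\<lambda>n. N n ** rev_matrix) (\<lambda>n k. inverse (s n (CARD('d) + 1 - k)))
      (\<lambda>n. rev_matrix ** K n) (N0 ** rev_matrix) (rev_matrix ** K0)"
    using \<Gamma>_inv[OF f(4)] by (simp add: framed_def)
  have "(*v) (N0 ** rev_matrix) ` head_space k = (*v) M0 -` tail_space (CARD('d) - k)" if "k \<in> \<theta>" for k
  proof -
    have "k \<le> CARD('d)" using \<theta>_range[OF that] by simp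
    then have "(*v) (N0 ** rev_matrix) ` head_space k = (*v) N0 ` tail_space (CARD('d) - k)"
      using rev_image_head[of k, where 'd='d and 'k='k] by (simp add: image_image[symmetric] matrix_vector_mul_assoc[symmetric])
    then show ?thesis using vimage_eq_image_matrix[OF N0(2,1)] by simp
  qed
  then have 1: "att_flag (N0 ** rev_matrix) = rep_flag M0" unfolding att_flag_def rep_flag_def by (rule restrict_ext)
  have "(*v) (rev_matrix ** K0) -` tail_space (CARD('d) - k) = (*v) L0 ` head_space k" if "k \<in> \<theta>" for k
  proof -
    have "k \<le> CARD('d)" using \<theta>_range[OF that] by simp
    then have "(*v) (rev_matrix ** K0) -` tail_space (CARD('d) - k) = (*v) K0 -` head_space k"
      using rev_matrix_head[of k, where 'd='d and 'k='k] by (auto simp: matrix_vector_mul_assoc[symmetric])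
    then show ?thesis using vimage_eq_image_matrix[OF K0(1,2)] by simp
  qed
  then have 2: "rep_flag (rev_matrix ** K0) = att_flag L0" unfolding att_flag_def rep_flag_def by (rule restrict_ext)
  show ?thesis using fr 1 2 by blast
qed

text \<open>Only eventually: \<open>U_space k\<close> is well defined once there is a gap, and
  divergence provides it.\<close>

lemma framed_U_space:
  assumes "framed \<gamma> A L s M L0 M0" "k \<in> \<theta>"
  shows "\<forall>\<^sub>F n in sequentially. U_space k (\<gamma> n) = (*v) (L n) ` head_space k"
proof -
  note f = framedD[OF assms(1)]
  have "\<forall>\<^sub>F n in sequentially. alpha k (\<gamma> n) > 0"
    using \<alpha>_tends[OF f(1,4) assms(2)] by (simp add: filterlim_at_top_dense)
  then show ?thesis
  proof eventually_elim
    case (elim n)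
    have "s n (k + 1) < s n k" using elim \<alpha>_eq[OF f(4,5,6) assms(2), of n] by (simp add: ln_gt_zero_iff)
    then show ?case using U_space_eq[OF \<Gamma>_carrier[OF f(4)] f(5,6)] \<theta>_range[OF assms(2)] by blast
  qed
qed

lemma framed_att:
  assumes "framed \<gamma> A L s M L0 M0" "k \<in> \<theta>"
  shows "(\<lambda>n. proj (U_space k (\<gamma> n))) \<longlonglongrightarrow> proj ((*v) L0 ` head_space k)"
proof -
  note f = framedD[OF assms(1)]
  have "(\<lambda>n. proj ((*v) (L n) ` head_space k)) \<longlonglongrightarrow> proj ((*v) L0 ` head_space k)"
    by (rule tendsto_proj_image[OF f(7,2) head_space_subspace])
  moreover have "\<forall>\<^sub>F n in sequentially. proj ((*v) (L n) ` head_space k) = proj (U_space k (\<gamma> n))"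
    using framed_U_space[OF assms] by eventually_elim simp
  ultimately show ?thesis by (rule Lim_transform_eventually)
qed

lemma framed_grass_dist:
  assumes "framed \<gamma> A L s M L0 M0" "k \<in> \<theta>" "\<And>n. vec.subspace (V n)"
  shows "\<forall>\<^sub>F n in sequentially. grass_dist (U_space k (\<gamma> n)) (V n) = dist (proj (U_space k (\<gamma> n))) (proj (V n))"
  using framed_U_space[OF assms(1,2)]
  by eventually_elim (simp add: grass_dist_eq_dist_proj vec_subspace_image head_space_subspace assms(3))

lemma framed_att_limit:
  assumes "framed \<gamma> A L s M L0 M0"
  shows "att_flag L0 \<in> flag_limits"
proof -
  note f = framedD[OF assms]
  obtain K0 where K0: "K0 ** L0 = mat 1" using unitary_inverse f(9) by metis
  have "att_flag L0 \<in> flags \<theta>"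
    unfolding flags_def
  proof (intro CollectI conjI ballI impI)
    show "att_flag L0 \<in> extensional \<theta>" by (simp add: att_flag_def)
    fix k assume k: "k \<in> \<theta>"
    show "vec.subspace (att_flag L0 k)" using k by (simp add: att_flag_def vec_subspace_image head_space_subspace)
    show "vec.dim (att_flag L0 k) = k" using k \<theta>_range[OF k] by (simp add: att_flag_def dim_image_matrix[OF K0] dim_head_space)
    fix j assume "j \<in> \<theta>" "j \<le> k"
    then show "att_flag L0 j \<subseteq> att_flag L0 k" using k head_space_mono by (auto simp: att_flag_def)
  qed
  moreover have "flag_tendsto \<theta> (\<lambda>n k. U_space k (\<gamma> n)) (att_flag L0)"
    unfolding flag_tendsto_def
  proof
    fix k assume k: "k \<in> \<theta>"
    have "(\<lambda>n. dist (proj (U_space k (\<gamma> n))) (proj ((*v) L0 ` head_space k))) \<longlonglongrightarrow> 0"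
      using framed_att[OF assms k] by (simp add: tendsto_dist_iff[symmetric])
    moreover have "\<forall>\<^sub>F n in sequentially. dist (proj (U_space k (\<gamma> n))) (proj ((*v) L0 ` head_space k)) = grass_dist (U_space k (\<gamma> n)) (att_flag L0 k)"
      using framed_grass_dist[OF assms k, of "\<lambda>_. (*v) L0 ` head_space k"] k
      by (simp add: att_flag_def vec_subspace_image head_space_subspace eq_commute)
    ultimately show "(\<lambda>n. grass_dist (U_space k (\<gamma> n)) (att_flag L0 k)) \<longlonglongrightarrow> 0" by (rule Lim_transform_eventually)
  qed
  ultimately show ?thesis using f(1,4) unfolding limit_set_def by blast
qed

lemma framed_rep_limit:
  assumes "framed \<gamma> A L s M L0 M0"
  shows "rep_flag M0 \<in> flag_limits"
  using framed_inverse[OF assms] framed_att_limit by metis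

lemma flag_limitsD:
  assumes "F \<in> flag_limits"
  shows "F \<in> extensional \<theta>" "k \<in> \<theta> \<Longrightarrow> vec.subspace (F k)" "k \<in> \<theta> \<Longrightarrow> vec.dim (F k) = k"
    "j \<in> \<theta> \<Longrightarrow> k \<in> \<theta> \<Longrightarrow> j \<le> k \<Longrightarrow> F j \<subseteq> F k" "F 1 \<in> projective_space"
  using assms one_in by (auto simp: limit_set_def flags_def projective_space_def)

lemma flag_eqI: "F \<in> flag_limits \<Longrightarrow> G \<in> flag_limits \<Longrightarrow> (\<And>k. k \<in> \<theta> \<Longrightarrow> F k = G k) \<Longrightarrow> F = G"
  using flag_limitsD(1) extensionalityI by blast

lemma att_flag_nth: "k \<in> \<theta> \<Longrightarrow> att_flag L0 k = (*v) L0 ` head_space k"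
  by (simp add: att_flag_def)

lemma rep_flag_nth: "k \<in> \<theta> \<Longrightarrow> rep_flag M0 (CARD('d) - k) = (*v) M0 -` tail_space k"
  using \<theta>_sym[of k] \<theta>_range(2)[of k] by (simp add: rep_flag_def)

lemma flag_limit_framed:
  assumes "F \<in> flag_limits"
  shows "\<exists>\<gamma> A L s M L0 M0. framed \<gamma> A L s M L0 M0 \<and> att_flag L0 = F"
proof -
  obtain \<gamma> where \<gamma>: "inj (\<gamma> :: nat \<Rightarrow> _)" "range \<gamma> \<subseteq> \<Gamma>" "flag_tendsto \<theta> (\<lambda>n k. U_space k (\<gamma> n)) F"
    using assms unfolding limit_set_def by blast
  have \<gamma>n: "\<gamma> n \<in> \<Gamma>" for n using \<gamma>(2) by blast
  obtain r A L s M L0 M0 where r: "strict_mono (r :: nat \<Rightarrow> nat)" "framed (\<lambda>n. \<gamma> (r n)) A L s M L0 M0"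
    using framed_ex[OF \<gamma>(1) \<gamma>n] by blast
  have "att_flag L0 = F"
  proof (rule flag_eqI[OF framed_att_limit[OF r(2)] assms])
    fix k assume k: "k \<in> \<theta>"
    have sF: "vec.subspace (F k)" using flag_limitsD(2)[OF assms k] .
    have "(\<lambda>n. grass_dist (U_space k (\<gamma> n)) (F k)) \<longlonglongrightarrow> 0" using \<gamma>(3) k by (simp add: flag_tendsto_def)
    from LIMSEQ_subseq_LIMSEQ[OF this r(1)]
    have "(\<lambda>n. grass_dist (U_space k (\<gamma> (r n))) (F k)) \<longlonglongrightarrow> 0" by (simp add: comp_def)
    then have "(\<lambda>n. dist (proj (U_space k (\<gamma> (r n)))) (proj (F k))) \<longlonglongrightarrow> 0"
      by (rule Lim_transform_eventually) (rule framed_grass_dist[OF r(2) k sF])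
    then have "(\<lambda>n. proj (U_space k (\<gamma> (r n)))) \<longlonglongrightarrow> proj (F k)" by (simp add: tendsto_dist_iff[symmetric])
    then have eq: "proj ((*v) L0 ` head_space k) = proj (F k)" using framed_att[OF r(2) k] LIMSEQ_unique by blast
    show "att_flag L0 k = F k"
      unfolding att_flag_nth[OF k] by (rule proj_inject[OF vec_subspace_image[OF head_space_subspace] sF, THEN iffD1, OF eq])
  qed
  then show ?thesis using r(2) by blast
qed

text \<open>The dimensions add up to \<open>d\<close>, so spanning is the same as trivial
  intersection.\<close>

lemma transverse_flags_limit:
  assumes "F \<in> flag_limits" "G \<in> flag_limits" "F \<noteq> G" "k \<in> \<theta>"
  shows "F k \<inter> G (CARD('d) - k) = {0}"
proof -
  have "transverse_spaces (F k) (G (CARD('d) - k))"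
    using hyp assms unfolding hypertransverse_wrt_def transverse_group_def transverse_flags_def by blast
  then have s: "{x + y |x y. x \<in> F k \<and> y \<in> G (CARD('d) - k)} = UNIV" by (simp add: transverse_spaces_def)
  have "vec.dim (F k \<inter> G (CARD('d) - k)) = 0"
    using vec.dim_sums_Int[OF flag_limitsD(2)[OF assms(1,4)] flag_limitsD(2)[OF assms(2) \<theta>_sym[OF assms(4)]]]
    unfolding s flag_limitsD(3)[OF assms(1,4)] flag_limitsD(3)[OF assms(2) \<theta>_sym[OF assms(4)]] vec_dim_card
    using \<theta>_range[OF assms(4)] by simp
  then have "F k \<inter> G (CARD('d) - k) \<subseteq> {0}" by (subst (asm) vec.dim_eq_0)
  then show ?thesis using vec.subspace_0 flag_limitsD(2) assms \<theta>_sym by blast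
qed

text \<open>If the lines agree, \<open>F 1\<close> lies in the hyperplane \<open>G (d - 1)\<close>,
  against transversality. This allows flags to be replaced by points of projective space.\<close>

lemma flag_limits_inject1:
  assumes "F \<in> flag_limits" "G \<in> flag_limits" "F 1 = G 1"
  shows "F = G"
proof (rule ccontr)
  assume "F \<noteq> G"
  have "G 1 \<subseteq> G (CARD('d) - 1)" using flag_limitsD(4)[OF assms(2) one_in \<theta>_sym[OF one_in]] d_gt_1 by simp
  then have "F 1 \<subseteq> {0}" using transverse_flags_limit[OF assms(1,2) \<open>F \<noteq> G\<close> one_in] assms(3) by blast
  then have "vec.dim (F 1) = 0" by (subst vec.dim_eq_0)
  then show False using flag_limitsD(3)[OF assms(1) one_in] by linarith
qed

text \<open>Each flag is approximated within \<open>1 / (n + 1)\<close> by the spaces of a group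
  element, with all elements distinct; the attracting flag of a framed subsequence is the limit of
  the flags.\<close>

lemma flag_limits_compact:
  assumes "\<And>n::nat. F n \<in> flag_limits"
  shows "\<exists>r G. strict_mono (r :: nat \<Rightarrow> nat) \<and> G \<in> flag_limits \<and> (\<forall>k\<in>\<theta>. (\<lambda>n. proj (F (r n) k)) \<longlonglongrightarrow> proj (G k))"
proof -
  have fin: "finite \<theta>" using \<theta>_range by (intro finite_subset[of \<theta> "{..<CARD('d)}"]) auto
  define P where "P n g \<longleftrightarrow> g \<in> \<Gamma> \<and> (\<forall>k\<in>\<theta>. \<bar>grass_dist (U_space k g) (F n k)\<bar> < inverse (real (Suc n)))" for n g
  have "infinite {g. P n g}" for n
  proof -
    obtain \<gamma> where \<gamma>: "inj (\<gamma> :: nat \<Rightarrow> _)" "range \<gamma> \<subseteq> \<Gamma>" "flag_tendsto \<theta> (\<lambda>n k. U_space k (\<gamma> n)) (F n)"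
      using assms[of n] unfolding limit_set_def by blast
    have "\<forall>\<^sub>F m in sequentially. \<bar>grass_dist (U_space k (\<gamma> m)) (F n k)\<bar> < inverse (real (Suc n))" if "k \<in> \<theta>" for k
      using \<gamma>(3) that tendstoD[of "\<lambda>m. grass_dist (U_space k (\<gamma> m)) (F n k)" 0 sequentially "inverse (real (Suc n))"]
      by (simp add: flag_tendsto_def dist_real_def)
    then have "\<forall>\<^sub>F m in sequentially. \<forall>k\<in>\<theta>. \<bar>grass_dist (U_space k (\<gamma> m)) (F n k)\<bar> < inverse (real (Suc n))"
      using fin by (simp add: eventually_ball_finite)
    then obtain m0 where "\<And>m. m \<ge> m0 \<Longrightarrow> P n (\<gamma> m)" using \<gamma>(2) by (auto simp: eventually_sequentially P_def)
    then have "\<gamma> ` {m0..} \<subseteq> {g. P n g}" by auto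
    moreover have "infinite (\<gamma> ` {m0..})" using \<gamma>(1) by (metis finite_imageD infinite_Ici inj_on_subset subset_UNIV)
    ultimately show ?thesis using finite_subset by blast
  qed
  then obtain g where g: "inj g" "\<And>n. P n (g n)" using injective_sequence_from_all_large[of P] by blast
  have g\<Gamma>: "g n \<in> \<Gamma>" for n using g(2)[of n] by (simp add: P_def)
  obtain r A L s M L0 M0 where r: "strict_mono (r :: nat \<Rightarrow> nat)" "framed (\<lambda>n. g (r n)) A L s M L0 M0"
    using framed_ex[OF g(1) g\<Gamma>] by blast
  have "(\<lambda>n. proj (F (r n) k)) \<longlonglongrightarrow> proj (att_flag L0 k)" if k: "k \<in> \<theta>" for k
  proof -
    have "(\<lambda>n. grass_dist (U_space k (g (r n))) (F (r n) k)) \<longlonglongrightarrow> 0"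
    proof (rule tendsto_rabs_zero_cancel, rule tendsto_sandwich[OF _ _ tendsto_const])
      show "(\<lambda>n. inverse (real (Suc (r n)))) \<longlonglongrightarrow> 0"
        using LIMSEQ_subseq_LIMSEQ[OF LIMSEQ_inverse_real_of_nat r(1)] by (simp add: comp_def)
      show "\<forall>\<^sub>F n in sequentially. \<bar>grass_dist (U_space k (g (r n))) (F (r n) k)\<bar> \<le> inverse (real (Suc (r n)))"
        using g(2) k by (auto simp: P_def intro!: always_eventually less_imp_le)
    qed auto
    then have "(\<lambda>n. dist (proj (U_space k (g (r n)))) (proj (F (r n) k))) \<longlonglongrightarrow> 0"
      by (rule Lim_transform_eventually) (rule framed_grass_dist[OF r(2) k flag_limitsD(2)[OF assms k]])
    from tendsto_add[OF this tendsto_dist[OF framed_att[OF r(2) k] tendsto_const, of "proj (att_flag L0 k)"]]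
    have z: "(\<lambda>n. dist (proj (U_space k (g (r n)))) (proj (F (r n) k)) + dist (proj (U_space k (g (r n)))) (proj (att_flag L0 k))) \<longlonglongrightarrow> 0"
      by (simp add: att_flag_nth[OF k])
    have "(\<lambda>n. dist (proj (F (r n) k)) (proj (att_flag L0 k))) \<longlonglongrightarrow> 0"
      by (rule tendsto_sandwich[OF _ _ tendsto_const z]) (auto intro!: always_eventually dist_triangle3)
    then show ?thesis by (simp add: tendsto_dist_iff[symmetric])
  qed
  then show ?thesis using r(1) framed_att_limit[OF r(2)] by blast
qed

text \<open>The map to lines is injective on a compact set of flags, so its inverse is continuous;
  here in terms of subsequences.\<close>

lemma flag_limits_tendsto:
  assumes F: "\<And>n::nat. F n \<in> flag_limits" and G: "G \<in> flag_limits" and lim: "(\<lambda>n. proj (F n 1)) \<longlonglongrightarrow> proj (G 1)" and k: "k \<in> \<theta>"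
  shows "(\<lambda>n. proj (F n k)) \<longlonglongrightarrow> proj (G k)"
proof (rule tendsto_if_subseq_tendsto)
  fix r :: "nat \<Rightarrow> nat" assume r: "strict_mono r"
  obtain t H where t: "strict_mono (t :: nat \<Rightarrow> nat)" "H \<in> flag_limits" "\<And>k. k \<in> \<theta> \<Longrightarrow> (\<lambda>n. proj (F (r (t n)) k)) \<longlonglongrightarrow> proj (H k)"
    using flag_limits_compact[of "\<lambda>n. F (r n)"] F by blast
  have "strict_mono (\<lambda>n. r (t n))" using r t(1) unfolding strict_mono_def by blast
  from LIMSEQ_subseq_LIMSEQ[OF lim this] have "(\<lambda>n. proj (F (r (t n)) 1)) \<longlonglongrightarrow> proj (G 1)" by (simp add: comp_def)
  then have "proj (G 1) = proj (H 1)" using t(3)[OF one_in] LIMSEQ_unique by blast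
  then have "G 1 = H 1" using proj_inject[OF flag_limitsD(2)[OF G one_in] flag_limitsD(2)[OF t(2) one_in]] by simp
  then have "G = H" using flag_limits_inject1 G t(2) by blast
  then show "\<exists>s :: nat \<Rightarrow> nat. strict_mono s \<and> (\<lambda>n. proj (F (r (s n)) k)) \<longlonglongrightarrow> proj (G k)" using t(1,3) k by blast
qed

end

section \<open>The action on limit points in projective space\<close>

lemma range_proj: "vec.subspace V \<Longrightarrow> range (blinfun_apply (proj V)) = V"
  using proj_in proj_id by (metis (no_types, lifting) image_subsetI rangeI subsetI subset_antisym)

lemma image_line: "(*v) A ` line v = line (A *v v)"
  by (auto simp: line_eq image_iff vector_scalar_commute)

lemma ln_ratio_lower:
  assumes "0 < m" "0 < a" "0 < b" "0 < b'" "m * a \<le> a'" "m * b' \<le> b"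
  shows "ln (a / b) + 2 * ln m \<le> ln (a' / (b' :: real))"
proof -
  have "m * m * (a / b) \<le> a' / b'"
  proof -
    have a': "0 < a'" using assms by (meson less_le_trans mult_pos_pos)
    have "(m * a) * (m * b') \<le> a' * b" using assms a' by (intro mult_mono) auto
    then show ?thesis using assms by (simp add: field_simps)
  qed
  then have "ln (m * m * (a / b)) \<le> ln (a' / b')" using assms by (intro ln_mono) auto
  also have "ln (m * m * (a / b)) = ln (a / b) + 2 * ln m" using assms by (simp add: ln_mult ln_div)
  finally show ?thesis .
qed

lemma singular_values_comparable:
  fixes B C :: "('k::{real_normed_field,euclidean_space}, 'd::{finite,linorder}) sqmatrix"
  assumes "Bi ** B = mat 1" "Ci ** C = mat 1"
  shows "\<exists>m>0. \<forall>A L s M L' s' M'. cartan_decomposition A L s M \<longrightarrow> cartan_decomposition (B ** A ** C) L' s' M' \<longrightarrow>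
    (\<forall>k\<in>{1..CARD('d)}. m * s k \<le> s' k \<and> m * s' k \<le> s k)"
proof -
  have inv': "B ** Bi = mat 1" "C ** Ci = mat 1" using assms by (simp_all add: matrix_left_right_inverse)
  obtain b where b: "b > 0" "\<And>x. b * norm x \<le> norm (B *v x)" using invertible_lower_bound[OF assms(1)] by blast
  obtain c where c: "c > 0" "\<And>x. c * norm x \<le> norm (C *v x)" using invertible_lower_bound[OF assms(2)] by blast
  obtain b' where b': "b' > 0" "\<And>x. b' * norm x \<le> norm (Bi *v x)" using invertible_lower_bound[OF inv'(1)] by blast
  obtain c' where c': "c' > 0" "\<And>x. c' * norm x \<le> norm (Ci *v x)" using invertible_lower_bound[OF inv'(2)] by blast
  define m where "m = min (b * c) (b' * c')"
  have m: "m > 0" using b c b' c' by (simp add: m_def)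
  have "m * s k \<le> s' k \<and> m * s' k \<le> s k"
    if A: "cartan_decomposition A L s M" and A': "cartan_decomposition (B ** A ** C) L' s' M'" and k: "k \<in> {1..CARD('d)}" for A L s M L' s' M' k
  proof
    have pos: "0 < s k" "0 < s' k" using cartan_pos[OF A k] cartan_pos[OF A' k] .
    have "m * s k \<le> (b * c) * s k" using pos by (intro mult_right_mono) (auto simp: m_def)
    also have "\<dots> \<le> s' k" using sing_val_mult_ge[OF A A' k _ b(2) _ c(2) assms(2) inv'(2)] b c by simp
    finally show "m * s k \<le> s' k" .
    have "Bi ** (B ** A ** C) ** Ci = A" using assms inv' by (metis matrix_mul_assoc matrix_mul_lid matrix_mul_rid)
    then have A1: "cartan_decomposition (Bi ** (B ** A ** C) ** Ci) L s M" using A by simp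
    have "m * s' k \<le> (b' * c') * s' k" using pos by (intro mult_right_mono) (auto simp: m_def)
    also have "\<dots> \<le> s k" using sing_val_mult_ge[OF A' A1 k _ b'(2) _ c'(2) inv'(2) assms(2)] b' c' by simp
    finally show "m * s' k \<le> s k" .
  qed
  then show ?thesis using m by blast
qed

context hypertransverse_group
begin

definition point_of :: "(nat \<Rightarrow> ('k, 'd) vec set) \<Rightarrow> ('k, 'd) vec \<Rightarrow>\<^sub>L ('k, 'd) vec" where
  "point_of F = proj (F 1)"

definition points where "points = point_of ` flag_limits"

text \<open>The line is recovered as the range of its projection, so that the action is a function
  on operators.\<close>

definition act_point :: "('k, 'd) sqmatrix set \<Rightarrow> (('k, 'd) vec \<Rightarrow>\<^sub>L ('k, 'd) vec) \<Rightarrow> ('k, 'd) vec \<Rightarrow>\<^sub>L ('k, 'd) vec" where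
  "act_point g x = proj (act_space g (range (blinfun_apply x)))"

definition attractor :: "('k, 'd) sqmatrix set \<Rightarrow> ('k, 'd) vec \<Rightarrow>\<^sub>L ('k, 'd) vec" where
  "attractor g = proj (U_space 1 g)"

definition attracting where
  "attracting \<gamma> a r \<longleftrightarrow> (\<exists>A L s M L0 M0. framed \<gamma> A L s M L0 M0 \<and> a = point_of (att_flag L0) \<and> r = point_of (rep_flag M0))"

lemma point_of_inject:
  assumes "F \<in> flag_limits" "G \<in> flag_limits"
  shows "point_of F = point_of G \<longleftrightarrow> F = G"
proof
  assume eq: "point_of F = point_of G"
  have "F 1 = G 1"
    by (rule proj_inject[OF flag_limitsD(2)[OF assms(1) one_in] flag_limitsD(2)[OF assms(2) one_in], THEN iffD1])
       (rule eq[unfolded point_of_def])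
  then show "F = G" by (rule flag_limits_inject1[OF assms])
qed simp

lemma act_point_line:
  assumes "g \<in> \<Gamma>" "lift_of g A"
  shows "act_point g (proj (line v)) = proj (line (A *v v))"
proof -
  have "A \<in> g" using assms(2) by (simp add: lift_of_def)
  then show ?thesis
    unfolding act_point_def range_proj[OF line_subspace]
    by (subst act_space_eq[OF \<Gamma>_carrier[OF assms(1)] _ line_subspace]) (auto simp: image_line)
qed

lemma points_choose:
  assumes "\<And>n::nat. X n \<in> points"
  shows "\<exists>F. \<forall>n. F n \<in> flag_limits \<and> X n = point_of (F n)"
proof -
  have "\<forall>n. \<exists>F. F \<in> flag_limits \<and> X n = point_of F" using assms unfolding points_def by blast
  then show ?thesis by (rule choice)
qed

lemma flag_limit_line: "F \<in> flag_limits \<Longrightarrow> \<exists>v. v \<noteq> 0 \<and> F 1 = line v"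
  using flag_limitsD(5) projective_space_iff by blast

lemma gap_tends:
  assumes "framed \<gamma> A L s M L0 M0" "k \<in> \<theta>"
  shows "(\<lambda>n. s n (k + 1) / s n k) \<longlonglongrightarrow> 0"
proof -
  note f = framedD[OF assms(1)]
  have "filterlim (\<lambda>n. - alpha k (\<gamma> n)) at_bot sequentially"
    using \<alpha>_tends[OF f(1,4) assms(2)] by (simp add: filterlim_uminus_at_top)
  then have "(\<lambda>n. exp (- alpha k (\<gamma> n))) \<longlonglongrightarrow> 0" by (rule filterlim_compose[OF exp_at_bot])
  then show ?thesis using \<alpha>_eq(2)[OF f(4-6) assms(2)] by simp
qed

text \<open>Both sides at once: left and right multiplication are the cases where one factor is the
  identity.\<close>

lemma framed_mult:
  assumes fr: "framed \<gamma> A L s M L0 M0" and g: "g \<in> \<Gamma>" "lift_of g B" and h: "h \<in> \<Gamma>" "lift_of h C"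
  shows "\<exists>(r :: nat \<Rightarrow> nat) A' L' s' M' L0' M0'. strict_mono r \<and>
    framed (\<lambda>n. g \<otimes>\<^bsub>PGL\<^esub> \<gamma> (r n) \<otimes>\<^bsub>PGL\<^esub> h) A' L' s' M' L0' M0' \<and>
    att_flag L0' = (\<lambda>k\<in>\<theta>. (*v) B ` att_flag L0 k)"
proof -
  interpret PGL: group "PGL :: ('k, 'd) sqmatrix set monoid" by (rule group_PGL)
  note f = framedD[OF fr]
  note c = \<Gamma>_carrier[OF g(1)] \<Gamma>_carrier[OF h(1)] \<Gamma>_carrier[OF f(4)]
  have 1: "inj (\<lambda>n. g \<otimes>\<^bsub>PGL\<^esub> \<gamma> n \<otimes>\<^bsub>PGL\<^esub> h)"
    using f(1) c by (auto simp: inj_def)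
  have 2: "g \<otimes>\<^bsub>PGL\<^esub> \<gamma> n \<otimes>\<^bsub>PGL\<^esub> h \<in> \<Gamma>" for n using \<Gamma>_mult f(4) g h by blast
  have 3: "lift_of (g \<otimes>\<^bsub>PGL\<^esub> \<gamma> n \<otimes>\<^bsub>PGL\<^esub> h) (B ** A n ** C)" for n
    using c g(2) h(2) f(5) by (intro lift_mult PGL.m_closed)
  obtain r L' s' M' L0' M0' where r: "strict_mono (r :: nat \<Rightarrow> nat)"
    "framed (\<lambda>n. g \<otimes>\<^bsub>PGL\<^esub> \<gamma> (r n) \<otimes>\<^bsub>PGL\<^esub> h) (\<lambda>n. B ** A (r n) ** C) L' s' M' L0' M0'"
    using framed_ex_lift[OF 1 2 3] by blast
  have fs: "framed (\<lambda>n. \<gamma> (r n)) (\<lambda>n. A (r n)) (\<lambda>n. L (r n)) (\<lambda>n. s (r n)) (\<lambda>n. M (r n)) L0 M0"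
    using framed_subseq[OF fr r(1)] .
  note f' = framedD[OF r(2)] and fs' = framedD[OF fs]
  have "invertible B" "invertible C" using in_PGL(2) c g(2) h(2) unfolding lift_of_def by blast+
  then obtain Bi Ci where inv: "Bi ** B = mat 1" "Ci ** C = mat 1" unfolding invertible_def by blast
  have "att_flag L0' = (\<lambda>k\<in>\<theta>. (*v) B ` att_flag L0 k)"
    unfolding att_flag_def
  proof (rule restrict_ext)
    fix k assume k: "k \<in> \<theta>"
    show "(*v) L0' ` head_space k = (*v) B ` (\<lambda>k\<in>\<theta>. (*v) L0 ` head_space k) k"
      using tendsto_attracting_space_mult[OF fs'(6,2) f'(6,2) inv \<theta>_range[OF k] gap_tends[OF fs k]] k by simp
  qed
  then show ?thesis using r by blast
qed

lemma lift_one: "\<one>\<^bsub>PGL\<^esub> \<in> \<Gamma>" "lift_of \<one>\<^bsub>PGL\<^esub> (mat 1 :: ('k, 'd) sqmatrix)"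
  using subgroup.one_closed[OF sub] by (auto simp: lift_of_def one_PGL proj_class_self)

lemma \<Gamma>_lift_ex: "g \<in> \<Gamma> \<Longrightarrow> \<exists>A. lift_of g A" using lift_ex \<Gamma>_carrier by blast

lemma act_flag_eq:
  assumes "g \<in> \<Gamma>" "lift_of g B" "F \<in> flag_limits"
  shows "act_flag \<theta> g F = (\<lambda>k\<in>\<theta>. (*v) B ` F k)"
  unfolding act_flag_def
  by (rule restrict_ext) (use act_space_eq[OF \<Gamma>_carrier[OF assms(1)]] assms(2) flag_limitsD(2)[OF assms(3)] in \<open>auto simp: lift_of_def\<close>)

text \<open>If \<open>F\<close> is the attracting flag of a sequence, its image under
  \<open>g\<close> is the attracting flag of the left translates.\<close>

lemma act_flag_limit:
  assumes "g \<in> \<Gamma>" "F \<in> flag_limits"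
  shows "act_flag \<theta> g F \<in> flag_limits" "point_of (act_flag \<theta> g F) = act_point g (point_of F)"
proof -
  obtain B where B: "lift_of g B" using \<Gamma>_lift_ex assms by blast
  obtain \<gamma> A L s M L0 M0 where fr: "framed \<gamma> A L s M L0 M0" "att_flag L0 = F" using flag_limit_framed[OF assms(2)] by blast
  obtain r A' L' s' M' L0' M0' where r: "framed (\<lambda>n. g \<otimes>\<^bsub>PGL\<^esub> \<gamma> (r n) \<otimes>\<^bsub>PGL\<^esub> \<one>\<^bsub>PGL\<^esub>) A' L' s' M' L0' M0'"
    "att_flag L0' = (\<lambda>k\<in>\<theta>. (*v) B ` att_flag L0 k)"
    using framed_mult[OF fr(1) assms(1) B lift_one] by blast
  then have "att_flag L0' = act_flag \<theta> g F" using act_flag_eq[OF assms(1) B assms(2)] fr(2) by simp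
  then show "act_flag \<theta> g F \<in> flag_limits" using framed_att_limit[OF r(1)] by simp
  obtain v where v: "F 1 = line v" using flag_limit_line[OF assms(2)] by blast
  show "point_of (act_flag \<theta> g F) = act_point g (point_of F)"
    unfolding point_of_def act_flag_eq[OF assms(1) B assms(2)] restrict_apply'[OF one_in] v image_line act_point_line[OF assms(1) B] ..
qed

lemma attracting_subseq: "attracting \<gamma> a r \<Longrightarrow> strict_mono t \<Longrightarrow> attracting (\<lambda>n. \<gamma> (t n)) a r"
  unfolding attracting_def using framed_subseq by blast

lemma attracting_inv: "attracting \<gamma> a r \<Longrightarrow> attracting (\<lambda>n. inv\<^bsub>PGL\<^esub> (\<gamma> n)) r a"
  unfolding attracting_def using framed_inverse by metis

lemma attracting_limits: "attracting \<gamma> a r \<Longrightarrow> a \<in> points \<and> r \<in> points"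
  unfolding attracting_def points_def using framed_att_limit framed_rep_limit by blast

lemma attracting_in: "attracting \<gamma> a r \<Longrightarrow> \<gamma> n \<in> \<Gamma>"
  unfolding attracting_def using framedD(4) by blast

lemma attracting_attractor: "attracting \<gamma> a r \<Longrightarrow> (\<lambda>n. attractor (\<gamma> n)) \<longlonglongrightarrow> a"
  unfolding attracting_def attractor_def point_of_def using framed_att one_in att_flag_nth by metis

lemma attracting_exists: "inj \<gamma> \<Longrightarrow> (\<And>n::nat. \<gamma> n \<in> \<Gamma>) \<Longrightarrow> \<exists>t a r. strict_mono (t :: nat \<Rightarrow> nat) \<and> attracting (\<lambda>n. \<gamma> (t n)) a r"
  unfolding attracting_def using framed_ex by metis

lemma limit_attracting: "z \<in> points \<Longrightarrow> \<exists>\<gamma> r. attracting \<gamma> z r"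
  unfolding attracting_def points_def using flag_limit_framed by blast

text \<open>\<open>framed_mult\<close> controls only a subsequence of each subsequence, but always
  with the limit \<open>act_point g a\<close>.\<close>

lemma attractor_mult:
  assumes "attracting \<gamma> a r" "g \<in> \<Gamma>" "h \<in> \<Gamma>"
  shows "(\<lambda>n. attractor (g \<otimes>\<^bsub>PGL\<^esub> \<gamma> n \<otimes>\<^bsub>PGL\<^esub> h)) \<longlonglongrightarrow> act_point g a"
proof (rule tendsto_if_subseq_tendsto)
  fix t :: "nat \<Rightarrow> nat" assume t: "strict_mono t"
  obtain A L s M L0 M0 where fr: "framed (\<lambda>n. \<gamma> (t n)) A L s M L0 M0" and a: "a = point_of (att_flag L0)"
    using attracting_subseq[OF assms(1) t] unfolding attracting_def by blast
  obtain B C where B: "lift_of g B" "lift_of h C" using \<Gamma>_lift_ex assms by blast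
  obtain u A' L' s' M' L0' M0' where u: "strict_mono (u :: nat \<Rightarrow> nat)"
    "framed (\<lambda>n. g \<otimes>\<^bsub>PGL\<^esub> \<gamma> (t (u n)) \<otimes>\<^bsub>PGL\<^esub> h) A' L' s' M' L0' M0'"
    "att_flag L0' = (\<lambda>k\<in>\<theta>. (*v) B ` att_flag L0 k)"
    using framed_mult[OF fr assms(2) B(1) assms(3) B(2)] by blast
  have F: "att_flag L0 \<in> flag_limits" using framed_att_limit[OF fr] .
  have "point_of (att_flag L0') = act_point g a"
    unfolding a u(3) act_flag_limit(2)[OF assms(2) F, symmetric] act_flag_eq[OF assms(2) B(1) F] ..
  moreover have "attracting (\<lambda>n. g \<otimes>\<^bsub>PGL\<^esub> \<gamma> (t (u n)) \<otimes>\<^bsub>PGL\<^esub> h) (point_of (att_flag L0')) (point_of (rep_flag M0'))"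
    unfolding attracting_def using u(2) by blast
  ultimately show "\<exists>s. strict_mono s \<and> (\<lambda>n. attractor (g \<otimes>\<^bsub>PGL\<^esub> \<gamma> (t (s n)) \<otimes>\<^bsub>PGL\<^esub> h)) \<longlonglongrightarrow> act_point g a"
    using attracting_attractor u(1) by metis
qed

lemma \<alpha>_lift:
  assumes "g \<in> \<Gamma>" "lift_of g A" "cartan_decomposition A L s M"
  shows "alpha 1 g = ln (s 1 / s 2)" "exp (- alpha 1 g) = s 2 / s 1" "0 < s 1" "0 < s 2" "s 2 \<le> s 1"
proof -
  show "alpha 1 g = ln (s 1 / s 2)" "exp (- alpha 1 g) = s 2 / s 1" "0 < s 1" "0 < s 2"
    using \<alpha>_eq[OF assms one_in] by (simp_all add: numeral_2_eq_2)
  show "s 2 \<le> s 1" using cartan_antimono[OF assms(3), of 1 2] d_gt_1 by simp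
qed

lemma \<Gamma>_cartan_ex: "g \<in> \<Gamma> \<Longrightarrow> lift_of g A \<Longrightarrow> \<exists>L s M. cartan_decomposition A L s M"
  using in_PGL(2)[OF \<Gamma>_carrier] cartan_decomposition_exists unfolding lift_of_def by blast

lemma \<alpha>_mult_bound:
  assumes "g \<in> \<Gamma>" "h \<in> \<Gamma>"
  shows "\<exists>C. \<forall>x\<in>\<Gamma>. \<bar>alpha 1 (g \<otimes>\<^bsub>PGL\<^esub> x \<otimes>\<^bsub>PGL\<^esub> h) - alpha 1 x\<bar> \<le> C"
proof -
  interpret PGL: group "PGL :: ('k, 'd) sqmatrix set monoid" by (rule group_PGL)
  obtain B C where B: "lift_of g B" "lift_of h C" using \<Gamma>_lift_ex assms by blast
  then have "invertible B" "invertible C" using in_PGL(2) \<Gamma>_carrier assms unfolding lift_of_def by blast+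
  then obtain Bi Ci where inv: "Bi ** B = mat 1" "Ci ** C = mat 1" unfolding invertible_def by blast
  obtain m where m: "m > 0" and sv: "\<And>A L s M L' s' M' k. cartan_decomposition A L s M \<Longrightarrow> cartan_decomposition (B ** A ** C) L' s' M' \<Longrightarrow>
    k \<in> {1..CARD('d)} \<Longrightarrow> m * s k \<le> s' k \<and> m * s' k \<le> s k" using singular_values_comparable[OF inv] by blast
  have k: "1 \<in> {1..CARD('d)}" "2 \<in> {1..CARD('d)}" using d_gt_1 by auto
  \<comment> \<open>Each of the two singular values in the ratio changes at most by the factor
    \<open>m\<close> or its inverse.\<close>
  have "\<bar>alpha 1 (g \<otimes>\<^bsub>PGL\<^esub> x \<otimes>\<^bsub>PGL\<^esub> h) - alpha 1 x\<bar> \<le> - 2 * ln m" if x: "x \<in> \<Gamma>" for x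
  proof -
    obtain A where A: "lift_of x A" using \<Gamma>_lift_ex x by blast
    have y: "g \<otimes>\<^bsub>PGL\<^esub> x \<otimes>\<^bsub>PGL\<^esub> h \<in> \<Gamma>" using \<Gamma>_mult x assms by blast
    have yl: "lift_of (g \<otimes>\<^bsub>PGL\<^esub> x \<otimes>\<^bsub>PGL\<^esub> h) (B ** A ** C)"
      using \<Gamma>_carrier x assms A B by (intro lift_mult PGL.m_closed) blast+
    obtain L s M where c: "cartan_decomposition A L s M" using \<Gamma>_cartan_ex x A by blast
    obtain L' s' M' where c': "cartan_decomposition (B ** A ** C) L' s' M'" using \<Gamma>_cartan_ex y yl by blast
    note a = \<alpha>_lift[OF x A c] and a' = \<alpha>_lift[OF y yl c']
    have "ln (s 1 / s 2) + 2 * ln m \<le> ln (s' 1 / s' 2)"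
      using sv[OF c c' k(1)] sv[OF c c' k(2)] a a' m by (intro ln_ratio_lower) auto
    moreover have "ln (s' 1 / s' 2) + 2 * ln m \<le> ln (s 1 / s 2)"
      using sv[OF c c' k(1)] sv[OF c c' k(2)] a a' m by (intro ln_ratio_lower) auto
    ultimately show ?thesis using a(1) a'(1) by linarith
  qed
  then show ?thesis by blast
qed

text \<open>The projections of one fixed vector \<open>v\<close> to the moving lines are convergent
  spanning vectors; the estimates below are computed with them.\<close>

lemma points_sequence:
  assumes "\<And>n::nat. X n \<in> points" "X \<longlonglongrightarrow> point_of F" "F \<in> flag_limits" "F 1 = line v" "v \<noteq> 0"
  shows "(\<lambda>n. blinfun_apply (X n) v) \<longlonglongrightarrow> v"
    "\<forall>\<^sub>F n in sequentially. X n v \<noteq> 0 \<and> (\<forall>g\<in>\<Gamma>. \<forall>A. lift_of g A \<longrightarrow> act_point g (X n) = proj (line (A *v X n v)))"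
proof -
  obtain G where G: "\<And>n. G n \<in> flag_limits" "\<And>n. X n = proj (G n 1)"
    using points_choose[of X] assms(1) unfolding point_of_def by blast
  have pr: "\<And>n. G n 1 \<in> projective_space" using flag_limitsD(5)[OF G(1)] .
  have lim: "(\<lambda>n. proj (G n 1)) \<longlonglongrightarrow> proj (line v)" using assms(2) unfolding point_of_def assms(4) G(2) .
  note cl = convergent_lines[OF pr lim assms(5)]
  show "(\<lambda>n. blinfun_apply (X n) v) \<longlonglongrightarrow> v" using cl(1) G(2) by simp
  show "\<forall>\<^sub>F n in sequentially. X n v \<noteq> 0 \<and> (\<forall>g\<in>\<Gamma>. \<forall>A. lift_of g A \<longrightarrow> act_point g (X n) = proj (line (A *v X n v)))"
    using cl(2)
  proof eventually_elim
    case (elim n)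
    then have "X n = proj (line (X n v))" "X n v \<noteq> 0" using G(2)[of n] by simp_all
    then show ?case using act_point_line by metis
  qed
qed

text \<open>Vanishing of \<open>head k (M0 *v v)\<close> means that \<open>v\<close> lies in the
  repelling space of dimension \<open>d - k\<close>, which is transverse to
  \<open>F k\<close>.\<close>

lemma head_nonzero:
  assumes "framed \<gamma> A L s M L0 M0" "F \<in> flag_limits" "F \<noteq> rep_flag M0" "k \<in> \<theta>" "v \<in> F k" "head k (M0 *v v) = 0"
  shows "v = 0"
proof -
  have "v \<in> rep_flag M0 (CARD('d) - k)" using assms by (simp add: rep_flag_nth tail_space_def)
  then show ?thesis using transverse_flags_limit[OF assms(2) framed_rep_limit[OF assms(1)] assms(3,4)] assms(5) by blast
qed

lemma act_point_continuous:
  assumes "g \<in> \<Gamma>"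
  shows "continuous_on points (act_point g)"
  unfolding continuous_on_sequentially comp_def
proof (intro allI impI ballI, elim conjE)
  fix X x assume X: "\<forall>n. X n \<in> points" "X \<longlonglongrightarrow> x" and x: "x \<in> points"
  obtain A where A: "lift_of g A" using \<Gamma>_lift_ex assms by blast
  obtain F where F: "F \<in> flag_limits" "x = point_of F" using x unfolding points_def by blast
  obtain v where v: "v \<noteq> 0" "F 1 = line v" using flag_limit_line[OF F(1)] by blast
  have Xn: "X n \<in> points" for n using X(1) by blast
  note p = points_sequence[OF Xn X(2)[unfolded F(2)] F(1) v(2,1)]
  have "invertible A" using in_PGL(2)[OF \<Gamma>_carrier[OF assms]] A unfolding lift_of_def by blast
  then obtain Ai where "Ai ** A = mat 1" unfolding invertible_def by blast
  then have "Ai *v (A *v v) = v" by (simp add: matrix_vector_mul_assoc)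
  then have "A *v v \<noteq> 0" using v(1) by (metis matrix_vector_mult_0_right)
  then have "(\<lambda>n. proj (line (A *v X n v))) \<longlonglongrightarrow> proj (line (A *v v))"
    by (intro tendsto_proj_line tendsto_matrix_vector_mult tendsto_const p(1))
  moreover have "\<forall>\<^sub>F n in sequentially. proj (line (A *v X n v)) = act_point g (X n)"
    using p(2) by eventually_elim (use assms A in simp)
  ultimately have "(\<lambda>n. act_point g (X n)) \<longlonglongrightarrow> proj (line (A *v v))" by (rule Lim_transform_eventually)
  then show "(\<lambda>n. act_point g (X n)) \<longlonglongrightarrow> act_point g x"
    using act_point_line[OF assms A] by (simp add: F(2) point_of_def v(2)[unfolded One_nat_def])
qed

lemma compact_points: "compact points"
  unfolding compact_def
proof (intro allI impI)
  fix X :: "nat \<Rightarrow> _" assume "\<forall>n. X n \<in> points"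
  then obtain F where F: "\<And>n. F n \<in> flag_limits" "\<And>n. X n = point_of (F n)" using points_choose[of X] by blast
  obtain r G where "strict_mono (r :: nat \<Rightarrow> nat)" "G \<in> flag_limits" "\<forall>k\<in>\<theta>. (\<lambda>n. proj (F (r n) k)) \<longlonglongrightarrow> proj (G k)"
    using flag_limits_compact[of F] F(1) by blast
  then show "\<exists>l\<in>points. \<exists>r. strict_mono r \<and> (X \<circ> r) \<longlonglongrightarrow> l"
    using one_in F(2) by (intro bexI[of _ "point_of G"] exI[of _ r]) (auto simp: points_def point_of_def comp_def)
qed

end

lemma eventually_head_lower:
  fixes v :: "nat \<Rightarrow> ('k::{real_normed_field,euclidean_space}, 'd::{finite,linorder}) vec"
  assumes "M \<longlonglongrightarrow> M0" "v \<longlonglongrightarrow> v0" "head k (M0 *v v0) \<noteq> 0"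
  shows "\<exists>h>0. \<forall>\<^sub>F n in sequentially. h < norm (head k (M n *v v n))"
proof -
  have "(\<lambda>n. norm (head k (M n *v v n))) \<longlonglongrightarrow> norm (head k (M0 *v v0))"
    by (intro tendsto_norm tendsto_head tendsto_matrix_vector_mult assms)
  moreover have "norm (head k (M0 *v v0)) / 2 < norm (head k (M0 *v v0))" using assms(3) by simp
  ultimately have "\<forall>\<^sub>F n in sequentially. norm (head k (M0 *v v0)) / 2 < norm (head k (M n *v v n))"
    by (rule order_tendstoD(1))
  then show ?thesis using assms(3) by (intro exI[of _ "norm (head k (M0 *v v0)) / 2"]) auto
qed

lemma eventually_norm_bound:
  fixes v :: "nat \<Rightarrow> 'a::real_normed_vector"
  assumes "v \<longlonglongrightarrow> v0"
  shows "\<forall>\<^sub>F n in sequentially. norm (v n) < norm v0 + 1"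
  by (rule order_tendstoD(2)[OF tendsto_norm[OF assms]]) simp

lemma norm_det_bounded:
  fixes L :: "nat \<Rightarrow> 'k::{real_normed_field,euclidean_space}^'d^'d"
  assumes "L \<longlonglongrightarrow> L0"
  shows "\<exists>C>0. \<forall>n. norm (det (L n)) \<le> C"
proof -
  have "(\<lambda>n. det (L n)) \<longlonglongrightarrow> det L0"
    unfolding det_def by (intro tendsto_intros assms)
  then have "Bseq (\<lambda>n. det (L n))" by (intro convergent_imp_Bseq convergentI)
  then show ?thesis by (auto simp: Bseq_def)
qed

lemma det_diag: "det (diag s :: ('k::{real_normed_field,euclidean_space}, 'd::{finite,linorder}) sqmatrix) = (\<Prod>i\<in>UNIV. of_real (s (index_rank (i::'d))))"
  by (subst det_diagonal) (auto simp: diag_def)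

section \<open>Contraction and separation\<close>

context hypertransverse_group
begin

text \<open>The image vector differs from its component in the attracting line by at most the second
  singular value times its original norm. Away from the repelling hyperplane both are at least a
  constant times the first singular value; the quotient is
  \<open>exp (- alpha 1 (\<gamma> n))\<close> up to a constant.\<close>

lemma attractor_bound:
  assumes n: "attracting \<gamma> a r" and X: "\<And>n. X n \<in> points" "X \<longlonglongrightarrow> x0" "x0 \<in> points" "x0 \<noteq> r"
  shows "\<exists>C. \<forall>\<^sub>F n in sequentially. dist (act_point (\<gamma> n) (X n)) (attractor (\<gamma> n)) \<le> C * exp (- alpha 1 (\<gamma> n))"
proof -
  obtain A L s M L0 M0 where fr: "framed \<gamma> A L s M L0 M0" and r: "r = point_of (rep_flag M0)"
    using n unfolding attracting_def by blast
  note f = framedD[OF fr]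
  obtain F where F: "F \<in> flag_limits" "x0 = point_of F" using X(3) unfolding points_def by blast
  obtain v where v: "v \<noteq> 0" "F 1 = line v" using flag_limit_line[OF F(1)] by blast
  note p = points_sequence[OF X(1) X(2)[unfolded F(2)] F(1) v(2,1)]
  have Fr: "F \<noteq> rep_flag M0" using X(4) r F(2) by blast
  have "v \<in> F 1" using v(2) by simp
  then have "head 1 (M0 *v v) \<noteq> 0" using head_nonzero[OF fr F(1) Fr one_in] v(1) by blast
  from eventually_head_lower[OF f(3) p(1) this]
  obtain h where h: "h > 0" "\<forall>\<^sub>F n in sequentially. h < norm (head 1 (M n *v X n v))" by blast
  have "\<forall>\<^sub>F n in sequentially. dist (act_point (\<gamma> n) (X n)) (attractor (\<gamma> n)) \<le> (4 * (norm v + 1) / h) * exp (- alpha 1 (\<gamma> n))"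
    using p(2) h(2) eventually_norm_bound[OF p(1)] framed_U_space[OF fr one_in]
  proof eventually_elim
    case (elim n)
    \<comment> \<open>The component of the image in the attracting line; being nonzero, it spans
      that line.\<close>
    define w where "w = L n *v head 1 (diag (s n) *v (M n *v X n v))"
    note a = \<alpha>_lift[OF f(4-6), of n]
    have k: "1 \<in> {1..CARD('d)}" using d_gt_1 by simp
    have Av: "s n 1 * h \<le> norm (A n *v X n v)"
    proof -
      have "s n 1 * h \<le> s n 1 * norm (head 1 (M n *v X n v))" using elim a(3) by (intro mult_left_mono) auto
      then show ?thesis using cartan_lower[OF f(6) k, of n "X n v"] by linarith
    qed
    have nw: "s n 1 * h \<le> norm w"
    proof -
      have "s n 1 * h \<le> s n 1 * norm (head 1 (M n *v X n v))" using elim a(3) by (intro mult_left_mono) auto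
      then show ?thesis using norm_diag_head_ge[OF f(6) k, of n "M n *v X n v"] f(7) by (simp add: w_def)
    qed
    have pos: "0 < s n 1 * h" using a(3) h(1) by simp
    have nz: "A n *v X n v \<noteq> 0" "w \<noteq> 0" using pos Av nw by auto
    have "w \<in> (*v) (L n) ` head_space 1" using head_idem_in by (auto simp: w_def)
    moreover have "(*v) (L n) ` head_space 1 \<in> projective_space"
    proof -
      obtain K where "K ** L n = mat 1" using unitary_inverse f(7) by blast
      then show ?thesis using d_gt_1 by (simp add: projective_space_def vec_subspace_image head_space_subspace dim_image_matrix dim_head_space)
    qed
    ultimately have "(*v) (L n) ` head_space 1 = line w" using line_eq_if_in nz(2) by blast
    then have att: "attractor (\<gamma> n) = proj (line w)" using elim(4) by (simp add: attractor_def)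
    have act: "act_point (\<gamma> n) (X n) = proj (line (A n *v X n v))" using elim(1) f(4,5) by blast
    have "norm (A n *v X n v - w) \<le> s n (1 + 1) * norm (X n v)"
      unfolding w_def by (rule cartan_tail[OF f(6) d_gt_1])
    also have "\<dots> \<le> s n 2 * (norm v + 1)" using elim(3) a(4) by (simp add: numeral_2_eq_2)
    finally have d: "norm (A n *v X n v - w) \<le> s n 2 * (norm v + 1)" .
    have "dist (act_point (\<gamma> n) (X n)) (attractor (\<gamma> n)) \<le>
      2 * (norm (A n *v X n v - w) / norm (A n *v X n v) + norm (A n *v X n v - w) / norm w)"
      unfolding att act by (rule dist_proj_line_le[OF nz])
    also have "\<dots> \<le> 2 * (s n 2 * (norm v + 1) / (s n 1 * h) + s n 2 * (norm v + 1) / (s n 1 * h))"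
      using d Av nw pos a(4) by (intro mult_left_mono add_mono frac_le) auto
    also have "\<dots> = (4 * (norm v + 1) / h) * (s n 2 / s n 1)" by simp
    finally show ?case unfolding a(2) .
  qed
  then show ?thesis by blast
qed

text \<open>The kernel of \<open>head q\<close> after \<open>M0\<close> is the repelling space of
  dimension \<open>d - q\<close>; modulo it, the two lines stay independent by the direct sum
  condition.\<close>

lemma independent_mod_repeller:
  assumes fr: "framed \<gamma> A L s M L0 M0" and F: "F \<in> flag_limits" "F \<noteq> rep_flag M0" "F 1 = line v" "v \<noteq> 0"
    and G: "G \<in> flag_limits" "G \<noteq> rep_flag M0" "G 1 = line w" "w \<noteq> 0" and FG: "F \<noteq> G"
  shows "head q (M0 *v v) \<noteq> 0" "head q (M0 *v w) \<notin> line (head q (M0 *v v))"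
proof -
  have ds: "direct_sum3 (F 1) (G 1) (rep_flag M0 (CARD('d) - q))"
    using hyp F(1,2) G(1,2) FG framed_rep_limit[OF fr] unfolding hypertransverse_wrt_def by metis
  have zero: "a *s v = 0 \<and> b *s w = 0" if "a *s head q (M0 *v v) + b *s head q (M0 *v w) = 0" for a b
  proof -
    define z where "z = 0 - (a *s v + b *s w)"
    have "M0 *v z = 0 - (a *s (M0 *v v) + b *s (M0 *v w))"
      by (simp only: z_def matrix_vector_mult_diff_distrib matrix_vector_right_distrib vector_scalar_commute matrix_vector_mult_0_right)
    then have "head q (M0 *v z) = 0" using that by (simp only: head_scale head_add head_diff head_zero) simp
    then have "z \<in> rep_flag M0 (CARD('d) - q)" using rep_flag_nth[OF q_in] by (simp add: tail_space_def)
    moreover have "a *s v \<in> F 1" "b *s w \<in> G 1" unfolding F(3) G(3) line_eq by blast+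
    moreover have "a *s v + b *s w + z = 0" by (simp add: z_def)
    ultimately show ?thesis using ds unfolding direct_sum3_def by blast
  qed
  show "head q (M0 *v v) \<noteq> 0" using zero[of 1 0] F(4) by auto
  show "head q (M0 *v w) \<notin> line (head q (M0 *v v))"
  proof
    assume "head q (M0 *v w) \<in> line (head q (M0 *v v))"
    then obtain c where "head q (M0 *v w) = c *s head q (M0 *v v)" by (auto simp: line_eq)
    then have "(- c) *s head q (M0 *v v) + 1 *s head q (M0 *v w) = 0" by simp
    then show False using zero[of "- c" 1] G(4) by simp
  qed
qed

text \<open>The distance of two lines is at least the relative distance of \<open>y\<close> from the
  line of \<open>x\<close>. Here \<open>y - c *s x\<close> is the image of a vector whose truncation
  to \<open>q\<close> coordinates is bounded below, so its norm is at least a constant times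
  singular value number \<open>q\<close>, while \<open>norm y\<close> is at most a constant times
  the first.\<close>

lemma separation:
  assumes n: "attracting \<gamma> a r" and X: "\<And>n. X n \<in> points" "X \<longlonglongrightarrow> x0" "x0 \<in> points" "x0 \<noteq> r"
    and Y: "\<And>n. Y n \<in> points" "Y \<longlonglongrightarrow> y0" "y0 \<in> points" "y0 \<noteq> r" and xy: "x0 \<noteq> y0"
  shows "\<exists>c>0. \<forall>\<^sub>F n in sequentially. c * exp (- alpha 1 (\<gamma> n)) \<le> dist (act_point (\<gamma> n) (X n)) (act_point (\<gamma> n) (Y n))"
proof -
  obtain A L s M L0 M0 where fr: "framed \<gamma> A L s M L0 M0" and r: "r = point_of (rep_flag M0)"
    using n unfolding attracting_def by blast
  note f = framedD[OF fr]
  obtain F where F: "F \<in> flag_limits" "x0 = point_of F" using X(3) unfolding points_def by blast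
  obtain G where G: "G \<in> flag_limits" "y0 = point_of G" using Y(3) unfolding points_def by blast
  obtain v where v: "v \<noteq> 0" "F 1 = line v" using flag_limit_line[OF F(1)] by blast
  obtain w where w: "w \<noteq> 0" "G 1 = line w" using flag_limit_line[OF G(1)] by blast
  note p = points_sequence[OF X(1) X(2)[unfolded F(2)] F(1) v(2,1)]
  note p' = points_sequence[OF Y(1) Y(2)[unfolded G(2)] G(1) w(2,1)]
  have "F \<noteq> rep_flag M0" "G \<noteq> rep_flag M0" "F \<noteq> G" using X(4) Y(4) r F(2) G(2) xy by blast+
  note ind = independent_mod_repeller[OF fr F(1) this(1) v(2,1) G(1) this(2) w(2,1) this(3)]
  define a where "a n = head q (M n *v X n v)" for n
  define b where "b n = head q (M n *v Y n w)" for n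
  define a0 where "a0 = head q (M0 *v v)"
  define b0 where "b0 = head q (M0 *v w)"
  have al: "a \<longlonglongrightarrow> a0" "b \<longlonglongrightarrow> b0" unfolding a_def b_def a0_def b0_def
    by (intro tendsto_head tendsto_matrix_vector_mult f(3) p(1) p'(1))+
  have "(\<lambda>n. norm (b n - proj (line (a n)) (b n))) \<longlonglongrightarrow> norm (b0 - proj (line a0) b0)"
    using ind(1) by (intro tendsto_intros al tendsto_proj_line) (simp add: a0_def)
  moreover have pos: "norm (b0 - proj (line a0) b0) > 0"
  proof -
    have "proj (line a0) b0 \<noteq> b0" using ind(2) proj_eq_iff_in[of "line a0" b0] by (simp add: a0_def b0_def)
    then show ?thesis by simp
  qed
  define \<kappa> where "\<kappa> = norm (b0 - proj (line a0) b0) / 2"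
  have \<kappa>: "\<kappa> > 0" "\<kappa> < norm (b0 - proj (line a0) b0)" using pos by (auto simp: \<kappa>_def)
  ultimately have ev: "\<forall>\<^sub>F n in sequentially. \<kappa> < norm (b n - proj (line (a n)) (b n))"
    by (intro order_tendstoD(1)) auto
  have q1: "q \<in> {1..CARD('d)}" using \<theta>_range[OF q_in] by simp
  have "\<forall>\<^sub>F n in sequentially. (\<kappa> / (norm w + 1)) * exp (- alpha 1 (\<gamma> n)) \<le> dist (act_point (\<gamma> n) (X n)) (act_point (\<gamma> n) (Y n))"
    using p(2) p'(2) ev eventually_norm_bound[OF p'(1)]
  proof eventually_elim
    case (elim n)
    note al = \<alpha>_lift[OF f(4-6), of n]
    define x where "x = A n *v X n v"
    define y where "y = A n *v Y n w"
    have act: "act_point (\<gamma> n) (X n) = proj (line x)" "act_point (\<gamma> n) (Y n) = proj (line y)"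
      using elim(1,2) f(4,5) by (auto simp: x_def y_def)
    have "proj (line x) y \<in> line x" by (rule proj_in) simp
    \<comment> \<open>\<open>c\<close> depends on \<open>n\<close> and is not controlled; the bound
      \<open>\<kappa>\<close> concerns the distance of \<open>b n\<close> from the whole line of
      \<open>a n\<close>.\<close>
    then obtain c where c: "proj (line x) y = c *s x" by (auto simp: line_eq)
    have "c *s a n \<in> line (a n)" by (auto simp: line_eq)
    then have "\<kappa> \<le> norm (b n - c *s a n)"
      using elim(3) norm_minus_proj_le[OF line_subspace, of "c *s a n" "a n" "b n"] by linarith
    then have "s n q * \<kappa> \<le> s n q * norm (b n - c *s a n)" using cartan_pos[OF f(6) q1, of n] by simp
    also have "b n - c *s a n = head q (M n *v (Y n w - c *s X n v))"
      by (simp add: a_def b_def head_diff head_scale matrix_vector_mult_diff_distrib vector_scalar_commute)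
    also have "s n q * norm \<dots> \<le> norm (A n *v (Y n w - c *s X n v))" by (rule cartan_lower[OF f(6) q1])
    also have "A n *v (Y n w - c *s X n v) = y - c *s x"
      by (simp add: x_def y_def matrix_vector_mult_diff_distrib vector_scalar_commute)
    also have "norm (y - c *s x) \<le> dist (proj (line x)) (proj (line y)) * norm y"
      unfolding c[symmetric] by (rule dist_proj_lower) simp_all
    also have "\<dots> \<le> dist (proj (line x)) (proj (line y)) * (s n 1 * (norm w + 1))"
    proof (rule mult_left_mono)
      have "norm y \<le> s n 1 * norm (Y n w)" unfolding y_def by (rule cartan_upper[OF f(6)])
      also have "\<dots> \<le> s n 1 * (norm w + 1)" using elim(4) al(3) by (intro mult_left_mono) auto
      finally show "norm y \<le> s n 1 * (norm w + 1)" .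
    qed simp
    \<comment> \<open>The equality of the singular values with indices 2 and \<open>q\<close> turns
      the bound into one in terms of \<open>alpha 1\<close>.\<close>
    finally have "s n 2 * \<kappa> \<le> dist (proj (line x)) (proj (line y)) * (s n 1 * (norm w + 1))"
      using s2_eq_sq[OF f(4-6), of n] by simp
    then have "(s n 2 * \<kappa>) / (s n 1 * (norm w + 1)) \<le> dist (proj (line x)) (proj (line y))"
      using al(3) by (subst pos_divide_le_eq) (auto intro!: mult_pos_pos add_nonneg_pos)
    then show ?case unfolding act al(2) by (simp add: mult.commute)
  qed
  then show ?thesis using \<kappa>(1) by (intro exI[of _ "\<kappa> / (norm w + 1)"]) (auto intro!: divide_pos_pos add_nonneg_pos)
qed

section \<open>Coarse additivity\<close>

text \<open>On the preimage of \<open>head_space k\<close> under \<open>M'\<close>, the second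
  factor stretches by at least \<open>s' k\<close>; the image has a definite component in the first
  \<open>k\<close> coordinates for \<open>M\<close>, which the first factor stretches by at least
  \<open>s k\<close>.\<close>

lemma sing_val_product_lower:
  fixes A A' :: "('k, 'd) sqmatrix"
  assumes c: "cartan_decomposition A L s M" "cartan_decomposition A' L' s' M'" "cartan_decomposition (A ** A') L'' s'' M''"
    and k: "k \<in> {1..CARD('d)}" and \<kappa>: "\<kappa> > 0" "\<And>u. u \<in> head_space k \<Longrightarrow> \<kappa> * norm u \<le> norm (head k ((M ** L') *v u))"
  shows "\<kappa> * (s k * s' k) \<le> s'' k"
proof (rule sing_val_ge[OF c(3) k])
  obtain N where N: "M' ** N = mat 1" "N ** M' = mat 1" using unitary_inverse cartan_unitary[OF c(2)] by blast
  show "vec.subspace ((*v) M' -` head_space k)" by (intro vec_subspace_vimage head_space_subspace)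
  show "k \<le> vec.dim ((*v) M' -` head_space k)" using k by (simp add: dim_vimage_matrix[OF N(2,1)] dim_head_space)
  have pos: "0 < s k" "0 < s' k" using cartan_pos[OF c(1) k] cartan_pos[OF c(2) k] .
  fix w assume "w \<in> (*v) M' -` head_space k"
  then have w: "head k (M' *v w) = M' *v w" by (simp add: head_space_def)
  define u where "u = diag s' *v (M' *v w)"
  have uh: "u \<in> head_space k" using w by (simp add: u_def head_space_def head_diag)
  have A'w: "A' *v w = L' *v u" by (simp add: cartan_apply[OF c(2)] u_def)
  have "s' k * norm w \<le> norm (A' *v w)" using cartan_lower[OF c(2) k, of w] w cartan_unitary[OF c(2)] by simp
  then have nu: "s' k * norm w \<le> norm u" using A'w cartan_unitary[OF c(2)] by simp
  have "\<kappa> * (s k * s' k) * norm w = s k * (\<kappa> * (s' k * norm w))" by (simp add: mult_ac)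
  also have "\<dots> \<le> s k * (\<kappa> * norm u)" using nu pos \<kappa>(1) by (intro mult_left_mono) auto
  also have "\<dots> \<le> s k * norm (head k (M *v (A' *v w)))"
    using \<kappa>(2)[OF uh] pos by (intro mult_left_mono) (auto simp: A'w matrix_vector_mul_assoc)
  also have "\<dots> \<le> norm (A *v (A' *v w))" by (rule cartan_lower[OF c(1) k])
  finally show "\<kappa> * (s k * s' k) * norm w \<le> norm ((A ** A') *v w)" by (simp add: matrix_vector_mul_assoc)
qed

text \<open>The test space has codimension 1: the vectors that \<open>A'\<close> maps into the
  directions which \<open>A\<close> stretches at most by \<open>s 2\<close>. Transversality shows
  that \<open>A'\<close> itself stretches them at most by a multiple of \<open>s' 2\<close>.\<close>

lemma sing_val_product_upper:
  fixes A A' :: "('k, 'd) sqmatrix"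
  assumes c: "cartan_decomposition A L s M" "cartan_decomposition A' L' s' M'" "cartan_decomposition (A ** A') L'' s'' M''"
    and \<kappa>: "\<kappa> > 0" "\<And>u. u \<in> head_space 1 \<Longrightarrow> \<kappa> * norm u \<le> norm (head 1 ((M ** L') *v u))" and inv: "invertible A'"
  shows "s'' 2 \<le> (1 / \<kappa> + 1) * (s 2 * s' 2)"
proof (rule sing_val_le[OF c(3)])
  obtain N where N: "M ** N = mat 1" "N ** M = mat 1" using unitary_inverse cartan_unitary[OF c(1)] by blast
  obtain B where B: "A' ** B = mat 1" "B ** A' = mat 1" using inv unfolding invertible_def by blast
  show "2 \<in> {1..CARD('d)}" using d_gt_1 by simp
  show "vec.subspace ((*v) A' -` ((*v) M -` tail_space 1))" by (intro vec_subspace_vimage tail_space_subspace)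
  show "CARD('d) < vec.dim ((*v) A' -` ((*v) M -` tail_space 1)) + 2"
    using d_gt_1 by (simp add: dim_vimage_matrix[OF B(2,1)] dim_vimage_matrix[OF N(2,1)] dim_tail_space)
  have k2: "2 \<in> {1..CARD('d)}" using d_gt_1 by simp
  have pos: "0 < s 2" "0 < s' 2" using cartan_pos[OF c(1) k2] cartan_pos[OF c(2) k2] .
  fix w assume "w \<in> (*v) A' -` ((*v) M -` tail_space 1)"
  then have w: "head 1 (M *v (A' *v w)) = 0" by (simp add: tail_space_def)
  define h where "h = head 1 (diag s' *v (M' *v w))"
  have hh: "h \<in> head_space 1" by (simp add: h_def head_idem_in)
  define e where "e = A' *v w - L' *v h"
  have ne: "norm e \<le> s' 2 * norm w"
    using cartan_tail[OF c(2) d_gt_1, of w] by (simp add: e_def h_def numeral_2_eq_2)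
  \<comment> \<open>The image \<open>A' *v w\<close> has no first coordinate after \<open>M\<close>,
    so the contributions of \<open>h\<close> and \<open>e\<close> cancel there; this bounds the
    dominant part \<open>h\<close> by the small part \<open>e\<close>.\<close>
  have "head 1 ((M ** L') *v h) = - head 1 (M *v e)"
  proof -
    have "M *v e = M *v (A' *v w) - (M ** L') *v h"
      by (simp add: e_def matrix_vector_mult_diff_distrib matrix_vector_mul_assoc)
    then show ?thesis using w by (simp add: head_diff)
  qed
  then have "\<kappa> * norm h \<le> norm (head 1 (M *v e))" using \<kappa>(2)[OF hh] by simp
  also have "\<dots> \<le> norm e" using norm_head_le[of 1 "M *v e"] cartan_unitary[OF c(1)] by simp
  finally have "norm h \<le> norm e / \<kappa>" using \<kappa>(1) by (simp add: pos_le_divide_eq mult.commute)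
  moreover have "norm (A' *v w) \<le> norm (L' *v h) + norm e" using norm_triangle_ineq[of "L' *v h" e] by (simp add: e_def)
  ultimately have "norm (A' *v w) \<le> (1 / \<kappa> + 1) * norm e" using cartan_unitary[OF c(2)] by (simp add: distrib_right)
  also have "\<dots> \<le> (1 / \<kappa> + 1) * (s' 2 * norm w)" using ne \<kappa>(1) by (intro mult_left_mono) auto
  finally have A'w: "norm (A' *v w) \<le> (1 / \<kappa> + 1) * (s' 2 * norm w)" .
  have "norm (A *v (A' *v w)) \<le> s (1 + 1) * norm (A' *v w)" by (rule cartan_upper_tail[OF c(1) d_gt_1 w])
  also have "\<dots> \<le> s 2 * ((1 / \<kappa> + 1) * (s' 2 * norm w))"
    using A'w pos by (simp add: numeral_2_eq_2)
  finally show "norm ((A ** A') *v w) \<le> (1 / \<kappa> + 1) * (s 2 * s' 2) * norm w"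
    by (simp add: matrix_vector_mul_assoc mult_ac)
qed

text \<open>Distinctness of \<open>a'\<close> and \<open>r\<close> makes the limit of
  \<open>M n ** L' n\<close> injective on head spaces modulo tails, for the indices 1 and
  \<open>q\<close>. This bounds the first two singular values of the product from both sides by the
  products of those of the factors.\<close>

lemma \<alpha>_add:
  assumes g: "attracting \<gamma> a r" and h: "attracting \<eta> a' r'" and ne: "a' \<noteq> r"
  shows "\<exists>C. \<forall>\<^sub>F n in sequentially. \<bar>alpha 1 (\<gamma> n \<otimes>\<^bsub>PGL\<^esub> \<eta> n) - alpha 1 (\<gamma> n) - alpha 1 (\<eta> n)\<bar> \<le> C"
proof -
  obtain A L s M L0 M0 where fr: "framed \<gamma> A L s M L0 M0" and r: "r = point_of (rep_flag M0)"
    using g unfolding attracting_def by blast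
  obtain A' L' s' M' L0' M0' where fr': "framed \<eta> A' L' s' M' L0' M0'" and a': "a' = point_of (att_flag L0')"
    using h unfolding attracting_def by blast
  note f = framedD[OF fr] and f' = framedD[OF fr']
  have ne': "att_flag L0' \<noteq> rep_flag M0"
  proof
    assume "att_flag L0' = rep_flag M0"
    then have "a' = r" unfolding r a' by simp
    then show False using ne by contradiction
  qed
  have lim: "(\<lambda>n. M n ** L' n) \<longlonglongrightarrow> M0 ** L0'" by (intro tendsto_matrix_mult f(3) f'(2))
  have inj: "u = 0" if "k \<in> \<theta>" "u \<in> head_space k" "head k ((M0 ** L0') *v u) = 0" for k u
  proof -
    have "L0' *v u \<in> att_flag L0' k" using that by (simp add: att_flag_nth)
    then have "L0' *v u = 0"
      using head_nonzero[OF fr framed_att_limit[OF fr'] ne' that(1)] that(3) by (simp add: matrix_vector_mul_assoc)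
    then have "norm u = 0" using unitary_norm[OF f'(9), of u] by simp
    then show ?thesis by simp
  qed
  obtain \<kappa>1 where \<kappa>1: "\<kappa>1 > 0" "\<forall>\<^sub>F n in sequentially. \<forall>u\<in>head_space 1. \<kappa>1 * norm u \<le> norm (head 1 ((M n ** L' n) *v u))"
    using uniform_head_lower_bound[OF lim, of 1] inj[OF one_in] by blast
  obtain \<kappa>q where \<kappa>q: "\<kappa>q > 0" "\<forall>\<^sub>F n in sequentially. \<forall>u\<in>head_space q. \<kappa>q * norm u \<le> norm (head q ((M n ** L' n) *v u))"
    using uniform_head_lower_bound[OF lim, of q] inj[OF q_in] by blast
  have k: "1 \<in> {1..CARD('d)}" "q \<in> {1..CARD('d)}" using d_gt_1 \<theta>_range[OF q_in] by auto
  define K where "K = 1 / \<kappa>1 + 1"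
  have K: "K > 0" using \<kappa>1(1) by (simp add: K_def add_pos_pos)
  have "\<forall>\<^sub>F n in sequentially. \<bar>alpha 1 (\<gamma> n \<otimes>\<^bsub>PGL\<^esub> \<eta> n) - alpha 1 (\<gamma> n) - alpha 1 (\<eta> n)\<bar> \<le> \<bar>ln (\<kappa>1 / K)\<bar> + \<bar>ln \<kappa>q\<bar>"
    using \<kappa>1(2) \<kappa>q(2)
  proof eventually_elim
    case (elim n)
    have gh: "\<gamma> n \<otimes>\<^bsub>PGL\<^esub> \<eta> n \<in> \<Gamma>" using \<Gamma>_mult f(4) f'(4) by blast
    have l: "lift_of (\<gamma> n \<otimes>\<^bsub>PGL\<^esub> \<eta> n) (A n ** A' n)" using lift_mult \<Gamma>_carrier f(4,5) f'(4,5) by blast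
    obtain L'' s'' M'' where c: "cartan_decomposition (A n ** A' n) L'' s'' M''" using \<Gamma>_cartan_ex gh l by blast
    have invA': "invertible (A' n)" using in_PGL(2)[OF \<Gamma>_carrier[OF f'(4)]] f'(5) unfolding lift_of_def by blast
    note a = \<alpha>_lift[OF f(4-6), of n] and a' = \<alpha>_lift[OF f'(4-6), of n] and a'' = \<alpha>_lift[OF gh l c]
    note cc = f(6)[of n] f'(6)[of n] c
    have 1: "\<kappa>1 * (s n 1 * s' n 1) \<le> s'' 1" using sing_val_product_lower[OF cc k(1) \<kappa>1(1)] elim(1) by blast
    \<comment> \<open>Index 2 need not belong to \<open>\<theta>\<close>, so transversality is used
      at index \<open>q\<close>, and the equality of singular values carries the bound over to all
      three matrices.\<close>
    have 2: "\<kappa>q * (s n 2 * s' n 2) \<le> s'' 2"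
      using sing_val_product_lower[OF cc k(2) \<kappa>q(1)] elim(2) s2_eq_sq[OF f(4-6), of n] s2_eq_sq[OF f'(4-6), of n] s2_eq_sq[OF gh l c] by simp
    have 3: "s'' 2 \<le> K * (s n 2 * s' n 2)" unfolding K_def
      using sing_val_product_upper[OF cc \<kappa>1(1) _ invA'] elim(1) by blast
    have 4: "s'' 1 \<le> s n 1 * s' n 1"
    proof (rule sing_val_le[OF c k(1) vec.subspace_UNIV])
      show "CARD('d) < vec.dim (UNIV :: ('k, 'd) vec set) + 1" by (simp only: vec_dim_card)
      fix w :: "('k, 'd) vec"
      have "norm (A n *v (A' n *v w)) \<le> s n 1 * norm (A' n *v w)" by (rule cartan_upper[OF f(6)])
      also have "\<dots> \<le> s n 1 * (s' n 1 * norm w)" using cartan_upper[OF f'(6), of n w] a(3) by simp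
      finally show "norm ((A n ** A' n) *v w) \<le> s n 1 * s' n 1 * norm w" by (simp add: matrix_vector_mul_assoc)
    qed
    have pos: "0 < s n 1 * s' n 1" "0 < s n 2 * s' n 2" using a a' by auto
    have sum: "alpha 1 (\<gamma> n) + alpha 1 (\<eta> n) = ln ((s n 1 * s' n 1) / (s n 2 * s' n 2))"
      using a a' by (simp add: ln_div ln_mult)
    have "s'' 1 / s'' 2 \<le> (s n 1 * s' n 1) / (\<kappa>q * (s n 2 * s' n 2))"
      using 4 2 pos \<kappa>q(1) by (intro frac_le) auto
    then have "ln (s'' 1 / s'' 2) \<le> ln ((s n 1 * s' n 1) / (\<kappa>q * (s n 2 * s' n 2)))" using a'' by (intro ln_mono) auto
    also have "\<dots> = ln ((s n 1 * s' n 1) / (s n 2 * s' n 2)) - ln \<kappa>q" using a(3,4) a'(3,4) \<kappa>q(1) by (simp add: ln_div ln_mult)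
    finally have up: "alpha 1 (\<gamma> n \<otimes>\<^bsub>PGL\<^esub> \<eta> n) \<le> alpha 1 (\<gamma> n) + alpha 1 (\<eta> n) - ln \<kappa>q" using a''(1) sum by simp
    have "(\<kappa>1 * (s n 1 * s' n 1)) / (K * (s n 2 * s' n 2)) \<le> s'' 1 / s'' 2"
      using 1 3 pos \<kappa>1(1) K a'' by (intro frac_le) auto
    then have "ln ((\<kappa>1 * (s n 1 * s' n 1)) / (K * (s n 2 * s' n 2))) \<le> ln (s'' 1 / s'' 2)"
      using pos \<kappa>1(1) K by (intro ln_mono) (auto intro!: divide_pos_pos mult_pos_pos)
    also have "ln ((\<kappa>1 * (s n 1 * s' n 1)) / (K * (s n 2 * s' n 2))) = ln ((s n 1 * s' n 1) / (s n 2 * s' n 2)) + ln (\<kappa>1 / K)"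
      using a(3,4) a'(3,4) \<kappa>1(1) K by (simp add: ln_div ln_mult)
    finally have low: "alpha 1 (\<gamma> n) + alpha 1 (\<eta> n) + ln (\<kappa>1 / K) \<le> alpha 1 (\<gamma> n \<otimes>\<^bsub>PGL\<^esub> \<eta> n)" using a''(1) sum by simp
    show ?case using up low by linarith
  qed
  then show ?thesis by blast
qed

text \<open>Since the determinant has modulus 1, up to constants
  \<open>1 \<le> s 2 * s 1 ^ (d - 1)\<close>, and the right side is
  \<open>exp (- alpha 1) * s 1 ^ d\<close>. So \<open>ln (s 1)\<close> grows at least like
  \<open>alpha 1 / d\<close>.\<close>

lemma first_singular_value_tends:
  assumes fr: "framed \<gamma> A L s M L0 M0"
  shows "filterlim (\<lambda>n. ln (s n 1)) at_top sequentially"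
proof -
  note f = framedD[OF fr]
  obtain C1 C2 where C: "C1 > 0" "\<And>n. norm (det (L n)) \<le> C1" "C2 > 0" "\<And>n. norm (det (M n)) \<le> C2"
    using norm_det_bounded[OF f(2)] norm_det_bounded[OF f(3)] by blast
  have "ln (s n 1) \<ge> (alpha 1 (\<gamma> n) - ln (C1 * C2)) / CARD('d)" for n
  proof -
    note a = \<alpha>_lift[OF f(4-6), of n]
    have dA: "A n = L n ** diag (s n) ** M n" using f(6)[of n] by (simp add: cartan_decomposition_def)
    have "1 = norm (det (L n)) * (\<Prod>i\<in>UNIV. s n (index_rank (i::'d))) * norm (det (M n))"
    proof -
      have "norm (of_real (s n (index_rank i)) :: 'k) = s n (index_rank i)" for i :: 'd
        using cartan_pos[OF f(6) index_rank_in[of i], of n] by simp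
      then show ?thesis using f(5)[of n] unfolding lift_of_def dA by (simp add: det_mul norm_mult det_diag prod_norm[symmetric])
    qed
    moreover have "(\<Prod>i\<in>UNIV. s n (index_rank (i::'d))) \<le> s n 2 * s n 1 ^ (CARD('d) - 1)"
    proof -
      obtain j :: 'd where j: "index_rank j = 2" using index_rank_surj[of 2, where 'd='d] d_gt_1 by auto
      have "(\<Prod>i\<in>UNIV. s n (index_rank (i::'d))) = s n (index_rank j) * (\<Prod>i\<in>UNIV - {j}. s n (index_rank i))"
        by (rule prod.remove) auto
      also have "(\<Prod>i\<in>UNIV - {j}. s n (index_rank i)) \<le> (\<Prod>i\<in>UNIV - {j}. s n 1)"
        using cartan_pos[OF f(6) index_rank_in, of n] cartan_antimono[OF f(6), of 1 _ n] index_rank_in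
        by (intro prod_mono) (auto intro: less_imp_le)
      finally show ?thesis using a(4) j by (simp add: card_Diff_singleton mult_left_mono)
    qed
    moreover have P0: "0 < (\<Prod>i\<in>UNIV. s n (index_rank (i::'d)))"
      using cartan_pos[OF f(6) index_rank_in, of n] by (intro prod_pos) auto
    ultimately have "1 \<le> C1 * (s n 2 * s n 1 ^ (CARD('d) - 1)) * C2"
    proof -
      assume 1: "1 = norm (det (L n)) * (\<Prod>i\<in>UNIV. s n (index_rank (i::'d))) * norm (det (M n))"
        and 2: "(\<Prod>i\<in>UNIV. s n (index_rank (i::'d))) \<le> s n 2 * s n 1 ^ (CARD('d) - 1)"
      have "norm (det (L n)) * (\<Prod>i\<in>UNIV. s n (index_rank (i::'d))) * norm (det (M n))
        \<le> C1 * (s n 2 * s n 1 ^ (CARD('d) - 1)) * C2"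
        using C P0 2 a by (intro mult_mono) (auto intro!: mult_nonneg_nonneg less_imp_le)
      then show ?thesis using 1 by simp
    qed
    also have "C1 * (s n 2 * s n 1 ^ (CARD('d) - 1)) * C2 = (C1 * C2) * (s n 2 / s n 1) * s n 1 ^ CARD('d)"
    proof -
      have "s n 1 ^ CARD('d) = s n 1 * s n 1 ^ (CARD('d) - 1)" using d_gt_1 by (metis less_imp_le_nat power_eq_if not_one_le_zero)
      then show ?thesis using a(3) by simp
    qed
    finally have "0 \<le> ln ((C1 * C2) * (s n 2 / s n 1) * s n 1 ^ CARD('d))" by simp
    also have "\<dots> = ln (C1 * C2) - ln (s n 1 / s n 2) + CARD('d) * ln (s n 1)"
      using C(1,3) a(3,4) by (simp add: ln_mult ln_div ln_realpow)
    finally have "alpha 1 (\<gamma> n) - ln (C1 * C2) \<le> CARD('d) * ln (s n 1)" using a(1) by simp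
    then show ?thesis by (simp add: pos_divide_le_eq mult.commute)
  qed
  note low = this
  have "filterlim (\<lambda>n. (- ln (C1 * C2)) + alpha 1 (\<gamma> n)) at_top sequentially"
    by (rule filterlim_tendsto_add_at_top[OF tendsto_const \<alpha>_tends[OF f(1,4) one_in]])
  then have "filterlim (\<lambda>n. (1 / CARD('d)) * ((- ln (C1 * C2)) + alpha 1 (\<gamma> n))) at_top sequentially"
    by (intro filterlim_tendsto_pos_mult_at_top[OF tendsto_const]) auto
  moreover have "(1 / CARD('d)) * ((- ln (C1 * C2)) + alpha 1 (\<gamma> n)) \<le> ln (s n 1)" for n
    using low[of n] by (simp add: diff_divide_distrib algebra_simps)
  ultimately show ?thesis by (rule filterlim_at_top_mono[OF _ always_eventually[OF allI]])
qed

text \<open>\<open>f\<close> is the logarithm of the modulus of the eigenvalue on the fixed line. It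
  does not depend on the lift, as lifts differ by scalars of modulus 1. If the line is away from the
  repelling hyperplane, the eigenvalue is at least a constant times the first singular
  value.\<close>

lemma fixed_point_hom:
  assumes \<xi>: "\<xi> \<in> points" and fixd: "\<And>g. g \<in> \<Gamma> \<Longrightarrow> act_point g \<xi> = \<xi>"
  shows "\<exists>f :: _ \<Rightarrow> real. (\<forall>g\<in>\<Gamma>. \<forall>h\<in>\<Gamma>. f (g \<otimes>\<^bsub>PGL\<^esub> h) = f g + f h) \<and>
    (\<forall>\<gamma> r. attracting \<gamma> \<xi> r \<longrightarrow> r \<noteq> \<xi> \<longrightarrow> filterlim (\<lambda>n. f (\<gamma> n)) at_top sequentially)"
proof -
  obtain F where F: "F \<in> flag_limits" "\<xi> = point_of F" using \<xi> unfolding points_def by blast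
  obtain v where v: "v \<noteq> 0" "F 1 = line v" using flag_limit_line[OF F(1)] by blast
  have \<xi>v: "\<xi> = proj (line v)" unfolding F(2) point_of_def v(2) ..
  define f where "f g = ln (norm ((SOME A. lift_of g A) *v v) / norm v)" for g
  have eig: "\<exists>c. A *v v = c *s v \<and> c \<noteq> 0" if g: "g \<in> \<Gamma>" "lift_of g A" for g A
  proof -
    have "proj (line (A *v v)) = proj (line v)" using fixd[OF g(1)] act_point_line[OF g] \<xi>v by simp
    then have "line (A *v v) = line v" using proj_inject[OF line_subspace line_subspace] by blast
    then obtain c where c: "A *v v = c *s v" using line_self[of "A *v v"] by (auto simp: line_eq)
    obtain B where "B ** A = mat 1" using in_PGL(2)[OF \<Gamma>_carrier[OF g(1)]] g(2) unfolding lift_of_def invertible_def by blast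
    then have "B *v (A *v v) = v" by (simp add: matrix_vector_mul_assoc)
    then have "A *v v \<noteq> 0" using v(1) by (metis matrix_vector_mult_0_right)
    then show ?thesis using c by auto
  qed
  have f_eq: "f g = ln (norm c)" if g: "g \<in> \<Gamma>" "lift_of g A" "A *v v = c *s v" for g A c
  proof -
    define A' where "A' = (SOME A. lift_of g A)"
    have "lift_of g A'" unfolding A'_def using g(2) by (rule someI)
    then obtain e where "norm e = 1" "A' = mat e ** A" using lift_unique[OF \<Gamma>_carrier[OF g(1)] g(2)] by blast
    then have "norm (A' *v v) = norm c * norm v"
      by (simp add: matrix_vector_mul_assoc[symmetric] mat_mult_vec g(3) norm_vector_scalar_mult norm_mult)
    then show ?thesis using v(1) by (simp add: f_def A'_def)
  qed
  have "f (g \<otimes>\<^bsub>PGL\<^esub> h) = f g + f h" if gh: "g \<in> \<Gamma>" "h \<in> \<Gamma>" for g h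
  proof -
    obtain A B where AB: "lift_of g A" "lift_of h B" using \<Gamma>_lift_ex gh by blast
    obtain a b where a: "A *v v = a *s v" "a \<noteq> 0" and b: "B *v v = b *s v" "b \<noteq> 0" using eig gh AB by blast
    have "(A ** B) *v v = (a * b) *s v"
      by (simp add: matrix_vector_mul_assoc[symmetric] a b vector_scalar_commute mult.commute)
    then have "f (g \<otimes>\<^bsub>PGL\<^esub> h) = ln (norm (a * b))"
      using f_eq[OF \<Gamma>_mult[OF gh] lift_mult[OF \<Gamma>_carrier[OF gh(1)] \<Gamma>_carrier[OF gh(2)] AB]] by blast
    then show ?thesis using f_eq[OF gh(1) AB(1) a(1)] f_eq[OF gh(2) AB(2) b(1)] a(2) b(2) by (simp add: norm_mult ln_mult)
  qed
  moreover have "filterlim (\<lambda>n. f (\<gamma> n)) at_top sequentially" if n: "attracting \<gamma> \<xi> r" "r \<noteq> \<xi>" for \<gamma> r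
  proof -
    obtain A L s M L0 M0 where fr: "framed \<gamma> A L s M L0 M0" and r: "r = point_of (rep_flag M0)"
      using n(1) unfolding attracting_def by blast
    note fd = framedD[OF fr]
    have "F \<noteq> rep_flag M0" using n(2) r F(2) by blast
    then have "head 1 (M0 *v v) \<noteq> 0" using head_nonzero[OF fr F(1) _ one_in, of v] v by auto
    from eventually_head_lower[OF fd(3) tendsto_const this]
    obtain h where h: "h > 0" "\<forall>\<^sub>F n in sequentially. h < norm (head 1 (M n *v v))" by blast
    have "\<forall>\<^sub>F n in sequentially. ln (h / norm v) + ln (s n 1) \<le> f (\<gamma> n)"
      using h(2)
    proof eventually_elim
      case (elim n)
      note a = \<alpha>_lift[OF fd(4-6), of n]
      have k: "1 \<in> {1..CARD('d)}" using d_gt_1 by simp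
      obtain c where c: "A n *v v = c *s v" "c \<noteq> 0" using eig[OF fd(4,5)] by blast
      have "s n 1 * h \<le> s n 1 * norm (head 1 (M n *v v))" using elim a(3) by (intro mult_left_mono) auto
      also have "\<dots> \<le> norm (A n *v v)" by (rule cartan_lower[OF fd(6) k])
      also have "\<dots> = norm c * norm v" by (simp add: c norm_vector_scalar_mult)
      finally have "h / norm v * s n 1 \<le> norm c" using v(1) by (simp add: pos_divide_le_eq mult.commute)
      then have "ln (h / norm v * s n 1) \<le> ln (norm c)" using h(1) v(1) a(3) by (intro ln_mono) auto
      moreover have "ln (h / norm v * s n 1) = ln (h / norm v) + ln (s n 1)"
        by (rule ln_mult_pos) (use h(1) v(1) a(3) in simp_all)
      ultimately show ?case using f_eq[OF fd(4,5) c(1)] by linarith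
    qed
    moreover have "filterlim (\<lambda>n. ln (h / norm v) + ln (s n 1)) at_top sequentially"
      by (rule filterlim_tendsto_add_at_top[OF tendsto_const first_singular_value_tends[OF fr]])
    ultimately show ?thesis by (rule filterlim_at_top_mono[rotated])
  qed
  ultimately show ?thesis by blast
qed

end

section \<open>Transfer to the abstract action\<close>

context hypertransverse_group
begin

lemma flag_tendsto_iff:
  assumes "\<And>n. F n \<in> flag_limits" "G \<in> flag_limits"
  shows "flag_tendsto \<theta> F G \<longleftrightarrow> (\<lambda>n. point_of (F n)) \<longlonglongrightarrow> point_of G"
proof -
  have g: "(\<lambda>n. grass_dist (F n k) (G k)) \<longlonglongrightarrow> 0 \<longleftrightarrow> (\<lambda>n. proj (F n k)) \<longlonglongrightarrow> proj (G k)" if "k \<in> \<theta>" for k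
    using grass_dist_eq_dist_proj[OF flag_limitsD(2)[OF assms(1) that] flag_limitsD(2)[OF assms(2) that]]
    by (simp add: tendsto_dist_iff[symmetric])
  show ?thesis
  proof
    assume "flag_tendsto \<theta> F G"
    then show "(\<lambda>n. point_of (F n)) \<longlonglongrightarrow> point_of G"
      unfolding flag_tendsto_def point_of_def using g[OF one_in] one_in by blast
  next
    assume "(\<lambda>n. point_of (F n)) \<longlonglongrightarrow> point_of G"
    then show "flag_tendsto \<theta> F G"
      unfolding flag_tendsto_def using g flag_limits_tendsto[OF assms] by (auto simp only: point_of_def)
  qed
qed

abbreviation \<Gamma>_group :: "('k, 'd) sqmatrix set monoid" where
  "\<Gamma>_group \<equiv> PGL\<lparr>carrier := \<Gamma>\<rparr>"

lemma inv_\<Gamma>_group: "g \<in> \<Gamma> \<Longrightarrow> inv\<^bsub>\<Gamma>_group\<^esub> g = inv\<^bsub>PGL\<^esub> g"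
  using group.m_inv_consistent[OF group_PGL sub] by blast

sublocale dyn: conformal_convergence_action \<Gamma>_group "alpha 1" attractor act_point points attracting
proof (intro conformal_convergence_action.intro conformal_convergence_action_axioms.intro)
  interpret PGL: group "PGL :: ('k, 'd) sqmatrix set monoid" by (rule group_PGL)
  show "group \<Gamma>_group" using subgroup.subgroup_is_group[OF sub group_PGL] .
  show "compact points" by (rule compact_points)
  show "0 \<le> alpha 1 g" if g: "g \<in> carrier \<Gamma>_group" for g
  proof -
    have g: "g \<in> \<Gamma>" using g by simp
    obtain A where A: "lift_of g A" using \<Gamma>_lift_ex g by blast
    obtain L s M where "cartan_decomposition A L s M" using \<Gamma>_cartan_ex g A by blast
    then show ?thesis using \<alpha>_eq(3)[OF g A _ one_in] by blast
  qed
  show "act_point g x \<in> points" if gx: "g \<in> carrier \<Gamma>_group" "x \<in> points" for g x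
  proof -
    obtain F where F: "F \<in> flag_limits" "x = point_of F" using gx(2) unfolding points_def by blast
    have "g \<in> \<Gamma>" using gx(1) by simp
    then show ?thesis using act_flag_limit[OF _ F(1)] F(2) unfolding points_def by (metis imageI)
  qed
  show "act_point (g \<otimes>\<^bsub>\<Gamma>_group\<^esub> h) x = act_point g (act_point h x)"
    if gh: "g \<in> carrier \<Gamma>_group" "h \<in> carrier \<Gamma>_group" and x: "x \<in> points" for g h x
  proof -
    have gh: "g \<in> \<Gamma>" "h \<in> \<Gamma>" using gh by simp_all
    obtain F where F: "F \<in> flag_limits" "x = point_of F" using x unfolding points_def by blast
    obtain v where v: "F 1 = line v" using flag_limit_line[OF F(1)] by blast
    obtain A B where AB: "lift_of g A" "lift_of h B" using \<Gamma>_lift_ex gh by blast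
    have "act_point (g \<otimes>\<^bsub>PGL\<^esub> h) x = proj (line ((A ** B) *v v))"
      unfolding F(2) point_of_def v
      by (rule act_point_line[OF \<Gamma>_mult[OF gh] lift_mult[OF \<Gamma>_carrier[OF gh(1)] \<Gamma>_carrier[OF gh(2)] AB]])
    also have "\<dots> = act_point g (act_point h x)"
      unfolding F(2) point_of_def v act_point_line[OF gh(2) AB(2)] act_point_line[OF gh(1) AB(1)] matrix_vector_mul_assoc ..
    finally show ?thesis by simp
  qed
  show "act_point \<one>\<^bsub>\<Gamma>_group\<^esub> x = x" if x: "x \<in> points" for x
  proof -
    obtain F where F: "F \<in> flag_limits" "x = point_of F" using x unfolding points_def by blast
    obtain v where v: "F 1 = line v" using flag_limit_line[OF F(1)] by blast
    show ?thesis using act_point_line[OF lift_one, of v] unfolding F(2) point_of_def v by simp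
  qed
  show "continuous_on points (act_point g)" if "g \<in> carrier \<Gamma>_group" for g
    using act_point_continuous that by simp
  show "\<gamma> n \<in> carrier \<Gamma>_group" if "attracting \<gamma> a r" for \<gamma> a r n using attracting_in[OF that] by simp
  show "a \<in> points \<and> r \<in> points" if "attracting \<gamma> a r" for \<gamma> a r using attracting_limits[OF that] .
  show "filterlim (\<lambda>n. alpha 1 (\<gamma> n)) at_top sequentially" if "attracting \<gamma> a r" for \<gamma> a r
    using that \<alpha>_tends[OF _ _ one_in] framedD(1,4) unfolding attracting_def by metis
  show "(\<lambda>n. attractor (\<gamma> n)) \<longlonglongrightarrow> a" if "attracting \<gamma> a r" for \<gamma> a r using attracting_attractor[OF that] .
  show "attracting (\<lambda>n. inv\<^bsub>\<Gamma>_group\<^esub> \<gamma> n) r a" if "attracting \<gamma> a r" for \<gamma> a r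
    using attracting_inv[OF that] inv_\<Gamma>_group[OF attracting_in[OF that]] by simp
  show "attracting (\<lambda>n. \<gamma> (t n)) a r" if "attracting \<gamma> a r" "strict_mono t" for \<gamma> a r and t :: "nat \<Rightarrow> nat"
    using attracting_subseq[OF that] .
  show "\<exists>t a r. strict_mono (t :: nat \<Rightarrow> nat) \<and> attracting (\<lambda>n. \<gamma> (t n)) a r" if "inj \<gamma>" "\<And>n. \<gamma> n \<in> carrier \<Gamma>_group" for \<gamma> :: "nat \<Rightarrow> _"
    using attracting_exists[OF that(1)] that(2) by simp
  show "\<exists>C. \<forall>\<^sub>F n in sequentially. dist (act_point (\<gamma> n) (X n)) (attractor (\<gamma> n)) \<le> C * exp (- alpha 1 (\<gamma> n))"
    if "attracting \<gamma> a r" "\<And>n. X n \<in> points" "X \<longlonglongrightarrow> x0" "x0 \<in> points" "x0 \<noteq> r" for \<gamma> a r X x0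
    using attractor_bound[OF that] .
  show "\<exists>c>0. \<forall>\<^sub>F n in sequentially. c * exp (- alpha 1 (\<gamma> n)) \<le> dist (act_point (\<gamma> n) (X n)) (act_point (\<gamma> n) (Y n))"
    if "attracting \<gamma> a r" "\<And>n. X n \<in> points" "X \<longlonglongrightarrow> x0" "x0 \<in> points" "x0 \<noteq> r"
      "\<And>n. Y n \<in> points" "Y \<longlonglongrightarrow> y0" "y0 \<in> points" "y0 \<noteq> r" "x0 \<noteq> y0" for \<gamma> a r X x0 Y y0
    using separation[OF that] .
  show "\<exists>C. \<forall>\<^sub>F n in sequentially. \<bar>alpha 1 (\<gamma> n \<otimes>\<^bsub>\<Gamma>_group\<^esub> \<eta> n) - alpha 1 (\<gamma> n) - alpha 1 (\<eta> n)\<bar> \<le> C"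
    if "attracting \<gamma> a r" "attracting \<eta> a' r'" "a' \<noteq> r" for \<gamma> a r \<eta> a' r'
    using \<alpha>_add[OF that] by simp
  show "\<exists>C. \<forall>h\<in>carrier \<Gamma>_group. \<bar>alpha 1 (g \<otimes>\<^bsub>\<Gamma>_group\<^esub> h) - alpha 1 h\<bar> \<le> C \<and> \<bar>alpha 1 (h \<otimes>\<^bsub>\<Gamma>_group\<^esub> g) - alpha 1 h\<bar> \<le> C"
    if "g \<in> carrier \<Gamma>_group" for g
  proof -
    have g: "g \<in> \<Gamma>" using that by simp
    obtain C1 where C1: "\<And>x. x \<in> \<Gamma> \<Longrightarrow> \<bar>alpha 1 (g \<otimes>\<^bsub>PGL\<^esub> x \<otimes>\<^bsub>PGL\<^esub> \<one>\<^bsub>PGL\<^esub>) - alpha 1 x\<bar> \<le> C1"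
      using \<alpha>_mult_bound[OF g lift_one(1)] by blast
    obtain C2 where C2: "\<And>x. x \<in> \<Gamma> \<Longrightarrow> \<bar>alpha 1 (\<one>\<^bsub>PGL\<^esub> \<otimes>\<^bsub>PGL\<^esub> x \<otimes>\<^bsub>PGL\<^esub> g) - alpha 1 x\<bar> \<le> C2"
      using \<alpha>_mult_bound[OF lift_one(1) g] by blast
    have "\<bar>alpha 1 (g \<otimes>\<^bsub>PGL\<^esub> x) - alpha 1 x\<bar> \<le> max C1 C2 \<and> \<bar>alpha 1 (x \<otimes>\<^bsub>PGL\<^esub> g) - alpha 1 x\<bar> \<le> max C1 C2" if "x \<in> \<Gamma>" for x
      using C1[OF that] C2[OF that] \<Gamma>_carrier[OF that] \<Gamma>_carrier[OF g] by (simp add: le_max_iff_disj)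
    then show ?thesis by auto
  qed
  show "(\<lambda>n. attractor (h \<otimes>\<^bsub>\<Gamma>_group\<^esub> \<gamma> n)) \<longlonglongrightarrow> act_point h a" if "attracting \<gamma> a r" "h \<in> carrier \<Gamma>_group" for \<gamma> a r h
  proof -
    have h: "h \<in> \<Gamma>" using that by simp
    show ?thesis using attractor_mult[OF that(1) h lift_one(1)] \<Gamma>_carrier[OF h] \<Gamma>_carrier[OF attracting_in[OF that(1)]] by simp
  qed
  show "(\<lambda>n. attractor (\<gamma> n \<otimes>\<^bsub>\<Gamma>_group\<^esub> h)) \<longlonglongrightarrow> a" if n: "attracting \<gamma> a r" "h \<in> carrier \<Gamma>_group" for \<gamma> a r h
  proof -
    have h: "h \<in> \<Gamma>" using n by simp
    obtain F where F: "F \<in> flag_limits" "a = point_of F" using attracting_limits[OF n(1)] unfolding points_def by blast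
    obtain v where v: "F 1 = line v" using flag_limit_line[OF F(1)] by blast
    have "act_point \<one>\<^bsub>PGL\<^esub> a = a" using act_point_line[OF lift_one, of v] unfolding F(2) point_of_def v by simp
    then show ?thesis using attractor_mult[OF n(1) lift_one(1) h] \<Gamma>_carrier[OF attracting_in[OF n(1)]] by simp
  qed
  show "\<exists>\<gamma> r. attracting \<gamma> z r" if "z \<in> points" for z using limit_attracting[OF that] .
  show "\<exists>f :: _ \<Rightarrow> real. (\<forall>g\<in>carrier \<Gamma>_group. \<forall>h\<in>carrier \<Gamma>_group. f (g \<otimes>\<^bsub>\<Gamma>_group\<^esub> h) = f g + f h) \<and>
      (\<forall>\<gamma> r. attracting \<gamma> \<xi> r \<longrightarrow> r \<noteq> \<xi> \<longrightarrow> filterlim (\<lambda>n. f (\<gamma> n)) at_top sequentially)"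
    if "\<xi> \<in> points" "\<And>g. g \<in> carrier \<Gamma>_group \<Longrightarrow> act_point g \<xi> = \<xi>" for \<xi>
    using fixed_point_hom[OF that(1)] that(2) by simp
qed

lemma conical_points: "point_of ` conical_limit_set \<theta> \<Gamma> = dyn.conical"
proof -
  have conv: "flag_tendsto \<theta> (\<lambda>n. act_flag \<theta> (\<gamma> n) x) a \<longleftrightarrow> (\<lambda>n. act_point (\<gamma> n) (point_of x)) \<longlonglongrightarrow> point_of a"
    if "range \<gamma> \<subseteq> \<Gamma>" "x \<in> flag_limits" "a \<in> flag_limits" for \<gamma> :: "nat \<Rightarrow> _" and x a
  proof -
    have "\<gamma> n \<in> \<Gamma>" for n using that(1) by blast
    then show ?thesis using flag_tendsto_iff[of "\<lambda>n. act_flag \<theta> (\<gamma> n) x" a] act_flag_limit that(2,3) by simp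
  qed
  show ?thesis
  proof (intro equalityI subsetI)
    fix p assume "p \<in> point_of ` conical_limit_set \<theta> \<Gamma>"
    then obtain x a b \<gamma> where x: "x \<in> flag_limits" "p = point_of x" and ab: "a \<in> flag_limits" "b \<in> flag_limits" "a \<noteq> b"
      and \<gamma>: "inj (\<gamma> :: nat \<Rightarrow> _)" "range \<gamma> \<subseteq> \<Gamma>" "flag_tendsto \<theta> (\<lambda>n. act_flag \<theta> (\<gamma> n) x) a"
        "\<forall>y\<in>flag_limits - {x}. flag_tendsto \<theta> (\<lambda>n. act_flag \<theta> (\<gamma> n) y) b"
      unfolding conical_limit_set_def by blast
    have "(\<lambda>n. act_point (\<gamma> n) y) \<longlonglongrightarrow> point_of b" if y: "y \<in> points - {p}" for y
    proof -
      obtain z where z: "z \<in> flag_limits" "y = point_of z" "z \<noteq> x" using y x(2) unfolding points_def by blast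
      then show ?thesis using \<gamma>(4) conv[OF \<gamma>(2) z(1) ab(2)] by blast
    qed
    moreover have "(\<lambda>n. act_point (\<gamma> n) p) \<longlonglongrightarrow> point_of a" using conv[OF \<gamma>(2) x(1) ab(1)] \<gamma>(3) x(2) by blast
    moreover have "point_of a \<noteq> point_of b" using point_of_inject ab by blast
    moreover have "p \<in> points" "point_of a \<in> points" "point_of b \<in> points" using x ab unfolding points_def by blast+
    ultimately show "p \<in> dyn.conical" unfolding dyn.conical_def using \<gamma>(1,2) by auto
  next
    fix p assume "p \<in> dyn.conical"
    then obtain a' b' \<gamma> where p: "p \<in> points" and ab': "a' \<in> points" "b' \<in> points" "a' \<noteq> b'"
      and \<gamma>: "inj (\<gamma> :: nat \<Rightarrow> _)" "range \<gamma> \<subseteq> \<Gamma>" "(\<lambda>n. act_point (\<gamma> n) p) \<longlonglongrightarrow> a'"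
        "\<forall>y\<in>points - {p}. (\<lambda>n. act_point (\<gamma> n) y) \<longlonglongrightarrow> b'"
      unfolding dyn.conical_def by auto
    obtain x a b where x: "x \<in> flag_limits" "p = point_of x" and ab: "a \<in> flag_limits" "a' = point_of a" "b \<in> flag_limits" "b' = point_of b"
      using p ab' unfolding points_def by blast
    have "flag_tendsto \<theta> (\<lambda>n. act_flag \<theta> (\<gamma> n) y) b" if y: "y \<in> flag_limits - {x}" for y
    proof -
      have "point_of y \<in> points - {p}" using y x point_of_inject unfolding points_def by auto
      then show ?thesis using \<gamma>(4) conv[OF \<gamma>(2) _ ab(3), of y] y ab(4) by blast
    qed
    moreover have "flag_tendsto \<theta> (\<lambda>n. act_flag \<theta> (\<gamma> n) x) a" using conv[OF \<gamma>(2) x(1) ab(1)] \<gamma>(3) x(2) ab(2) by blast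
    moreover have "a \<noteq> b" using ab'(3) ab by blast
    ultimately have "x \<in> conical_limit_set \<theta> \<Gamma>" unfolding conical_limit_set_def using x(1) ab \<gamma>(1,2) by blast
    then show "p \<in> point_of ` conical_limit_set \<theta> \<Gamma>" using x(2) by blast
  qed
qed

end

section \<open>Riemannian distances on projective space\<close>

lemma vector_derivative_quotient:
  assumes "(f has_vector_derivative f') (at x)"
  shows "((\<lambda>h. (f (x + h) - f x) /\<^sub>R h) \<longlongrightarrow> f') (at 0)"
proof (rule LIM_zero_cancel, rule tendsto_norm_zero_cancel)
  have "(\<lambda>h. norm (f (x + h) - f x - h *\<^sub>R f') / norm h) \<midarrow>0\<rightarrow> 0"
    using assms by (simp add: has_vector_derivative_def has_derivative_at)
  moreover have "\<forall>\<^sub>F h in at 0. norm (f (x + h) - f x - h *\<^sub>R f') / norm h = norm ((f (x + h) - f x) /\<^sub>R h - f')"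
    unfolding eventually_at
  proof (intro exI[of _ 1] conjI ballI impI)
    fix h :: real assume "h \<noteq> 0 \<and> dist h 0 < 1"
    then have "(f (x + h) - f x) /\<^sub>R h - f' = (f (x + h) - f x - h *\<^sub>R f') /\<^sub>R h"
      by (simp add: scaleR_diff_right)
    then show "norm (f (x + h) - f x - h *\<^sub>R f') / norm h = norm ((f (x + h) - f x) /\<^sub>R h - f')"
      by (simp add: divide_inverse mult.commute)
  qed simp
  ultimately show "((\<lambda>h. norm ((f (x + h) - f x) /\<^sub>R h - f')) \<longlongrightarrow> 0) (at 0)"
    by (rule Lim_transform_eventually)
qed

lemma inner_scalars:
  fixes v :: "'k::{real_normed_field,euclidean_space}^'d"
  shows "(a *s v) \<bullet> (b *s v) = (a \<bullet> b) * (v \<bullet> v)"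
proof -
  have e: "a *s v + b *s v = (a + b) *s v" by (simp add: vector_sadd_rdistrib)
  have "(a *s v) \<bullet> (b *s v) = ((norm (a + b))\<^sup>2 - (norm a)\<^sup>2 - (norm b)\<^sup>2) / 2 * (norm v)\<^sup>2"
    unfolding dot_norm e norm_vector_scalar_mult power_mult_distrib by (simp add: field_simps)
  moreover have "v \<bullet> v = (norm v)\<^sup>2" by (simp add: power2_norm_eq_inner)
  ultimately show ?thesis by (simp only: dot_norm[of a b])
qed

text \<open>The multiples of \<open>v\<close> by a real basis of the field are an orthogonal real
  basis of the line. The formula shows that the projection is differentiable in
  \<open>v\<close>.\<close>

lemma proj_line_formula:
  fixes v :: "'k::{real_normed_field,euclidean_space}^'d"
  assumes "v \<noteq> 0"
  shows "proj (line v) x = (\<Sum>b\<in>Basis. ((x \<bullet> (b *s v)) / (v \<bullet> v)) *\<^sub>R (b *s v))"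
proof (rule proj_unique[OF line_subspace])
  let ?y = "\<Sum>b\<in>Basis. ((x \<bullet> (b *s v)) / (v \<bullet> v)) *\<^sub>R (b *s v)"
  show "?y \<in> line v"
    using vec_subspace_real[OF line_subspace, of v] by (intro subspace_sum subspace_mul) (auto simp: line_eq)
  fix z assume "z \<in> line v"
  then obtain c where c: "z = c *s v" by (auto simp: line_eq)
  have lin: "linear (\<lambda>c. c *s v)" by (rule linearI) (simp_all add: vector_sadd_rdistrib scaleR_eq_scalar_mult scaleR_conv_of_real)
  have b0: "(x - ?y) \<bullet> (b' *s v) = 0" if b': "b' \<in> Basis" for b'
  proof -
    have "?y \<bullet> (b' *s v) = (\<Sum>b\<in>Basis. (x \<bullet> (b *s v)) * (b \<bullet> b'))"
      using assms by (simp add: inner_sum_left inner_scalars)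
    also have "\<dots> = x \<bullet> (b' *s v)"
      using b' by (simp add: inner_Basis if_distrib[of "\<lambda>y. _ * y"] cong: if_cong)
    finally show ?thesis by (simp add: inner_diff_left)
  qed
  have "c *s v = (\<lambda>c. c *s v) (\<Sum>b\<in>Basis. (c \<bullet> b) *\<^sub>R b)" by (simp add: euclidean_representation)
  also have "\<dots> = (\<Sum>b\<in>Basis. (c \<bullet> b) *\<^sub>R (b *s v))"
    by (simp only: linear_sum[OF lin] linear_scale[OF lin])
  finally show "(x - ?y) \<bullet> z = 0" using b0 by (simp add: c inner_sum_right)
qed

lemma bounded_linear_scalar_mult: "bounded_linear (\<lambda>v :: 'k::{real_normed_field,euclidean_space}^'d. c *s v)"
  unfolding linear_conv_bounded_linear[symmetric]
  by (rule linearI) (simp_all add: vector_add_ldistrib scaleR_eq_scalar_mult mult.commute)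

text \<open>Only the component of the velocity transverse to the line counts. Differentiability
  comes from the formula, the bound from \<open>dist_proj_line_le\<close>; its two quotients have
  the same limit, whence \<open>4 = 2 * 2\<close>.\<close>

lemma proj_line_path_derivative:
  fixes p :: "real \<Rightarrow> 'k::{real_normed_field,euclidean_space}^'d"
  assumes p: "(p has_vector_derivative D) (at t)" and nz: "p t \<noteq> 0"
  shows "\<exists>f'. ((\<lambda>t. \<Sum>b\<in>Basis. ((x \<bullet> (b *s p t)) / (p t \<bullet> p t)) *\<^sub>R (b *s p t)) has_vector_derivative f') (at t) \<and>
    norm f' \<le> 4 * (norm (D - proj (line (p t)) D) / norm (p t)) * norm x"
proof -
  define f where "f t = (\<Sum>b\<in>Basis. ((x \<bullet> (b *s p t)) / (p t \<bullet> p t)) *\<^sub>R (b *s p t))" for t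
  have f_eq: "f t = proj (line (p t)) x" if "p t \<noteq> 0" for t
    using proj_line_formula[OF that] by (simp add: f_def)
  have dp: "p differentiable (at t)" using p by (rule differentiableI_vector)
  have db: "(\<lambda>t. b *s p t) differentiable (at t)" for b
    using bounded_linear.has_vector_derivative[OF bounded_linear_scalar_mult p] by (rule differentiableI_vector)
  have "f differentiable (at t)"
    unfolding f_def using dp db nz
    by (intro differentiable_sum ballI differentiable_scaleR differentiable_divide differentiable_inner differentiable_const) auto
  then obtain f' where f': "(f has_vector_derivative f') (at t)" using vector_derivative_works by blast
  obtain c where c: "proj (line (p t)) D = c *s p t" using proj_in[OF line_subspace, of "p t" D] by (auto simp: line_eq)
  have pc: "((\<lambda>h. p (t + h)) \<longlongrightarrow> p t) (at 0)"
    using has_vector_derivative_continuous[OF p] by (simp add: isCont_def LIM_offset_zero_iff)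
  have cc: "((\<lambda>h. (1 + of_real h * c) *s p t) \<longlongrightarrow> p t) (at 0)"
  proof -
    have "((\<lambda>h. p t + h *\<^sub>R (c *s p t)) \<longlongrightarrow> p t + 0 *\<^sub>R (c *s p t)) (at 0)" by (intro tendsto_intros)
    then show ?thesis by (simp add: vector_sadd_rdistrib scaleR_eq_scalar_mult vector_smult_assoc)
  qed
  \<comment> \<open>The comparison vector \<open>(1 + of_real h * c) *s p t\<close> spans the same
    line as \<open>p t\<close> but follows the component of the velocity along it, so that component
    drops out of the difference.\<close>
  define a where "a h = norm (p (t + h) - (1 + of_real h * c) *s p t)" for h
  have al: "((\<lambda>h. a h / \<bar>h\<bar>) \<longlongrightarrow> norm (D - proj (line (p t)) D)) (at 0)"
  proof -
    have "((\<lambda>h. norm ((p (t + h) - p t) /\<^sub>R h - c *s p t)) \<longlongrightarrow> norm (D - c *s p t)) (at 0)"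
      by (intro tendsto_intros vector_derivative_quotient p)
    moreover have "\<forall>\<^sub>F h in at 0. norm ((p (t + h) - p t) /\<^sub>R h - c *s p t) = a h / \<bar>h\<bar>"
      unfolding eventually_at
    proof (intro exI[of _ 1] conjI ballI impI)
      fix h :: real assume h: "h \<noteq> 0 \<and> dist h 0 < 1"
      have "(1 + of_real h * c) *s p t = p t + h *\<^sub>R (c *s p t)"
        by (simp add: vector_sadd_rdistrib scaleR_eq_scalar_mult vector_smult_assoc)
      then have "p (t + h) - (1 + of_real h * c) *s p t = h *\<^sub>R ((p (t + h) - p t) /\<^sub>R h - c *s p t)"
        using h by (simp add: scaleR_diff_right)
      then have "a h = \<bar>h\<bar> * norm ((p (t + h) - p t) /\<^sub>R h - c *s p t)" unfolding a_def by simp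
      then show "norm ((p (t + h) - p t) /\<^sub>R h - c *s p t) = a h / \<bar>h\<bar>" using h by simp
    qed simp
    ultimately show ?thesis unfolding c by (rule Lim_transform_eventually)
  qed
  have "((\<lambda>h. norm ((f (t + h) - f t) /\<^sub>R h)) \<longlongrightarrow> norm f') (at 0)"
    by (intro tendsto_norm vector_derivative_quotient f')
  moreover have "((\<lambda>h. 2 * ((a h / \<bar>h\<bar>) / norm (p (t + h)) + (a h / \<bar>h\<bar>) / norm ((1 + of_real h * c) *s p t)) * norm x) \<longlongrightarrow>
    2 * (norm (D - proj (line (p t)) D) / norm (p t) + norm (D - proj (line (p t)) D) / norm (p t)) * norm x) (at 0)"
    using nz by (intro tendsto_intros al pc cc) auto
  moreover have "\<forall>\<^sub>F h in at 0. norm ((f (t + h) - f t) /\<^sub>R h) \<le>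
      2 * ((a h / \<bar>h\<bar>) / norm (p (t + h)) + (a h / \<bar>h\<bar>) / norm ((1 + of_real h * c) *s p t)) * norm x"
    using tendsto_imp_eventually_ne[OF pc nz] tendsto_imp_eventually_ne[OF cc nz]
  proof eventually_elim
    case (elim h)
    have "1 + of_real h * c \<noteq> 0"
    proof
      assume "1 + of_real h * c = 0"
      then have "(1 + of_real h * c) *s p t = 0" by (simp only: vector_smult_lzero)
      then show False using elim(2) by contradiction
    qed
    then have "line ((1 + of_real h * c) *s p t) = line (p t)" by (rule line_scale)
    then have "dist (proj (line (p (t + h)))) (proj (line (p t))) \<le> 2 * (a h / norm (p (t + h)) + a h / norm ((1 + of_real h * c) *s p t))"
      using dist_proj_line_le[OF elim] by (simp add: a_def)
    moreover have "norm (f (t + h) - f t) \<le> dist (proj (line (p (t + h)))) (proj (line (p t))) * norm x"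
      using norm_blinfun[of "proj (line (p (t + h))) - proj (line (p t))" x]
      by (simp add: f_eq elim(1) nz blinfun.diff_left dist_norm)
    ultimately have "norm (f (t + h) - f t) \<le> 2 * (a h / norm (p (t + h)) + a h / norm ((1 + of_real h * c) *s p t)) * norm x"
      by (meson mult_right_mono norm_ge_zero order_trans)
    then have "norm (f (t + h) - f t) / \<bar>h\<bar> \<le> 2 * (a h / norm (p (t + h)) + a h / norm ((1 + of_real h * c) *s p t)) * norm x / \<bar>h\<bar>"
      by (rule divide_right_mono) simp
    moreover have "norm ((f (t + h) - f t) /\<^sub>R h) = norm (f (t + h) - f t) / \<bar>h\<bar>"
      by (simp only: norm_scaleR abs_inverse divide_inverse mult.commute)
    moreover have "2 * (y / u + y / w) * z / k = 2 * ((y / k) / u + (y / k) / w) * z" for y u w z k :: real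
      by (simp add: divide_inverse algebra_simps)
    ultimately show ?case by simp
  qed
  ultimately have "norm f' \<le> 2 * (norm (D - proj (line (p t)) D) / norm (p t) + norm (D - proj (line (p t)) D) / norm (p t)) * norm x"
    by (intro tendsto_le[OF _ _ _]) auto
  then have "norm f' \<le> 4 * (norm (D - proj (line (p t)) D) / norm (p t)) * norm x" by simp
  then show ?thesis using f' unfolding f_def by blast
qed

locale riemannian =
  fixes G :: "'k::{real_normed_field,euclidean_space}^'d \<Rightarrow> 'k^'d \<Rightarrow> 'k^'d \<Rightarrow> real"
  assumes G: "riemannian_metric G"
begin

lemma G_bilinear: "v \<noteq> 0 \<Longrightarrow> bilinear (G v)"
  and G_sym: "v \<noteq> 0 \<Longrightarrow> G v w w' = G v w' w"
  and G_nonneg: "v \<noteq> 0 \<Longrightarrow> 0 \<le> G v w w"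
  and G_zero: "v \<noteq> 0 \<Longrightarrow> G v w w = 0 \<longleftrightarrow> w \<in> line v"
  and G_scale: "v \<noteq> 0 \<Longrightarrow> c \<noteq> 0 \<Longrightarrow> G (c *s v) (c *s w) (c *s w') = G v w w'"
  using G unfolding riemannian_metric_def line_def by blast+

section \<open>Comparison of the metric with the norm\<close>

lemma G_expand:
  assumes "v \<noteq> 0"
  shows "G v w w = (\<Sum>i\<in>Basis. \<Sum>j\<in>Basis. (w \<bullet> i) * (w \<bullet> j) * G v i j)"
proof -
  have l: "linear (\<lambda>x. G v x y)" "linear (G v y)" for y using G_bilinear[OF assms] by (auto simp: bilinear_def)
  have "G v w w = G v (\<Sum>i\<in>Basis. (w \<bullet> i) *\<^sub>R i) w" by (simp add: euclidean_representation)
  also have "\<dots> = (\<Sum>i\<in>Basis. (w \<bullet> i) * G v i w)" by (simp add: linear_sum[OF l(1)] linear_scale[OF l(1)])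
  also have "\<dots> = (\<Sum>i\<in>Basis. (w \<bullet> i) * G v i (\<Sum>j\<in>Basis. (w \<bullet> j) *\<^sub>R j))" by (simp add: euclidean_representation)
  also have "\<dots> = (\<Sum>i\<in>Basis. (w \<bullet> i) * (\<Sum>j\<in>Basis. (w \<bullet> j) * G v i j))" by (simp add: linear_sum[OF l(2)] linear_scale[OF l(2)])
  finally show ?thesis by (simp add: sum_distrib_left mult.assoc)
qed

lemma G_continuous: "continuous_on ((- {0}) \<times> UNIV) (\<lambda>(v, w). G v w w)"
proof -
  have c: "continuous_on (- {0}) (\<lambda>v. G v i j)" for i j
  proof -
    have "smooth_fun_on (- {0}) (\<lambda>v. G v i j)" using G by (simp add: riemannian_metric_def)
    then have "\<forall>x\<in>- {0}. (\<lambda>v. G v i j) differentiable (at x)" unfolding smooth_fun_on_def by blast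
    then show ?thesis by (intro continuous_at_imp_continuous_on ballI differentiable_imp_continuous_within) auto
  qed
  have c': "continuous_on ((- {0}) \<times> UNIV) (\<lambda>p :: ('k^'d) \<times> ('k^'d). G (fst p) i j)" for i j
    by (rule continuous_on_compose2[OF c continuous_on_fst[OF continuous_on_id]]) auto
  have "continuous_on ((- {0}) \<times> UNIV) (\<lambda>p. \<Sum>i\<in>Basis. \<Sum>j\<in>Basis. (snd p \<bullet> i) * (snd p \<bullet> j) * G (fst p) i j)"
    by (intro continuous_intros c')
  moreover have "(\<Sum>i\<in>Basis. \<Sum>j\<in>Basis. (snd p \<bullet> i) * (snd p \<bullet> j) * G (fst p) i j) = (\<lambda>(v, w). G v w w) p"
    if "p \<in> (- {0}) \<times> UNIV" for p
    using that G_expand[of "fst p" "snd p"] by (cases p) simp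
  ultimately show ?thesis by (rule continuous_on_eq)
qed

text \<open>A vector on which a semidefinite form vanishes is a minimum of it, and the first
  variation there is zero.\<close>

lemma G_kernel:
  assumes "v \<noteq> 0" "k \<in> line v"
  shows "G v k x = 0"
proof -
  have l: "linear (\<lambda>x. G v x y)" "linear (G v y)" for y using G_bilinear[OF assms(1)] by (auto simp: bilinear_def)
  have "- G v k x = 0"
  proof (rule quadratic_first_variation)
    fix t :: real
    have "0 \<le> G v (k + t *\<^sub>R x) (k + t *\<^sub>R x)" by (rule G_nonneg[OF assms(1)])
    also have "\<dots> = G v k k + t * G v k x + t * G v x k + t\<^sup>2 * G v x x"
      using linear_add[OF l(1)] linear_add[OF l(2)] linear_scale[OF l(1)] linear_scale[OF l(2)]
      by (simp add: power2_eq_square algebra_simps)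
    also have "\<dots> = 2 * t * G v k x + t\<^sup>2 * G v x x"
      using G_zero[OF assms(1), of k] assms(2) G_sym[OF assms(1), of x k] by simp
    finally show "2 * t * - G v k x \<le> t\<^sup>2 * G v x x" by simp
  qed
  then show ?thesis by simp
qed

lemma G_mod_line:
  assumes "v \<noteq> 0"
  shows "G v (w - proj (line v) w) (w - proj (line v) w) = G v w w"
proof -
  have l: "linear (\<lambda>x. G v x y)" "linear (G v y)" for y using G_bilinear[OF assms] by (auto simp: bilinear_def)
  have "proj (line v) w \<in> line v" by (rule proj_in) simp
  note k = G_kernel[OF assms this]
  show ?thesis using linear_diff[OF l(1)] linear_diff[OF l(2)] k G_sym[OF assms] by simp
qed

text \<open>Invariance under a common scaling together with homogeneity in \<open>w\<close> reduces
  bounds to the compact product of unit spheres.\<close>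

lemma G_normalize:
  assumes "v \<noteq> 0" "w \<noteq> 0"
  shows "(norm v)\<^sup>2 * G v w w = (norm w)\<^sup>2 * G (v /\<^sub>R norm v) (w /\<^sub>R norm w) (w /\<^sub>R norm w)"
proof -
  define r where "r = inverse (norm v)"
  define u where "u = w /\<^sub>R norm w"
  have r: "r \<noteq> 0" using assms by (simp add: r_def)
  have nz: "r *\<^sub>R v \<noteq> 0" using r assms by simp
  have l: "linear (\<lambda>x. G (r *\<^sub>R v) x y)" "linear (G (r *\<^sub>R v) y)" for y using G_bilinear[OF nz] by (auto simp: bilinear_def)
  have "G v w w = G (r *\<^sub>R v) (r *\<^sub>R w) (r *\<^sub>R w)"
    using G_scale[OF assms(1), of "of_real r" w w] r by (simp add: scaleR_eq_scalar_mult)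
  also have "r *\<^sub>R w = (r * norm w) *\<^sub>R u" using assms by (simp add: u_def)
  also have "G (r *\<^sub>R v) ((r * norm w) *\<^sub>R u) ((r * norm w) *\<^sub>R u) = (r * norm w)\<^sup>2 * G (r *\<^sub>R v) u u"
    using linear_scale[OF l(1)] linear_scale[OF l(2)] by (simp add: power2_eq_square)
  finally show ?thesis using assms by (simp add: r_def u_def power_mult_distrib power_inverse)
qed

text \<open>On the compact set of pairs of unit vectors with \<open>w\<close> orthogonal to the line
  of \<open>v\<close>, the form is positive, because its kernel is that line; removing the component
  along the line does not change the form.\<close>

lemma G_lower: "\<exists>c>0. \<forall>v w. v \<noteq> 0 \<longrightarrow> c * (norm (w - proj (line v) w))\<^sup>2 \<le> (norm v)\<^sup>2 * G v w w"
proof -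
  define S where "S = (sphere 0 1 \<times> sphere 0 1) \<inter> {p :: ('k^'d) \<times> ('k^'d). \<forall>c. (c *s fst p) \<bullet> snd p = 0}"
  have "closed {p :: ('k^'d) \<times> ('k^'d). \<forall>c. (c *s fst p) \<bullet> snd p = 0}"
  proof -
    have "closed {p :: ('k^'d) \<times> ('k^'d). (c *s fst p) \<bullet> snd p = 0}" for c
      by (intro closed_Collect_eq continuous_intros bounded_linear.continuous_on[OF bounded_linear_scalar_mult])
    then show ?thesis by (auto intro: closed_Collect_all)
  qed
  then have S: "compact S" unfolding S_def by (intro compact_Int_closed compact_Times compact_sphere)
  have sub: "S \<subseteq> (- {0}) \<times> UNIV" by (auto simp: S_def)
  have pos: "0 < G v w w" if vw: "(v, w) \<in> S" for v w
  proof -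
    have v: "v \<noteq> 0" "w \<noteq> 0" "\<And>c. (c *s v) \<bullet> w = 0" using vw by (auto simp: S_def)
    have "w \<notin> line v"
    proof
      assume "w \<in> line v"
      then obtain c where "w = c *s v" by (auto simp: line_eq)
      then have "w \<bullet> w = 0" using v(3)[of c] by simp
      then show False using v(2) by simp
    qed
    then show ?thesis using G_zero[OF v(1)] G_nonneg[OF v(1)] by (metis less_eq_real_def)
  qed
  obtain c where c: "c > 0" "\<And>v w. (v, w) \<in> S \<Longrightarrow> c \<le> G v w w"
  proof (cases "S = {}")
    case True then show ?thesis using that[of 1] by auto
  next
    case False
    obtain p where p: "p \<in> S" "\<forall>y\<in>S. (\<lambda>(v, w). G v w w) p \<le> (\<lambda>(v, w). G v w w) y"
      using continuous_attains_inf[OF S False continuous_on_subset[OF G_continuous sub]] by blast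
    show ?thesis
      by (rule that[of "(\<lambda>(v, w). G v w w) p"]) (use p pos in \<open>auto split: prod.splits\<close>)
  qed
  have "c * (norm (w - proj (line v) w))\<^sup>2 \<le> (norm v)\<^sup>2 * G v w w" if v: "v \<noteq> 0" for v w
  proof (cases "w - proj (line v) w = 0")
    case True then show ?thesis using G_nonneg[OF v] by simp
  next
    case False
    define w' where "w' = w - proj (line v) w"
    have w': "w' \<noteq> 0" using False by (simp add: w'_def)
    have orth: "(c *s v) \<bullet> w' = 0" for c
      using proj_orth[OF line_subspace, of "c *s v" v w] by (auto simp: w'_def line_eq inner_commute)
    have "(v /\<^sub>R norm v, w' /\<^sub>R norm w') \<in> S"
      using v w' orth by (auto simp: S_def scaleR_eq_scalar_mult[of "inverse (norm v)"] vector_smult_assoc norm_vector_scalar_mult norm_inverse)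
    then have "(norm w')\<^sup>2 * c \<le> (norm w')\<^sup>2 * G (v /\<^sub>R norm v) (w' /\<^sub>R norm w') (w' /\<^sub>R norm w')"
      using c(2) by (intro mult_left_mono) auto
    also have "\<dots> = (norm v)\<^sup>2 * G v w' w'" using G_normalize[OF v w'] by simp
    also have "\<dots> = (norm v)\<^sup>2 * G v w w" using G_mod_line[OF v] by (simp add: w'_def)
    finally show ?thesis by (simp add: w'_def mult.commute)
  qed
  then show ?thesis using c(1) by blast
qed

lemma G_upper: "\<exists>C>0. \<forall>v w. v \<noteq> 0 \<longrightarrow> (norm v)\<^sup>2 * G v w w \<le> C * (norm w)\<^sup>2"
proof -
  define S where "S = sphere (0 :: 'k^'d) 1 \<times> sphere (0 :: 'k^'d) 1"
  have "compact S" unfolding S_def by (intro compact_Times compact_sphere)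
  moreover have "continuous_on S (\<lambda>(v, w). G v w w)" by (rule continuous_on_subset[OF G_continuous]) (auto simp: S_def)
  ultimately have "bounded ((\<lambda>(v, w). G v w w) ` S)" by (intro compact_imp_bounded compact_continuous_image)
  then obtain C where "\<forall>x\<in>(\<lambda>(v, w). G v w w) ` S. norm x \<le> C" unfolding bounded_iff by blast
  then have C: "\<bar>G v w w\<bar> \<le> C" if "(v, w) \<in> S" for v w using that by force
  have "(norm v)\<^sup>2 * G v w w \<le> (\<bar>C\<bar> + 1) * (norm w)\<^sup>2" if v: "v \<noteq> 0" for v w
  proof (cases "w = 0")
    case True
    then have "w \<in> line v" by (auto simp: line_eq intro: exI[of _ 0])
    then have "G v w w = 0" using G_zero[OF v] by blast
    then show ?thesis using True by simp
  next
    case False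
    have "(v /\<^sub>R norm v, w /\<^sub>R norm w) \<in> S" using v False by (simp add: S_def)
    from C[OF this] have "G (v /\<^sub>R norm v) (w /\<^sub>R norm w) (w /\<^sub>R norm w) \<le> \<bar>C\<bar> + 1" by simp
    then have "(norm w)\<^sup>2 * G (v /\<^sub>R norm v) (w /\<^sub>R norm w) (w /\<^sub>R norm w) \<le> (norm w)\<^sup>2 * (\<bar>C\<bar> + 1)" by (rule mult_left_mono) simp
    then show ?thesis using G_normalize[OF v False] by (simp add: mult.commute)
  qed
  then show ?thesis by (intro exI[of _ "\<bar>C\<bar> + 1"]) auto
qed

section \<open>Lengths of paths and the two distances\<close>

lemma length_nonneg:
  assumes "0 \<notin> path_image p"
  shows "0 \<le> riemannian_length G p"
proof -
  have "0 \<le> sqrt (G (p t) (vector_derivative p (at t)) (vector_derivative p (at t)))" if "t \<in> {0..1}" for t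
  proof -
    have "p t \<noteq> 0" using assms that by (auto simp: path_image_def)
    then show ?thesis using G_nonneg by simp
  qed
  \<comment> \<open>The integral of a non-integrable function is 0 by convention, so the case
    distinction covers every path.\<close>
  then show ?thesis unfolding riemannian_length_def
    by (cases "(\<lambda>t. sqrt (G (p t) (vector_derivative p (at t)) (vector_derivative p (at t)))) integrable_on {0..1}")
       (auto intro: Henstock_Kurzweil_Integration.integral_nonneg simp: not_integrable_integral)
qed

text \<open>For a fixed vector \<open>x\<close>, the projections of \<open>x\<close> to the lines
  along the path form a curve whose speed is at most \<open>4 / sqrt c\<close> times the Riemannian
  speed times \<open>norm x\<close>. Integrating and varying \<open>x\<close> bounds the operator
  norm.\<close>

lemma length_lower:
  assumes c: "c > 0" "\<And>v w. v \<noteq> 0 \<Longrightarrow> c * (norm (w - proj (line v) w))\<^sup>2 \<le> (norm v)\<^sup>2 * G v w w"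
    and p: "p C1_differentiable_on {0..1}" "0 \<notin> path_image p"
  shows "dist (proj (line (p 0))) (proj (line (p 1))) \<le> (4 / sqrt c) * riemannian_length G p"
proof -
  obtain D where D: "\<And>t. t \<in> {0..1} \<Longrightarrow> (p has_vector_derivative D t) (at t)" "continuous_on {0..1} D"
    using p(1) unfolding C1_differentiable_on_def by blast
  have nz: "p t \<noteq> 0" if "t \<in> {0..1}" for t using p(2) that by (auto simp: path_image_def)
  have vd: "vector_derivative p (at t) = D t" if "t \<in> {0..1}" for t using D(1)[OF that] by (rule vector_derivative_at)
  define g where "g t = sqrt (G (p t) (D t) (D t))" for t
  have "continuous_on {0..1} p" using D(1) has_vector_derivative_continuous continuous_at_imp_continuous_on by blast
  then have "continuous_on {0..1} (\<lambda>t. (p t, D t))" using D(2) by (rule continuous_on_Pair)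
  then have "continuous_on {0..1} (\<lambda>t. (\<lambda>(v, w). G v w w) (p t, D t))"
    by (rule continuous_on_compose2[OF G_continuous]) (use nz in auto)
  then have "continuous_on {0..1} g" unfolding g_def by (intro continuous_on_real_sqrt) simp
  then have gi: "g integrable_on {0..1}" by (rule integrable_continuous_real)
  have len: "riemannian_length G p = integral {0..1} g"
    unfolding riemannian_length_def g_def by (rule integral_cong) (simp add: vd)
  have "norm ((proj (line (p 0)) - proj (line (p 1))) x) \<le> (4 / sqrt c) * integral {0..1} g * norm x" for x
  proof -
    define f where "f t = (\<Sum>b\<in>Basis. ((x \<bullet> (b *s p t)) / (p t \<bullet> p t)) *\<^sub>R (b *s p t))" for t
    have "\<forall>t\<in>{0..1}. \<exists>f'. (f has_vector_derivative f') (at t) \<and> norm f' \<le> 4 * (norm (D t - proj (line (p t)) (D t)) / norm (p t)) * norm x"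
      unfolding f_def using proj_line_path_derivative[OF D(1) nz] by blast
    then obtain f' where f': "\<And>t. t \<in> {0..1} \<Longrightarrow> (f has_vector_derivative f' t) (at t)"
      "\<And>t. t \<in> {0..1} \<Longrightarrow> norm (f' t) \<le> 4 * (norm (D t - proj (line (p t)) (D t)) / norm (p t)) * norm x" by metis
    have "(f' has_integral (f 1 - f 0)) {0..1}"
      using f'(1) by (intro fundamental_theorem_of_calculus) (auto intro: has_vector_derivative_at_within)
    then have int: "f' integrable_on {0..1}" "integral {0..1} f' = f 1 - f 0" by (auto simp: has_integral_integrable integral_unique)
    have "norm (integral {0..1} f') \<le> integral {0..1} (\<lambda>t. (4 / sqrt c * norm x) * g t)"
    proof (rule integral_norm_bound_integral[OF int(1)])
      show "(\<lambda>t. (4 / sqrt c * norm x) * g t) integrable_on {0..1}" using gi by (rule integrable_on_mult_right)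
      fix t :: real assume t: "t \<in> {0..1}"
      have "sqrt c * norm (D t - proj (line (p t)) (D t)) \<le> norm (p t) * g t"
      proof (rule power2_le_imp_le)
        show "(sqrt c * norm (D t - proj (line (p t)) (D t)))\<^sup>2 \<le> (norm (p t) * g t)\<^sup>2"
          using c(2)[OF nz[OF t], of "D t"] c(1) G_nonneg[OF nz[OF t], of "D t"] by (simp add: power_mult_distrib g_def)
        show "0 \<le> norm (p t) * g t" using G_nonneg[OF nz[OF t], of "D t"] by (simp add: g_def)
      qed
      then have "norm (D t - proj (line (p t)) (D t)) / norm (p t) \<le> g t / sqrt c"
        using nz[OF t] c(1) by (simp add: field_simps)
      then have "4 * (norm (D t - proj (line (p t)) (D t)) / norm (p t)) * norm x \<le> 4 * (g t / sqrt c) * norm x"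
        by (intro mult_right_mono mult_left_mono) auto
      then show "norm (f' t) \<le> (4 / sqrt c * norm x) * g t" using f'(2)[OF t] by (simp add: mult_ac)
    qed
    also have "\<dots> = (4 / sqrt c) * integral {0..1} g * norm x" by (simp add: mult_ac)
    finally have "norm (f 1 - f 0) \<le> (4 / sqrt c) * integral {0..1} g * norm x" by (simp add: int)
    moreover have "f t = proj (line (p t)) x" if "t \<in> {0..1}" for t
      using proj_line_formula[OF nz[OF that]] by (simp add: f_def)
    ultimately show ?thesis by (simp add: blinfun.diff_left norm_minus_commute)
  qed
  moreover have "0 \<le> (4 / sqrt c) * integral {0..1} g" using length_nonneg[OF p(2)] c(1) by (simp add: len)
  ultimately show ?thesis unfolding dist_norm len by (intro norm_blinfun_bound) auto
qed

lemma segment_C1: "(\<lambda>t. v + t *\<^sub>R u) C1_differentiable_on {0..1}"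
  unfolding C1_differentiable_on_def
  by (rule exI[of _ "\<lambda>_. u"]) (auto intro!: derivative_eq_intros)

lemma length_set_bdd_below:
  fixes V W :: "('k^'d) set"
  shows "bdd_below {riemannian_length G p | p. p C1_differentiable_on {0..1} \<and> 0 \<notin> path_image p \<and> pathstart p \<in> V \<and> pathfinish p \<in> W}"
  using length_nonneg by (intro bdd_belowI[of _ 0]) auto

text \<open>A segment between spanning vectors avoids 0 if their inner product is nonnegative, which
  a change of sign achieves.\<close>

lemma length_set_nonempty:
  fixes V W :: "('k^'d) set"
  assumes "V \<in> projective_space" "W \<in> projective_space"
  shows "\<exists>p. p C1_differentiable_on {0..1} \<and> 0 \<notin> path_image p \<and> pathstart p \<in> V \<and> pathfinish p \<in> W"
proof -
  obtain v w where v: "v \<noteq> 0" "V = line v" and w: "w \<noteq> 0" "W = line w" using assms projective_space_iff by metis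
  define w' where "w' = (if v \<bullet> w \<ge> 0 then w else - w)"
  have w': "w' \<noteq> 0" "w' \<in> W" "v \<bullet> w' \<ge> 0"
    using w vec_subspace_real[OF line_subspace, of w] by (auto simp: w'_def subspace_neg)
  define p where "p t = v + t *\<^sub>R (w' - v)" for t
  have "p t \<noteq> 0" if t: "t \<in> {0..1}" for t
  proof
    assume "p t = 0"
    then have z: "(1 - t) *\<^sub>R v + t *\<^sub>R w' = 0" by (simp add: p_def algebra_simps)
    have "v \<bullet> ((1 - t) *\<^sub>R v + t *\<^sub>R w') = 0" "w' \<bullet> ((1 - t) *\<^sub>R v + t *\<^sub>R w') = 0" by (simp_all add: z)
    then have "(1 - t) * (v \<bullet> v) + t * (v \<bullet> w') = 0" "(1 - t) * (v \<bullet> w') + t * (w' \<bullet> w') = 0"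
      by (simp_all add: inner_add_right inner_commute)
    moreover have "0 \<le> (1 - t) * (v \<bullet> v)" "0 \<le> t * (v \<bullet> w')" "0 \<le> (1 - t) * (v \<bullet> w')" "0 \<le> t * (w' \<bullet> w')"
      using t w'(3) by auto
    ultimately have "(1 - t) * (v \<bullet> v) = 0" "t * (w' \<bullet> w') = 0" by linarith+
    then show False using v(1) w'(1) by auto
  qed
  then have "0 \<notin> path_image p" by (auto simp: path_image_def)
  moreover have "p C1_differentiable_on {0..1}" unfolding p_def by (rule segment_C1)
  moreover have "pathstart p \<in> V" "pathfinish p \<in> W" using v w' by (auto simp: p_def pathstart_def pathfinish_def)
  ultimately show ?thesis by blast
qed

lemma dist_proj_le_riemannian:
  "\<exists>K>0. \<forall>V\<in>projective_space. \<forall>W\<in>projective_space. dist (proj V) (proj W) \<le> K * riemannian_dist G V W"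
proof -
  obtain c where c: "c > 0" "\<And>v w. v \<noteq> 0 \<Longrightarrow> c * (norm (w - proj (line v) w))\<^sup>2 \<le> (norm v)\<^sup>2 * G v w w"
    using G_lower by blast
  have "dist (proj V) (proj W) \<le> (4 / sqrt c) * riemannian_dist G V W" if VW: "V \<in> projective_space" "W \<in> projective_space" for V W
  proof -
    have "dist (proj V) (proj W) / (4 / sqrt c) \<le> riemannian_dist G V W"
      unfolding riemannian_dist_def
    proof (rule cInf_greatest)
      show "{riemannian_length G p | p. p C1_differentiable_on {0..1} \<and> 0 \<notin> path_image p \<and> pathstart p \<in> V \<and> pathfinish p \<in> W} \<noteq> {}"
        using length_set_nonempty[OF VW] by auto
      fix l assume "l \<in> {riemannian_length G p | p. p C1_differentiable_on {0..1} \<and> 0 \<notin> path_image p \<and> pathstart p \<in> V \<and> pathfinish p \<in> W}"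
      then obtain p where p: "l = riemannian_length G p" "p C1_differentiable_on {0..1}" "0 \<notin> path_image p" "p 0 \<in> V" "p 1 \<in> W"
        by (auto simp: pathstart_def pathfinish_def)
      have "p 0 \<noteq> 0" "p 1 \<noteq> 0" using p(3) by (auto simp: path_image_def)
      then have "V = line (p 0)" "W = line (p 1)" using line_eq_if_in VW p(4,5) by blast+
      then show "dist (proj V) (proj W) / (4 / sqrt c) \<le> l"
        using length_lower[OF c p(2,3)] c(1) p(1) by (simp add: field_simps)
    qed
    then show ?thesis using c(1) by (simp add: field_simps)
  qed
  then show ?thesis using c(1) by (intro exI[of _ "4 / sqrt c"]) auto
qed

text \<open>The segment from a unit vector of \<open>V\<close> to its projection on \<open>W\<close>
  has Euclidean length at most the distance of the projections.\<close>

lemma riemannian_le_dist_proj: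
  "\<exists>K>0. \<forall>V\<in>projective_space. \<forall>W\<in>projective_space. dist (proj V) (proj W) \<le> 1/2 \<longrightarrow>
    riemannian_dist G V W \<le> K * dist (proj V) (proj W)"
proof -
  obtain C where C: "C > 0" "\<And>v w. v \<noteq> 0 \<Longrightarrow> (norm v)\<^sup>2 * G v w w \<le> C * (norm w)\<^sup>2" using G_upper by blast
  have "riemannian_dist G V W \<le> (2 * sqrt C) * dist (proj V) (proj W)"
    if VW: "V \<in> projective_space" "W \<in> projective_space" "dist (proj V) (proj W) \<le> 1/2" for V W
  proof -
    define \<rho> where "\<rho> = dist (proj V) (proj W)"
    have s: "vec.subspace V" "vec.subspace W" using VW by (auto simp: projective_space_def)
    obtain v0 where v0: "v0 \<noteq> 0" "V = line v0" using VW projective_space_iff by metis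
    define v where "v = v0 /\<^sub>R norm v0"
    have v: "norm v = 1" "v \<in> V" using v0 vec_subspace_real[OF line_subspace, of v0] by (auto simp: v_def subspace_mul)
    define w where "w = proj W v"
    define u where "u = w - v"
    have w: "w \<in> W" using proj_in[OF s(2)] by (simp add: w_def)
    have nu: "norm u \<le> \<rho>"
      using dist_proj_lower[OF s(2,1) v(2)] v(1) by (simp add: u_def w_def \<rho>_def dist_commute norm_minus_commute)
    define p where "p t = v + t *\<^sub>R u" for t
    \<comment> \<open>The restriction to distance at most \<open>1/2\<close> keeps the segment away
      from 0, so that the norm in \<open>G_upper\<close> costs only a factor 2 in length.\<close>
    have np: "1/2 \<le> norm (p t)" if t: "t \<in> {0..1}" for t
    proof -
      have "norm (t *\<^sub>R u) \<le> 1 * norm u" using t by (simp add: mult_left_le_one_le)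
      also have "\<dots> \<le> 1/2" using nu VW(3) by (simp add: \<rho>_def)
      finally have "norm (t *\<^sub>R u) \<le> 1/2" .
      moreover have "norm v \<le> norm (p t) + norm (t *\<^sub>R u)"
        using norm_triangle_ineq4[of "p t" "t *\<^sub>R u"] by (simp add: p_def)
      ultimately show ?thesis using v(1) by simp
    qed
    then have nz: "p t \<noteq> 0" if "t \<in> {0..1}" for t using that by fastforce
    have pi: "0 \<notin> path_image p" using nz by (auto simp: path_image_def)
    have C1: "p C1_differentiable_on {0..1}" unfolding p_def by (rule segment_C1)
    have vd: "vector_derivative p (at t) = u" for t
      unfolding p_def by (rule vector_derivative_at) (auto intro!: derivative_eq_intros)
    have g: "sqrt (G (p t) (vector_derivative p (at t)) (vector_derivative p (at t))) \<le> 2 * sqrt C * \<rho>" if t: "t \<in> {0..1}" for t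
    proof -
      have "(1/2)\<^sup>2 * G (p t) u u \<le> (norm (p t))\<^sup>2 * G (p t) u u"
        using np[OF t] G_nonneg[OF nz[OF t]] by (intro mult_right_mono power_mono) auto
      also have "\<dots> \<le> C * (norm u)\<^sup>2" by (rule C(2)[OF nz[OF t]])
      also have "\<dots> \<le> C * \<rho>\<^sup>2" using nu C(1) by (intro mult_left_mono power_mono) auto
      finally have "G (p t) u u \<le> 4 * C * \<rho>\<^sup>2" by (simp add: power2_eq_square)
      moreover have "(2 * sqrt C * \<rho>)\<^sup>2 = 4 * C * \<rho>\<^sup>2" using C(1) by (simp add: power_mult_distrib)
      ultimately have "G (p t) u u \<le> (2 * sqrt C * \<rho>)\<^sup>2" by simp
      then have "sqrt (G (p t) u u) \<le> sqrt ((2 * sqrt C * \<rho>)\<^sup>2)" by (rule real_sqrt_le_mono)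
      then show ?thesis using C(1) by (simp add: vd \<rho>_def abs_mult)
    qed
    have "riemannian_length G p \<le> 2 * sqrt C * \<rho>"
    proof (cases "(\<lambda>t. sqrt (G (p t) (vector_derivative p (at t)) (vector_derivative p (at t)))) integrable_on {0..1}")
      case True
      then have "riemannian_length G p \<le> integral {0..1::real} (\<lambda>_. 2 * sqrt C * \<rho>)"
        unfolding riemannian_length_def using g by (intro integral_le) auto
      then show ?thesis by simp
    next
      case False
      then show ?thesis using C(1) by (simp add: riemannian_length_def not_integrable_integral \<rho>_def)
    qed
    moreover have "riemannian_dist G V W \<le> riemannian_length G p"
      unfolding riemannian_dist_def using pi C1 v(2) w
      by (intro cInf_lower[OF _ length_set_bdd_below]) (auto simp: p_def u_def pathstart_def pathfinish_def intro!: exI[of _ p])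
    ultimately show ?thesis by (simp add: \<rho>_def)
  qed
  then show ?thesis using C(1) by (intro exI[of _ "2 * sqrt C"]) auto
qed

lemma riemannian_dist_nonneg:
  fixes V W :: "('k^'d) set"
  assumes "V \<in> projective_space" "W \<in> projective_space"
  shows "0 \<le> riemannian_dist G V W"
  unfolding riemannian_dist_def
  by (rule cInf_greatest) (use length_set_nonempty[OF assms] length_nonneg in auto)

end

section \<open>The Hausdorff dimension\<close>

lemma le_enn2real_ediam:
  assumes "ediam \<rho> U \<le> ennreal e" "x \<in> U" "y \<in> U" "0 \<le> \<rho> x y"
  shows "\<rho> x y \<le> enn2real (ediam \<rho> U)"
proof -
  have "ennreal (\<rho> x y) \<le> ediam \<rho> U"
    unfolding ediam_def using assms(2,3) by (meson SUP_upper order_trans)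
  then have "enn2real (ennreal (\<rho> x y)) \<le> enn2real (ediam \<rho> U)"
    by (rule enn2real_mono[OF _ le_less_trans[OF assms(1) ennreal_less_top]])
  then show ?thesis using assms(4) by simp
qed

lemma hausdorff_measure_zero_cover:
  assumes "hausdorff_measure X \<rho> s S = 0" "0 < \<epsilon>" "0 < \<tau>"
  obtains U where "\<And>i::nat. U i \<subseteq> X" "\<And>i. ediam \<rho> (U i) \<le> ennreal \<epsilon>" "S \<subseteq> (\<Union>i. U i)"
    "(\<Sum>i. ennreal (enn2real (ediam \<rho> (U i)) powr s)) < \<tau>"
proof -
  have "hausdorff_premeasure X \<rho> s \<epsilon> S \<le> hausdorff_measure X \<rho> s S"
    unfolding hausdorff_measure_def using assms(2) by (intro SUP_upper) simp
  then have "hausdorff_premeasure X \<rho> s \<epsilon> S < \<tau>" using assms(1,3) by simp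
  then show ?thesis unfolding hausdorff_premeasure_def Inf_less_iff using that by blast
qed

text \<open>Arbitrary upper bounds \<open>D i\<close> replace exact diameters, so that covers
  described by radii can be used.\<close>

lemma hausdorff_measure_eq_zeroI:
  assumes "0 < s"
    and cover: "\<And>\<epsilon> \<tau>. 0 < \<epsilon> \<Longrightarrow> 0 < \<tau> \<Longrightarrow> \<exists>U D. S \<subseteq> (\<Union>i::nat. U i) \<and> (\<forall>i. U i \<subseteq> X \<and> 0 \<le> D i \<and> D i \<le> \<epsilon> \<and>
      (\<forall>x\<in>U i. \<forall>y\<in>U i. \<rho> x y \<le> D i)) \<and> (\<Sum>i. ennreal (D i powr s)) \<le> ennreal \<tau>"
  shows "hausdorff_measure X \<rho> s S = 0"
proof -
  have *: "hausdorff_premeasure X \<rho> s \<epsilon> S \<le> ennreal \<tau>" if \<epsilon>: "0 < \<epsilon>" and \<tau>: "0 < \<tau>" for \<epsilon> \<tau>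
  proof -
    obtain U D where U: "S \<subseteq> (\<Union>i::nat. U i)" "\<And>i. U i \<subseteq> X" "\<And>i. 0 \<le> D i" "\<And>i. D i \<le> \<epsilon>"
      "\<And>i x y. x \<in> U i \<Longrightarrow> y \<in> U i \<Longrightarrow> \<rho> x y \<le> D i" "(\<Sum>i. ennreal (D i powr s)) \<le> ennreal \<tau>"
      using cover[OF \<epsilon> \<tau>] by blast
    have d: "ediam \<rho> (U i) \<le> ennreal (D i)" for i
      unfolding ediam_def by (intro SUP_least ennreal_leI U(5))
    have e: "ediam \<rho> (U i) \<le> ennreal \<epsilon>" for i using d[of i] ennreal_leI[OF U(4)] by (rule order_trans)
    have "hausdorff_premeasure X \<rho> s \<epsilon> S \<le> (\<Sum>i. ennreal (enn2real (ediam \<rho> (U i)) powr s))"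
      unfolding hausdorff_premeasure_def using U(1,2) e by (intro Inf_lower) blast
    also have "\<dots> \<le> (\<Sum>i. ennreal (D i powr s))"
    proof (intro suminf_le ennreal_leI powr_mono2)
      show "enn2real (ediam \<rho> (U i)) \<le> D i" for i
        using enn2real_mono[OF d ennreal_less_top, of i] U(3) by simp
    qed (use assms(1) in auto)
    finally show ?thesis using U(6) by simp
  qed
  have "hausdorff_premeasure X \<rho> s \<epsilon> S \<le> 0" if "0 < \<epsilon>" for \<epsilon>
    by (rule ennreal_le_epsilon) (simp add: *[OF that])
  then show ?thesis unfolding hausdorff_measure_def by (intro antisym SUP_least) auto
qed

context hypertransverse_group
begin

lemma proj_conical: "proj ` conical_limit_set1 \<theta> \<Gamma> = dyn.conical"
  unfolding conical_points[symmetric] conical_limit_set1_def point_of_def image_image ..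

lemma conical_projective: "conical_limit_set1 \<theta> \<Gamma> \<subseteq> projective_space"
  unfolding conical_limit_set1_def conical_limit_set_def using flag_limitsD(5) by blast

lemma hausdorff_measure_conical_eq_zero:
  assumes G: "riemannian_metric G" and s: "0 < s" and sum: "(\<lambda>g. exp (- s * alpha 1 g)) summable_on \<Gamma>"
  shows "hausdorff_measure projective_space (riemannian_dist G) s (conical_limit_set1 \<theta> \<Gamma>) = 0"
proof (rule hausdorff_measure_eq_zeroI[OF s])
  interpret riemannian G by (rule riemannian.intro[OF G])
  obtain K where K: "K > 0" "\<And>V W. V \<in> projective_space \<Longrightarrow> W \<in> projective_space \<Longrightarrow> dist (proj V) (proj W) \<le> 1/2 \<Longrightarrow>
      riemannian_dist G V W \<le> K * dist (proj V) (proj W)"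
    using riemannian_le_dist_proj by blast
  fix \<epsilon> \<tau> :: real assume \<epsilon>: "0 < \<epsilon>" and \<tau>: "0 < \<tau>"
  \<comment> \<open>The bound \<open>1/2\<close> admits the local comparison of distances; dividing
    by \<open>K\<close> and by \<open>K powr s\<close> compensates its Lipschitz constant in
    diameters and in the sum.\<close>
  have pos: "0 < \<tau> / K powr s" "0 < min (1/2) (\<epsilon> / K)" using \<epsilon> \<tau> K(1) by auto
  have sum': "(\<lambda>g. exp (- s * alpha 1 g)) summable_on carrier \<Gamma>_group" using sum by simp
  obtain U D where U: "dyn.conical \<subseteq> (\<Union>i::nat. U i)" "\<And>i. 0 \<le> D i" "\<And>i. D i \<le> min (1/2) (\<epsilon> / K)"
    "\<And>i x y. x \<in> U i \<Longrightarrow> y \<in> U i \<Longrightarrow> dist x y \<le> D i" "(\<Sum>i. ennreal (D i powr s)) \<le> ennreal (\<tau> / K powr s)"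
    using dyn.conical_cover_upper_bound[OF sum' s pos] by blast
  define V where "V i = {l \<in> projective_space. proj l \<in> U i}" for i
  have "conical_limit_set1 \<theta> \<Gamma> \<subseteq> (\<Union>i. V i)"
  proof
    fix l assume l: "l \<in> conical_limit_set1 \<theta> \<Gamma>"
    then have "proj l \<in> dyn.conical" unfolding proj_conical[symmetric] by (rule imageI)
    then obtain i where "proj l \<in> U i" using U(1) by blast
    then have "l \<in> V i" using l conical_projective unfolding V_def by blast
    then show "l \<in> (\<Union>i. V i)" by blast
  qed
  moreover have "V i \<subseteq> projective_space \<and> 0 \<le> K * D i \<and> K * D i \<le> \<epsilon> \<and>
      (\<forall>x\<in>V i. \<forall>y\<in>V i. riemannian_dist G x y \<le> K * D i)" for i
  proof (intro conjI ballI)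
    show "K * D i \<le> \<epsilon>" using U(3)[of i] K(1) by (simp add: field_simps)
    fix x y assume xy: "x \<in> V i" "y \<in> V i"
    then have d: "dist (proj x) (proj y) \<le> D i" using U(4) by (auto simp: V_def)
    then have "riemannian_dist G x y \<le> K * dist (proj x) (proj y)" using K(2) xy U(3)[of i] by (auto simp: V_def)
    also have "\<dots> \<le> K * D i" using d K(1) by simp
    finally show "riemannian_dist G x y \<le> K * D i" .
  qed (use U(2) K(1) in \<open>auto simp: V_def\<close>)
  moreover have "(\<Sum>i. ennreal ((K * D i) powr s)) \<le> ennreal \<tau>"
  proof -
    have "(\<Sum>i. ennreal ((K * D i) powr s)) = (\<Sum>i. ennreal (K powr s) * ennreal (D i powr s))"
      using U(2) K(1) by (simp add: powr_mult ennreal_mult)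
    also have "\<dots> = ennreal (K powr s) * (\<Sum>i. ennreal (D i powr s))" by (rule ennreal_suminf_cmult)
    also have "\<dots> \<le> ennreal (K powr s) * ennreal (\<tau> / K powr s)" by (rule mult_left_mono[OF U(5)]) simp
    also have "\<dots> = ennreal \<tau>" using K(1) \<tau> by (simp flip: ennreal_mult)
    finally show ?thesis .
  qed
  ultimately show "\<exists>U D. conical_limit_set1 \<theta> \<Gamma> \<subseteq> (\<Union>i::nat. U i) \<and> (\<forall>i. U i \<subseteq> projective_space \<and> 0 \<le> D i \<and> D i \<le> \<epsilon> \<and>
      (\<forall>x\<in>U i. \<forall>y\<in>U i. riemannian_dist G x y \<le> D i)) \<and> (\<Sum>i. ennreal (D i powr s)) \<le> ennreal \<tau>"
    by (intro exI[of _ V] exI[of _ "\<lambda>i. K * D i"]) blast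
qed

lemma summable_if_hausdorff_measure_zero:
  assumes G: "riemannian_metric G" and ne: "\<not> is_singleton (limit_set \<theta> \<Gamma>)" and s: "0 < s" "s < t"
    and zero: "hausdorff_measure projective_space (riemannian_dist G) s (conical_limit_set1 \<theta> \<Gamma>) = 0"
  shows "(\<lambda>g. exp (- t * alpha 1 g)) summable_on \<Gamma>"
proof (rule ccontr)
  interpret riemannian G by (rule riemannian.intro[OF G])
  assume div: "\<not> (\<lambda>g. exp (- t * alpha 1 g)) summable_on \<Gamma>"
  have "inj_on point_of flag_limits" by (rule inj_onI) (simp add: point_of_inject)
  then have ns: "\<not> is_singleton points"
    using ne by (simp add: points_def is_singleton_altdef card_image)
  obtain \<kappa> \<epsilon> where \<kappa>: "0 \<le> \<kappa>" "0 < \<epsilon>" and low: "\<And>U D. dyn.conical \<subseteq> (\<Union>i::nat. U i) \<Longrightarrow>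
      (\<forall>i. 0 \<le> D i \<and> D i \<le> \<epsilon> \<and> (\<forall>x\<in>U i \<inter> dyn.conical. \<forall>y\<in>U i \<inter> dyn.conical. dist x y \<le> D i)) \<Longrightarrow>
      1 \<le> (\<Sum>i. ennreal (\<kappa> * D i powr s))"
    using dyn.conical_cover_lower_bound[OF _ ns s] div by auto
  obtain K where K: "K > 0" "\<And>V W. V \<in> projective_space \<Longrightarrow> W \<in> projective_space \<Longrightarrow>
      dist (proj V) (proj W) \<le> K * riemannian_dist G V W"
    using dist_proj_le_riemannian by blast
  define c where "c = \<kappa> * K powr s"
  have c: "0 \<le> c" using \<kappa>(1) by (simp add: c_def)
  \<comment> \<open>A total below \<open>1 / (c + 1)\<close> becomes \<open>c / (c + 1) < 1\<close>
    after multiplication by \<open>c\<close>, against the lower bound 1; adding 1 covers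
    \<open>c = 0\<close>.\<close>
  have pos: "0 < \<epsilon> / K" "0 < ennreal (1 / (c + 1))" using \<kappa>(2) K(1) c by auto
  obtain U where U: "\<And>i::nat. U i \<subseteq> projective_space" "\<And>i. ediam (riemannian_dist G) (U i) \<le> ennreal (\<epsilon> / K)"
    "conical_limit_set1 \<theta> \<Gamma> \<subseteq> (\<Union>i. U i)"
    "(\<Sum>i. ennreal (enn2real (ediam (riemannian_dist G) (U i)) powr s)) < ennreal (1 / (c + 1))"
    by (rule hausdorff_measure_zero_cover[OF zero pos]) blast
  define e where "e i = enn2real (ediam (riemannian_dist G) (U i))" for i
  have e0: "0 \<le> e i" for i by (simp add: e_def)
  have "1 \<le> (\<Sum>i. ennreal (\<kappa> * (K * e i) powr s))"
  proof (rule low[of "\<lambda>i. proj ` U i"])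
    show "dyn.conical \<subseteq> (\<Union>i. proj ` U i)" unfolding proj_conical[symmetric] image_UN[symmetric] using U(3) by (rule image_mono)
    show "\<forall>i. 0 \<le> K * e i \<and> K * e i \<le> \<epsilon> \<and>
        (\<forall>x\<in>proj ` U i \<inter> dyn.conical. \<forall>y\<in>proj ` U i \<inter> dyn.conical. dist x y \<le> K * e i)"
    proof (intro allI conjI ballI)
      fix i
      show "0 \<le> K * e i" using K(1) e0 by simp
      have "e i \<le> \<epsilon> / K" using enn2real_mono[OF U(2) ennreal_less_top, of i] pos(1) by (simp add: e_def)
      then show "K * e i \<le> \<epsilon>" using K(1) by (simp add: field_simps)
      fix x y assume "x \<in> proj ` U i \<inter> dyn.conical" "y \<in> proj ` U i \<inter> dyn.conical"
      then obtain V W where VW: "x = proj V" "V \<in> U i" "y = proj W" "W \<in> U i" by blast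
      then have P: "V \<in> projective_space" "W \<in> projective_space" using U(1) by auto
      have "dist x y \<le> K * riemannian_dist G V W" using K(2)[OF P] VW by simp
      also have "\<dots> \<le> K * e i"
        using le_enn2real_ediam[OF U(2) VW(2,4) riemannian_dist_nonneg[OF P]] K(1) by (simp add: e_def)
      finally show "dist x y \<le> K * e i" .
    qed
  qed
  also have "(\<Sum>i. ennreal (\<kappa> * (K * e i) powr s)) = (\<Sum>i. ennreal c * ennreal (e i powr s))"
    using K(1) e0 c by (simp add: powr_mult c_def mult.assoc flip: ennreal_mult)
  also have "\<dots> = ennreal c * (\<Sum>i. ennreal (e i powr s))" by (rule ennreal_suminf_cmult)
  also have "\<dots> \<le> ennreal c * ennreal (1 / (c + 1))" using U(4) by (intro mult_left_mono) (auto simp: e_def)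
  also have "\<dots> = ennreal (c / (c + 1))" using c by (simp flip: ennreal_mult)
  also have "\<dots> < 1" using c by (simp add: ennreal_less_one_iff)
  finally show False by simp
qed

theorem hausdorff_dim_conical:
  assumes G: "riemannian_metric G" and ne: "\<not> is_singleton (limit_set \<theta> \<Gamma>)"
  shows "hausdorff_dim projective_space (riemannian_dist G) (conical_limit_set1 \<theta> \<Gamma>) = critical_exponent (alpha 1) \<Gamma>"
proof (rule antisym)
  show "hausdorff_dim projective_space (riemannian_dist G) (conical_limit_set1 \<theta> \<Gamma>) \<le> critical_exponent (alpha 1) \<Gamma>"
    unfolding critical_exponent_def
  proof (rule Inf_greatest)
    fix x assume "x \<in> ereal ` {s. 0 \<le> s \<and> (\<lambda>g. exp (- s * alpha 1 g)) summable_on \<Gamma>}"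
    then obtain s where s: "x = ereal s" "0 \<le> s" "(\<lambda>g. exp (- s * alpha 1 g)) summable_on \<Gamma>" by blast
    show "hausdorff_dim projective_space (riemannian_dist G) (conical_limit_set1 \<theta> \<Gamma>) \<le> x"
    \<comment> \<open>Raising the exponent by \<open>e\<close> makes it positive, as
      \<open>hausdorff_dim\<close> demands, even when \<open>s\<close> is 0.\<close>
    proof (rule ereal_le_epsilon2)
      fix e :: real assume e: "0 < e"
      have "exp (- (s + e) * alpha 1 g) \<le> exp (- s * alpha 1 g)" if "g \<in> \<Gamma>" for g
        using mult_nonneg_nonneg[of e "alpha 1 g"] dyn.\<alpha>_nonneg[of g] that e by (simp add: algebra_simps)
      then have "(\<lambda>g. exp (- (s + e) * alpha 1 g)) summable_on \<Gamma>"
        by (intro summable_on_comparison_test[OF s(3)]) auto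
      then have "hausdorff_measure projective_space (riemannian_dist G) (s + e) (conical_limit_set1 \<theta> \<Gamma>) = 0"
        using s(2) e by (intro hausdorff_measure_conical_eq_zero[OF G]) auto
      then show "hausdorff_dim projective_space (riemannian_dist G) (conical_limit_set1 \<theta> \<Gamma>) \<le> x + ereal e"
        unfolding hausdorff_dim_def using s(1,2) e by (intro Inf_lower image_eqI[of _ _ "s + e"]) auto
    qed
  qed
  show "critical_exponent (alpha 1) \<Gamma> \<le> hausdorff_dim projective_space (riemannian_dist G) (conical_limit_set1 \<theta> \<Gamma>)"
    unfolding hausdorff_dim_def
  proof (rule Inf_greatest)
    fix x assume "x \<in> ereal ` {s. 0 < s \<and> hausdorff_measure projective_space (riemannian_dist G) s (conical_limit_set1 \<theta> \<Gamma>) = 0}"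
    then obtain s where s: "x = ereal s" "0 < s"
      "hausdorff_measure projective_space (riemannian_dist G) s (conical_limit_set1 \<theta> \<Gamma>) = 0" by blast
    show "critical_exponent (alpha 1) \<Gamma> \<le> x"
    proof (rule ereal_le_epsilon2)
      fix e :: real assume e: "0 < e"
      have "s + e \<in> {s. 0 \<le> s \<and> (\<lambda>g. exp (- s * alpha 1 g)) summable_on \<Gamma>}"
      proof (intro CollectI conjI)
        show "(\<lambda>g. exp (- (s + e) * alpha 1 g)) summable_on \<Gamma>"
          using e by (intro summable_if_hausdorff_measure_zero[OF G ne s(2) _ s(3)]) simp
      qed (use s(2) e in simp)
      then show "critical_exponent (alpha 1) \<Gamma> \<le> x + ereal e"
        unfolding critical_exponent_def by (rule INF_lower2) (simp add: s(1))
    qed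
  qed
qed

end

theorem theorem1p5:
  fixes \<theta> :: "nat set" and q :: nat
  shows
    "(\<forall>\<Gamma> :: (real, 'd::{finite,linorder}) sqmatrix set set.
        subgroup \<Gamma> PGL \<longrightarrow>
        hypertransverse_wrt \<theta> q \<Gamma> \<longrightarrow>
        \<not> is_singleton (limit_set \<theta> \<Gamma>) \<longrightarrow>
        (\<forall>\<gamma>\<in>\<Gamma>. sing_val \<gamma> 2 = sing_val \<gamma> q) \<longrightarrow>
        (\<forall>G. riemannian_metric G \<longrightarrow>
           hausdorff_dim projective_space (riemannian_dist G) (conical_limit_set1 \<theta> \<Gamma>)
             = critical_exponent (alpha 1) \<Gamma>)) \<and>
     (\<forall>\<Gamma> :: (complex, 'd::{finite,linorder}) sqmatrix set set.
        subgroup \<Gamma> PGL \<longrightarrow>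
        hypertransverse_wrt \<theta> q \<Gamma> \<longrightarrow>
        \<not> is_singleton (limit_set \<theta> \<Gamma>) \<longrightarrow>
        (\<forall>\<gamma>\<in>\<Gamma>. sing_val \<gamma> 2 = sing_val \<gamma> q) \<longrightarrow>
        (\<forall>G. riemannian_metric G \<longrightarrow>
           hausdorff_dim projective_space (riemannian_dist G) (conical_limit_set1 \<theta> \<Gamma>)
             = critical_exponent (alpha 1) \<Gamma>))"
  by (intro conjI allI impI hypertransverse_group.hausdorff_dim_conical[OF hypertransverse_group.intro]) auto

end
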